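(* Let $\Omega\subset\mathbb{R}^N$ be a bounded $C^1$-domain and let $\mathcal{I}(u,x)=\int_{\mathbb{R}^N}[u(x+z)-u(x)]\,\nu_x(dz)$ satisfy assumptions (M0), (M1), (M2), (M3) of the context with the same $\sigma\in(0,1)$. Let $H\in C(\bar\Omega\times\mathbb{R}\times\mathbb{R}^N)$ satisfy (H1) and (H2) of the context with $m>\sigma$, let $f\in C(\bar Q)$, $\varphi\in C(\partial\Omega\times[0,\infty))$, $u_0\in C(\bar\Omega)$, and assume $u_0=\varphi(\cdot,0)$ on $\partial\Omega$. Then there exists a unique $u\in C(\bar Q)$ which is a viscosity solution (with generalized boundary and initial conditions) to $$u_t-\mathcal{I}(u(\cdot,t),x)+H(x,u,Du)=f\ \text{in }Q,\qquad u=\varphi\ \text{on }\partial Q,\qquad u=u_0\ \text{on }\bar\Omega\times\{0\}.$$ For each $T>0$ this solution satisfies, for all $(x,t)\in\bar Q_T$, $$|u(x,t)|\le\big(\|H(\cdot,0,0)\|_{L^\infty(\bar\Omega)}+\|f\|_{L^\infty(\bar Q_T)}\big)\,t+\|\varphi\|_{L^\infty(\partial Q_T)}+\|u_0\|_{L^\infty(\bar\Omega)}.$$ Moreover, if there exists $\lambda_0>0$ such that $\lambda_R\ge\lambda_0$ for all $R>0$ (with $\lambda_R$ the constants in (H1)), and $f,\varphi$ are uniformly bounded, then $u$ is uniformly bounded in $\bar Q$, with $$|u(x,t)|\le\lambda_0^{-1}\big(\|H(\cdot,0,0)\|_{L^\infty(\bar\Omega)}+\|f\|_{L^\infty(\bar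 Q)}\big)+\|\varphi\|_{L^\infty(\partial Q)}+\|u_0\|_{L^\infty(\bar\Omega)}\quad\text{for all }(x,t)\in\bar Q.$$
   Context: Notation: $Q=\Omega\times(0,\infty)$, $\partial Q=\partial\Omega\times(0,\infty)$, $Q_T=\Omega\times(0,T]$, $\partial Q_T=\partial\Omega\times(0,T]$, $d(x)=\mathrm{dist}(x,\partial\Omega)$, $B_r(x)$ is the open ball, $B_r=B_r(0)$, $B_r^c$ its complement. "$C^1$-domain" means that the boundary is $C^1$, with the convention that there is $\delta_0>0$ such that $d$ is of class $C^1$ in $\{x\in\Omega:d(x)<\delta_0\}$. For each $x\in\bar\Omega$, $\nu_x$ is a nonnegative regular measure on $\mathbb{R}^N$. For $D\subset\mathbb{R}^N$, $\mathcal{I}[D](u,y)=\int_D[u(y+z)-u(y)]\nu_y(dz)$. (M0): (M0-1) $\bigcup_{x\in\bar\Omega}\{x+\mathrm{supp}\,\nu_x\}\subseteq\bar\Omega$. (M0-2) if $x\in\bar\Omega$, $r>0$ and $u\in L^\infty(\bar\Omega)$ is $C^1$ in $B_r(x)$ (i.e. in $B_r(x)\cap\bar\Omega$), then $\mathcal{I}(u,x)$ is well defined, and for any $D\subset\mathbb{R}^N$ the map $y\mapsto\mathcal{I}[D](u,y)$ is continuous in $B_r(x)$ (i.e. in $B_r(x)\cap\bar\Omega$). (M1): there is $C_1>0$ such that for all $\beta\in[0,2]$ and $\delta>0$, $\sup_{x\in\bar\Omega}\int_{B_\delta^c}\min\{1,|z|^\beta\}\nu_x(dz)\le C_1h_{\beta,\sigma}(\delta)$,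 where $h_{\beta,\sigma}(\delta)=\delta^{\beta-\sigma}$ if $\beta<\sigma$, $=|\ln\delta|+1$ if $\beta=\sigma$, $=1$ if $\beta>\sigma$ (convention $|z|^0=1$). (M2): there is $C_2>0$ such that for all $\beta\in(\sigma,2]$ and $\delta\in(0,1)$, $\sup_{x\in\bar\Omega}\int_{B_\delta}|z|^\beta\nu_x(dz)\le C_2\delta^{\beta-\sigma}$. (M3): for each $\beta>0$ there is a modulus of continuity $\omega_{\beta,\sigma}$ such that for all $x,y\in\bar\Omega$, $\delta>0$, $\int_{B_\delta^c}|z|^\beta|\nu_x(dz)-\nu_y(dz)|\le(1+h_{\beta,\sigma}(\delta))\,\omega_{\beta,\sigma}(|x-y|)$, where $|\nu_x-\nu_y|$ is the total variation measure. (H1): for all $R>0$ there is $\lambda_R\ge0$ such that $H(x,u,p)-H(x,v,p)\ge\lambda_R(u-v)$ for all $x\in\bar\Omega$, $p\in\mathbb{R}^N$, $u\ge v$ with $|u|,|v|\le R$. (H2) (with exponent $m$): there is $\underline c>0$ such that for each $R>0$ there is $C_R\ge0$ with $H(x,r,p)\ge\underline c|p|^m-C_R$ for all $x\in\bar\Omega$, $p\in\mathbb{R}^N$, $|r|\le R$. Viscosity solutions: put $\mathcal{E}_\delta(u,\phi,x,t)=\phi_t(x,t)-\mathcal{I}[B_\delta](\phi(\cdot,t),x)-\mathcal{I}[B_\delta^c](u(\cdot,t),x)+H(x,u(x,t),D\phi(x,t))-f(x,t)$. An upper semicontinuous $u:\bar Q\to\mathbb{R}$ is a viscosity subsolution if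 for each $\phi\in C^1(\bar Q)$ and each maximum point $(x_0,t_0)\in\bar Q$ of $u-\phi$ on $\bar Q$, for all $\delta>0$: $\mathcal{E}_\delta(u,\phi,x_0,t_0)\le0$ if $(x_0,t_0)\in Q$; $\min\{\mathcal{E}_\delta(u,\phi,x_0,t_0),u(x_0,t_0)-\varphi(x_0,t_0)\}\le0$ if $(x_0,t_0)\in\partial Q$; $\min\{\mathcal{E}_\delta(u,\phi,x_0,t_0),u(x_0,t_0)-u_0(x_0)\}\le0$ if $t_0=0$. A lower semicontinuous function is a viscosity supersolution if the analogous conditions hold with minimum points, reversed inequalities and $\max$ in place of $\min$; a solution is both. *)

theory Defs
  imports "HOL-Analysis.Analysis"
begin

text \<open>Functions on \<open>closure \<Omega>\<close> or \<open>closure \<Omega> \<times> {0..}\<close> are total functions whose values outside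
  those sets never matter.\<close>

subsection \<open>Regularity of functions and of the domain\<close>

text \<open>\<open>G\<close> is the gradient of \<open>u\<close> on \<open>S\<close>, up to and including those points of the boundary that
  belong to \<open>S\<close>. On the closure of a \<open>C\<^sup>1\<close> domain (times a time interval) the gradient relative to
  the set is unique, also at boundary points.\<close>

definition C1_with_gradient ::
    "'b::euclidean_space set \<Rightarrow> ('b \<Rightarrow> real) \<Rightarrow> ('b \<Rightarrow> 'b) \<Rightarrow> bool" where
  "C1_with_gradient S u G \<longleftrightarrow>
     continuous_on S G \<and> (\<forall>y\<in>S. (u has_derivative (\<lambda>h. G y \<bullet> h)) (at y within S))"

definition C1_on :: "'b::euclidean_space set \<Rightarrow> ('b \<Rightarrow> real) \<Rightarrow> bool" where
  "C1_on S u \<longleftrightarrow> (\<exists>G. C1_with_gradient S u G)"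

definition usc_on :: "'b::topological_space set \<Rightarrow> ('b \<Rightarrow> real) \<Rightarrow> bool" where
  "usc_on S u \<longleftrightarrow> (\<forall>x\<in>S. \<forall>a>u x. \<forall>\<^sub>F y in at x within S. u y < a)"

definition lsc_on :: "'b::topological_space set \<Rightarrow> ('b \<Rightarrow> real) \<Rightarrow> bool" where
  "lsc_on S u \<longleftrightarrow> (\<forall>x\<in>S. \<forall>a<u x. \<forall>\<^sub>F y in at x within S. a < u y)"

text \<open>Near each boundary point, \<open>\<Omega>\<close> is the region above a \<open>C\<^sup>1\<close> graph over the hyperplane
  orthogonal to some unit vector \<open>e\<close>; \<open>\<gamma>\<close> is only evaluated on that hyperplane.\<close>

definition C1_boundary :: "'a::euclidean_space set \<Rightarrow> bool" where
  "C1_boundary \<Omega> \<longleftrightarrow>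
     (\<forall>x0\<in>frontier \<Omega>. \<exists>r>0. \<exists>e \<gamma>. norm e = 1 \<and> C1_on UNIV \<gamma> \<and>
        \<Omega> \<inter> ball x0 r = {x \<in> ball x0 r. \<gamma> (x - (x \<bullet> e) *\<^sub>R e) < x \<bullet> e})"

definition C1_domain :: "'a::euclidean_space set \<Rightarrow> bool" where
  "C1_domain \<Omega> \<longleftrightarrow>
     open \<Omega> \<and> connected \<Omega> \<and> \<Omega> \<noteq> {} \<and> C1_boundary \<Omega> \<and>
     (\<exists>\<delta>0>0. C1_on {x \<in> \<Omega>. infdist x (frontier \<Omega>) < \<delta>0} (\<lambda>x. infdist x (frontier \<Omega>)))"

definition modulus_of_continuity :: "(real \<Rightarrow> real) \<Rightarrow> bool" where
  "modulus_of_continuity \<omega> \<longleftrightarrow> mono_on {0..} \<omega> \<and> \<omega> 0 = 0 \<and> (\<omega> \<longlongrightarrow> 0) (at_right 0)"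

subsection \<open>Measures and the nonlocal operator\<close>

text \<open>The measures may have infinite mass near the origin (for example \<open>|z| powr (- N - \<sigma>) dz\<close>),
  so that \<open>{0}\<close> need not be outer regular. Regularity is therefore that of a Borel measure
  on the locally compact space \<open>- {0}\<close>; a point mass at \<open>0\<close> plays no role in what follows.\<close>

definition regular_measure :: "'a::euclidean_space measure \<Rightarrow> bool" where
  "regular_measure \<mu> \<longleftrightarrow> sets \<mu> = sets borel \<and>
     (\<forall>A\<in>sets borel. 0 \<notin> A \<longrightarrow>
        emeasure \<mu> A = (SUP K\<in>{K. compact K \<and> K \<subseteq> A}. emeasure \<mu> K) \<and>
        emeasure \<mu> A = (INF U\<in>{U. open U \<and> A \<subseteq> U}. emeasure \<mu> U))"

definition measure_support :: "'a::topological_space measure \<Rightarrow> 'a set" where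
  "measure_support \<mu> = {z. \<forall>U. open U \<and> z \<in> U \<longrightarrow> emeasure \<mu> U > 0}"

text \<open>The total variation measure of \<open>\<mu> - \<mu>'\<close>, for finite measures \<open>\<mu>\<close> and \<open>\<mu>'\<close> on the same
  \<open>\<sigma>\<close>-algebra: supremum over countable measurable partitions.\<close>

definition tv_diff :: "'a measure \<Rightarrow> 'a measure \<Rightarrow> 'a measure" where
  "tv_diff \<mu> \<mu>' = measure_of (space \<mu>) (sets \<mu>)
     (\<lambda>A. SUP E\<in>{E :: nat \<Rightarrow> 'a set. range E \<subseteq> sets \<mu> \<and> disjoint_family E \<and> (\<Union>i. E i) = A}.
        \<Sum>i. ennreal \<bar>measure \<mu> (E i) - measure \<mu>' (E i)\<bar>)"

text \<open>Since \<open>u\<close> is only meaningful on \<open>closure \<Omega>\<close>, the integral is taken over those \<open>z\<close> with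
  \<open>y + z \<in> closure \<Omega>\<close>; by (M0-1) the remaining \<open>z\<close> form a null set of \<open>\<nu> y\<close>.\<close>

definition nonlocal ::
    "'a::euclidean_space set \<Rightarrow> ('a \<Rightarrow> 'a measure) \<Rightarrow> 'a set \<Rightarrow> ('a \<Rightarrow> real) \<Rightarrow> 'a \<Rightarrow> real" where
  "nonlocal \<Omega> \<nu> D u y = (LINT z:{z\<in>D. y + z \<in> closure \<Omega>}|\<nu> y. u (y + z) - u y)"

definition nonlocal_defined ::
    "'a::euclidean_space set \<Rightarrow> ('a \<Rightarrow> 'a measure) \<Rightarrow> 'a set \<Rightarrow> ('a \<Rightarrow> real) \<Rightarrow> 'a \<Rightarrow> bool" where
  "nonlocal_defined \<Omega> \<nu> D u y \<longleftrightarrow>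
     set_integrable (\<nu> y) {z\<in>D. y + z \<in> closure \<Omega>} (\<lambda>z. u (y + z) - u y)"

subsection \<open>Assumptions on the measures\<close>

text \<open>In (M0-2) the sets \<open>D\<close> are Borel and \<open>L\<^sup>\<infinity>\<close> consists of the bounded Borel functions (not of
  equivalence classes for Lebesgue measure), so that the integrals against \<open>\<nu> y\<close> make sense.\<close>

definition M0 :: "'a::euclidean_space set \<Rightarrow> ('a \<Rightarrow> 'a measure) \<Rightarrow> bool" where
  "M0 \<Omega> \<nu> \<longleftrightarrow>
     (\<Union>x\<in>closure \<Omega>. (+) x ` measure_support (\<nu> x)) \<subseteq> closure \<Omega> \<and>
     (\<forall>x\<in>closure \<Omega>. \<forall>r>0. \<forall>u :: 'a \<Rightarrow> real.
        u \<in> borel_measurable (restrict_space borel (closure \<Omega>)) \<and> bounded (u ` closure \<Omega>) \<and>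
        C1_on (ball x r \<inter> closure \<Omega>) u \<longrightarrow>
          nonlocal_defined \<Omega> \<nu> UNIV u x \<and>
          (\<forall>D\<in>sets borel. continuous_on (ball x r \<inter> closure \<Omega>) (nonlocal \<Omega> \<nu> D u)))"

definition h_fun :: "real \<Rightarrow> real \<Rightarrow> real \<Rightarrow> real" where
  "h_fun \<beta> \<sigma> \<delta> =
     (if \<beta> < \<sigma> then \<delta> powr (\<beta> - \<sigma>) else if \<beta> = \<sigma> then \<bar>ln \<delta>\<bar> + 1 else 1)"

definition M1 :: "'a::euclidean_space set \<Rightarrow> ('a \<Rightarrow> 'a measure) \<Rightarrow> real \<Rightarrow> bool" where
  "M1 \<Omega> \<nu> \<sigma> \<longleftrightarrow>
     (\<exists>C1>0. \<forall>\<beta>\<in>{0..2}. \<forall>\<delta>>0.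
        (SUP x\<in>closure \<Omega>. \<integral>\<^sup>+z\<in>- ball 0 \<delta>. ennreal (min 1 (norm z powr \<beta>)) \<partial>\<nu> x)
          \<le> ennreal (C1 * h_fun \<beta> \<sigma> \<delta>))"

definition M2 :: "'a::euclidean_space set \<Rightarrow> ('a \<Rightarrow> 'a measure) \<Rightarrow> real \<Rightarrow> bool" where
  "M2 \<Omega> \<nu> \<sigma> \<longleftrightarrow>
     (\<exists>C2>0. \<forall>\<beta>\<in>{\<sigma><..2}. \<forall>\<delta>\<in>{0<..<1}.
        (SUP x\<in>closure \<Omega>. \<integral>\<^sup>+z\<in>ball 0 \<delta>. ennreal (norm z powr \<beta>) \<partial>\<nu> x)
          \<le> ennreal (C2 * \<delta> powr (\<beta> - \<sigma>)))"

text \<open>Restricting to \<open>- ball 0 \<delta>\<close> first makes the two measures finite (by (M1) with \<open>\<beta> = 0\<close>), so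
  that their difference and its total variation are defined.\<close>

definition M3 :: "'a::euclidean_space set \<Rightarrow> ('a \<Rightarrow> 'a measure) \<Rightarrow> real \<Rightarrow> bool" where
  "M3 \<Omega> \<nu> \<sigma> \<longleftrightarrow>
     (\<forall>\<beta>>0. \<exists>\<omega>. modulus_of_continuity \<omega> \<and>
        (\<forall>x\<in>closure \<Omega>. \<forall>y\<in>closure \<Omega>. \<forall>\<delta>>0.
           (\<integral>\<^sup>+z. ennreal (norm z powr \<beta>)
              \<partial>tv_diff (restrict_space (\<nu> x) (- ball 0 \<delta>)) (restrict_space (\<nu> y) (- ball 0 \<delta>)))
             \<le> ennreal ((1 + h_fun \<beta> \<sigma> \<delta>) * \<omega> (dist x y))))"

subsection \<open>Assumptions on the Hamiltonian\<close>

text \<open>The constants \<open>\<lambda>\<^sub>R\<close> are a parameter \<open>lam R\<close>.\<close>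

definition H1 ::
    "'a::euclidean_space set \<Rightarrow> ('a \<Rightarrow> real \<Rightarrow> 'a \<Rightarrow> real) \<Rightarrow> (real \<Rightarrow> real) \<Rightarrow> bool" where
  "H1 \<Omega> H lam \<longleftrightarrow>
     (\<forall>R>0. lam R \<ge> 0 \<and>
        (\<forall>x\<in>closure \<Omega>. \<forall>p u v. u \<ge> v \<and> \<bar>u\<bar> \<le> R \<and> \<bar>v\<bar> \<le> R \<longrightarrow>
           H x u p - H x v p \<ge> lam R * (u - v)))"

definition H2 ::
    "'a::euclidean_space set \<Rightarrow> ('a \<Rightarrow> real \<Rightarrow> 'a \<Rightarrow> real) \<Rightarrow> real \<Rightarrow> bool" where
  "H2 \<Omega> H m \<longleftrightarrow>
     (\<exists>c>0. \<forall>R>0. \<exists>C\<ge>0. \<forall>x\<in>closure \<Omega>. \<forall>p r. \<bar>r\<bar> \<le> R \<longrightarrow>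
        H x r p \<ge> c * norm p powr m - C)"

subsection \<open>Viscosity solutions\<close>

definition Qbar :: "'a::euclidean_space set \<Rightarrow> ('a \<times> real) set" where
  "Qbar \<Omega> = closure \<Omega> \<times> {0..}"

text \<open>\<open>G\<close> is the space-time gradient of the test function \<open>\<phi>\<close>, that is, \<open>G = (D\<phi>, \<phi>\<^sub>t)\<close>.\<close>

definition visc_E ::
    "'a::euclidean_space set \<Rightarrow> ('a \<Rightarrow> 'a measure) \<Rightarrow> ('a \<Rightarrow> real \<Rightarrow> 'a \<Rightarrow> real) \<Rightarrow>
     ('a \<times> real \<Rightarrow> real) \<Rightarrow> real \<Rightarrow> ('a \<times> real \<Rightarrow> real) \<Rightarrow> ('a \<times> real \<Rightarrow> real) \<Rightarrow>
     ('a \<times> real \<Rightarrow> 'a \<times> real) \<Rightarrow> 'a \<Rightarrow> real \<Rightarrow> real" where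
  "visc_E \<Omega> \<nu> H f \<delta> u \<phi> G x t =
     snd (G (x, t))
     - nonlocal \<Omega> \<nu> (ball 0 \<delta>) (\<lambda>y. \<phi> (y, t)) x
     - nonlocal \<Omega> \<nu> (- ball 0 \<delta>) (\<lambda>y. u (y, t)) x
     + H x (u (x, t)) (fst (G (x, t))) - f (x, t)"

text \<open>\<open>g\<close> is the lateral boundary datum and \<open>u0\<close> the initial datum. For a function that is both a
  sub- and a supersolution, hence continuous, the integrals in \<^const>\<open>visc_E\<close> all converge.\<close>

definition viscosity_subsolution ::
    "'a::euclidean_space set \<Rightarrow> ('a \<Rightarrow> 'a measure) \<Rightarrow> ('a \<Rightarrow> real \<Rightarrow> 'a \<Rightarrow> real) \<Rightarrow>
     ('a \<times> real \<Rightarrow> real) \<Rightarrow> ('a \<times> real \<Rightarrow> real) \<Rightarrow> ('a \<Rightarrow> real) \<Rightarrow> ('a \<times> real \<Rightarrow> real) \<Rightarrow> bool" where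
  "viscosity_subsolution \<Omega> \<nu> H f g u0 u \<longleftrightarrow>
     usc_on (Qbar \<Omega>) u \<and>
     (\<forall>\<phi> G x t. C1_with_gradient (Qbar \<Omega>) \<phi> G \<and> (x, t) \<in> Qbar \<Omega> \<and>
        (\<forall>q\<in>Qbar \<Omega>. u q - \<phi> q \<le> u (x, t) - \<phi> (x, t)) \<longrightarrow>
        (\<forall>\<delta>>0.
          (x \<in> \<Omega> \<and> t > 0 \<longrightarrow> visc_E \<Omega> \<nu> H f \<delta> u \<phi> G x t \<le> 0) \<and>
          (x \<in> frontier \<Omega> \<and> t > 0 \<longrightarrow>
             min (visc_E \<Omega> \<nu> H f \<delta> u \<phi> G x t) (u (x, t) - g (x, t)) \<le> 0) \<and>
          (t = 0 \<longrightarrow> min (visc_E \<Omega> \<nu> H f \<delta> u \<phi> G x t) (u (x, t) - u0 x) \<le> 0)))"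

definition viscosity_supersolution ::
    "'a::euclidean_space set \<Rightarrow> ('a \<Rightarrow> 'a measure) \<Rightarrow> ('a \<Rightarrow> real \<Rightarrow> 'a \<Rightarrow> real) \<Rightarrow>
     ('a \<times> real \<Rightarrow> real) \<Rightarrow> ('a \<times> real \<Rightarrow> real) \<Rightarrow> ('a \<Rightarrow> real) \<Rightarrow> ('a \<times> real \<Rightarrow> real) \<Rightarrow> bool" where
  "viscosity_supersolution \<Omega> \<nu> H f g u0 u \<longleftrightarrow>
     lsc_on (Qbar \<Omega>) u \<and>
     (\<forall>\<phi> G x t. C1_with_gradient (Qbar \<Omega>) \<phi> G \<and> (x, t) \<in> Qbar \<Omega> \<and>
        (\<forall>q\<in>Qbar \<Omega>. u q - \<phi> q \<ge> u (x, t) - \<phi> (x, t)) \<longrightarrow>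
        (\<forall>\<delta>>0.
          (x \<in> \<Omega> \<and> t > 0 \<longrightarrow> visc_E \<Omega> \<nu> H f \<delta> u \<phi> G x t \<ge> 0) \<and>
          (x \<in> frontier \<Omega> \<and> t > 0 \<longrightarrow>
             max (visc_E \<Omega> \<nu> H f \<delta> u \<phi> G x t) (u (x, t) - g (x, t)) \<ge> 0) \<and>
          (t = 0 \<longrightarrow> max (visc_E \<Omega> \<nu> H f \<delta> u \<phi> G x t) (u (x, t) - u0 x) \<ge> 0)))"

definition viscosity_solution ::
    "'a::euclidean_space set \<Rightarrow> ('a \<Rightarrow> 'a measure) \<Rightarrow> ('a \<Rightarrow> real \<Rightarrow> 'a \<Rightarrow> real) \<Rightarrow>
     ('a \<times> real \<Rightarrow> real) \<Rightarrow> ('a \<times> real \<Rightarrow> real) \<Rightarrow> ('a \<Rightarrow> real) \<Rightarrow> ('a \<times> real \<Rightarrow> real) \<Rightarrow> bool" where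
  "viscosity_solution \<Omega> \<nu> H f g u0 u \<longleftrightarrow>
     viscosity_subsolution \<Omega> \<nu> H f g u0 u \<and> viscosity_supersolution \<Omega> \<nu> H f g u0 u"

text \<open>The functions to which this is applied are continuous, so the \<open>L\<^sup>\<infinity>\<close> norm is the supremum.
  It is meaningful only if \<open>w\<close> is bounded on the nonempty set \<open>S\<close>.\<close>

definition sup_norm :: "'b set \<Rightarrow> ('b \<Rightarrow> real) \<Rightarrow> real" where
  "sup_norm S w = (SUP q\<in>S. \<bar>w q\<bar>)"

end

(* Comparison. Let u be a subsolution that is regular at the boundary (its boundary values are
   limits of interior ones) and v a supersolution. By coercivity, with m > sigma, a time-regularised
   u is Lipschitz locally in Omega, with a constant that blows up like d^(-sigma/m) at the boundary;
   since sigma/m < 1 this integrates to a Hoelder modulus transversally to the boundary. In the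
   doubling of variables, shifting the penalty by a transversal vector and adding a small term in
   the distance to the boundary then keeps the maximum point of u inside Omega, where its
   equation can be used; if the other point lies on the boundary, v is below the datum g there
   and the equation for v holds too.

   Existence. The upper envelope of the class of continuous subsolutions is a subsolution, and it
   is regular at the boundary because the members of the class are continuous. The supremum of the
   class is lower semicontinuous, and it is a supersolution: otherwise a bump would produce a larger
   continuous member. Comparison identifies the envelope with the supremum. Working with
   continuous members avoids any discussion of boundary regularity for general subsolutions. *)

theory Submission
  imports Defs
begin

subsection \<open>Gradients relative to a set\<close>

text \<open>Coercivity helps subsolutions only: no slope bound is available for \<open>v\<close>.
  The penalty is therefore a smoothed cone \<open>L * sqrt ((norm (x - (y + \<rho> *\<^sub>R
  \<xi>)))\<^sup>2 + \<rho>\<^sup>2)\<close> with \<open>L\<close> fixed and only \<rho> tending to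
  0. Once \<open>L\<close> exceeds every slope that the equation of \<open>u\<close> admits, the
  maximum sits within \<rho> of the vertex, and the penalty gradients never exceed \<open>L\<close>.
  They converge along a subsequence, so continuity of \<open>H\<close> and of the integrals away
  from the origin is enough in the limit. The time penalty \<eta> is kept fixed as well: coercivity
  controls the space gradient only if the time derivative is bounded below. The exponent \<sigma>/m
  is a matter of scaling. On a ball of radius \<open>s\<close> a test function has slopes up to
  order 1/s, which cost s^(-\<sigma>) in the nonlocal term; the m-th power of the slope at the
  maximum pays for this. At boundary points two C^1 functions that touch may have different
  gradients. Gradients are therefore identified at interior points only, and the data alternative is
  used elsewhere.\<close>

lemma C1_with_gradient_subset:
  "C1_with_gradient S u G \<Longrightarrow> T \<subseteq> S \<Longrightarrow> C1_with_gradient T u G"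
  unfolding C1_with_gradient_def
  by (meson continuous_on_subset has_derivative_subset subsetD)

lemma C1_with_gradient_cong:
  assumes "C1_with_gradient S u G" "\<And>x. x \<in> S \<Longrightarrow> u x = v x" "\<And>x. x \<in> S \<Longrightarrow> G x = F x"
  shows "C1_with_gradient S v F"
proof -
  have "(v has_derivative (\<lambda>h. F y \<bullet> h)) (at y within S)" if "y \<in> S" for y
    using assms that unfolding C1_with_gradient_def
    by (metis (no_types, lifting) has_derivative_transform)
  moreover have "continuous_on S F"
    using assms unfolding C1_with_gradient_def by (metis continuous_on_cong)
  ultimately show ?thesis by (simp add: C1_with_gradient_def)
qed

lemma C1_with_gradientI:
  assumes "continuous_on S G"
    and "\<And>y. y \<in> S \<Longrightarrow> (u has_derivative D y) (at y within S)"
    and "\<And>y h. y \<in> S \<Longrightarrow> D y h = G y \<bullet> h"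
  shows "C1_with_gradient S u G"
proof -
  have "D y = (\<lambda>h. G y \<bullet> h)" if "y \<in> S" for y using assms(3)[OF that] by (rule ext)
  then show ?thesis using assms(1,2) by (simp add: C1_with_gradient_def)
qed

lemma C1_with_gradientD:
  assumes "C1_with_gradient S u G"
  shows "continuous_on S G" "\<And>y. y \<in> S \<Longrightarrow> (u has_derivative (\<lambda>h. G y \<bullet> h)) (at y within S)"
  using assms by (auto simp: C1_with_gradient_def)

lemma C1_with_gradient_const: "C1_with_gradient S (\<lambda>_. c) (\<lambda>_. 0)"
  by (simp add: C1_with_gradient_def)

lemma C1_with_gradient_add:
  assumes "C1_with_gradient S u G" "C1_with_gradient S v F"
  shows "C1_with_gradient S (\<lambda>x. u x + v x) (\<lambda>x. G x + F x)"
  by (rule C1_with_gradientI[OF continuous_on_add has_derivative_add])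
     (use assms in \<open>auto simp: C1_with_gradient_def inner_add_left\<close>)

lemma C1_with_gradient_scale:
  assumes "C1_with_gradient S u G"
  shows "C1_with_gradient S (\<lambda>x. c * u x) (\<lambda>x. c *\<^sub>R G x)"
  by (rule C1_with_gradientI[OF continuous_on_scaleR[OF continuous_on_const] has_derivative_mult_right])
     (use assms in \<open>auto simp: C1_with_gradient_def\<close>)

lemma C1_with_gradient_minus:
  assumes "C1_with_gradient S u G"
  shows "C1_with_gradient S (\<lambda>x. - u x) (\<lambda>x. - G x)"
  using C1_with_gradient_scale[OF assms, of "-1"] by simp

lemma C1_with_gradient_diff:
  assumes "C1_with_gradient S u G" "C1_with_gradient S v F"
  shows "C1_with_gradient S (\<lambda>x. u x - v x) (\<lambda>x. G x - F x)"
  using C1_with_gradient_add[OF assms(1) C1_with_gradient_minus[OF assms(2)]] by simp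

lemma C1_with_gradient_compose:
  assumes "C1_with_gradient S u G"
    and "\<And>x. x \<in> S \<Longrightarrow> (h has_real_derivative h' (u x)) (at (u x))"
    and "continuous_on S (\<lambda>x. h' (u x))"
  shows "C1_with_gradient S (\<lambda>x. h (u x)) (\<lambda>x. h' (u x) *\<^sub>R G x)"
proof -
  have D: "((\<lambda>x. h (u x)) has_derivative (\<lambda>v. h' (u y) * (G y \<bullet> v))) (at y within S)" if "y \<in> S" for y
  proof -
    have "(u has_derivative (\<lambda>h. G y \<bullet> h)) (at y within S)"
      using assms(1) that unfolding C1_with_gradient_def by blast
    moreover have "(h has_derivative (\<lambda>k. h' (u y) * k)) (at (u y))"
      using assms(2)[OF that] by (simp add: has_field_derivative_def)
    ultimately show ?thesis by (rule has_derivative_compose)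
  qed
  show ?thesis
    by (rule C1_with_gradientI[OF continuous_on_scaleR[OF assms(3)] D])
       (use assms(1) in \<open>auto simp: C1_with_gradient_def\<close>)
qed

lemma C1_with_gradient_inner: "C1_with_gradient S (\<lambda>x. x \<bullet> a) (\<lambda>_. a)"
  unfolding C1_with_gradient_def
  by (auto intro!: derivative_eq_intros simp: inner_commute)

lemma C1_with_gradient_normsq:
  "C1_with_gradient S (\<lambda>x. (norm (x - a))\<^sup>2) (\<lambda>x. 2 *\<^sub>R (x - a))"
  unfolding C1_with_gradient_def power2_norm_eq_inner
  by (auto intro!: derivative_eq_intros continuous_intros simp: inner_commute algebra_simps)

text \<open>The smoothed cone from which the penalties are built: C^1 across the vertex
  \<open>a\<close>, between \<open>norm (x - a)\<close> and \<open>norm (x - a) + \<rho>\<close>,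
  and of slope less than 1.\<close>

lemma C1_with_gradient_sqrt:
  assumes "\<rho> > 0"
  shows "C1_with_gradient S (\<lambda>x. sqrt ((norm (x - a))\<^sup>2 + \<rho>\<^sup>2))
           (\<lambda>x. (1 / sqrt ((norm (x - a))\<^sup>2 + \<rho>\<^sup>2)) *\<^sub>R (x - a))"
proof -
  have p: "(norm (x - a))\<^sup>2 + \<rho>\<^sup>2 > 0" for x using assms by (simp add: add_nonneg_pos)
  have "C1_with_gradient S (\<lambda>x. (norm (x - a))\<^sup>2 + \<rho>\<^sup>2) (\<lambda>x. 2 *\<^sub>R (x - a) + 0)"
    by (intro C1_with_gradient_add C1_with_gradient_normsq C1_with_gradient_const)
  then have "C1_with_gradient S (\<lambda>x. sqrt ((norm (x - a))\<^sup>2 + \<rho>\<^sup>2))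
      (\<lambda>x. (inverse (sqrt ((norm (x - a))\<^sup>2 + \<rho>\<^sup>2)) / 2) *\<^sub>R (2 *\<^sub>R (x - a) + 0))"
    by (rule C1_with_gradient_compose[where h = sqrt and h' = "\<lambda>t. inverse (sqrt t) / 2"])
       (use p in \<open>auto intro!: DERIV_real_sqrt continuous_intros simp: less_imp_neq[symmetric]\<close>)
  then show ?thesis
    by (rule C1_with_gradient_cong) (auto simp: divide_simps)
qed

lemma C1_with_gradient_fst:
  assumes "C1_with_gradient A u G"
  shows "C1_with_gradient (A \<times> B) (\<lambda>q. u (fst q)) (\<lambda>q. (G (fst q), 0))"
proof -
  have "((\<lambda>q. u (fst q)) has_derivative (\<lambda>h. (G (fst y), 0) \<bullet> h)) (at y within A \<times> B)"
    if "y \<in> A \<times> B" for y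
  proof -
    have 1: "(fst has_derivative fst) (at y within A \<times> B)"
      by (rule has_derivative_fst[OF has_derivative_ident])
    have "(u has_derivative (\<lambda>h. G (fst y) \<bullet> h)) (at (fst y) within fst ` (A \<times> B))"
      using assms that unfolding C1_with_gradient_def
      by (auto intro: has_derivative_subset)
    from has_derivative_in_compose[OF 1 this] show ?thesis
      by (simp add: inner_prod_def)
  qed
  moreover have "continuous_on (A \<times> B) (\<lambda>q. (G (fst q), 0::'b))"
    using assms unfolding C1_with_gradient_def
    by (auto intro!: continuous_intros elim!: continuous_on_compose2)
  ultimately show ?thesis by (simp add: C1_with_gradient_def)
qed

lemma C1_with_gradient_snd:
  assumes "\<And>t. t \<in> B \<Longrightarrow> (a has_real_derivative a' t) (at t within B)" "continuous_on B a'"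
  shows "C1_with_gradient (A \<times> B) (\<lambda>q. a (snd q)) (\<lambda>q. (0, a' (snd q)))"
proof -
  have "((\<lambda>q. a (snd q)) has_derivative (\<lambda>h. (0, a' (snd y)) \<bullet> h)) (at y within A \<times> B)"
    if "y \<in> A \<times> B" for y
  proof -
    have 1: "(snd has_derivative snd) (at y within A \<times> B)"
      by (rule has_derivative_snd[OF has_derivative_ident])
    have "(a has_derivative (\<lambda>h. a' (snd y) * h)) (at (snd y) within snd ` (A \<times> B))"
      using assms(1)[of "snd y"] that
      by (auto simp: has_field_derivative_def intro: has_derivative_subset)
    from has_derivative_in_compose[OF 1 this] show ?thesis
      by (simp add: inner_prod_def)
  qed
  moreover have "continuous_on (A \<times> B) (\<lambda>q. (0::'a, a' (snd q)))"
    using assms(2) by (auto intro!: continuous_intros elim!: continuous_on_compose2)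
  ultimately show ?thesis by (simp add: C1_with_gradient_def)
qed

text \<open>The one-sided penalty used throughout. It vanishes together with its derivative on the
  negative half-line, so adding it changes neither the value nor the gradient of a test function
  there.\<close>

lemma has_real_derivative_pos_part_square:
  "((\<lambda>t. (max 0 t)\<^sup>2) has_real_derivative 2 * max 0 t) (at (t::real))"
proof -
  consider "t > 0" | "t < 0" | "t = 0" by linarith
  then show ?thesis
  proof cases
    case 1
    have "((\<lambda>t. t\<^sup>2) has_real_derivative 2 * t) (at t)" by (auto intro!: derivative_eq_intros)
    then show ?thesis
      by (rule has_field_derivative_transform_within_open[where S = "{0<..}", THEN DERIV_cong]) (use 1 in auto)
  next
    case 2
    have "((\<lambda>t. 0) has_real_derivative 0) (at t)" by simp
    then show ?thesis
      by (rule has_field_derivative_transform_within_open[where S = "{..<0}", THEN DERIV_cong]) (use 2 in auto)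
  next
    case 3
    have "((\<lambda>h::real. (max 0 h)\<^sup>2 / h) \<longlongrightarrow> 0) (at 0)"
    proof (rule Lim_null_comparison)
      show "\<forall>\<^sub>F h::real in at 0. norm ((max 0 h)\<^sup>2 / h) \<le> \<bar>h\<bar>"
        by (intro always_eventually) (auto simp: max_def power2_eq_square)
      show "((\<lambda>h::real. \<bar>h\<bar>) \<longlongrightarrow> 0) (at 0)" by (auto intro!: tendsto_eq_intros)
    qed
    then show ?thesis using 3 by (simp add: DERIV_def)
  qed
qed

lemma C1_with_gradient_pos_part_square:
  assumes "C1_with_gradient S u G"
  shows "C1_with_gradient S (\<lambda>x. (max 0 (u x))\<^sup>2) (\<lambda>x. (2 * max 0 (u x)) *\<^sub>R G x)"
proof -
  have "continuous_on S u"
    by (rule has_derivative_continuous_on, erule C1_with_gradientD(2)[OF assms(1)])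
  then show ?thesis
    by (intro C1_with_gradient_compose[OF assms] has_real_derivative_pos_part_square continuous_intros)
qed

lemma C1_with_gradient_imp_continuous_on:
  "C1_with_gradient S u G \<Longrightarrow> continuous_on S u"
  by (rule has_derivative_continuous_on, erule C1_with_gradientD(2))

lemma C1_with_gradient_segment_bound:
  assumes "C1_with_gradient S u G" "closed_segment x y \<subseteq> S"
    and "\<And>z. z \<in> closed_segment x y \<Longrightarrow> norm (G z) \<le> B"
  shows "\<bar>u x - u y\<bar> \<le> B * norm (x - y)"
proof -
  have "norm (u x - u y) \<le> B * norm (x - y)"
  proof (rule differentiable_bound[where S = "closed_segment x y" and f' = "\<lambda>z h. G z \<bullet> h"])
    show "(u has_derivative (\<bullet>) (G z)) (at z within closed_segment x y)"
      if "z \<in> closed_segment x y" for z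
      using assms that unfolding C1_with_gradient_def by (meson has_derivative_subset subsetD)
    show "onorm ((\<bullet>) (G z)) \<le> B" if "z \<in> closed_segment x y" for z
    proof (rule onorm_le)
      fix h show "norm (G z \<bullet> h) \<le> B * norm h"
        using Cauchy_Schwarz_ineq2[of "G z" h] assms(3)[OF that]
        by (smt (verit) mult_right_mono norm_ge_zero real_norm_def)
    qed
  qed auto
  then show ?thesis by simp
qed

subsection \<open>Semicontinuous functions on compact sets\<close>

lemma usc_onD:
  fixes U :: "'b::metric_space \<Rightarrow> real"
  assumes "usc_on S U" "x \<in> S" "U x < a"
  shows "\<exists>r>0. \<forall>y\<in>S. dist y x < r \<longrightarrow> U y < a"
  using assms unfolding usc_on_def eventually_at by (metis dist_nz dist_commute)

lemma usc_onI:
  fixes U :: "'b::metric_space \<Rightarrow> real"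
  assumes "\<And>x a. x \<in> S \<Longrightarrow> U x < a \<Longrightarrow> \<exists>r>0. \<forall>y\<in>S. dist y x < r \<longrightarrow> U y < a"
  shows "usc_on S U"
  using assms unfolding usc_on_def eventually_at by metis

lemma usc_on_subset: "usc_on S U \<Longrightarrow> T \<subseteq> S \<Longrightarrow> usc_on T (U :: 'b::metric_space \<Rightarrow> real)"
  by (rule usc_onI) (meson subsetD usc_onD)

lemma usc_on_sequentially:
  fixes U :: "'b::metric_space \<Rightarrow> real"
  assumes "usc_on S U" "\<And>n. X n \<in> S" "X \<longlonglongrightarrow> x" "x \<in> S" "U x < a"
  shows "\<forall>\<^sub>F n in sequentially. U (X n) < a"
proof -
  obtain r where "r > 0" "\<forall>y\<in>S. dist y x < r \<longrightarrow> U y < a"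
    using usc_onD[OF assms(1,4,5)] by blast
  then show ?thesis using tendstoD[OF assms(3), of r] assms(2) by (auto elim: eventually_mono)
qed

lemma usc_on_limit_le:
  fixes U :: "'b::metric_space \<Rightarrow> real"
  assumes "usc_on S U" "\<And>n. X n \<in> S" "X \<longlonglongrightarrow> x" "x \<in> S"
    and "(\<lambda>n. U (X n)) \<longlonglongrightarrow> l"
  shows "l \<le> U x"
proof (rule ccontr)
  assume "\<not> l \<le> U x"
  then obtain a where a: "U x < a" "a < l" using dense[of "U x" l] by auto
  have "\<forall>\<^sub>F n in sequentially. U (X n) \<le> a"
    using usc_on_sequentially[OF assms(1-4) a(1)] by (auto elim: eventually_mono)
  then show False using tendsto_upperbound[OF assms(5)] a(2) by fastforce
qed

lemma continuous_imp_usc: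
  fixes U :: "'b::metric_space \<Rightarrow> real"
  assumes "continuous_on S U"
  shows "usc_on S U"
proof (rule usc_onI)
  fix x a assume "x \<in> S" "U x < a"
  then obtain r where "r > 0" "\<forall>y\<in>S. dist y x < r \<longrightarrow> dist (U y) (U x) < a - U x"
    using assms[unfolded continuous_on_iff, rule_format, of x "a - U x"] by auto
  then show "\<exists>r>0. \<forall>y\<in>S. dist y x < r \<longrightarrow> U y < a"
    by (intro exI[of _ r]) (auto simp: dist_real_def abs_less_iff)
qed

lemma usc_on_add:
  fixes U V :: "'b::metric_space \<Rightarrow> real"
  assumes "usc_on S U" "usc_on S V"
  shows "usc_on S (\<lambda>x. U x + V x)"
proof (rule usc_onI)
  fix x a assume *: "x \<in> S" "U x + V x < a"
  define e where "e = (a - (U x + V x)) / 2"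
  have e: "e > 0" using * by (simp add: e_def)
  obtain r where r: "r > 0" "\<forall>y\<in>S. dist y x < r \<longrightarrow> U y < U x + e"
    using usc_onD[OF assms(1) *(1), of "U x + e"] e by auto
  obtain s where s: "s > 0" "\<forall>y\<in>S. dist y x < s \<longrightarrow> V y < V x + e"
    using usc_onD[OF assms(2) *(1), of "V x + e"] e by auto
  have "U y + V y < a" if "y \<in> S" "dist y x < min r s" for y
    using r s that unfolding e_def by (smt (verit) field_sum_of_halves min_less_iff_conj)
  then show "\<exists>r>0. \<forall>y\<in>S. dist y x < r \<longrightarrow> U y + V y < a"
    using r s by (intro exI[of _ "min r s"]) auto
qed

lemma usc_on_compose:
  fixes U :: "'b::metric_space \<Rightarrow> real" and h :: "'c::metric_space \<Rightarrow> 'b"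
  assumes "usc_on S U" "continuous_on T h" "h ` T \<subseteq> S"
  shows "usc_on T (\<lambda>x. U (h x))"
proof (rule usc_onI)
  fix x a assume *: "x \<in> T" "U (h x) < a"
  then obtain r where r: "r > 0" "\<forall>y\<in>S. dist y (h x) < r \<longrightarrow> U y < a"
    using usc_onD[OF assms(1), of "h x" a] assms(3) by auto
  obtain s where "s > 0" "\<forall>y\<in>T. dist y x < s \<longrightarrow> dist (h y) (h x) < r"
    using assms(2) *(1) r(1) unfolding continuous_on_iff by metis
  then show "\<exists>r>0. \<forall>y\<in>T. dist y x < r \<longrightarrow> U (h y) < a"
    using r assms(3) by (meson image_subset_iff)
qed

lemma lsc_on_iff_usc_on_minus: "lsc_on S V \<longleftrightarrow> usc_on S (\<lambda>x. - V x)"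
proof -
  have "(\<forall>a<V x. \<forall>\<^sub>F y in at x within S. a < V y) \<longleftrightarrow> (\<forall>a>- V x. \<forall>\<^sub>F y in at x within S. - V y < a)" for x
  proof safe
    fix a assume "\<forall>a<V x. \<forall>\<^sub>F y in at x within S. a < V y" "- V x < a"
    then have "\<forall>\<^sub>F y in at x within S. - a < V y" by (simp add: minus_less_iff)
    then show "\<forall>\<^sub>F y in at x within S. - V y < a" by (simp add: minus_less_iff)
  next
    fix a assume *: "\<forall>a>- V x. \<forall>\<^sub>F y in at x within S. - V y < a" "a < V x"
    show "\<forall>\<^sub>F y in at x within S. a < V y" using *(1)[rule_format, of "- a"] *(2) by simp
  qed
  then show ?thesis unfolding lsc_on_def usc_on_def by blast
qed

text \<open>If no point were maximal, each \<open>p\<close> would have a better point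
  \<open>f p\<close> whose value dominates \<open>U\<close> near \<open>p\<close>. Among finitely
  many such neighbourhoods covering \<open>P\<close>, the best of the points \<open>f p\<close> lies
  in one of them and is beaten by the corresponding better point.\<close>

lemma usc_attains_sup:
  fixes U :: "'b::metric_space \<Rightarrow> real"
  assumes "compact P" "P \<noteq> {}" "usc_on P U"
  shows "\<exists>p\<in>P. \<forall>q\<in>P. U q \<le> U p"
proof (rule ccontr)
  assume "\<not> ?thesis"
  then have "\<forall>p\<in>P. \<exists>q\<in>P. U p < U q" by force
  then have "\<forall>p\<in>P. \<exists>q\<in>P. \<exists>r>0. \<forall>y\<in>P. dist y p < r \<longrightarrow> U y < U q"
    using usc_onD[OF assms(3)] by blast
  then obtain f r where fr: "\<And>p. p \<in> P \<Longrightarrow> f p \<in> P \<and> r p > 0 \<and> (\<forall>y\<in>P. dist y p < r p \<longrightarrow> U y < U (f p))"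
    by metis
  have "P \<subseteq> (\<Union>p\<in>P. ball p (r p))" using fr by force
  then obtain D where D: "D \<subseteq> P" "finite D" "P \<subseteq> (\<Union>p\<in>D. ball p (r p))"
    using compactE_image[OF assms(1), of P "\<lambda>p. ball p (r p)"] by blast
  then have "D \<noteq> {}" using assms(2) by auto
  have "Max ((\<lambda>d. U (f d)) ` D) \<in> (\<lambda>d. U (f d)) ` D"
    using D(2) \<open>D \<noteq> {}\<close> by (intro Max_in) auto
  then obtain p where p: "p \<in> D" "\<And>d. d \<in> D \<Longrightarrow> U (f d) \<le> U (f p)"
    using D(2) by (smt (verit) Max_ge finite_imageI imageE imageI)
  have "f p \<in> P" using fr p D by blast
  then obtain d where "d \<in> D" "dist (f p) d < r d" using D(3) by (auto simp: dist_commute)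
  then show False using fr[of d] p D \<open>f p \<in> P\<close> by fastforce
qed

lemma usc_bounded_above:
  fixes U :: "'b::metric_space \<Rightarrow> real"
  assumes "compact P" "usc_on P U"
  shows "\<exists>C. \<forall>q\<in>P. U q \<le> C"
  using usc_attains_sup[OF assms(1) _ assms(2)] by (cases "P = {}") auto

text \<open>Sup-convolutions with the cones \<open>real n * dist q q'\<close>: they are n-Lipschitz,
  and points at distance at least \<open>r\<close> from \<open>q\<close> stop contributing once
  \<open>n * r\<close> exceeds \<open>C - b\<close>. They carry over to semicontinuous functions
  what is known about averages of continuous ones.\<close>

lemma usc_approximation_from_above:
  fixes U :: "'b::metric_space \<Rightarrow> real"
  assumes "usc_on P U" and C: "\<And>q. q \<in> P \<Longrightarrow> \<bar>U q\<bar> \<le> C"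
  shows "\<exists>c :: nat \<Rightarrow> 'b \<Rightarrow> real. (\<forall>n. continuous_on P (c n)) \<and> (\<forall>n. \<forall>q\<in>P. U q \<le> c n q) \<and>
    (\<forall>n. \<forall>q\<in>P. c n q \<le> C) \<and> (\<forall>q\<in>P. (\<lambda>n. c n q) \<longlonglongrightarrow> U q)"
proof -
  define c where "c = (\<lambda>(n::nat) q. SUP q'\<in>P. U q' - real n * dist q q')"
  have bdd: "bdd_above ((\<lambda>q'. U q' - real n * dist q q') ` P)" for n q
    by (intro bdd_aboveI2[of _ _ C]) (use C in \<open>smt (verit) mult_nonneg_nonneg of_nat_0_le_iff zero_le_dist\<close>)
  have low: "U q' - real n * dist q q' \<le> c n q" if "q' \<in> P" for n q q'
    unfolding c_def by (rule cSUP_upper[OF that bdd])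
  have up: "c n q \<le> b" if "P \<noteq> {}" "\<And>q'. q' \<in> P \<Longrightarrow> U q' - real n * dist q q' \<le> b" for n q b
    unfolding c_def by (rule cSUP_least) (use that in auto)
  have lip: "c n p \<le> c n q + real n * dist p q" if "p \<in> P" for n p q
  proof (rule up)
    fix q' assume "q' \<in> P"
    then have "U q' - real n * dist q q' \<le> c n q" by (rule low)
    moreover have "real n * dist q q' \<le> real n * dist p q + real n * dist p q'"
      by (metis dist_triangle3 distrib_left mult_left_mono of_nat_0_le_iff)
    ultimately show "U q' - real n * dist p q' \<le> c n q + real n * dist p q" by linarith
  qed (use that in auto)
  show ?thesis
  proof (intro exI[of _ c] conjI allI ballI)
    show "continuous_on P (c n)" for n
    proof -
      have "(real n)-lipschitz_on P (c n)"
      proof (rule lipschitz_onI)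
        fix p q assume "p \<in> P" "q \<in> P"
        then show "dist (c n p) (c n q) \<le> real n * dist p q"
          using lip[of p n q] lip[of q n p] by (simp add: dist_real_def abs_le_iff dist_commute)
      qed simp
      then show ?thesis by (rule lipschitz_on_continuous_on)
    qed
    show "U q \<le> c n q" if "q \<in> P" for n q using low[OF that, of n q] by simp
    show "c n q \<le> C" if "q \<in> P" for n q
      by (rule up) (use that C in \<open>auto, smt (verit) mult_nonneg_nonneg of_nat_0_le_iff zero_le_dist\<close>)
    show "(\<lambda>n. c n q) \<longlonglongrightarrow> U q" if q: "q \<in> P" for q
    proof (rule order_tendstoI)
      fix a assume "a < U q"
      then show "\<forall>\<^sub>F n in sequentially. a < c n q"
        using low[OF q, of _ q] by (intro always_eventually) (auto intro: less_le_trans)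
    next
      fix a assume a: "U q < a"
      then obtain b where b: "U q < b" "b < a" using dense by blast
      obtain r where r: "r > 0" "\<forall>y\<in>P. dist y q < r \<longrightarrow> U y < b"
        using usc_onD[OF assms(1) q b(1)] by blast
      obtain N where N: "C - b < real N * r" using reals_Archimedean3[OF r(1)] by blast
      have "c n q \<le> b" if "n \<ge> N" for n
      proof (rule up)
        fix q' assume q': "q' \<in> P"
        show "U q' - real n * dist q q' \<le> b"
        proof (cases "dist q' q < r")
          case True
          then show ?thesis using r(2) q' by (smt (verit) mult_nonneg_nonneg of_nat_0_le_iff zero_le_dist)
        next
          case False
          have "real N * r \<le> real n * dist q q'"
            using that False r(1) by (intro mult_mono) (simp_all add: dist_commute)
          then show ?thesis using N C[OF q'] by linarith
        qed
      qed (use q in auto)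
      then show "\<forall>\<^sub>F n in sequentially. c n q < a"
        using b(2) unfolding eventually_sequentially by (meson le_less_trans)
    qed
  qed
qed

subsection \<open>The nonlocal operator\<close>

locale levy_kernels =
  fixes \<Omega> :: "'a::euclidean_space set" and \<nu> :: "'a \<Rightarrow> 'a measure" and \<sigma> :: real
  assumes bounded_domain: "bounded \<Omega>" and open_domain: "open \<Omega>" and domain_nonempty: "\<Omega> \<noteq> {}"
    and boundary_chart: "C1_boundary \<Omega>"
    and sigma_pos: "0 < \<sigma>" and sigma_less: "\<sigma> < 1"
    and sets_kernel: "\<And>x. x \<in> closure \<Omega> \<Longrightarrow> sets (\<nu> x) = sets borel"
    and M0: "M0 \<Omega> \<nu>" and M1: "M1 \<Omega> \<nu> \<sigma>" and M2: "M2 \<Omega> \<nu> \<sigma>"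
begin

abbreviation "K \<equiv> closure \<Omega>"

lemma compact_K: "compact K"
  using bounded_domain by (simp add: compact_closure)

lemma K_nonempty: "K \<noteq> {}"
  using domain_nonempty by simp

lemma domain_subset_K: "x \<in> \<Omega> \<Longrightarrow> x \<in> K"
  using closure_subset by blast

lemma K_cases: "x \<in> K \<Longrightarrow> x \<in> \<Omega> \<or> x \<in> frontier \<Omega>"
  using open_domain by (simp add: frontier_def interior_open)

lemma frontier_subset_K: "x \<in> frontier \<Omega> \<Longrightarrow> x \<in> K"
  by (simp add: frontier_def)

lemma frontier_not_domain: "x \<in> frontier \<Omega> \<Longrightarrow> x \<notin> \<Omega>"
  using open_domain by (simp add: frontier_def interior_open)

lemma compact_K_times: "compact (K \<times> {0..T::real})"
  by (intro compact_Times compact_K compact_Icc)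

definition far :: "real \<Rightarrow> 'a \<Rightarrow> 'a set" where
  "far \<delta> x = {z \<in> - ball 0 \<delta>. x + z \<in> K}"

definition near :: "real \<Rightarrow> 'a \<Rightarrow> 'a set" where
  "near \<delta> x = {z \<in> ball 0 \<delta>. x + z \<in> K}"

lemma translate_K_closed: "closed {z. x + z \<in> K}"
proof -
  have "{z. x + z \<in> K} = (\<lambda>z. x + z) -` K" by auto
  then show ?thesis by (simp add: closed_vimage continuous_intros)
qed

lemma near_borel [measurable]: "near \<delta> x \<in> sets borel"
proof -
  have "near \<delta> x = ball 0 \<delta> \<inter> {z. x + z \<in> K}" by (auto simp: near_def)
  then show ?thesis using translate_K_closed by (simp add: borel_closed)
qed

lemma far_borel [measurable]: "far \<delta> x \<in> sets borel"
proof -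
  have "far \<delta> x = (- ball 0 \<delta>) \<inter> {z. x + z \<in> K}" by (auto simp: far_def)
  then show ?thesis using translate_K_closed by (simp add: borel_closed sets.Int)
qed

text \<open>(M1) with exponent 0 bounds the mass away from the origin, and (M2) with exponent 1
  bounds the first moment near it; the latter is where \<sigma> < 1 enters. Both are uniform in the
  base point and are given one common constant.\<close>

lemma kernel_constant_exists:
  "\<exists>C>0. (\<forall>\<delta>>0. \<forall>x\<in>K. emeasure (\<nu> x) (far \<delta> x) \<le> ennreal (C * \<delta> powr (- \<sigma>))) \<and>
     (\<forall>\<delta>\<in>{0<..<1}. \<forall>x\<in>K. (\<integral>\<^sup>+z\<in>near \<delta> x. ennreal (norm z) \<partial>\<nu> x) \<le> ennreal (C * \<delta> powr (1 - \<sigma>)))"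
proof -
  obtain C1 where C1: "C1 > 0" "\<forall>\<beta>\<in>{0..2}. \<forall>\<delta>>0.
      (SUP x\<in>K. \<integral>\<^sup>+z\<in>- ball 0 \<delta>. ennreal (min 1 (norm z powr \<beta>)) \<partial>\<nu> x) \<le> ennreal (C1 * h_fun \<beta> \<sigma> \<delta>)"
    using M1 unfolding M1_def by blast
  obtain C2 where C2: "C2 > 0" "\<forall>\<beta>\<in>{\<sigma><..2}. \<forall>\<delta>\<in>{0<..<1}.
      (SUP x\<in>K. \<integral>\<^sup>+z\<in>ball 0 \<delta>. ennreal (norm z powr \<beta>) \<partial>\<nu> x) \<le> ennreal (C2 * \<delta> powr (\<beta> - \<sigma>))"
    using M2 unfolding M2_def by blast
  define C where "C = C1 + C2"
  have 1: "emeasure (\<nu> x) (far \<delta> x) \<le> ennreal (C * \<delta> powr (- \<sigma>))" if d: "\<delta> > 0" and x: "x \<in> K" for \<delta> x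
  proof -
    have m: "far \<delta> x \<in> sets (\<nu> x)" using sets_kernel[OF x] far_borel by simp
    have "emeasure (\<nu> x) (far \<delta> x) = (\<integral>\<^sup>+z. indicator (far \<delta> x) z \<partial>\<nu> x)"
      using m by simp
    also have "\<dots> \<le> (\<integral>\<^sup>+z\<in>- ball 0 \<delta>. ennreal (min 1 (norm z powr 0)) \<partial>\<nu> x)"
      by (intro nn_integral_mono) (use d in \<open>auto simp: far_def indicator_def\<close>)
    also have "\<dots> \<le> (SUP x\<in>K. \<integral>\<^sup>+z\<in>- ball 0 \<delta>. ennreal (min 1 (norm z powr 0)) \<partial>\<nu> x)"
      by (rule SUP_upper[OF x])
    also have "\<dots> \<le> ennreal (C1 * h_fun 0 \<sigma> \<delta>)" by (rule C1(2)[rule_format, OF _ d]) simp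
    also have "\<dots> \<le> ennreal (C * \<delta> powr (- \<sigma>))"
      using sigma_pos C2(1) by (intro ennreal_leI) (simp add: h_fun_def C_def mult_right_mono)
    finally show ?thesis .
  qed
  have 2: "(\<integral>\<^sup>+z\<in>near \<delta> x. ennreal (norm z) \<partial>\<nu> x) \<le> ennreal (C * \<delta> powr (1 - \<sigma>))"
    if d: "\<delta> \<in> {0<..<1}" and x: "x \<in> K" for \<delta> x
  proof -
    have "(\<integral>\<^sup>+z\<in>near \<delta> x. ennreal (norm z) \<partial>\<nu> x) \<le> (\<integral>\<^sup>+z\<in>ball 0 \<delta>. ennreal (norm z powr 1) \<partial>\<nu> x)"
      by (intro nn_integral_mono) (auto simp: near_def indicator_def)
    also have "\<dots> \<le> (SUP x\<in>K. \<integral>\<^sup>+z\<in>ball 0 \<delta>. ennreal (norm z powr 1) \<partial>\<nu> x)"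
      by (rule SUP_upper[OF x])
    also have "\<dots> \<le> ennreal (C2 * \<delta> powr (1 - \<sigma>))"
      by (rule C2(2)[rule_format, OF _ d]) (use sigma_less in simp)
    also have "\<dots> \<le> ennreal (C * \<delta> powr (1 - \<sigma>))"
      using C1(1) by (intro ennreal_leI) (simp add: C_def mult_right_mono)
    finally show ?thesis .
  qed
  show ?thesis using 1 2 C1(1) C2(1) by (intro exI[of _ C]) (auto simp: C_def)
qed

definition "C\<nu> = (SOME C. C > 0 \<and> (\<forall>\<delta>>0. \<forall>x\<in>K. emeasure (\<nu> x) (far \<delta> x) \<le> ennreal (C * \<delta> powr (- \<sigma>))) \<and>
     (\<forall>\<delta>\<in>{0<..<1}. \<forall>x\<in>K. (\<integral>\<^sup>+z\<in>near \<delta> x. ennreal (norm z) \<partial>\<nu> x) \<le> ennreal (C * \<delta> powr (1 - \<sigma>))))"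

lemma C\<nu>_pos: "C\<nu> > 0"
  and emeasure_far_le: "\<delta> > 0 \<Longrightarrow> x \<in> K \<Longrightarrow> emeasure (\<nu> x) (far \<delta> x) \<le> ennreal (C\<nu> * \<delta> powr (- \<sigma>))"
  and nn_integral_near_le: "\<delta> > 0 \<Longrightarrow> \<delta> < 1 \<Longrightarrow> x \<in> K \<Longrightarrow>
     (\<integral>\<^sup>+z\<in>near \<delta> x. ennreal (norm z) \<partial>\<nu> x) \<le> ennreal (C\<nu> * \<delta> powr (1 - \<sigma>))"
  using someI_ex[OF kernel_constant_exists] unfolding C\<nu>_def[symmetric] by auto

definition mass :: "real \<Rightarrow> 'a \<Rightarrow> real" where
  "mass \<delta> x = measure (\<nu> x) (far \<delta> x)"

text \<open>Away from the origin the kernel is finite, so the integral of a difference splits into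
  this average and a multiple of \<open>mass\<close>. For continuous integrands each part is
  continuous in the base point.\<close>

definition average :: "real \<Rightarrow> ('a \<Rightarrow> real) \<Rightarrow> 'a \<Rightarrow> real" where
  "average \<delta> c x = (LINT z:far \<delta> x|\<nu> x. c (x + z))"

lemma far_finite: "\<delta> > 0 \<Longrightarrow> x \<in> K \<Longrightarrow> emeasure (\<nu> x) (far \<delta> x) < \<infinity>"
  using emeasure_far_le[of \<delta> x] by (metis ennreal_less_top infinity_ennreal_def le_less_trans)

lemma mass_nonneg: "0 \<le> mass \<delta> x"
  by (simp add: mass_def)

lemma mass_le: "\<delta> > 0 \<Longrightarrow> x \<in> K \<Longrightarrow> mass \<delta> x \<le> C\<nu> * \<delta> powr (- \<sigma>)"
  unfolding mass_def measure_def using emeasure_far_le[of \<delta> x] C\<nu>_pos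
  by (intro enn2real_leI) auto

text \<open>Extension by zero: values off \<open>K\<close> are arbitrary and must not influence
  measurability.\<close>

definition borel_K :: "('a \<Rightarrow> real) \<Rightarrow> bool" where
  "borel_K c \<longleftrightarrow> (\<lambda>y. indicator K y * c y) \<in> borel_measurable borel"

lemma continuous_imp_borel_K: "continuous_on K c \<Longrightarrow> borel_K c"
  unfolding borel_K_def
  using borel_measurable_continuous_on_indicator[of K c] by (simp add: borel_closed)

lemma borel_K_limit:
  assumes "\<And>n. borel_K (c n)" "\<And>q. q \<in> K \<Longrightarrow> (\<lambda>n. c n q) \<longlonglongrightarrow> u q"
  shows "borel_K u"
  unfolding borel_K_def
  by (rule borel_measurable_LIMSEQ_real[of borel "\<lambda>n y. indicator K y * c n y"])
     (use assms in \<open>auto simp: borel_K_def indicator_def\<close>)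

lemma borel_K_minus: "borel_K c \<Longrightarrow> borel_K (\<lambda>x. - c x)"
  unfolding borel_K_def using borel_measurable_uminus by fastforce

lemma borel_K_usc:
  assumes "usc_on K u" "\<And>q. q \<in> K \<Longrightarrow> \<bar>u q\<bar> \<le> C"
  shows "borel_K u"
proof -
  obtain c :: "nat \<Rightarrow> 'a \<Rightarrow> real"
    where "\<forall>n. continuous_on K (c n)" "\<forall>q\<in>K. (\<lambda>n. c n q) \<longlonglongrightarrow> u q"
    using usc_approximation_from_above[OF assms] by blast
  then show ?thesis by (intro borel_K_limit[of c u]) (simp_all add: continuous_imp_borel_K)
qed

lemma indicator_shift_measurable:
  assumes "borel_K c" "A \<in> sets borel" "A \<subseteq> {z. x + z \<in> K}" "x \<in> K"
  shows "(\<lambda>z. indicator A z * c (x + z)) \<in> borel_measurable (\<nu> x)"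
proof -
  have [measurable]: "(\<lambda>y. indicator K y * c y) \<in> borel_measurable borel" "A \<in> sets borel"
    using assms by (auto simp: borel_K_def)
  have "(\<lambda>z. x + z) \<in> borel_measurable borel" by measurable
  from measurable_compose[OF this assms(1)[unfolded borel_K_def]]
  have "(\<lambda>z. indicator A z * (indicator K (x + z) * c (x + z))) \<in> borel_measurable borel"
    by (rule borel_measurable_times[OF borel_measurable_indicator[OF assms(2)]])
  moreover have "(\<lambda>z. indicator A z * (indicator K (x + z) * c (x + z))) = (\<lambda>z. indicator A z * c (x + z))"
    using assms(3) by (auto simp: indicator_def fun_eq_iff)
  ultimately show ?thesis
    using sets_kernel[OF assms(4)] by (simp cong: measurable_cong_sets)
qed

lemma far_integrable_const:
  "\<delta> > 0 \<Longrightarrow> x \<in> K \<Longrightarrow> set_integrable (\<nu> x) (far \<delta> x) (\<lambda>_. k::real)"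
  unfolding set_integrable_def
  using far_finite[of \<delta> x] sets_kernel[of x] far_borel[of \<delta> x]
  by (auto intro!: integrable_mult_left integrable_real_indicator simp: mult.commute)

lemma far_integrable:
  assumes "borel_K c" "\<And>y. y \<in> K \<Longrightarrow> \<bar>c y\<bar> \<le> C" "\<delta> > 0" "x \<in> K"
  shows "set_integrable (\<nu> x) (far \<delta> x) (\<lambda>z. c (x + z))"
  unfolding set_integrable_def
proof (rule Bochner_Integration.integrable_bound[OF far_integrable_const[OF assms(3,4), of C, unfolded set_integrable_def]])
  show "(\<lambda>z. indicator (far \<delta> x) z *\<^sub>R c (x + z)) \<in> borel_measurable (\<nu> x)"
    using indicator_shift_measurable[OF assms(1) far_borel _ assms(4), of \<delta> x]
    by (auto simp: far_def)
  show "AE z in \<nu> x. norm (indicator (far \<delta> x) z *\<^sub>R c (x + z)) \<le> norm (indicator (far \<delta> x) z *\<^sub>R C)"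
  proof (rule AE_I2)
    fix z show "norm (indicator (far \<delta> x) z *\<^sub>R c (x + z)) \<le> norm (indicator (far \<delta> x) z *\<^sub>R C)"
      using assms(2)[of "x + z"] by (cases "z \<in> far \<delta> x") (auto simp: far_def)
  qed
qed

lemma set_integral_far_const:
  "\<delta> > 0 \<Longrightarrow> x \<in> K \<Longrightarrow> (LINT z:far \<delta> x|\<nu> x. k) = k * mass \<delta> x"
  unfolding set_lebesgue_integral_def mass_def
  using far_finite[of \<delta> x] sets_kernel[of x] far_borel[of \<delta> x] by simp

lemma nonlocal_far:
  assumes "borel_K c" "\<And>y. y \<in> K \<Longrightarrow> \<bar>c y\<bar> \<le> C" "\<delta> > 0" "x \<in> K"
  shows "nonlocal \<Omega> \<nu> (- ball 0 \<delta>) c x = average \<delta> c x - c x * mass \<delta> x"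
proof -
  have "nonlocal \<Omega> \<nu> (- ball 0 \<delta>) c x = (LINT z:far \<delta> x|\<nu> x. c (x + z) - c x)"
    by (simp add: nonlocal_def far_def)
  also have "\<dots> = average \<delta> c x - (LINT z:far \<delta> x|\<nu> x. c x)"
    unfolding average_def
    by (intro set_integral_diff far_integrable[OF assms] far_integrable_const assms)
  finally show ?thesis by (simp add: set_integral_far_const[OF assms(3,4)])
qed

lemma average_minus: "average \<delta> (\<lambda>y. - c y) x = - average \<delta> c x"
  unfolding average_def set_lebesgue_integral_def by simp

lemma average_mono:
  assumes "borel_K c" "borel_K d" "\<And>y. y \<in> K \<Longrightarrow> \<bar>c y\<bar> \<le> C" "\<And>y. y \<in> K \<Longrightarrow> \<bar>d y\<bar> \<le> C"
    "\<delta> > 0" "x \<in> K" "\<And>y. y \<in> K \<Longrightarrow> c y \<le> d y"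
  shows "average \<delta> c x \<le> average \<delta> d x"
  unfolding average_def
  by (rule set_integral_mono[OF far_integrable[OF assms(1,3,5,6)] far_integrable[OF assms(2,4,5,6)]])
     (auto simp: far_def assms)

lemma average_diff_le:
  assumes "borel_K c" "borel_K d" "\<And>y. y \<in> K \<Longrightarrow> \<bar>c y\<bar> \<le> C" "\<And>y. y \<in> K \<Longrightarrow> \<bar>d y\<bar> \<le> C"
    "\<delta> > 0" "x \<in> K" "\<And>y. y \<in> K \<Longrightarrow> \<bar>c y - d y\<bar> \<le> e"
  shows "\<bar>average \<delta> c x - average \<delta> d x\<bar> \<le> e * mass \<delta> x"
proof -
  note ic = far_integrable[OF assms(1,3,5,6)] and id = far_integrable[OF assms(2,4,5,6)]
  have "average \<delta> c x - average \<delta> d x = (LINT z:far \<delta> x|\<nu> x. c (x + z) - d (x + z))"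
    unfolding average_def by (simp add: set_integral_diff[OF ic id])
  moreover have "(LINT z:far \<delta> x|\<nu> x. c (x + z) - d (x + z)) \<le> (LINT z:far \<delta> x|\<nu> x. e)"
    by (intro set_integral_mono set_integral_diff ic id far_integrable_const assms(5,6))
       (use assms(7) in \<open>auto simp: far_def abs_le_iff\<close>)
  moreover have "- e \<le> c (x + z) - d (x + z)" if "z \<in> far \<delta> x" for z
    using assms(7)[of "x + z"] that by (simp add: far_def abs_le_iff)
  then have "(LINT z:far \<delta> x|\<nu> x. - e) \<le> (LINT z:far \<delta> x|\<nu> x. c (x + z) - d (x + z))"
    by (intro set_integral_mono set_integral_diff ic id far_integrable_const assms(5,6))
  ultimately show ?thesis
    unfolding set_integral_far_const[OF assms(5,6)] by (simp add: abs_le_iff)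
qed

text \<open>The cut-off at distance \<open>\<delta>/2\<close> from \<open>x\<^sub>0\<close> does not affect the integral over \<open>far \<delta> y\<close> for \<open>y\<close>
  near \<open>x\<^sub>0\<close>, and makes the integrand \<open>C\<^sup>1\<close> there, as (M0-2) demands.\<close>

lemma average_continuous:
  assumes "continuous_on K c" "\<delta> > 0"
  shows "continuous_on K (average \<delta> c)"
proof -
  have "continuous (at x0 within K) (average \<delta> c)" if x0: "x0 \<in> K" for x0
  proof -
    define r where "r = \<delta> / 2"
    have r: "r > 0" using assms(2) by (simp add: r_def)
    define w where "w = (\<lambda>y. if y \<in> ball x0 r then 0 else c y)"
    have "bounded (c ` K)" using assms(1) compact_K compact_continuous_image compact_imp_bounded by blast
    then obtain C where C: "\<And>y. y \<in> K \<Longrightarrow> \<bar>c y\<bar> \<le> C" by (auto simp: bounded_iff)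
    have cm: "(\<lambda>y. indicator K y * c y) \<in> borel_measurable borel"
      using continuous_imp_borel_K[OF assms(1)] by (simp add: borel_K_def)
    have "(\<lambda>y. indicator K y * w y) = (\<lambda>y. indicator (- ball x0 r) y * (indicator K y * c y))"
      by (auto simp: w_def indicator_def fun_eq_iff)
    also have "\<dots> \<in> borel_measurable borel"
      by (rule borel_measurable_times[OF borel_measurable_indicator cm]) (auto intro: borel_closed)
    finally have m: "borel_K w" by (simp add: borel_K_def)
    have "w \<in> borel_measurable (restrict_space borel K)"
      using m by (subst borel_measurable_restrict_space_iff) (auto simp: borel_K_def borel_closed mult.commute)
    moreover have "bounded (w ` K)"
      unfolding bounded_iff by (intro exI[of _ "max C 0"]) (use C in \<open>fastforce simp: w_def\<close>)
    moreover have "C1_on (ball x0 r \<inter> K) w"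
      unfolding C1_on_def
      by (rule exI, rule C1_with_gradient_cong[OF C1_with_gradient_const[of _ 0]]) (auto simp: w_def)
    ultimately have "continuous_on (ball x0 r \<inter> K) (nonlocal \<Omega> \<nu> (- ball 0 \<delta>) w)"
      using M0 x0 r unfolding M0_def by (simp add: borel_closed)
    moreover have "nonlocal \<Omega> \<nu> (- ball 0 \<delta>) w y = average \<delta> c y" if "y \<in> ball x0 r \<inter> K" for y
    proof -
      have "x0 \<noteq> y + z \<and> y + z \<notin> ball x0 r" if "z \<in> far \<delta> y" for z
      proof -
        have "\<delta> \<le> norm z" using that by (simp add: far_def)
        moreover have "norm z \<le> dist x0 (y + z) + dist x0 y"
          by (metis add_diff_cancel_left' dist_norm dist_triangle2 dist_commute)
        ultimately show ?thesis using \<open>y \<in> ball x0 r \<inter> K\<close> r by (auto simp: r_def)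
      qed
      then have E: "indicator (far \<delta> y) z *\<^sub>R (w (y + z) - w y) = indicator (far \<delta> y) z *\<^sub>R c (y + z)" for z
        using that by (cases "z \<in> far \<delta> y") (auto simp: w_def)
      show ?thesis
        unfolding nonlocal_def average_def set_lebesgue_integral_def far_def[symmetric] by (simp only: E)
    qed
    ultimately have "continuous_on (ball x0 r \<inter> K) (average \<delta> c)"
      by (metis (no_types, lifting) continuous_on_cong)
    then have "continuous (at x0 within (ball x0 r \<inter> K)) (average \<delta> c)"
      using x0 r by (simp add: continuous_on_eq_continuous_within)
    moreover have "at x0 within (ball x0 r \<inter> K) = at x0 within K"
      by (rule at_within_nhd[of _ "ball x0 r"]) (use r in auto)
    ultimately show ?thesis by simp
  qed
  then show ?thesis by (simp add: continuous_on_eq_continuous_within)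
qed

end

section \<open>Limits and estimates of the nonlocal terms\<close>

context levy_kernels
begin

lemma average_one: "\<delta> > 0 \<Longrightarrow> x \<in> K \<Longrightarrow> average \<delta> (\<lambda>_. 1) x = mass \<delta> x"
  using set_integral_far_const[of \<delta> x 1] by (simp add: average_def)

lemma mass_tendsto:
  assumes "\<delta> > 0" "\<And>n. X n \<in> K" "X \<longlonglongrightarrow> x0" "x0 \<in> K"
  shows "(\<lambda>n. mass \<delta> (X n)) \<longlonglongrightarrow> mass \<delta> x0"
proof -
  have "(\<lambda>n. average \<delta> (\<lambda>_. 1) (X n)) \<longlonglongrightarrow> average \<delta> (\<lambda>_. 1) x0"
    by (rule continuous_on_tendsto_compose[OF average_continuous]) (use assms in auto)
  then show ?thesis using assms by (simp add: average_one)
qed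

text \<open>Base point and time are moved one after the other. The change in time is uniformly small
  on \<open>K\<close> and is integrated against a mass that is bounded independently of the base
  point.\<close>

lemma average_tendsto:
  fixes s :: "nat \<Rightarrow> real"
  assumes c: "continuous_on (K \<times> {0..T}) c" and "\<delta> > 0"
    and X: "\<And>n. X n \<in> K" "X \<longlonglongrightarrow> x0" "x0 \<in> K"
    and s: "\<And>n. s n \<in> {0..T}" "s \<longlonglongrightarrow> t0" "t0 \<in> {0..T}"
  shows "(\<lambda>n. average \<delta> (\<lambda>y. c (y, s n)) (X n)) \<longlonglongrightarrow> average \<delta> (\<lambda>y. c (y, t0)) x0"
proof -
  have slice: "continuous_on K (\<lambda>y. c (y, t))" if "t \<in> {0..T}" for t
    by (rule continuous_on_compose2[OF c]) (use that in \<open>auto intro!: continuous_intros\<close>)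
  have "bounded (c ` (K \<times> {0..T}))"
    using c compact_K_times compact_continuous_image compact_imp_bounded by blast
  then obtain C where C: "\<And>q. q \<in> K \<times> {0..T} \<Longrightarrow> \<bar>c q\<bar> \<le> C" unfolding bounded_iff by auto
  have unif: "uniformly_continuous_on (K \<times> {0..T}) c"
    by (rule compact_uniformly_continuous[OF c compact_K_times])
  have 1: "(\<lambda>n. average \<delta> (\<lambda>y. c (y, t0)) (X n)) \<longlonglongrightarrow> average \<delta> (\<lambda>y. c (y, t0)) x0"
    by (rule continuous_on_tendsto_compose[OF average_continuous[OF slice]]) (use assms in auto)
  have 2: "(\<lambda>n. average \<delta> (\<lambda>y. c (y, s n)) (X n) - average \<delta> (\<lambda>y. c (y, t0)) (X n)) \<longlonglongrightarrow> 0"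
  proof (rule LIMSEQ_I)
    fix r :: real assume r: "r > 0"
    define M where "M = C\<nu> * \<delta> powr (- \<sigma>) + 1"
    have M: "M > 0" using C\<nu>_pos by (simp add: M_def add_nonneg_pos)
    obtain d where d: "d > 0" "\<And>q q'. q \<in> K \<times> {0..T} \<Longrightarrow> q' \<in> K \<times> {0..T} \<Longrightarrow> dist q' q < d \<Longrightarrow> dist (c q') (c q) < r / (2 * M)"
      using unif[unfolded uniformly_continuous_on_def, rule_format, of "r / (2 * M)"] r M by auto
    obtain n0 where n0: "\<And>n. n \<ge> n0 \<Longrightarrow> dist (s n) t0 < d"
      using s(2) d(1) unfolding lim_sequentially by blast
    have "norm (average \<delta> (\<lambda>y. c (y, s n)) (X n) - average \<delta> (\<lambda>y. c (y, t0)) (X n) - 0) < r" if "n \<ge> n0" for n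
    proof -
      have "\<bar>average \<delta> (\<lambda>y. c (y, s n)) (X n) - average \<delta> (\<lambda>y. c (y, t0)) (X n)\<bar> \<le> r / (2 * M) * mass \<delta> (X n)"
      proof (rule average_diff_le[where C = C])
        show "borel_K (\<lambda>y. c (y, s n))" "borel_K (\<lambda>y. c (y, t0))"
          using slice s by (auto intro: continuous_imp_borel_K)
        fix y assume "y \<in> K"
        then show "\<bar>c (y, s n)\<bar> \<le> C" "\<bar>c (y, t0)\<bar> \<le> C" using C s by auto
        have "dist (c (y, s n)) (c (y, t0)) < r / (2 * M)"
          using \<open>y \<in> K\<close> s n0[OF that] by (intro d(2)) (auto simp: dist_Pair_Pair)
        then show "\<bar>c (y, s n) - c (y, t0)\<bar> \<le> r / (2 * M)" by (simp add: dist_real_def)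
      qed (use assms in auto)
      also have "\<dots> \<le> r / (2 * M) * M"
        using mass_le[OF \<open>\<delta> > 0\<close> X(1)[of n]] r M by (intro mult_left_mono) (auto simp: M_def)
      also have "\<dots> < r" using r M by simp
      finally show ?thesis by simp
    qed
    then show "\<exists>no. \<forall>n\<ge>no. norm (average \<delta> (\<lambda>y. c (y, s n)) (X n) - average \<delta> (\<lambda>y. c (y, t0)) (X n) - 0) < r"
      by blast
  qed
  show ?thesis using tendsto_add[OF 2 1] by simp
qed

lemma average_dominated_convergence:
  assumes c: "\<And>k. borel_K (c k)" "\<And>k y. y \<in> K \<Longrightarrow> \<bar>c k y\<bar> \<le> C" "\<And>y. y \<in> K \<Longrightarrow> (\<lambda>k. c k y) \<longlonglongrightarrow> u y"
    and x: "\<delta> > 0" "x \<in> K"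
  shows "(\<lambda>k. average \<delta> (c k) x) \<longlonglongrightarrow> average \<delta> u x"
  unfolding average_def set_lebesgue_integral_def
proof (rule integral_dominated_convergence)
  have u: "borel_K u" by (rule borel_K_limit[OF c(1,3)])
  show "(\<lambda>z. indicator (far \<delta> x) z *\<^sub>R u (x + z)) \<in> borel_measurable (\<nu> x)"
    using indicator_shift_measurable[OF u far_borel _ x(2), of \<delta> x] by (auto simp: far_def)
  show "(\<lambda>z. indicator (far \<delta> x) z *\<^sub>R c k (x + z)) \<in> borel_measurable (\<nu> x)" for k
    using indicator_shift_measurable[OF c(1) far_borel _ x(2), of \<delta> x] by (auto simp: far_def)
  show "integrable (\<nu> x) (\<lambda>z. indicator (far \<delta> x) z *\<^sub>R C)"
    using far_integrable_const[OF x] by (simp add: set_integrable_def)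
  show "AE z in \<nu> x. (\<lambda>k. indicator (far \<delta> x) z *\<^sub>R c k (x + z)) \<longlonglongrightarrow> indicator (far \<delta> x) z *\<^sub>R u (x + z)"
    by (intro AE_I2) (use c(3) in \<open>auto simp: indicator_def far_def\<close>)
  show "AE z in \<nu> x. norm (indicator (far \<delta> x) z *\<^sub>R c k (x + z)) \<le> indicator (far \<delta> x) z *\<^sub>R C" for k
    by (intro AE_I2) (use c(2) in \<open>auto simp: indicator_def far_def\<close>)
qed

text \<open>Upper semicontinuity of the far term along moving points and functions. One continuous
  majorant \<open>c k\<close> of \<open>U\<close> is fixed whose average at the limit point is
  already close to that of \<open>U\<close>; the limit in \<open>n\<close> is then taken with
  \<open>c k\<close> only. The values \<open>w n (X n)\<close> need only converge to some
  \<open>r\<close>, which may differ from \<open>U (x0, t0)\<close>.\<close>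

lemma nonlocal_far_limit_le:
  fixes s :: "nat \<Rightarrow> real"
  assumes U: "usc_on (K \<times> {0..T}) U" and C: "\<And>q. q \<in> K \<times> {0..T} \<Longrightarrow> \<bar>U q\<bar> \<le> C" and d: "\<delta> > 0"
    and X: "\<And>n. X n \<in> K" "X \<longlonglongrightarrow> x0" "x0 \<in> K"
    and s: "\<And>n. s n \<in> {0..T}" "s \<longlonglongrightarrow> t0" "t0 \<in> {0..T}"
    and w: "\<And>n. borel_K (w n)" "\<And>n y. y \<in> K \<Longrightarrow> \<bar>w n y\<bar> \<le> C" "\<And>n y. y \<in> K \<Longrightarrow> w n y \<le> U (y, s n)"
      "(\<lambda>n. w n (X n)) \<longlonglongrightarrow> r"
    and e: "e > 0"
  shows "\<forall>\<^sub>F n in sequentially.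
    nonlocal \<Omega> \<nu> (- ball 0 \<delta>) (w n) (X n) \<le> average \<delta> (\<lambda>y. U (y, t0)) x0 - r * mass \<delta> x0 + e"
proof -
  obtain c :: "nat \<Rightarrow> 'a \<times> real \<Rightarrow> real" where c: "\<And>k. continuous_on (K \<times> {0..T}) (c k)"
      "\<And>k q. q \<in> K \<times> {0..T} \<Longrightarrow> U q \<le> c k q" "\<And>k q. q \<in> K \<times> {0..T} \<Longrightarrow> c k q \<le> C"
      "\<And>q. q \<in> K \<times> {0..T} \<Longrightarrow> (\<lambda>k. c k q) \<longlonglongrightarrow> U q"
    using usc_approximation_from_above[OF U C] by blast
  have cC: "\<bar>c k q\<bar> \<le> C" if "q \<in> K \<times> {0..T}" for k q
    using c(2)[OF that, of k] c(3)[OF that, of k] C[OF that] by linarith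
  have slice: "borel_K (\<lambda>y. c k (y, t))" if "t \<in> {0..T}" for k t
    by (rule continuous_imp_borel_K, rule continuous_on_compose2[OF c(1)[of k]])
       (use that in \<open>auto intro!: continuous_intros\<close>)
  have "(\<lambda>k. average \<delta> (\<lambda>y. c k (y, t0)) x0) \<longlonglongrightarrow> average \<delta> (\<lambda>y. U (y, t0)) x0"
    by (rule average_dominated_convergence[where C = C, OF slice[OF s(3)] _ _ d X(3)]) (use cC c(4) s(3) in auto)
  then obtain k where k: "average \<delta> (\<lambda>y. c k (y, t0)) x0 < average \<delta> (\<lambda>y. U (y, t0)) x0 + e / 2"
    using order_tendstoD(2)[of _ "average \<delta> (\<lambda>y. U (y, t0)) x0" sequentially "average \<delta> (\<lambda>y. U (y, t0)) x0 + e / 2"] e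
    by (auto simp: eventually_sequentially)
  have "(\<lambda>n. average \<delta> (\<lambda>y. c k (y, s n)) (X n) - w n (X n) * mass \<delta> (X n))
      \<longlonglongrightarrow> average \<delta> (\<lambda>y. c k (y, t0)) x0 - r * mass \<delta> x0"
    by (intro tendsto_intros average_tendsto[OF c(1) d X s] mass_tendsto[OF d X] w)
  then have "\<forall>\<^sub>F n in sequentially. average \<delta> (\<lambda>y. c k (y, s n)) (X n) - w n (X n) * mass \<delta> (X n)
      < average \<delta> (\<lambda>y. c k (y, t0)) x0 - r * mass \<delta> x0 + e / 2"
    using e by (intro order_tendstoD(2)) auto
  then show ?thesis
  proof (rule eventually_mono)
    fix n
    assume a: "average \<delta> (\<lambda>y. c k (y, s n)) (X n) - w n (X n) * mass \<delta> (X n)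
      < average \<delta> (\<lambda>y. c k (y, t0)) x0 - r * mass \<delta> x0 + e / 2"
    have "average \<delta> (w n) (X n) \<le> average \<delta> (\<lambda>y. c k (y, s n)) (X n)"
    proof (rule average_mono[OF w(1) slice[OF s(1)] w(2) _ d X(1)])
      fix y assume "y \<in> K"
      then show "\<bar>c k (y, s n)\<bar> \<le> C" "w n y \<le> c k (y, s n)"
        using cC[of "(y, s n)" k] c(2)[of "(y, s n)" k] w(3)[of y n] s(1)[of n] by auto
    qed
    then show "nonlocal \<Omega> \<nu> (- ball 0 \<delta>) (w n) (X n) \<le> average \<delta> (\<lambda>y. U (y, t0)) x0 - r * mass \<delta> x0 + e"
      using a k nonlocal_far[OF w(1)[of n] w(2)[of _ n] d X(1)[of n]] by simp
  qed
qed

lemma near_norm_integrable: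
  assumes "0 < \<delta>" "\<delta> < 1" "x \<in> K"
  shows "integrable (\<nu> x) (\<lambda>z. indicator (near \<delta> x) z * (B * norm z))"
    and "(\<integral>z. indicator (near \<delta> x) z * norm z \<partial>\<nu> x) \<le> C\<nu> * \<delta> powr (1 - \<sigma>)"
proof -
  have eq: "(\<integral>\<^sup>+z. ennreal (indicator (near \<delta> x) z * norm z) \<partial>\<nu> x) = (\<integral>\<^sup>+z\<in>near \<delta> x. ennreal (norm z) \<partial>\<nu> x)"
    by (intro nn_integral_cong) (auto simp: indicator_def)
  have [measurable]: "near \<delta> x \<in> sets (\<nu> x)" using sets_kernel[OF assms(3)] near_borel by simp
  have "norm \<in> borel_measurable (borel :: 'a measure)" by measurable
  then have [measurable]: "norm \<in> borel_measurable (\<nu> x)"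
    using sets_kernel[OF assms(3)] by (simp cong: measurable_cong_sets)
  have m: "(\<lambda>z. indicator (near \<delta> x) z * norm z) \<in> borel_measurable (\<nu> x)" by measurable
  have le: "(\<integral>\<^sup>+z. ennreal (indicator (near \<delta> x) z * norm z) \<partial>\<nu> x) \<le> ennreal (C\<nu> * \<delta> powr (1 - \<sigma>))"
    unfolding eq by (rule nn_integral_near_le[OF assms])
  then have i: "integrable (\<nu> x) (\<lambda>z. indicator (near \<delta> x) z * norm z)"
    by (intro integrableI_nonneg m AE_I2 le_less_trans[OF le]) auto
  then show "integrable (\<nu> x) (\<lambda>z. indicator (near \<delta> x) z * (B * norm z))"
    using integrable_mult_right[OF i, of B] by (simp add: algebra_simps)
  show "(\<integral>z. indicator (near \<delta> x) z * norm z \<partial>\<nu> x) \<le> C\<nu> * \<delta> powr (1 - \<sigma>)"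
    using nn_integral_eq_integral[OF i] le C\<nu>_pos by (simp add: ennreal_le_iff)
qed

text \<open>A one-sided slope bound suffices, and integrability of \<phi> is not asked for: a
  divergent integral has the value 0, for which the bound holds because \<Lambda> is
  nonnegative.\<close>

lemma nonlocal_near_le:
  assumes "0 < \<delta>" "\<delta> < 1" "x \<in> K" "0 \<le> \<Lambda>"
    and "\<And>y. y \<in> K \<Longrightarrow> dist y x < \<delta> \<Longrightarrow> \<phi> y - \<phi> x \<le> \<Lambda> * dist y x"
  shows "nonlocal \<Omega> \<nu> (ball 0 \<delta>) \<phi> x \<le> \<Lambda> * (C\<nu> * \<delta> powr (1 - \<sigma>))"
proof -
  have "nonlocal \<Omega> \<nu> (ball 0 \<delta>) \<phi> x = (\<integral>z. indicator (near \<delta> x) z *\<^sub>R (\<phi> (x + z) - \<phi> x) \<partial>\<nu> x)"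
    by (simp add: nonlocal_def near_def set_lebesgue_integral_def)
  also have "\<dots> \<le> (\<integral>z. indicator (near \<delta> x) z * (\<Lambda> * norm z) \<partial>\<nu> x)"
  proof (rule integral_mono'[OF near_norm_integrable(1)[OF assms(1-3)]])
    fix z show "indicator (near \<delta> x) z *\<^sub>R (\<phi> (x + z) - \<phi> x) \<le> indicator (near \<delta> x) z * (\<Lambda> * norm z)"
      using assms(5)[of "x + z"] by (cases "z \<in> near \<delta> x") (auto simp: near_def dist_norm)
    show "0 \<le> indicator (near \<delta> x) z * (\<Lambda> * norm z)" using assms(4) by simp
  qed
  also have "\<dots> = \<Lambda> * (\<integral>z. indicator (near \<delta> x) z * norm z \<partial>\<nu> x)"
    by (subst integral_mult_right_zero[symmetric]) (simp add: algebra_simps)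
  also have "\<dots> \<le> \<Lambda> * (C\<nu> * \<delta> powr (1 - \<sigma>))"
    by (intro mult_left_mono near_norm_integrable assms)
  finally show ?thesis .
qed

lemma nonlocal_minus: "nonlocal \<Omega> \<nu> D (\<lambda>y. - u y) x = - nonlocal \<Omega> \<nu> D u x"
  unfolding nonlocal_def set_lebesgue_integral_def
  by (subst integral_minus[symmetric]) (simp add: algebra_simps)

lemma nonlocal_near_abs_le:
  assumes "0 < \<delta>" "\<delta> < 1" "x \<in> K" "0 \<le> \<Lambda>"
    and "\<And>y. y \<in> K \<Longrightarrow> dist y x < \<delta> \<Longrightarrow> \<bar>\<phi> y - \<phi> x\<bar> \<le> \<Lambda> * dist y x"
  shows "\<bar>nonlocal \<Omega> \<nu> (ball 0 \<delta>) \<phi> x\<bar> \<le> \<Lambda> * (C\<nu> * \<delta> powr (1 - \<sigma>))"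
proof -
  have "nonlocal \<Omega> \<nu> (ball 0 \<delta>) \<phi> x \<le> \<Lambda> * (C\<nu> * \<delta> powr (1 - \<sigma>))"
    by (rule nonlocal_near_le[OF assms(1-4)]) (use assms(5) in \<open>auto simp: abs_le_iff\<close>)
  moreover have "nonlocal \<Omega> \<nu> (ball 0 \<delta>) (\<lambda>y. - \<phi> y) x \<le> \<Lambda> * (C\<nu> * \<delta> powr (1 - \<sigma>))"
    by (rule nonlocal_near_le[OF assms(1-4)]) (use assms(5) in \<open>fastforce simp: abs_le_iff\<close>)
  ultimately show ?thesis by (simp add: nonlocal_minus abs_le_iff)
qed

lemma nonlocal_far_le:
  assumes "0 < \<delta>" "x \<in> K" "0 \<le> k" "\<And>y. y \<in> K \<Longrightarrow> u y - u x \<le> k"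
  shows "nonlocal \<Omega> \<nu> (- ball 0 \<delta>) u x \<le> k * mass \<delta> x"
proof -
  have "nonlocal \<Omega> \<nu> (- ball 0 \<delta>) u x = (\<integral>z. indicator (far \<delta> x) z *\<^sub>R (u (x + z) - u x) \<partial>\<nu> x)"
    by (simp add: nonlocal_def far_def set_lebesgue_integral_def)
  also have "\<dots> \<le> (\<integral>z. indicator (far \<delta> x) z *\<^sub>R k \<partial>\<nu> x)"
  proof (rule integral_mono'[OF far_integrable_const[OF assms(1,2), unfolded set_integrable_def]])
    fix z show "indicator (far \<delta> x) z *\<^sub>R (u (x + z) - u x) \<le> indicator (far \<delta> x) z *\<^sub>R k"
      using assms(4)[of "x + z"] by (cases "z \<in> far \<delta> x") (auto simp: far_def)
    show "0 \<le> indicator (far \<delta> x) z *\<^sub>R k" using assms(3) by simp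
  qed
  also have "\<dots> = k * mass \<delta> x"
    using set_integral_far_const[OF assms(1,2), of k] by (simp add: set_lebesgue_integral_def)
  finally show ?thesis .
qed

lemma near_integrable:
  assumes "0 < \<delta>" "\<delta> < 1" "x \<in> K" "borel_K \<phi>"
    and "\<And>y. y \<in> K \<Longrightarrow> dist y x < \<delta> \<Longrightarrow> \<bar>\<phi> y - \<phi> x\<bar> \<le> B * dist y x"
  shows "set_integrable (\<nu> x) (near \<delta> x) (\<lambda>z. \<phi> (x + z) - \<phi> x)"
  unfolding set_integrable_def
proof (rule Bochner_Integration.integrable_bound[OF near_norm_integrable(1)[OF assms(1-3), of B]])
  have "(\<lambda>z. indicator (near \<delta> x) z * \<phi> (x + z)) \<in> borel_measurable (\<nu> x)"
    by (rule indicator_shift_measurable[OF assms(4) near_borel _ assms(3)]) (auto simp: near_def)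
  moreover have "(\<lambda>z. indicator (near \<delta> x) z * \<phi> x) \<in> borel_measurable (\<nu> x)"
    using sets_kernel[OF assms(3)] near_borel[of \<delta> x] by (intro borel_measurable_times borel_measurable_indicator) auto
  ultimately show "(\<lambda>z. indicator (near \<delta> x) z *\<^sub>R (\<phi> (x + z) - \<phi> x)) \<in> borel_measurable (\<nu> x)"
    by (simp add: right_diff_distrib)
  show "AE z in \<nu> x. norm (indicator (near \<delta> x) z *\<^sub>R (\<phi> (x + z) - \<phi> x))
      \<le> norm (indicator (near \<delta> x) z * (B * norm z))"
  proof (rule AE_I2)
    fix z show "norm (indicator (near \<delta> x) z *\<^sub>R (\<phi> (x + z) - \<phi> x)) \<le> norm (indicator (near \<delta> x) z * (B * norm z))"
      using assms(5)[of "x + z"] by (cases "z \<in> near \<delta> x") (auto simp: near_def dist_norm)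
  qed
qed

text \<open>The annulus between the radii \<delta>' and \<delta> is expressed by two far integrals,
  whose limits are known; only the ball of radius \<delta>' remains to be estimated.\<close>

lemma nonlocal_near_split:
  assumes "0 < \<delta>'" "\<delta>' < 1" "\<delta>' \<le> \<delta>" "x \<in> K" "borel_K \<phi>" "\<And>y. y \<in> K \<Longrightarrow> \<bar>\<phi> y\<bar> \<le> C"
    and "\<And>y. y \<in> K \<Longrightarrow> dist y x < \<delta>' \<Longrightarrow> \<bar>\<phi> y - \<phi> x\<bar> \<le> B * dist y x"
  shows "nonlocal \<Omega> \<nu> (ball 0 \<delta>) \<phi> x =
    nonlocal \<Omega> \<nu> (ball 0 \<delta>') \<phi> x + nonlocal \<Omega> \<nu> (- ball 0 \<delta>') \<phi> x - nonlocal \<Omega> \<nu> (- ball 0 \<delta>) \<phi> x"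
proof -
  define f where "f = (\<lambda>z. \<phi> (x + z) - \<phi> x)"
  define mid where "mid = near \<delta> x \<inter> far \<delta>' x"
  have d: "\<delta> > 0" using assms by simp
  have ms: "mid \<in> sets (\<nu> x)" "far \<delta> x \<in> sets (\<nu> x)" "near \<delta>' x \<in> sets (\<nu> x)"
    using sets_kernel[OF assms(4)] by (auto simp: mid_def)
  have 1: "set_integrable (\<nu> x) (near \<delta>' x) f"
    unfolding f_def by (rule near_integrable) (use assms in auto)
  have 2: "set_integrable (\<nu> x) (far \<delta>' x) f"
    unfolding f_def using assms by (intro set_integral_diff far_integrable far_integrable_const) auto
  have 3: "set_integrable (\<nu> x) mid f"
    by (rule set_integrable_subset[OF 2 ms(1)]) (auto simp: mid_def)
  have 4: "set_integrable (\<nu> x) (far \<delta> x) f"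
    unfolding f_def using assms d by (intro set_integral_diff far_integrable far_integrable_const) auto
  have "near \<delta> x = near \<delta>' x \<union> mid" "near \<delta>' x \<inter> mid = {}"
    using assms(3) by (auto simp: mid_def near_def far_def)
  then have A: "set_lebesgue_integral (\<nu> x) (near \<delta> x) f = set_lebesgue_integral (\<nu> x) (near \<delta>' x) f + set_lebesgue_integral (\<nu> x) mid f"
    using set_integral_Un[OF _ 1 3] by simp
  have "far \<delta>' x = far \<delta> x \<union> mid" "far \<delta> x \<inter> mid = {}"
    using assms(3) by (auto simp: mid_def near_def far_def)
  then have B: "set_lebesgue_integral (\<nu> x) (far \<delta>' x) f = set_lebesgue_integral (\<nu> x) (far \<delta> x) f + set_lebesgue_integral (\<nu> x) mid f"
    using set_integral_Un[OF _ 4 3] by simp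
  show ?thesis using A B unfolding nonlocal_def near_def far_def f_def by simp
qed

end

subsection \<open>Boundary charts\<close>

text \<open>The chart \<open>\<beta>\<close> is the height above the graph in direction \<open>e\<close>, with gradient \<open>N\<close>.\<close>

definition boundary_function ::
    "'a::euclidean_space set \<Rightarrow> 'a \<Rightarrow> ('a \<Rightarrow> real) \<Rightarrow> ('a \<Rightarrow> 'a) \<Rightarrow> 'a \<Rightarrow> real \<Rightarrow> real \<Rightarrow> bool" where
  "boundary_function \<Omega> x0 \<beta> N e r l \<longleftrightarrow>
     C1_with_gradient UNIV \<beta> N \<and> norm e = 1 \<and> r > 0 \<and> l \<ge> 1 \<and>
     (\<forall>x\<in>ball x0 r. x \<in> \<Omega> \<longleftrightarrow> \<beta> x > 0) \<and>
     (\<forall>x\<in>ball x0 r \<inter> closure \<Omega>. \<beta> x \<ge> 0) \<and>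
     (\<forall>x \<tau>. \<beta> (x + \<tau> *\<^sub>R e) = \<beta> x + \<tau>) \<and>
     (\<forall>x\<in>ball x0 r. \<forall>y\<in>ball x0 r. \<bar>\<beta> x - \<beta> y\<bar> \<le> l * dist x y) \<and>
     (\<forall>x\<in>ball x0 r. \<forall>y\<in>ball x0 r. \<bar>\<beta> y - \<beta> x - N x \<bullet> (y - x)\<bar> \<le> dist x y / 4) \<and>
     (\<forall>x. N x \<bullet> e = 1)"

lemma boundary_function_exists:
  assumes "C1_boundary \<Omega>" "x0 \<in> frontier \<Omega>"
  shows "\<exists>\<beta> N e r l. boundary_function \<Omega> x0 \<beta> N e r l"
proof -
  obtain r0 e \<gamma> where r0: "r0 > 0" and e: "norm e = 1" and "C1_on UNIV \<gamma>" and
    graph: "\<Omega> \<inter> ball x0 r0 = {x \<in> ball x0 r0. \<gamma> (x - (x \<bullet> e) *\<^sub>R e) < x \<bullet> e}"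
    using assms unfolding C1_boundary_def by blast
  then obtain g where g: "C1_with_gradient UNIV \<gamma> g" by (auto simp: C1_on_def)
  define P where "P = (\<lambda>x. x - (x \<bullet> e) *\<^sub>R e)"
  define \<beta> where "\<beta> = (\<lambda>x. x \<bullet> e - \<gamma> (P x))"
  define N where "N = (\<lambda>x. e - (g (P x) - (g (P x) \<bullet> e) *\<^sub>R e))"
  have ee: "e \<bullet> e = 1" using e by (simp add: dot_square_norm)
  have P: "(P has_derivative P) (at x)" for x
    unfolding P_def by (auto intro!: derivative_eq_intros)
  have contP: "continuous_on UNIV P" unfolding P_def by (intro continuous_intros)
  have contg: "continuous_on UNIV (\<lambda>x. g (P x))"
    using continuous_on_compose2[OF C1_with_gradientD(1)[OF g] contP] by simp
  have C: "C1_with_gradient UNIV \<beta> N"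
  proof (rule C1_with_gradientI)
    show "continuous_on UNIV N" unfolding N_def by (intro continuous_intros contg)
    fix y :: 'a
    have "((\<lambda>x. \<gamma> (P x)) has_derivative (\<lambda>h. g (P y) \<bullet> P h)) (at y)"
      by (rule has_derivative_compose[OF P]) (use C1_with_gradientD(2)[OF g, of "P y"] in simp)
    then show "(\<beta> has_derivative (\<lambda>h. h \<bullet> e - g (P y) \<bullet> P h)) (at y)"
      unfolding \<beta>_def by (auto intro!: derivative_eq_intros)
    fix h show "h \<bullet> e - g (P y) \<bullet> P h = N y \<bullet> h"
      by (simp add: N_def P_def inner_diff_left inner_diff_right inner_commute)
  qed
  have Ne: "N x \<bullet> e = 1" for x by (simp add: N_def inner_diff_left ee)
  have shift: "\<beta> (x + \<tau> *\<^sub>R e) = \<beta> x + \<tau>" for x \<tau>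
  proof -
    have "P (x + \<tau> *\<^sub>R e) = P x" by (simp add: P_def inner_add_left ee algebra_simps)
    then show ?thesis by (simp add: \<beta>_def inner_add_left ee)
  qed
  have "isCont N x0" using C1_with_gradientD(1)[OF C] by (simp add: continuous_on_eq_continuous_at)
  \<comment> \<open>Oscillation 1/8 about \<open>N x0\<close> makes the gradient vary by at most 1/4
    on the ball, which gives the Taylor error required of a chart. That error later controls the
    angle between the normal and the penalty gradient.\<close>
  then obtain r1 where r1: "r1 > 0" "\<And>x. dist x x0 < r1 \<Longrightarrow> dist (N x) (N x0) < 1/8"
    unfolding continuous_at_eps_delta by (metis zero_less_divide_1_iff zero_less_numeral)
  define r where "r = min r0 r1"
  define l where "l = norm (N x0) + 1"
  have r: "r > 0" using r0 r1 by (simp add: r_def)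
  have seg: "closed_segment x y \<subseteq> ball x0 r" if "x \<in> ball x0 r" "y \<in> ball x0 r" for x y
    using that convex_ball[of x0 r] by (simp add: closed_segment_subset)
  have NN: "norm (N z - N x0) < 1/8" if "z \<in> ball x0 r" for z
    using r1(2)[of z] that by (simp add: r_def dist_norm norm_minus_commute)
  have pos: "x \<in> \<Omega> \<longleftrightarrow> \<beta> x > 0" if "x \<in> ball x0 r" for x
    using that graph by (auto simp: \<beta>_def P_def r_def set_eq_iff)
  have nonneg: "\<beta> x \<ge> 0" if x: "x \<in> ball x0 r" "x \<in> closure \<Omega>" for x
  proof (rule ccontr)
    assume "\<not> \<beta> x \<ge> 0"
    moreover have "open (\<beta> -` {..<0})"
      using C1_with_gradient_imp_continuous_on[OF C] by (simp add: open_vimage)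
    ultimately have "open (ball x0 r \<inter> \<beta> -` {..<0})" "x \<in> ball x0 r \<inter> \<beta> -` {..<0}" using x by auto
    then have "\<Omega> \<inter> (ball x0 r \<inter> \<beta> -` {..<0}) \<noteq> {}"
      using x(2) by (metis closure_iff_nhds_not_empty inf_commute order_refl)
    then show False using pos by force
  qed
  have lip: "\<bar>\<beta> x - \<beta> y\<bar> \<le> l * dist x y" if "x \<in> ball x0 r" "y \<in> ball x0 r" for x y
    unfolding dist_norm
  proof (rule C1_with_gradient_segment_bound[OF C])
    fix z assume "z \<in> closed_segment x y"
    then have "norm (N z - N x0) < 1/8" using NN seg[OF that] by blast
    then show "norm (N z) \<le> l" using norm_triangle_sub[of "N z" "N x0"] by (simp add: l_def)
  qed simp
  have diff: "\<bar>\<beta> y - \<beta> x - N x \<bullet> (y - x)\<bar> \<le> dist x y / 4" if xy: "x \<in> ball x0 r" "y \<in> ball x0 r" for x y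
  proof -
    have C': "C1_with_gradient UNIV (\<lambda>z. \<beta> z - z \<bullet> N x) (\<lambda>z. N z - N x)"
      by (intro C1_with_gradient_diff C C1_with_gradient_inner)
    have "\<bar>(\<beta> y - y \<bullet> N x) - (\<beta> x - x \<bullet> N x)\<bar> \<le> 1/4 * norm (y - x)"
    proof (rule C1_with_gradient_segment_bound[OF C'])
      fix z assume "z \<in> closed_segment y x"
      then have "norm (N z - N x0) < 1/8" "norm (N x - N x0) < 1/8" using NN seg[OF xy(2,1)] xy by blast+
      then show "norm (N z - N x) \<le> 1/4" using norm_triangle_ineq4[of "N z - N x0" "N x - N x0"] by simp
    qed simp
    then show ?thesis by (simp add: dist_norm norm_minus_commute inner_diff_right inner_commute algebra_simps)
  qed
  show ?thesis
    unfolding boundary_function_def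
    by (rule exI[of _ \<beta>], rule exI[of _ N], rule exI[of _ e], rule exI[of _ r], rule exI[of _ l])
       (use C e r pos nonneg shift lip diff Ne in \<open>auto simp: l_def\<close>)
qed

text \<open>A step \<tau> along \<open>e\<close> raises the height by \<tau>, while a displacement
  of length less than \<tau>/(2l) lowers it by less than \<tau>/2. The opening of this interior cone
  is uniform, also at boundary points.\<close>

lemma boundary_function_cone:
  assumes "boundary_function \<Omega> x0 \<beta> N e r l" "x \<in> closure \<Omega>" "dist x x0 < r / 2" "0 < \<tau>" "\<tau> < r / 4"
  shows "ball (x + \<tau> *\<^sub>R e) (\<tau> / (2 * l)) \<subseteq> \<Omega>"
proof
  fix p assume p: "p \<in> ball (x + \<tau> *\<^sub>R e) (\<tau> / (2 * l))"
  have l: "l \<ge> 1" and e: "norm e = 1" using assms(1) by (auto simp: boundary_function_def)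
  have 0: "\<tau> / (2 * l) \<le> \<tau> / 2" using l assms(4) by (simp add: field_simps)
  have pd: "dist p (x + \<tau> *\<^sub>R e) < \<tau> / (2 * l)" using p by (simp add: dist_commute)
  have xd: "dist (x + \<tau> *\<^sub>R e) x0 < r / 2 + \<tau>"
  proof -
    have "dist (x + \<tau> *\<^sub>R e) x0 \<le> dist (x + \<tau> *\<^sub>R e) x + dist x x0" by (rule dist_triangle)
    then show ?thesis using assms(3,4) e by (simp add: dist_norm)
  qed
  have q: "x + \<tau> *\<^sub>R e \<in> ball x0 r" using xd assms(4,5) by (simp add: dist_commute)
  have pb: "p \<in> ball x0 r"
    using dist_triangle[of p x0 "x + \<tau> *\<^sub>R e"] pd xd 0 assms(4,5) by (simp add: dist_commute)
  have "dist x x0 < r" using assms(3) zero_le_dist[of x x0] by linarith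
  then have "x \<in> ball x0 r" by (simp add: dist_commute)
  then have "\<beta> x \<ge> 0" using assms(1,2) by (auto simp: boundary_function_def)
  moreover have "\<beta> (x + \<tau> *\<^sub>R e) = \<beta> x + \<tau>" using assms(1) by (auto simp: boundary_function_def)
  moreover have "\<bar>\<beta> p - \<beta> (x + \<tau> *\<^sub>R e)\<bar> \<le> l * dist p (x + \<tau> *\<^sub>R e)"
    using assms(1) pb q unfolding boundary_function_def by blast
  moreover have "l * dist p (x + \<tau> *\<^sub>R e) < l * (\<tau> / (2 * l))"
    using pd l by (intro mult_strict_left_mono) auto
  ultimately have "\<beta> p > \<tau> - \<tau> / 2" using l by simp
  then show "p \<in> \<Omega>" using assms(1,4) pb by (auto simp: boundary_function_def)
qed

context levy_kernels
begin

text \<open>Near the boundary \<open>K\<close> need not be convex. Two points are joined by going up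
  along \<open>e\<close>, across, and down again; a lift comparable to their distance
  suffices.\<close>

lemma locally_quasiconvex:
  assumes "x0 \<in> K"
  shows "\<exists>r>0. \<exists>k\<ge>1. \<forall>x\<in>K \<inter> ball x0 r. \<forall>y\<in>K \<inter> ball x0 r. \<exists>x' y'.
    closed_segment x x' \<subseteq> K \<and> closed_segment x' y' \<subseteq> K \<and> closed_segment y' y \<subseteq> K \<and>
    dist x x' \<le> k * dist x y \<and> dist x' y' \<le> k * dist x y \<and> dist y' y \<le> k * dist x y"
proof (cases "x0 \<in> \<Omega>")
  case True
  then obtain r where r: "r > 0" "ball x0 r \<subseteq> \<Omega>" using open_domain open_contains_ball by blast
  have "closed_segment x y \<subseteq> K" if "x \<in> ball x0 r" "y \<in> ball x0 r" for x y
    using that r(2) closed_segment_subset[OF that convex_ball] domain_subset_K by blast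
  then show ?thesis
    using r(1) by (intro exI[of _ r] exI[of _ 1] conjI ballI)
      (auto intro!: exI)
next
  case False
  then have "x0 \<in> frontier \<Omega>" using K_cases assms by blast
  then obtain \<beta> N e r l where b: "boundary_function \<Omega> x0 \<beta> N e r l"
    using boundary_function_exists[OF boundary_chart] by blast
  then have r: "r > 0" and l: "l \<ge> 1" and e: "norm e = 1" by (auto simp: boundary_function_def)
  define r1 where "r1 = r / (64 * l)"
  have r1: "r1 > 0" "r1 \<le> r / 64" using r l by (auto simp: r1_def field_simps)
  have up: "closed_segment x (x + \<tau> *\<^sub>R e) \<subseteq> K" if "x \<in> K" "dist x x0 < r / 2" "\<tau> > 0" "\<tau> < r / 4" for x \<tau>
  proof
    fix p assume "p \<in> closed_segment x (x + \<tau> *\<^sub>R e)"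
    then obtain u where u: "0 \<le> u" "u \<le> 1" "p = (1 - u) *\<^sub>R x + u *\<^sub>R (x + \<tau> *\<^sub>R e)"
      by (auto simp: closed_segment_def)
    then have p: "p = x + (u * \<tau>) *\<^sub>R e" by (simp add: algebra_simps)
    show "p \<in> K"
    proof (cases "u = 0")
      case True then show ?thesis using p that by simp
    next
      case False
      then have "0 < u * \<tau>" using u that by simp
      moreover have "u * \<tau> \<le> \<tau>" using u that by (simp add: mult_left_le_one_le)
      then have "u * \<tau> < r / 4" using that by linarith
      ultimately have "0 < u * \<tau>" "u * \<tau> < r / 4" by auto
      then have "p \<in> ball (x + (u * \<tau>) *\<^sub>R e) (u * \<tau> / (2 * l))" using l by (simp add: p)
      then show ?thesis
        using boundary_function_cone[OF b that(1,2) \<open>0 < u * \<tau>\<close> \<open>u * \<tau> < r / 4\<close>] domain_subset_K by blast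
    qed
  qed
  have "\<exists>x' y'. closed_segment x x' \<subseteq> K \<and> closed_segment x' y' \<subseteq> K \<and> closed_segment y' y \<subseteq> K \<and>
    dist x x' \<le> (4 * l) * dist x y \<and> dist x' y' \<le> (4 * l) * dist x y \<and> dist y' y \<le> (4 * l) * dist x y"
    if x: "x \<in> K \<inter> ball x0 r1" and y: "y \<in> K \<inter> ball x0 r1" for x y
  proof (cases "x = y")
    case True
    then show ?thesis using x by (intro exI[of _ x]) auto
  next
    case False
    \<comment> \<open>With this lift the cone property yields a ball of radius
      \<open>2 * dist x y\<close> about the first lifted point; it contains the second one, so the
      middle segment stays inside the domain.\<close>
    define \<tau> where "\<tau> = 4 * l * dist x y"
    have d: "dist x x0 < r1" "dist y x0 < r1" using x y by (auto simp: dist_commute)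
    have "dist x y < 2 * r1" using dist_triangle2[of x y x0] d by linarith
    then have "\<tau> < 4 * l * (2 * r1)" unfolding \<tau>_def using l by (intro mult_strict_left_mono) auto
    also have "\<dots> = r / 8" using l by (simp add: r1_def)
    finally have t: "\<tau> < r / 4" using r by simp
    have t0: "\<tau> > 0" using False l by (simp add: \<tau>_def)
    have d2: "dist x x0 < r / 2" "dist y x0 < r / 2" using d r1 r by auto
    have "ball (x + \<tau> *\<^sub>R e) (\<tau> / (2 * l)) \<subseteq> \<Omega>"
      by (rule boundary_function_cone[OF b _ d2(1) t0 t]) (use x in auto)
    moreover have "y + \<tau> *\<^sub>R e \<in> ball (x + \<tau> *\<^sub>R e) (\<tau> / (2 * l))" "x + \<tau> *\<^sub>R e \<in> ball (x + \<tau> *\<^sub>R e) (\<tau> / (2 * l))"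
      using False l t0 by (auto simp: \<tau>_def)
    ultimately have "closed_segment (x + \<tau> *\<^sub>R e) (y + \<tau> *\<^sub>R e) \<subseteq> K"
      using closed_segment_subset[OF _ _ convex_ball] domain_subset_K by blast
    moreover have "closed_segment (y + \<tau> *\<^sub>R e) y \<subseteq> K"
      using up[of y \<tau>] y d2 t0 t by (simp add: closed_segment_commute)
    moreover have "closed_segment x (x + \<tau> *\<^sub>R e) \<subseteq> K" using up[of x \<tau>] x d2 t0 t by simp
    moreover have "dist (x + \<tau> *\<^sub>R e) (y + \<tau> *\<^sub>R e) \<le> 4 * l * dist x y"
      using l mult_right_mono[of 1 "4 * l" "dist x y"] by simp
    ultimately show ?thesis
      using t0 e by (intro exI[of _ "x + \<tau> *\<^sub>R e"] exI[of _ "y + \<tau> *\<^sub>R e"]) (auto simp: dist_norm \<tau>_def)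
  qed
  then show ?thesis using r1 l by (intro exI[of _ r1] conjI exI[of _ "4 * l"]) auto
qed

text \<open>A gradient bound integrates only along segments inside \<open>K\<close>. The
  three-segment paths provide them, at the cost of the factor \<open>3 * k\<close>.\<close>

lemma test_function_locally_lipschitz:
  assumes \<phi>: "C1_with_gradient (Qbar \<Omega>) \<phi> G" and x0: "x0 \<in> K"
  shows "\<exists>r>0. \<exists>B\<ge>0. \<forall>x\<in>K \<inter> ball x0 r. \<forall>y\<in>K \<inter> ball x0 r. \<forall>t\<in>{0..T}.
    \<bar>\<phi> (x, t) - \<phi> (y, t)\<bar> \<le> B * dist x y"
proof -
  obtain r k where r: "r > 0" and k: "k \<ge> 1" and q: "\<And>x y. x\<in>K \<inter> ball x0 r \<Longrightarrow> y\<in>K \<inter> ball x0 r \<Longrightarrow> \<exists>x' y'.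
    closed_segment x x' \<subseteq> K \<and> closed_segment x' y' \<subseteq> K \<and> closed_segment y' y \<subseteq> K \<and>
    dist x x' \<le> k * dist x y \<and> dist x' y' \<le> k * dist x y \<and> dist y' y \<le> k * dist x y"
    using locally_quasiconvex[OF x0] by blast
  have sub: "K \<times> {0..T} \<subseteq> Qbar \<Omega>" by (auto simp: Qbar_def)
  then have "continuous_on (K \<times> {0..T}) G"
    using C1_with_gradientD(1)[OF \<phi>] continuous_on_subset by blast
  then have "bounded (G ` (K \<times> {0..T}))"
    using compact_K_times compact_continuous_image compact_imp_bounded by blast
  then obtain B0 where B0: "\<And>p. p \<in> K \<times> {0..T} \<Longrightarrow> norm (G p) \<le> B0" unfolding bounded_iff by auto
  define B where "B = max B0 0"
  have step: "\<bar>\<phi> (x, t) - \<phi> (y, t)\<bar> \<le> B * dist x y" if "closed_segment x y \<subseteq> K" "t \<in> {0..T}" for x y t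
  proof -
    have seg: "closed_segment (x, t) (y, t) \<subseteq> K \<times> {0..T}"
      using that by (auto simp: closed_segment_def algebra_simps scaleR_left_distrib[symmetric] subset_iff)
    have "\<bar>\<phi> (x, t) - \<phi> (y, t)\<bar> \<le> B * norm ((x, t) - (y, t))"
      by (rule C1_with_gradient_segment_bound[OF \<phi>]) (use seg sub B0 in \<open>force simp: B_def\<close>)+
    then show ?thesis by (simp add: dist_norm norm_Pair)
  qed
  have "\<bar>\<phi> (x, t) - \<phi> (y, t)\<bar> \<le> (B * (3 * k)) * dist x y"
    if x: "x \<in> K \<inter> ball x0 r" and y: "y \<in> K \<inter> ball x0 r" and t: "t \<in> {0..T}" for x y t
  proof -
    obtain x' y' where xy: "closed_segment x x' \<subseteq> K" "closed_segment x' y' \<subseteq> K" "closed_segment y' y \<subseteq> K"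
      "dist x x' \<le> k * dist x y" "dist x' y' \<le> k * dist x y" "dist y' y \<le> k * dist x y"
      using q[OF x y] by blast
    have B: "B \<ge> 0" by (simp add: B_def)
    have "\<bar>\<phi> (x, t) - \<phi> (y, t)\<bar> \<le> B * dist x x' + B * dist x' y' + B * dist y' y"
      using step[OF xy(1) t] step[OF xy(2) t] step[OF xy(3) t] by linarith
    also have "\<dots> \<le> B * (k * dist x y) + B * (k * dist x y) + B * (k * dist x y)"
      using xy B by (intro add_mono mult_left_mono) auto
    finally show ?thesis by (simp add: algebra_simps)
  qed
  then show ?thesis
    using r k by (intro exI[of _ r] conjI exI[of _ "B * (3 * k)"]) (auto simp: B_def)
qed

lemma continuous_slice:
  assumes "continuous_on (Qbar \<Omega>) \<phi>" "t \<ge> 0"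
  shows "continuous_on K (\<lambda>y. \<phi> (y, t))"
  by (rule continuous_on_compose2[OF assms(1)]) (use assms(2) in \<open>auto simp: Qbar_def intro!: continuous_intros\<close>)

lemma continuous_bounded_on_K_times:
  assumes "continuous_on (Qbar \<Omega>) (\<phi> :: _ \<Rightarrow> real)"
  shows "\<exists>C. \<forall>q\<in>K \<times> {0..T}. \<bar>\<phi> q\<bar> \<le> C"
proof -
  have "continuous_on (K \<times> {0..T}) \<phi>" by (rule continuous_on_subset[OF assms]) (auto simp: Qbar_def)
  then have "bounded (\<phi> ` (K \<times> {0..T}))"
    using compact_K_times compact_continuous_image compact_imp_bounded by blast
  then show ?thesis unfolding bounded_iff by auto
qed

text \<open>For base points near \<open>x0\<close> a small ball of radius d contributes at most a
  multiple of d^(1-\<sigma>), uniformly. What remains is a difference of two far integrals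
  \<open>F\<close>, and these converge.\<close>

lemma nonlocal_near_tendsto:
  fixes s :: "nat \<Rightarrow> real"
  assumes \<phi>: "C1_with_gradient (Qbar \<Omega>) \<phi> G" and d: "\<delta> > 0"
    and X: "\<And>n. X n \<in> K" "X \<longlonglongrightarrow> x0" "x0 \<in> K"
    and s: "\<And>n. s n \<in> {0..T}" "s \<longlonglongrightarrow> t0" "t0 \<in> {0..T}"
  shows "(\<lambda>n. nonlocal \<Omega> \<nu> (ball 0 \<delta>) (\<lambda>y. \<phi> (y, s n)) (X n)) \<longlonglongrightarrow> nonlocal \<Omega> \<nu> (ball 0 \<delta>) (\<lambda>y. \<phi> (y, t0)) x0"
proof -
  obtain r B where r: "r > 0" and B: "B \<ge> 0" and lip: "\<And>x y t. x\<in>K \<inter> ball x0 r \<Longrightarrow> y\<in>K \<inter> ball x0 r \<Longrightarrow> t\<in>{0..T} \<Longrightarrow>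
    \<bar>\<phi> (x, t) - \<phi> (y, t)\<bar> \<le> B * dist x y"
    using test_function_locally_lipschitz[OF \<phi> X(3), of T] by blast
  have cont: "continuous_on (Qbar \<Omega>) \<phi>" by (rule C1_with_gradient_imp_continuous_on[OF \<phi>])
  then have cont': "continuous_on (K \<times> {0..T}) \<phi>" by (rule continuous_on_subset) (auto simp: Qbar_def)
  obtain C where C: "\<And>q. q \<in> K \<times> {0..T} \<Longrightarrow> \<bar>\<phi> q\<bar> \<le> C" using continuous_bounded_on_K_times[OF cont] by blast
  have bor: "borel_K (\<lambda>y. \<phi> (y, t))" if "t \<in> {0..T}" for t
    using continuous_slice[OF cont, of t] that by (intro continuous_imp_borel_K) auto
  define F where "F = (\<lambda>\<delta> (x, t). average \<delta> (\<lambda>y. \<phi> (y, t)) x - \<phi> (x, t) * mass \<delta> x)"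
  have Fn: "nonlocal \<Omega> \<nu> (- ball 0 d) (\<lambda>y. \<phi> (y, t)) x = F d (x, t)" if "d > 0" "x \<in> K" "t \<in> {0..T}" for d x t
    unfolding F_def using nonlocal_far[OF bor[OF that(3)] _ that(1,2), of C] C that by auto
  have Ftend: "(\<lambda>n. F d (X n, s n)) \<longlonglongrightarrow> F d (x0, t0)" if "d > 0" for d
    unfolding F_def split
    by (intro tendsto_intros average_tendsto[OF cont' that X s] mass_tendsto[OF that X]
        continuous_on_tendsto_compose[OF cont']) (use X s in auto)
  have est: "\<bar>nonlocal \<Omega> \<nu> (ball 0 d) (\<lambda>y. \<phi> (y, t)) x\<bar> \<le> B * (C\<nu> * d powr (1 - \<sigma>)) \<and>
      nonlocal \<Omega> \<nu> (ball 0 \<delta>) (\<lambda>y. \<phi> (y, t)) x = nonlocal \<Omega> \<nu> (ball 0 d) (\<lambda>y. \<phi> (y, t)) x + F d (x, t) - F \<delta> (x, t)"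
    if dd: "0 < d" "d < 1" "d \<le> \<delta>" "d \<le> r / 2" and x: "x \<in> K" "dist x x0 < r / 2" and t: "t \<in> {0..T}" for d x t
  proof -
    have *: "\<bar>\<phi> (y, t) - \<phi> (x, t)\<bar> \<le> B * dist y x" if "y \<in> K" "dist y x < d" for y
      using that dd x t dist_triangle[of y x0 x] zero_le_dist[of x x0] by (intro lip) (auto simp: dist_commute)
    show ?thesis
      using nonlocal_near_abs_le[of d x B "\<lambda>y. \<phi> (y, t)"] nonlocal_near_split[OF dd(1-3) x(1) bor[OF t], of C B]
        * C t dd x B d by (auto simp: Fn)
  qed
  show ?thesis
  proof (rule LIMSEQ_I)
    fix \<epsilon> :: real assume eps: "\<epsilon> > 0"
    have "((\<lambda>d. B * (C\<nu> * d powr (1 - \<sigma>))) \<longlongrightarrow> B * (C\<nu> * 0 powr (1 - \<sigma>))) (at_right 0)"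
      by (intro tendsto_intros tendsto_powr') (use sigma_less in \<open>auto simp: eventually_at_right_less eventually_at_filter\<close>)
    then have "\<forall>\<^sub>F d in at_right 0. B * (C\<nu> * d powr (1 - \<sigma>)) < \<epsilon> / 4"
      using eps sigma_less by (intro order_tendstoD(2)) auto
    moreover have "\<forall>\<^sub>F d in at_right 0. d < min (min 1 \<delta>) (r / 2)"
      by (rule eventually_at_right_real[of 0 "min (min 1 \<delta>) (r / 2)", THEN eventually_mono]) (use d r in auto)
    moreover have "\<forall>\<^sub>F d::real in at_right 0. d > 0" by (rule eventually_at_right_less)
    ultimately have "\<forall>\<^sub>F d in at_right 0. B * (C\<nu> * d powr (1 - \<sigma>)) < \<epsilon> / 4 \<and> d < min (min 1 \<delta>) (r / 2) \<and> d > 0"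
      by eventually_elim auto
    then obtain d' where d': "B * (C\<nu> * d' powr (1 - \<sigma>)) < \<epsilon> / 4" "d' < min (min 1 \<delta>) (r / 2)" "d' > 0"
      using eventually_happens'[OF trivial_limit_at_right_real] by blast
    have "(\<lambda>n. F d' (X n, s n) - F \<delta> (X n, s n)) \<longlonglongrightarrow> F d' (x0, t0) - F \<delta> (x0, t0)"
      by (intro tendsto_intros Ftend d' d)
    then obtain n1 where n1: "\<And>n. n \<ge> n1 \<Longrightarrow> \<bar>(F d' (X n, s n) - F \<delta> (X n, s n)) - (F d' (x0, t0) - F \<delta> (x0, t0))\<bar> < \<epsilon> / 4"
      using LIMSEQ_D[of "\<lambda>n. F d' (X n, s n) - F \<delta> (X n, s n)" _ "\<epsilon> / 4"] eps by auto
    obtain n2 where n2: "\<And>n. n \<ge> n2 \<Longrightarrow> dist (X n) x0 < r / 2"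
      using X(2) r unfolding lim_sequentially by (metis half_gt_zero)
    have "norm (nonlocal \<Omega> \<nu> (ball 0 \<delta>) (\<lambda>y. \<phi> (y, s n)) (X n) - nonlocal \<Omega> \<nu> (ball 0 \<delta>) (\<lambda>y. \<phi> (y, t0)) x0) < \<epsilon>"
      if "n \<ge> max n1 n2" for n
    proof -
      have a: "0 < d'" "d' < 1" "d' \<le> \<delta>" "d' \<le> r / 2" using d' by auto
      have "dist x0 x0 < r / 2" "dist (X n) x0 < r / 2" using n2[of n] that r by auto
      note e1 = est[OF a X(3) this(1) s(3)] and e2 = est[OF a X(1)[of n] this(2) s(1)[of n]]
      show ?thesis using e1 e2 n1[of n] that d'(1) eps unfolding real_norm_def by linarith
    qed
    then show "\<exists>no. \<forall>n\<ge>no. norm (nonlocal \<Omega> \<nu> (ball 0 \<delta>) (\<lambda>y. \<phi> (y, s n)) (X n) - nonlocal \<Omega> \<nu> (ball 0 \<delta>) (\<lambda>y. \<phi> (y, t0)) x0) < \<epsilon>"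
      by blast
  qed
qed

end

subsection \<open>Auxiliary real functions\<close>

text \<open>A locally finite sum of multiples of squared positive parts. On [n, n+1) the term of
  index \<open>n\<close> has base at least 1, so this term and its derivative alone already dominate
  a bound of \<open>M\<close> on [0, n+1]. The majorant is used to turn local maxima in time into
  global ones and to build a subsolution for unbounded data.\<close>

lemma smooth_majorant:
  fixes M :: "real \<Rightarrow> real"
  assumes "\<And>T. \<exists>C. \<forall>s\<in>{0..T}. M s \<le> C"
  shows "\<exists>\<theta> \<theta>'. (\<forall>s. (\<theta> has_real_derivative \<theta>' s) (at s)) \<and> continuous_on UNIV \<theta>' \<and>
    (\<forall>s\<ge>0. M s \<le> \<theta> s \<and> M s \<le> \<theta>' s \<and> 0 \<le> \<theta> s \<and> 0 \<le> \<theta>' s)"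
proof -
  obtain C where C: "\<And>n s. s \<in> {0..real n + 1} \<Longrightarrow> M s \<le> C n"
    using assms[of "real _ + 1"] by metis
  define a where "a = (\<lambda>n. max 0 (C n))"
  define \<theta> where "\<theta> = (\<lambda>s. \<Sum>n. a n * (max 0 (s - real n + 1))\<^sup>2)"
  define \<theta>' where "\<theta>' = (\<lambda>s. \<Sum>n. a n * (2 * max 0 (s - real n + 1)))"
  have fin: "\<theta> s = (\<Sum>n<Suc N. a n * (max 0 (s - real n + 1))\<^sup>2)"
    "\<theta>' s = (\<Sum>n<Suc N. a n * (2 * max 0 (s - real n + 1)))" if "s < real N" for s N
    unfolding \<theta>_def \<theta>'_def by (rule suminf_finite; use that in \<open>auto simp: not_less_eq\<close>)+
  have der: "(\<theta> has_real_derivative \<theta>' s) (at s)" for s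
  proof -
    obtain N where N: "s < real N" using reals_Archimedean2 by blast
    have "((\<lambda>t. a n * (max 0 (t - real n + 1))\<^sup>2) has_real_derivative a n * (2 * max 0 (s - real n + 1))) (at s)" for n
    proof (rule DERIV_cmult)
      have "((\<lambda>t. (max 0 (t - real n + 1))\<^sup>2) has_real_derivative (2 * max 0 (s - real n + 1)) * 1) (at s)"
        by (rule DERIV_chain2[where f = "\<lambda>t. (max 0 t)\<^sup>2", OF has_real_derivative_pos_part_square])
          (auto intro!: derivative_eq_intros)
      then show "((\<lambda>t. (max 0 (t - real n + 1))\<^sup>2) has_real_derivative 2 * max 0 (s - real n + 1)) (at s)" by simp
    qed
    then have "((\<lambda>t. \<Sum>n<Suc N. a n * (max 0 (t - real n + 1))\<^sup>2) has_real_derivative \<theta>' s) (at s)"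
      unfolding fin(2)[OF N] by (intro DERIV_sum)
    then show ?thesis
      by (rule has_field_derivative_transform_within_open[where S = "{..<real N}"]) (use N fin in auto)
  qed
  have cont: "continuous_on UNIV \<theta>'"
    unfolding continuous_on_eq_continuous_at[OF open_UNIV]
  proof
    fix s :: real
    obtain N where N: "s < real N" using reals_Archimedean2 by blast
    have "continuous_on {..<real N} (\<lambda>t. \<Sum>n<Suc N. a n * (2 * max 0 (t - real n + 1)))"
      by (intro continuous_intros)
    then have "continuous_on {..<real N} \<theta>'"
      by (rule continuous_on_eq) (use fin in auto)
    then show "isCont \<theta>' s" using N by (simp add: continuous_on_eq_continuous_at)
  qed
  have ge: "M s \<le> \<theta> s \<and> M s \<le> \<theta>' s \<and> 0 \<le> \<theta> s \<and> 0 \<le> \<theta>' s" if s: "s \<ge> 0" for s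
  proof -
    define n where "n = nat \<lfloor>s\<rfloor>"
    have n: "real n \<le> s" "s < real n + 1" using s by (auto simp: n_def)
    have lt: "s < real (Suc n)" using n by simp
    have a0: "a k \<ge> 0" for k by (simp add: a_def)
    have "M s \<le> a n" using C[of s n] n s by (simp add: a_def)
    also have "\<dots> \<le> a n * (max 0 (s - real n + 1))\<^sup>2"
    proof -
      have "1 \<le> (max 0 (s - real n + 1))\<^sup>2" using n by (intro one_le_power) auto
      from mult_left_mono[OF this a0[of n]] show ?thesis by simp
    qed
    also have "\<dots> \<le> \<theta> s" unfolding fin(1)[OF lt]
      by (rule member_le_sum) (use a0 in auto)
    finally have 1: "M s \<le> \<theta> s" .
    have "M s \<le> a n" using C[of s n] n s by (simp add: a_def)
    also have "\<dots> \<le> a n * (2 * max 0 (s - real n + 1))"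
    proof -
      have "1 \<le> 2 * max 0 (s - real n + 1)" using n by (simp add: max_def)
      from mult_left_mono[OF this a0[of n]] show ?thesis by simp
    qed
    also have "\<dots> \<le> \<theta>' s" unfolding fin(2)[OF lt]
      by (rule member_le_sum) (use a0 in auto)
    finally have 2: "M s \<le> \<theta>' s" .
    have "0 \<le> \<theta> s" "0 \<le> \<theta>' s" unfolding fin[OF lt] by (intro sum_nonneg mult_nonneg_nonneg a0; simp)+
    then show ?thesis using 1 2 by simp
  qed
  show ?thesis using der cont ge by blast
qed

text \<open>The form in which \<open>\<sigma> < m\<close> enters: at a large slope the coercive term
  outweighs the nonlocal cost, even if the Lipschitz constant exceeds the gradient by a fixed
  factor.\<close>

lemma powr_dominates:
  fixes \<sigma> m a k D :: real
  assumes "\<sigma> < m" "0 < a" "0 < k" "0 \<le> D"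
  shows "\<exists>X0>0. \<forall>X\<ge>X0. D * (k * X) powr \<sigma> < (a * X) powr m"
proof -
  define q where "q = D * k powr \<sigma> / a powr m + 1"
  have q: "q > 0" using assms by (simp add: q_def add_nonneg_pos)
  have "D * (k * X) powr \<sigma> < (a * X) powr m" if X: "X \<ge> q powr (1 / (m - \<sigma>))" for X
  proof -
    have X0: "X > 0" using X q by (smt (verit) powr_gt_zero)
    have "q = (q powr (1 / (m - \<sigma>))) powr (m - \<sigma>)" using q assms(1) by (simp add: powr_powr)
    also have "\<dots> \<le> X powr (m - \<sigma>)" using X assms(1) by (intro powr_mono2) auto
    finally have "D * k powr \<sigma> / a powr m < X powr (m - \<sigma>)" by (simp add: q_def)
    then have "D * k powr \<sigma> < X powr (m - \<sigma>) * a powr m" using assms by (simp add: pos_divide_less_eq)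
    then have "D * k powr \<sigma> * X powr \<sigma> < X powr (m - \<sigma>) * a powr m * X powr \<sigma>"
      using X0 by (intro mult_strict_right_mono) auto
    also have "\<dots> = (a * X) powr m"
      using X0 assms by (simp add: powr_mult powr_diff)
    finally show ?thesis using X0 assms by (simp add: powr_mult mult.assoc)
  qed
  then show ?thesis using q by (intro exI[of _ "q powr (1 / (m - \<sigma>))"]) auto
qed

section \<open>Global barriers from boundary charts\<close>

context levy_kernels
begin

text \<open>A chart made global: it is nonnegative and Lipschitz on all of \<open>K\<close>, so it
  may enter test functions whose maximum is taken over \<open>K\<close>. The geometric properties
  stay local.\<close>

definition barrier :: "'a \<Rightarrow> ('a \<Rightarrow> real) \<Rightarrow> ('a \<Rightarrow> 'a) \<Rightarrow> 'a \<Rightarrow> real \<Rightarrow> real \<Rightarrow> real \<Rightarrow> bool" where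
  "barrier x0 \<beta> N e r l B \<longleftrightarrow>
     C1_with_gradient UNIV \<beta> N \<and> norm e = 1 \<and> r > 0 \<and> l \<ge> 1 \<and> B \<ge> 1 \<and>
     (\<forall>x\<in>ball x0 r. x \<in> \<Omega> \<longleftrightarrow> \<beta> x > 0) \<and> (\<forall>x\<in>K. \<beta> x \<ge> 0) \<and>
     (\<forall>x\<in>ball x0 r. \<forall>\<tau>. x + \<tau> *\<^sub>R e \<in> ball x0 r \<longrightarrow> \<beta> (x + \<tau> *\<^sub>R e) = \<beta> x + \<tau>) \<and>
     (\<forall>x\<in>ball x0 r. \<forall>y\<in>ball x0 r. \<bar>\<beta> x - \<beta> y\<bar> \<le> l * dist x y) \<and>
     (\<forall>x\<in>ball x0 r. \<forall>y\<in>ball x0 r. \<bar>\<beta> y - \<beta> x - N x \<bullet> (y - x)\<bar> \<le> dist x y / 4) \<and>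
     (\<forall>x\<in>ball x0 r. N x \<bullet> e = 1) \<and>
     (\<forall>x\<in>K. \<forall>\<tau>\<in>{0<..<r}. dist x x0 < r \<longrightarrow> ball (x + \<tau> *\<^sub>R e) (\<tau> / (2 * l)) \<subseteq> \<Omega>) \<and>
     (\<forall>x\<in>K. \<forall>y\<in>K. \<beta> x - \<beta> y \<le> B * dist x y)"

lemma barrier_exists:
  assumes x0: "x0 \<in> frontier \<Omega>"
  shows "\<exists>\<beta> N e r l B. barrier x0 \<beta> N e r l B"
proof -
  obtain b P e r l where b: "boundary_function \<Omega> x0 b P e r l"
    using boundary_function_exists[OF boundary_chart x0] by blast
  then have bC: "C1_with_gradient UNIV b P" and r: "r > 0" by (auto simp: boundary_function_def)
  have "continuous_on K b" using C1_with_gradient_imp_continuous_on[OF bC] continuous_on_subset by blast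
  then have "bounded (b ` K)" using compact_K compact_continuous_image compact_imp_bounded by blast
  then obtain M0 where M0: "\<And>x. x \<in> K \<Longrightarrow> \<bar>b x\<bar> \<le> M0" unfolding bounded_iff by auto
  define r1 where "r1 = r / 4"
  \<comment> \<open>The correction \<open>M * (w x)\<^sup>2\<close> vanishes on
    \<open>ball x0 r1\<close>, so the chart is unchanged there. Outside \<open>ball x0 r\<close> it
    is at least \<bar>M0\<bar> + 1 and outweighs every negative value of the chart; in between the
    chart itself is nonnegative on \<open>K\<close>.\<close>
  define M where "M = (\<bar>M0\<bar> + 1) / (r1\<^sup>2)\<^sup>2"
  have M: "M > 0" using r by (simp add: M_def r1_def)
  define w where "w = (\<lambda>x. max 0 ((norm (x - x0))\<^sup>2 + (- r1\<^sup>2)))"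
  define \<beta> where "\<beta> = (\<lambda>x. b x + M * (w x)\<^sup>2)"
  define N where "N = (\<lambda>x. P x + M *\<^sub>R ((2 * w x) *\<^sub>R (2 *\<^sub>R (x - x0) + 0)))"
  have C: "C1_with_gradient UNIV \<beta> N"
    unfolding \<beta>_def N_def w_def
    by (intro C1_with_gradient_add bC C1_with_gradient_scale C1_with_gradient_pos_part_square
        C1_with_gradient_normsq C1_with_gradient_const)
  have eq: "\<beta> x = b x" "N x = P x" if "x \<in> ball x0 r1" for x
  proof -
    have "(norm (x - x0))\<^sup>2 \<le> r1\<^sup>2"
      using that by (intro power_mono) (auto simp: dist_norm norm_minus_commute)
    then have "w x = 0" by (simp add: w_def)
    then show "\<beta> x = b x" "N x = P x" by (simp_all add: \<beta>_def N_def)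
  qed
  have nonneg: "\<beta> x \<ge> 0" if x: "x \<in> K" for x
  proof (cases "x \<in> ball x0 r")
    case True
    then have "b x \<ge> 0" using b x by (auto simp: boundary_function_def)
    then show ?thesis using M by (simp add: \<beta>_def)
  next
    case False
    then have "r \<le> norm (x - x0)" by (simp add: dist_norm norm_minus_commute)
    then have "(4 * r1)\<^sup>2 \<le> (norm (x - x0))\<^sup>2" using r by (intro power_mono) (auto simp: r1_def)
    then have "16 * r1\<^sup>2 \<le> (norm (x - x0))\<^sup>2" by (simp add: power_mult_distrib)
    then have "r1\<^sup>2 \<le> w x" using zero_le_power2[of r1] unfolding w_def by linarith
    then have "(r1\<^sup>2)\<^sup>2 \<le> (w x)\<^sup>2" by (intro power_mono) auto
    then have "M * (r1\<^sup>2)\<^sup>2 \<le> M * (w x)\<^sup>2" using M by simp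
    moreover have "M * (r1\<^sup>2)\<^sup>2 = \<bar>M0\<bar> + 1" using r by (simp add: M_def r1_def)
    ultimately show ?thesis using M0[OF x] by (simp add: \<beta>_def)
  qed
  obtain R where "K \<subseteq> ball 0 R"
    using bounded_subset_ballD[OF compact_imp_bounded[OF compact_K]] by blast
  then have R: "K \<subseteq> cball 0 R" using ball_subset_cball by blast
  have "continuous_on (cball 0 R) N" using C1_with_gradientD(1)[OF C] continuous_on_subset by blast
  then have "bounded (N ` cball 0 R)" using compact_continuous_image compact_imp_bounded compact_cball by blast
  then obtain B0 where B0: "\<forall>x\<in>cball 0 R. norm (N x) \<le> B0"
    unfolding bounded_iff by (auto simp del: mem_cball)
  have lipK: "\<beta> x - \<beta> y \<le> max 1 B0 * dist x y" if "x \<in> K" "y \<in> K" for x y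
  proof -
    have "closed_segment x y \<subseteq> cball 0 R"
      using that R by (intro closed_segment_subset convex_cball) auto
    then have "\<bar>\<beta> x - \<beta> y\<bar> \<le> max 1 B0 * norm (x - y)"
      by (intro C1_with_gradient_segment_bound[OF C]) (use B0 in \<open>auto simp: le_max_iff_disj\<close>)
    then show ?thesis by (simp add: dist_norm)
  qed
  have sub: "x \<in> ball x0 r" if "x \<in> ball x0 r1" for x using that r by (simp add: r1_def)
  have cone: "ball (x + \<tau> *\<^sub>R e) (\<tau> / (2 * l)) \<subseteq> \<Omega>" if "x \<in> K" "\<tau> \<in> {0<..<r1}" "dist x x0 < r1" for x \<tau>
    by (rule boundary_function_cone[OF b]) (use that r in \<open>auto simp: r1_def\<close>)
  have "barrier x0 \<beta> N e r1 l (max 1 B0)"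
    unfolding barrier_def
    using b C nonneg lipK cone r sub eq unfolding boundary_function_def by (simp add: r1_def)
  then show ?thesis by blast
qed

end

subsection \<open>The equation\<close>

locale equation = levy_kernels \<Omega> \<nu> \<sigma>
  for \<Omega> :: "'a::euclidean_space set" and \<nu> :: "'a \<Rightarrow> 'a measure" and \<sigma> :: real +
  fixes H :: "'a \<Rightarrow> real \<Rightarrow> 'a \<Rightarrow> real" and f g :: "'a \<times> real \<Rightarrow> real" and u0 :: "'a \<Rightarrow> real"
  assumes H_continuous: "continuous_on (closure \<Omega> \<times> UNIV \<times> UNIV) (\<lambda>(x, r, p). H x r p)"
    and H_mono: "\<And>x r s p. x \<in> closure \<Omega> \<Longrightarrow> r \<le> s \<Longrightarrow> H x r p \<le> H x s p"
    and f_continuous: "continuous_on (Qbar \<Omega>) f"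
    and g_continuous: "continuous_on (frontier \<Omega> \<times> {0..}) g"
    and u0_continuous: "continuous_on (closure \<Omega>) u0"
    and compatible: "\<And>x. x \<in> frontier \<Omega> \<Longrightarrow> u0 x = g (x, 0)"
begin

abbreviation "subsolution \<equiv> viscosity_subsolution \<Omega> \<nu> H f g u0"
abbreviation "supersolution \<equiv> viscosity_supersolution \<Omega> \<nu> H f g u0"
abbreviation "E \<equiv> visc_E \<Omega> \<nu> H f"

definition sub_at where
  "sub_at u \<phi> G x t \<delta> \<longleftrightarrow>
     (x \<in> \<Omega> \<and> t > 0 \<longrightarrow> E \<delta> u \<phi> G x t \<le> 0) \<and>
     (x \<in> frontier \<Omega> \<and> t > 0 \<longrightarrow> min (E \<delta> u \<phi> G x t) (u (x, t) - g (x, t)) \<le> 0) \<and>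
     (t = 0 \<longrightarrow> min (E \<delta> u \<phi> G x t) (u (x, t) - u0 x) \<le> 0)"

lemma subsolution_iff:
  "subsolution u \<longleftrightarrow> usc_on (Qbar \<Omega>) u \<and>
     (\<forall>\<phi> G x t. C1_with_gradient (Qbar \<Omega>) \<phi> G \<and> (x, t) \<in> Qbar \<Omega> \<and>
        (\<forall>q\<in>Qbar \<Omega>. u q - \<phi> q \<le> u (x, t) - \<phi> (x, t)) \<longrightarrow> (\<forall>\<delta>>0. sub_at u \<phi> G x t \<delta>))"
  by (simp add: viscosity_subsolution_def sub_at_def)

lemma usc_K_times:
  assumes "subsolution u" shows "usc_on (K \<times> {0..T}) u"
proof (rule usc_on_subset)
  show "usc_on (Qbar \<Omega>) u" using assms by (simp add: subsolution_iff)
qed (auto simp: Qbar_def)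

text \<open>The definition demands a maximum over all times, whereas maxima are found on compact
  time intervals. A function of time alone that vanishes to first order at \<open>t\<close> is added
  to the test function. It leaves \<open>E\<close> unchanged at the maximum point and grows fast
  enough to suppress all later times.\<close>

lemma sub_at_local:
  assumes u: "subsolution u" and \<phi>: "C1_with_gradient (Qbar \<Omega>) \<phi> G"
    and x: "x \<in> K" "0 \<le> t" "t < T" "\<delta> > 0"
    and max: "\<And>y s. y \<in> K \<Longrightarrow> s \<in> {0..T} \<Longrightarrow> u (y, s) - \<phi> (y, s) \<le> u (x, t) - \<phi> (x, t)"
  shows "sub_at u \<phi> G x t \<delta>"
proof -
  define M where "M = (\<lambda>s. (SUP y\<in>K. u (y, s) - \<phi> (y, s)) - (u (x, t) - \<phi> (x, t)))"
  have cont: "continuous_on (Qbar \<Omega>) \<phi>" by (rule C1_with_gradient_imp_continuous_on[OF \<phi>])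
  have bnd: "\<exists>C. \<forall>q\<in>K \<times> {0..T'}. u q - \<phi> q \<le> C" for T'
  proof -
    have "usc_on (K \<times> {0..T'}) (\<lambda>q. u q + - \<phi> q)"
      by (intro usc_on_add usc_K_times[OF u] continuous_imp_usc continuous_on_minus continuous_on_subset[OF cont])
         (auto simp: Qbar_def)
    then show ?thesis using usc_bounded_above[OF compact_K_times] by fastforce
  qed
  have "\<exists>C. \<forall>s\<in>{0..T'}. M s \<le> C" for T'
  proof -
    obtain C where "\<And>q. q \<in> K \<times> {0..T'} \<Longrightarrow> u q - \<phi> q \<le> C" using bnd by blast
    then show ?thesis
      using K_nonempty unfolding M_def
      by (intro exI[of _ "C - (u (x, t) - \<phi> (x, t))"]) (auto intro!: cSUP_least)
  qed
  from smooth_majorant[OF this] obtain \<theta> \<theta>' where th: "\<And>s. (\<theta> has_real_derivative \<theta>' s) (at s)" "continuous_on UNIV \<theta>'"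
    "\<And>s. s \<ge> 0 \<Longrightarrow> M s \<le> \<theta> s \<and> M s \<le> \<theta>' s \<and> 0 \<le> \<theta> s \<and> 0 \<le> \<theta>' s"
    by blast
  have thc: "continuous_on UNIV \<theta>" using th(1) by (meson DERIV_continuous_on has_field_derivative_at_within)
  \<comment> \<open>For \<open>s > T\<close> the factor \<open>N * (s - t)\<^sup>2\<close> is at
    least 1, so the added term exceeds \<open>\<theta> s\<close> and with it the excess
    \<open>M s\<close> over the value at the maximum point.\<close>
  define N where "N = 1 / (T - t)\<^sup>2"
  have N: "N > 0" using x by (simp add: N_def)
  define a where "a = (\<lambda>s. N * ((max 0 (s - t))\<^sup>2 * \<theta> s))"
  define a' where "a' = (\<lambda>s. N * ((2 * max 0 (s - t)) * \<theta> s + (max 0 (s - t))\<^sup>2 * \<theta>' s))"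
  have sq: "((\<lambda>s. (max 0 (s - t))\<^sup>2) has_real_derivative 2 * max 0 (s - t)) (at s)" for s
  proof -
    have "((\<lambda>s. (max 0 (s - t))\<^sup>2) has_real_derivative (2 * max 0 (s - t)) * 1) (at s)"
      by (rule DERIV_chain2[where f = "\<lambda>t. (max 0 t)\<^sup>2", OF has_real_derivative_pos_part_square])
         (auto intro!: derivative_eq_intros)
    then show ?thesis by simp
  qed
  have a: "(a has_real_derivative a' s) (at s)" for s
    unfolding a_def a'_def
    by (rule DERIV_cong[OF DERIV_cmult[OF DERIV_mult[OF sq th(1)]]]) (simp add: algebra_simps)
  have ac: "continuous_on {0..} a'"
    unfolding a'_def by (intro continuous_intros continuous_on_subset[OF thc] continuous_on_subset[OF th(2)]) auto
  have C': "C1_with_gradient (Qbar \<Omega>) (\<lambda>q. \<phi> q + a (snd q)) (\<lambda>q. G q + (0, a' (snd q)))"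
    unfolding Qbar_def
    by (intro C1_with_gradient_add \<phi>[unfolded Qbar_def] C1_with_gradient_snd ac)
       (use a in \<open>auto intro: has_field_derivative_at_within\<close>)
  have a0: "a s \<ge> 0" if "s \<ge> 0" for s using th(3)[OF that] N by (simp add: a_def)
  have at: "a t = 0" "a' t = 0" by (auto simp: a_def a'_def)
  have "u q - (\<phi> q + a (snd q)) \<le> u (x, t) - (\<phi> (x, t) + a (snd (x, t)))" if q: "q \<in> Qbar \<Omega>" for q
  proof -
    obtain y s where ys: "q = (y, s)" "y \<in> K" "s \<ge> 0" using q by (auto simp: Qbar_def)
    show ?thesis
    proof (cases "s \<le> T")
      case True
      then show ?thesis using max[of y s] ys a0[of s] at by simp
    next
      case False
      have "(T - t)\<^sup>2 \<le> (max 0 (s - t))\<^sup>2" using x False by (intro power_mono) auto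
      then have "1 \<le> N * (max 0 (s - t))\<^sup>2" using x by (simp add: N_def divide_simps)
      then have "\<theta> s \<le> a s" using th(3)[OF ys(3)] mult_right_mono[of 1 "N * (max 0 (s - t))\<^sup>2" "\<theta> s"]
        by (simp add: a_def mult.assoc)
      moreover have "u (y, s) - \<phi> (y, s) \<le> (SUP y\<in>K. u (y, s) - \<phi> (y, s))"
      proof (rule cSUP_upper[OF ys(2)])
        obtain C where "\<And>q. q \<in> K \<times> {0..s} \<Longrightarrow> u q - \<phi> q \<le> C" using bnd by blast
        then show "bdd_above ((\<lambda>y. u (y, s) - \<phi> (y, s)) ` K)" using ys by (intro bdd_aboveI2[of _ _ C]) auto
      qed
      ultimately show ?thesis using th(3)[OF ys(3)] ys at by (simp add: M_def)
    qed
  qed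
  then have "sub_at u (\<lambda>q. \<phi> q + a (snd q)) (\<lambda>q. G q + (0, a' (snd q))) x t \<delta>"
    using u C' x unfolding subsolution_iff by (auto simp: Qbar_def)
  moreover have "E \<delta> u (\<lambda>q. \<phi> q + a (snd q)) (\<lambda>q. G q + (0, a' (snd q))) x t = E \<delta> u \<phi> G x t"
    by (simp add: visc_E_def at)
  ultimately show ?thesis unfolding sub_at_def by (simp only:)
qed

lemma nonlocal_const: "nonlocal \<Omega> \<nu> D (\<lambda>_. c) x = 0"
  by (simp add: nonlocal_def set_lebesgue_integral_def)

text \<open>True without integrability, since a divergent integral has the value 0.\<close>

lemma nonlocal_nonpos:
  assumes "\<And>y. y \<in> K \<Longrightarrow> u y \<le> u x"
  shows "nonlocal \<Omega> \<nu> D u x \<le> 0"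
proof -
  have "0 \<le> (\<integral>z. - (indicator {z \<in> D. x + z \<in> K} z *\<^sub>R (u (x + z) - u x)) \<partial>\<nu> x)"
    by (rule integral_nonneg_AE, rule AE_I2) (use assms in \<open>auto simp: indicator_def\<close>)
  then show ?thesis by (simp add: nonlocal_def set_lebesgue_integral_def)
qed

text \<open>Comparison with a function of time alone. Such a test function has no near term, and the
  far term is nonpositive at a maximum in space; the slope \<kappa> makes the inequality strict.
  Where \<open>u\<close> exceeds \<open>a\<close> it also exceeds both data, so neither alternative
  to the equation is open.\<close>

lemma maximum_principle:
  assumes u: "subsolution u" and a: "\<And>s. (a has_real_derivative a' s) (at s)" "continuous_on UNIV a'"
    and ineq: "\<And>x t r. x \<in> K \<Longrightarrow> 0 \<le> t \<Longrightarrow> t \<le> T \<Longrightarrow> a t \<le> r \<Longrightarrow> 0 \<le> a' t + H x r 0 - f (x, t)"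
    and bd: "\<And>x t. x \<in> frontier \<Omega> \<Longrightarrow> 0 < t \<Longrightarrow> t \<le> T \<Longrightarrow> g (x, t) \<le> a t"
    and ini: "\<And>x. x \<in> K \<Longrightarrow> u0 x \<le> a 0"
    and x: "x1 \<in> K" "0 \<le> t1" "t1 < T"
  shows "u (x1, t1) \<le> a t1"
proof (rule ccontr)
  assume "\<not> ?thesis"
  then have pos: "u (x1, t1) - a t1 > 0" by simp
  define \<kappa> where "\<kappa> = (u (x1, t1) - a t1) / (2 * (t1 + 1))"
  have k: "\<kappa> > 0" using pos x by (simp add: \<kappa>_def)
  have "\<kappa> * t1 \<le> (u (x1, t1) - a t1) / 2" using pos x by (simp add: \<kappa>_def divide_simps mult_le_cancel_left)
  then have "\<kappa> * t1 < u (x1, t1) - a t1" by (rule le_less_trans) (use pos in simp)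
  with k have k: "\<kappa> > 0" "\<kappa> * t1 < u (x1, t1) - a t1" by auto
  have ca: "continuous_on UNIV a" using a(1) by (meson DERIV_continuous_on has_field_derivative_at_within)
  have us: "usc_on (K \<times> {0..T}) u" by (rule usc_K_times[OF u])
  have usca: "usc_on (K \<times> {0..T}) (\<lambda>q. u q + - (c * (snd q) + N * (max 0 (snd q - t1))\<^sup>2 + a (snd q)))" for c N
    by (intro usc_on_add us continuous_imp_usc continuous_intros continuous_on_compose2[OF ca]) auto
  obtain C where C: "\<And>q. q \<in> K \<times> {0..T} \<Longrightarrow> u q + - (0 * snd q + 0 * (max 0 (snd q - t1))\<^sup>2 + a (snd q)) \<le> C"
    using usc_bounded_above[OF compact_K_times usca] by blast
  \<comment> \<open>At time \<open>T\<close> the penalty exceeds the upper bound \<open>C\<close> of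
    \<open>u - a\<close>, so the maximum is attained earlier and the localised test applies.\<close>
  define N where "N = (\<bar>C\<bar> + 1) / (T - t1)\<^sup>2"
  have N: "N > 0" using x by (simp add: N_def add_nonneg_pos)
  define \<theta> where "\<theta> = (\<lambda>s. \<kappa> * s + N * (max 0 (s - t1))\<^sup>2 + a s)"
  define \<theta>' where "\<theta>' = (\<lambda>s. \<kappa> + N * (2 * max 0 (s - t1)) + a' s)"
  have sq: "((\<lambda>s. (max 0 (s - t1))\<^sup>2) has_real_derivative 2 * max 0 (s - t1)) (at s)" for s
  proof -
    have "((\<lambda>s. (max 0 (s - t1))\<^sup>2) has_real_derivative (2 * max 0 (s - t1)) * 1) (at s)"
      by (rule DERIV_chain2[where f = "\<lambda>t. (max 0 t)\<^sup>2", OF has_real_derivative_pos_part_square])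
         (auto intro!: derivative_eq_intros)
    then show ?thesis by simp
  qed
  have th: "(\<theta> has_real_derivative \<theta>' s) (at s)" for s
    unfolding \<theta>_def \<theta>'_def by (intro DERIV_add DERIV_cmult_Id DERIV_cmult sq a(1))
  have thc: "continuous_on {0..} \<theta>'"
    unfolding \<theta>'_def by (intro continuous_intros continuous_on_subset[OF a(2)]) auto
  have P: "C1_with_gradient (Qbar \<Omega>) (\<lambda>q. \<theta> (snd q)) (\<lambda>q. (0, \<theta>' (snd q)))"
    unfolding Qbar_def by (intro C1_with_gradient_snd thc) (use th in \<open>auto intro: has_field_derivative_at_within\<close>)
  have "K \<times> {0..T} \<noteq> {}" using x by auto
  then obtain p where p: "p \<in> K \<times> {0..T}" "\<And>q. q \<in> K \<times> {0..T} \<Longrightarrow> u q - \<theta> (snd q) \<le> u p - \<theta> (snd p)"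
    using usc_attains_sup[OF compact_K_times _ usca[of \<kappa> N]] unfolding \<theta>_def
    by (metis (no_types, lifting) diff_conv_add_uminus)
  obtain x t where pt: "p = (x, t)" "x \<in> K" "0 \<le> t" "t \<le> T" using p(1) by auto
  have val: "u (x, t) - \<theta> t > 0"
    using p(2)[of "(x1, t1)"] k x pt by (simp add: \<theta>_def)
  have "t < T"
  proof (rule ccontr)
    assume "\<not> t < T"
    then have "t = T" using pt by simp
    moreover have "N * (T - t1)\<^sup>2 = \<bar>C\<bar> + 1" using x by (simp add: N_def)
    moreover have "\<kappa> * T > 0" using k x by simp
    moreover have "\<kappa> * T + N * (T - t1)\<^sup>2 + a T < u (x, T)"
      using val \<open>t = T\<close> x by (simp add: \<theta>_def max_def split: if_splits)
    moreover have "u (x, T) - a T \<le> C" using C[of "(x, t)"] pt \<open>t = T\<close> by simp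
    ultimately show False by linarith
  qed
  have ge: "u (x, t) > a t" using val k(1) N pt(3) unfolding \<theta>_def
    by (smt (verit) mult_nonneg_nonneg zero_le_power2)
  have Epos: "E 1 u (\<lambda>q. \<theta> (snd q)) (\<lambda>q. (0, \<theta>' (snd q))) x t > 0"
  proof -
    have "nonlocal \<Omega> \<nu> (- ball 0 1) (\<lambda>y. u (y, t)) x \<le> 0"
      by (rule nonlocal_nonpos) (use p(2) pt in fastforce)
    moreover have "0 \<le> a' t + H x (u (x, t)) 0 - f (x, t)" using ineq[of x t "u (x, t)"] pt ge by simp
    moreover have "\<theta>' t \<ge> \<kappa> + a' t" using N by (simp add: \<theta>'_def)
    ultimately show ?thesis using k(1) by (simp add: visc_E_def nonlocal_const)
  qed
  have "sub_at u (\<lambda>q. \<theta> (snd q)) (\<lambda>q. (0, \<theta>' (snd q))) x t 1"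
    by (rule sub_at_local[OF u P pt(2,3) \<open>t < T\<close>]) (use p(2) pt in fastforce)+
  moreover have "u (x, t) > g (x, t)" if "x \<in> frontier \<Omega>" "t > 0" using bd[OF that] pt ge by simp
  moreover have "u (x, t) > u0 x" if "t = 0" using ini[OF pt(2)] ge that by simp
  ultimately show False
    using Epos K_cases[OF pt(2)] pt(3) unfolding sub_at_def by (cases "t = 0") (auto simp: min_def split: if_splits)
qed

text \<open>The reflection that turns supersolutions into subsolutions. Monotonicity in
  \<open>r\<close> survives it but coercivity changes direction; the symmetry therefore lives at the
  level of \<open>equation\<close> and hands to supersolutions only what needs no
  coercivity.\<close>

lemma dual: "equation \<Omega> \<nu> \<sigma> (\<lambda>x r p. - H x (- r) (- p)) (\<lambda>q. - f q) (\<lambda>q. - g q) (\<lambda>x. - u0 x)"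
proof
  have "continuous_on (K \<times> UNIV \<times> UNIV) (\<lambda>z. (case (fst z, - fst (snd z), - snd (snd z)) of (x, r, p) \<Rightarrow> H x r p))"
    by (rule continuous_on_compose2[OF H_continuous]) (auto intro!: continuous_intros)
  then show "continuous_on (closure \<Omega> \<times> UNIV \<times> UNIV) (\<lambda>(x, r, p). - H x (- r) (- p))"
    by (auto simp: case_prod_unfold intro!: continuous_intros)
qed (use H_mono compatible f_continuous g_continuous u0_continuous in \<open>auto intro!: continuous_intros\<close>)

lemma visc_E_dual:
  "visc_E \<Omega> \<nu> (\<lambda>x r p. - H x (- r) (- p)) (\<lambda>q. - f q) \<delta> (\<lambda>q. - v q) (\<lambda>q. - \<phi> q) (\<lambda>q. - G q) x t
    = - E \<delta> v \<phi> G x t"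
  by (simp add: visc_E_def nonlocal_minus)

lemma supersolution_dual:
  assumes "supersolution v"
  shows "viscosity_subsolution \<Omega> \<nu> (\<lambda>x r p. - H x (- r) (- p)) (\<lambda>q. - f q) (\<lambda>q. - g q) (\<lambda>x. - u0 x) (\<lambda>q. - v q)"
  unfolding viscosity_subsolution_def
proof (intro conjI allI impI)
  show "usc_on (Qbar \<Omega>) (\<lambda>q. - v q)"
    using assms by (simp add: viscosity_supersolution_def lsc_on_iff_usc_on_minus)
  fix \<phi> G x t and \<delta> :: real
  assume a: "C1_with_gradient (Qbar \<Omega>) \<phi> G \<and> (x, t) \<in> Qbar \<Omega> \<and>
        (\<forall>q\<in>Qbar \<Omega>. - v q - \<phi> q \<le> - v (x, t) - \<phi> (x, t))" and d: "\<delta> > 0"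
  define \<psi> where "\<psi> = (\<lambda>q. - \<phi> q)"
  define F where "F = (\<lambda>q. - G q)"
  have "C1_with_gradient (Qbar \<Omega>) \<psi> F" unfolding \<psi>_def F_def using a by (simp add: C1_with_gradient_minus)
  moreover have "\<forall>q\<in>Qbar \<Omega>. v q - \<psi> q \<ge> v (x, t) - \<psi> (x, t)" using a by (auto simp: \<psi>_def)
  ultimately have s: "(x \<in> \<Omega> \<and> t > 0 \<longrightarrow> E \<delta> v \<psi> F x t \<ge> 0) \<and>
          (x \<in> frontier \<Omega> \<and> t > 0 \<longrightarrow> max (E \<delta> v \<psi> F x t) (v (x, t) - g (x, t)) \<ge> 0) \<and>
          (t = 0 \<longrightarrow> max (E \<delta> v \<psi> F x t) (v (x, t) - u0 x) \<ge> 0)"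
    using assms a d unfolding viscosity_supersolution_def by blast
  have e: "visc_E \<Omega> \<nu> (\<lambda>x r p. - H x (- r) (- p)) (\<lambda>q. - f q) \<delta> (\<lambda>q. - v q) \<phi> G x t = - E \<delta> v \<psi> F x t"
    using visc_E_dual[of \<delta> v \<psi> F x t] by (simp add: \<psi>_def F_def)
  show "visc_E \<Omega> \<nu> (\<lambda>x r p. - H x (- r) (- p)) (\<lambda>q. - f q) \<delta> (\<lambda>q. - v q) \<phi> G x t \<le> 0" if "x \<in> \<Omega> \<and> t > 0"
    using s that by (simp add: e)
  show "min (visc_E \<Omega> \<nu> (\<lambda>x r p. - H x (- r) (- p)) (\<lambda>q. - f q) \<delta> (\<lambda>q. - v q) \<phi> G x t) (- v (x, t) - - g (x, t)) \<le> 0"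
    if "x \<in> frontier \<Omega> \<and> t > 0"
    using s that unfolding e by (auto simp: min_def max_def split: if_splits)
  show "min (visc_E \<Omega> \<nu> (\<lambda>x r p. - H x (- r) (- p)) (\<lambda>q. - f q) \<delta> (\<lambda>q. - v q) \<phi> G x t) (- v (x, t) - - u0 x) \<le> 0"
    if "t = 0"
    using s that unfolding e by (auto simp: min_def max_def split: if_splits)
qed

end

section \<open>The initial condition\<close>

context equation
begin

lemma K_bounded: "\<exists>R>0. \<forall>x\<in>K. \<forall>y\<in>K. dist x y \<le> R"
proof -
  have "bounded K" by (rule compact_imp_bounded[OF compact_K])
  then have "dist x y \<le> diameter K + 1" if "x \<in> K" "y \<in> K" for x y
    using diameter_bounded_bound[of K x y] that by simp
  moreover have "diameter K + 1 > 0" using diameter_ge_0[OF \<open>bounded K\<close>] by simp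
  ultimately show ?thesis by blast
qed

lemma H_bounded: "\<exists>h. \<forall>x\<in>K. \<forall>s\<in>{a..b}. \<forall>p\<in>cball 0 R. \<bar>H x s p\<bar> \<le> h"
proof -
  have "compact (K \<times> {a..b} \<times> cball (0::'a) R)" by (intro compact_Times compact_K compact_Icc compact_cball)
  moreover have "continuous_on (K \<times> {a..b} \<times> cball 0 R) (\<lambda>(x, r, p). H x r p)"
    by (rule continuous_on_subset[OF H_continuous]) auto
  ultimately have "bounded ((\<lambda>(x, r, p). H x r p) ` (K \<times> {a..b} \<times> cball 0 R))"
    using compact_continuous_image compact_imp_bounded by blast
  then obtain h where "\<forall>q\<in>(\<lambda>(x, r, p). H x r p) ` (K \<times> {a..b} \<times> cball 0 R). norm q \<le> h"
    unfolding bounded_iff by blast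
  then show ?thesis by (intro exI[of _ h]) force
qed

lemma g_near:
  assumes "x0 \<in> frontier \<Omega>" "t0 \<ge> 0" "g (x0, t0) < c"
  shows "\<exists>r>0. \<forall>x\<in>frontier \<Omega>. \<forall>t\<ge>0. dist x x0 < r \<longrightarrow> \<bar>t - t0\<bar> < r \<longrightarrow> g (x, t) < c"
proof -
  obtain r where r: "r > 0" "\<forall>q\<in>frontier \<Omega> \<times> {0..}. dist q (x0, t0) < r \<longrightarrow> g q < c"
    using usc_onD[OF continuous_imp_usc[OF g_continuous], of "(x0, t0)" c] assms by auto
  have "g (x, t) < c" if "x \<in> frontier \<Omega>" "t \<ge> 0" "dist x x0 < r / 2" "\<bar>t - t0\<bar> < r / 2" for x t
  proof -
    have "dist (x, t) (x0, t0) \<le> dist x x0 + dist t t0"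
      unfolding dist_Pair_Pair by (rule sqrt_sum_squares_le_sum) auto
    then show ?thesis using r(2) that by (auto simp: dist_real_def)
  qed
  then show ?thesis using r(1) by (intro exI[of _ "r / 2"]) auto
qed

text \<open>Testing with \<open>A |x - x\<^sub>0|\<^sup>2 + B t\<close>, where \<open>A\<close> localises the maximum and then \<open>B\<close>
  is taken so large that the equation cannot hold there.\<close>

lemma subsolution_initial:
  assumes u: "subsolution u" and x0: "x0 \<in> K"
  shows "u (x0, 0) \<le> u0 x0"
proof (rule ccontr)
  assume "\<not> ?thesis"
  then have gt: "u0 x0 < u (x0, 0)" by simp
  obtain r1 where r1: "r1 > 0" "\<And>x. x \<in> K \<Longrightarrow> dist x x0 < r1 \<Longrightarrow> u0 x < u (x0, 0)"
    using usc_onD[OF continuous_imp_usc[OF u0_continuous] x0 gt] by blast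
  have "\<exists>r>0. \<forall>x\<in>frontier \<Omega>. \<forall>t\<ge>0. dist x x0 < r \<longrightarrow> \<bar>t - 0\<bar> < r \<longrightarrow> g (x, t) < u (x0, 0)"
  proof (cases "x0 \<in> \<Omega>")
    case True
    then obtain r where "r > 0" "ball x0 r \<subseteq> \<Omega>" using open_domain open_contains_ball by blast
    then show ?thesis using frontier_not_domain by (intro exI[of _ r]) (auto simp: dist_commute subset_iff)
  next
    case False
    then have "x0 \<in> frontier \<Omega>" using K_cases x0 by blast
    then show ?thesis using g_near[of x0 0] gt compatible by simp
  qed
  then obtain r2 where r2: "r2 > 0" "\<And>x t. x \<in> frontier \<Omega> \<Longrightarrow> t \<ge> 0 \<Longrightarrow> dist x x0 < r2 \<Longrightarrow> t < r2 \<Longrightarrow> g (x, t) < u (x0, 0)"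
    by auto
  define r where "r = Min {r1, r2, 1}"
  have r: "r > 0" "r \<le> r1" "r \<le> r2" "r \<le> 1" using r1 r2 by (auto simp: r_def)
  obtain C where C: "\<And>q. q \<in> K \<times> {0..1} \<Longrightarrow> u q \<le> C"
    using usc_bounded_above[OF compact_K_times usc_K_times[OF u]] by blast
  define D where "D = C - u (x0, 0) + 1"
  have D: "D > 0" using C[of "(x0, 0)"] x0 by (simp add: D_def)
  obtain R where R: "R > 0" "\<And>x y. x \<in> K \<Longrightarrow> y \<in> K \<Longrightarrow> dist x y \<le> R" using K_bounded by blast
  \<comment> \<open>\<open>D\<close> exceeds the rise of \<open>u\<close> above
    \<open>u (x0, 0)\<close>. A maximum point therefore lies within \<open>r\<close> of
    \<open>x0\<close>, whatever nonnegative \<open>B\<close> is taken.\<close>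
  define A where "A = D / r\<^sup>2"
  have A: "A > 0" using D r by (simp add: A_def)
  obtain h where h: "\<And>x s p. x \<in> K \<Longrightarrow> s \<in> {u (x0, 0)..C} \<Longrightarrow> p \<in> cball 0 (2 * A * R) \<Longrightarrow> \<bar>H x s p\<bar> \<le> h"
    using H_bounded by blast
  obtain fb where fb: "\<And>q. q \<in> K \<times> {0..1} \<Longrightarrow> \<bar>f q\<bar> \<le> fb"
    using continuous_bounded_on_K_times[OF f_continuous] by blast
  \<comment> \<open>\<open>D / r\<close> confines the maximum to times below \<open>r\<close>; the
    other summands bound in turn the near term, the far term, the Hamiltonian and the source, with 1
    to spare. There is no circularity: \<open>h\<close> involves space gradients only, and these are
    bounded by \<open>2 * A * R\<close>.\<close>
  define B where "B = D / r + 2 * A * R * (C\<nu> * (1/2) powr (1 - \<sigma>)) + D * (C\<nu> * (1/2) powr (- \<sigma>)) + h + fb + 1"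
  have hfb: "h \<ge> 0" "fb \<ge> 0"
    using h[of x0 "u (x0, 0)" 0] fb[of "(x0, 0)"] x0 C[of "(x0, 0)"] A R by auto
  have B: "B > D / r" "B > 0"
  proof -
    have "2 * A * R * (C\<nu> * (1/2) powr (1 - \<sigma>)) \<ge> 0" "D * (C\<nu> * (1/2) powr (- \<sigma>)) \<ge> 0" "D / r > 0"
      using D r A R C\<nu>_pos by simp_all
    then show "B > D / r" "B > 0" using hfb unfolding B_def by linarith+
  qed
  define \<phi> where "\<phi> = (\<lambda>q::'a \<times> real. A * (norm (fst q - x0))\<^sup>2 + B * snd q)"
  define G where "G = (\<lambda>q::'a \<times> real. (A *\<^sub>R (2 *\<^sub>R (fst q - x0)), 0) + (0::'a, B))"
  have P: "C1_with_gradient (Qbar \<Omega>) \<phi> G"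
    unfolding \<phi>_def G_def Qbar_def
    by (intro C1_with_gradient_add C1_with_gradient_fst[of _ "\<lambda>x. A * (norm (x - x0))\<^sup>2"]
        C1_with_gradient_snd[of _ "\<lambda>t. B * t" "\<lambda>_. B"] C1_with_gradient_scale C1_with_gradient_normsq)
       (auto intro!: derivative_eq_intros)
  have pc: "continuous_on UNIV \<phi>" unfolding \<phi>_def by (intro continuous_intros)
  have "usc_on (K \<times> {0..1}) (\<lambda>q. u q + - \<phi> q)"
    by (intro usc_on_add usc_K_times[OF u] continuous_imp_usc continuous_on_minus continuous_on_subset[OF pc]) auto
  moreover have "K \<times> {0..1::real} \<noteq> {}" using x0 by auto
  ultimately obtain p where p: "p \<in> K \<times> {0..1}" "\<forall>q\<in>K \<times> {0..1}. u q + - \<phi> q \<le> u p + - \<phi> p"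
    using usc_attains_sup[OF compact_K_times] by blast
  obtain x t where pt: "p = (x, t)" "x \<in> K" "0 \<le> t" "t \<le> 1" using p(1) by auto
  have mx: "u (y, s) - \<phi> (y, s) \<le> u (x, t) - \<phi> (x, t)" if "y \<in> K" "s \<in> {0..1}" for y s
    using p(2) that pt by force
  have val: "u (x0, 0) + A * (norm (x - x0))\<^sup>2 + B * t \<le> u (x, t)"
    using mx[of x0 0] x0 by (simp add: \<phi>_def)
  have uC: "u (x, t) \<le> C" using C pt by simp
  have nn: "A * (norm (x - x0))\<^sup>2 \<ge> 0" "B * t \<ge> 0" using A B pt by auto
  have "A * (norm (x - x0))\<^sup>2 < D" using val uC nn by (simp add: D_def)
  then have "(norm (x - x0))\<^sup>2 < r\<^sup>2" using D r by (simp add: A_def divide_simps)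
  then have xr: "dist x x0 < r" using r by (simp add: dist_norm power2_less_imp_less)
  have "B * t < D" using val uC nn by (simp add: D_def)
  then have "B * t < B * r" using B(1) r by (simp add: divide_less_eq) 
  then have tr: "t < r" using B(2) by simp
  have ge: "u (x, t) \<ge> u (x0, 0)" using val nn by linarith
  have sa: "sub_at u \<phi> G x t (1/2)"
    by (rule sub_at_local[OF u P pt(2,3), of 1]) (use tr r mx in auto)
  have E: "E (1/2) u \<phi> G x t \<le> 0"
  proof (cases "t = 0")
    case True
    then show ?thesis using sa r1(2)[OF pt(2)] xr r ge by (auto simp: sub_at_def min_def split: if_splits)
  next
    case False
    then show ?thesis using sa r2(2)[of x t] xr r ge tr K_cases[OF pt(2)] pt(3)
      by (auto simp: sub_at_def min_def split: if_splits)
  qed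
  have 1: "nonlocal \<Omega> \<nu> (ball 0 (1/2)) (\<lambda>y. \<phi> (y, t)) x \<le> 2 * A * R * (C\<nu> * (1/2) powr (1 - \<sigma>))"
  proof (rule nonlocal_near_le)
    fix y assume y: "y \<in> K"
    have "(norm (y - x0))\<^sup>2 - (norm (x - x0))\<^sup>2 = (norm (y - x0) - norm (x - x0)) * (norm (y - x0) + norm (x - x0))"
      by (simp add: power2_eq_square algebra_simps)
    also have "\<dots> \<le> dist y x * (2 * R)"
    proof (rule mult_mono)
      show "norm (y - x0) - norm (x - x0) \<le> dist y x"
        using norm_triangle_ineq2[of "y - x0" "x - x0"] by (simp add: dist_norm)
      show "norm (y - x0) + norm (x - x0) \<le> 2 * R"
        using R(2)[OF y x0] R(2)[OF pt(2) x0] by (simp add: dist_norm)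
    qed auto
    finally have "A * ((norm (y - x0))\<^sup>2 - (norm (x - x0))\<^sup>2) \<le> A * (dist y x * (2 * R))"
      using A by (intro mult_left_mono) auto
    then show "\<phi> (y, t) - \<phi> (x, t) \<le> 2 * A * R * dist y x" by (simp add: \<phi>_def algebra_simps)
  qed (use pt A R in auto)
  have "nonlocal \<Omega> \<nu> (- ball 0 (1/2)) (\<lambda>y. u (y, t)) x \<le> D * mass (1/2) x"
    by (rule nonlocal_far_le) (use pt D C ge in \<open>auto simp: D_def intro: add_increasing2 order_trans\<close>, fastforce)
  also have "\<dots> \<le> D * (C\<nu> * (1/2) powr (- \<sigma>))"
    using mass_le[of "1/2" x] pt D by (intro mult_left_mono) auto
  finally have 2: "nonlocal \<Omega> \<nu> (- ball 0 (1/2)) (\<lambda>y. u (y, t)) x \<le> D * (C\<nu> * (1/2) powr (- \<sigma>))" .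
  have 3: "\<bar>H x (u (x, t)) (fst (G (x, t)))\<bar> \<le> h"
  proof (rule h[OF pt(2)])
    have "A * dist x x0 \<le> A * R" using R(2)[OF pt(2) x0] A by simp
    then show "fst (G (x, t)) \<in> cball 0 (2 * A * R)" using A by (simp add: G_def dist_norm)
  qed (use ge uC in simp)
  have 4: "\<bar>f (x, t)\<bar> \<le> fb" using fb pt by simp
  have 5: "snd (G (x, t)) = B" by (simp add: G_def)
  have "D / r > 0" using D r by simp
  then show False using E 1 2 3 4 unfolding visc_E_def 5 B_def by linarith
qed

end

lemma (in equation) supersolution_initial:
  assumes "supersolution v" "x0 \<in> K"
  shows "u0 x0 \<le> v (x0, 0)"
  using equation.subsolution_initial[OF dual supersolution_dual[OF assms(1)] assms(2)] by simp

subsection \<open>Coercivity\<close>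

locale coercive_equation = equation \<Omega> \<nu> \<sigma> H f g u0
  for \<Omega> :: "'a::euclidean_space set" and \<nu> \<sigma> H f g u0 +
  fixes m :: real
  assumes m_gt: "\<sigma> < m" and H2: "H2 \<Omega> H m"
begin

text \<open>Choosing \<open>\<delta> = 1/\<Lambda>\<close> balances the two parts of the nonlocal term: a test function with
  Lipschitz constant \<open>\<Lambda>\<close> costs only \<open>\<Lambda>\<^sup>\<sigma>\<close>, less than the \<open>\<Lambda>\<^sup>m\<close> provided by coercivity.\<close>

lemma coercive_bound:
  assumes "C > 0"
  shows "\<exists>D>0. \<forall>u \<phi> G x t \<Lambda>. x \<in> K \<and> 2 \<le> \<Lambda> \<and> \<bar>u (x, t)\<bar> \<le> C \<and>
    (\<forall>y\<in>K. u (y, t) - u (x, t) \<le> 2 * C) \<and>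
    (\<forall>y\<in>K. dist y x < 1 / \<Lambda> \<longrightarrow> \<phi> (y, t) - \<phi> (x, t) \<le> \<Lambda> * dist y x) \<and>
    E (1 / \<Lambda>) u \<phi> G x t \<le> 0 \<and> - C \<le> snd (G (x, t)) \<and> f (x, t) \<le> C \<longrightarrow>
    norm (fst (G (x, t))) powr m \<le> D * \<Lambda> powr \<sigma>"
proof -
  obtain c where c: "c > 0" "\<And>R. R > 0 \<Longrightarrow> \<exists>C\<ge>0. \<forall>x\<in>K. \<forall>p r. \<bar>r\<bar> \<le> R \<longrightarrow> H x r p \<ge> c * norm p powr m - C"
    using H2 unfolding H2_def by blast
  then obtain h where h: "h \<ge> 0" "\<And>x p r. x \<in> K \<Longrightarrow> \<bar>r\<bar> \<le> C \<Longrightarrow> H x r p \<ge> c * norm p powr m - h"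
    using assms by meson
  define D where "D = (h + 2 * C + C\<nu> + 2 * C * C\<nu>) / c"
  have D: "D > 0" using h c assms C\<nu>_pos by (simp add: D_def add_nonneg_pos)
  have "norm (fst (G (x, t))) powr m \<le> D * \<Lambda> powr \<sigma>"
    if x: "x \<in> K" and L: "2 \<le> \<Lambda>" and u: "\<bar>u (x, t)\<bar> \<le> C" "\<And>y. y \<in> K \<Longrightarrow> u (y, t) - u (x, t) \<le> 2 * C"
      and \<phi>: "\<And>y. y \<in> K \<Longrightarrow> dist y x < 1 / \<Lambda> \<Longrightarrow> \<phi> (y, t) - \<phi> (x, t) \<le> \<Lambda> * dist y x"
      and E: "E (1 / \<Lambda>) u \<phi> G x t \<le> 0" and G: "- C \<le> snd (G (x, t))" and f: "f (x, t) \<le> C" for u \<phi> G x t \<Lambda>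
  proof -
    have p1: "(1 / \<Lambda>) powr (- \<sigma>) = \<Lambda> powr \<sigma>"
      using L by (simp add: powr_minus powr_divide)
    have p2: "\<Lambda> * (1 / \<Lambda>) powr (1 - \<sigma>) = \<Lambda> powr \<sigma>"
      using L by (simp add: powr_divide powr_diff)
    have one: "1 \<le> \<Lambda> powr \<sigma>" using L sigma_pos by (intro ge_one_powr_ge_zero) auto
    have "nonlocal \<Omega> \<nu> (ball 0 (1 / \<Lambda>)) (\<lambda>y. \<phi> (y, t)) x \<le> \<Lambda> * (C\<nu> * (1 / \<Lambda>) powr (1 - \<sigma>))"
      by (rule nonlocal_near_le) (use L x \<phi> in auto)
    also have "\<dots> = C\<nu> * \<Lambda> powr \<sigma>" using p2 by (simp add: algebra_simps)
    finally have 1: "nonlocal \<Omega> \<nu> (ball 0 (1 / \<Lambda>)) (\<lambda>y. \<phi> (y, t)) x \<le> C\<nu> * \<Lambda> powr \<sigma>" .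
    have "nonlocal \<Omega> \<nu> (- ball 0 (1 / \<Lambda>)) (\<lambda>y. u (y, t)) x \<le> 2 * C * mass (1 / \<Lambda>) x"
      by (rule nonlocal_far_le) (use L x u(2) assms in auto)
    also have "\<dots> \<le> 2 * C * (C\<nu> * \<Lambda> powr \<sigma>)"
      using mass_le[of "1 / \<Lambda>" x] L x p1 assms by (intro mult_left_mono) auto
    finally have 2: "nonlocal \<Omega> \<nu> (- ball 0 (1 / \<Lambda>)) (\<lambda>y. u (y, t)) x \<le> 2 * C * C\<nu> * \<Lambda> powr \<sigma>" by simp
    have 3: "c * norm (fst (G (x, t))) powr m - h \<le> H x (u (x, t)) (fst (G (x, t)))" by (rule h(2)[OF x u(1)])
    have "(h + 2 * C) * 1 \<le> (h + 2 * C) * \<Lambda> powr \<sigma>" using h assms one by (intro mult_left_mono) auto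
    then have "c * norm (fst (G (x, t))) powr m \<le> (h + 2 * C + C\<nu> + 2 * C * C\<nu>) * \<Lambda> powr \<sigma>"
      using E 1 2 3 G f unfolding visc_E_def by (simp add: algebra_simps)
    also have "\<dots> = c * (D * \<Lambda> powr \<sigma>)" using c by (simp add: D_def)
    finally show ?thesis using c by simp
  qed
  then show ?thesis using D by blast
qed

lemma barrier_norm_ge:
  assumes "barrier x0 \<beta> N e r l B" "x \<in> ball x0 r"
  shows "1 \<le> norm (N x)"
  using assms norm_cauchy_schwarz[of "N x" e] by (auto simp: barrier_def)

text \<open>If \<open>u\<close> exceeded the datum, the equation would hold at boundary points near
  by, even for a test function with an arbitrarily large slope \<open>k\<close> along the inner
  normal. Since \<beta> is nonnegative on \<open>K\<close> and zero at \<open>x0\<close>, the slope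
  does not disturb the localisation by \<open>A\<close>; the gradient is at least
  \<open>k / 2\<close> and the Lipschitz constant at most a multiple of \<open>k\<close>, which
  contradicts coercivity for large \<open>k\<close>.\<close>

lemma subsolution_lateral:
  assumes u: "subsolution u" and x0: "x0 \<in> frontier \<Omega>" and t0: "t0 > 0"
  shows "u (x0, t0) \<le> g (x0, t0)"
proof (rule ccontr)
  assume "\<not> ?thesis"
  then have gt: "g (x0, t0) < u (x0, t0)" by simp
  obtain r1 where r1: "r1 > 0" "\<And>x t. x \<in> frontier \<Omega> \<Longrightarrow> t \<ge> 0 \<Longrightarrow> dist x x0 < r1 \<Longrightarrow> \<bar>t - t0\<bar> < r1 \<Longrightarrow> g (x, t) < u (x0, t0)"
    using g_near[OF x0 _ gt] t0 by auto
  obtain \<beta> N e r2 l B where b: "barrier x0 \<beta> N e r2 l B" using barrier_exists[OF x0] by blast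
  then have r2: "r2 > 0" and B: "B \<ge> 1" and \<beta>C: "C1_with_gradient UNIV \<beta> N"
    and \<beta>0: "\<And>x. x \<in> K \<Longrightarrow> \<beta> x \<ge> 0" and \<beta>lip: "\<And>x y. x \<in> K \<Longrightarrow> y \<in> K \<Longrightarrow> \<beta> x - \<beta> y \<le> B * dist x y"
    by (auto simp: barrier_def)
  have x0K: "x0 \<in> K" using x0 frontier_subset_K by blast
  have "\<not> \<beta> x0 > 0" using b r2 frontier_not_domain[OF x0] by (auto simp: barrier_def)
  then have bx0: "\<beta> x0 = 0" using \<beta>0[OF x0K] by simp
  define T where "T = t0 + 1"
  define r where "r = Min {r1, r2, 1, t0}"
  have r: "r > 0" "r \<le> r1" "r \<le> r2" "r \<le> 1" "r \<le> t0" using r1 r2 t0 by (auto simp: r_def)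
  obtain C0 where C0: "\<And>q. q \<in> K \<times> {0..T} \<Longrightarrow> u q \<le> C0"
    using usc_bounded_above[OF compact_K_times usc_K_times[OF u]] by blast
  obtain fb where fb: "\<And>q. q \<in> K \<times> {0..T} \<Longrightarrow> \<bar>f q\<bar> \<le> fb"
    using continuous_bounded_on_K_times[OF f_continuous] by blast
  define D where "D = C0 - u (x0, t0) + 1"
  have D: "D > 0" using C0[of "(x0, t0)"] x0K t0 by (simp add: D_def T_def)
  obtain R where R: "R > 0" "\<And>x y. x \<in> K \<Longrightarrow> y \<in> K \<Longrightarrow> dist x y \<le> R" using K_bounded by blast
  define A where "A = D / r\<^sup>2"
  have A: "A > 0" using D r by (simp add: A_def)
  \<comment> \<open>The term \<open>2 * A\<close> covers the time derivative of the penalty. Nothing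
    here depends on \<open>k\<close>, so the constant \<open>D'\<close> is fixed before the slope is
    chosen.\<close>
  define C where "C = \<bar>C0\<bar> + \<bar>u (x0, t0)\<bar> + \<bar>fb\<bar> + 2 * A + 1"
  have C: "C > 0" using A by (simp add: C_def add_nonneg_pos)
  obtain D' where D': "D' > 0" "\<forall>u \<phi> G x t \<Lambda>. x \<in> K \<and> 2 \<le> \<Lambda> \<and> \<bar>u (x, t)\<bar> \<le> C \<and>
    (\<forall>y\<in>K. u (y, t) - u (x, t) \<le> 2 * C) \<and>
    (\<forall>y\<in>K. dist y x < 1 / \<Lambda> \<longrightarrow> \<phi> (y, t) - \<phi> (x, t) \<le> \<Lambda> * dist y x) \<and>
    E (1 / \<Lambda>) u \<phi> G x t \<le> 0 \<and> - C \<le> snd (G (x, t)) \<and> f (x, t) \<le> C \<longrightarrow>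
    norm (fst (G (x, t))) powr m \<le> D' * \<Lambda> powr \<sigma>"
    using coercive_bound[OF C] by blast
  obtain X0 where X0: "X0 > 0" "\<And>X. X \<ge> X0 \<Longrightarrow> D' * ((B + 1) * X) powr \<sigma> < (1/2 * X) powr m"
    using powr_dominates[OF m_gt, of "1/2" "B + 1" D'] B D' by auto
  define k where "k = max X0 (max (4 * A * R) 2)"
  have k: "k \<ge> X0" "k \<ge> 4 * A * R" "k \<ge> 2" by (auto simp: k_def)
  define \<phi> where "\<phi> = (\<lambda>q::'a \<times> real. (k * \<beta> (fst q) + A * (norm (fst q - x0))\<^sup>2) + A * (snd q - t0)\<^sup>2)"
  define G where "G = (\<lambda>q::'a \<times> real. (k *\<^sub>R N (fst q) + A *\<^sub>R (2 *\<^sub>R (fst q - x0)), 0) + (0::'a, A * (2 * (snd q - t0))))"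
  have P: "C1_with_gradient (Qbar \<Omega>) \<phi> G"
    unfolding \<phi>_def G_def Qbar_def
    by (intro C1_with_gradient_add C1_with_gradient_fst[of _ "\<lambda>x. k * \<beta> x + A * (norm (x - x0))\<^sup>2"]
        C1_with_gradient_snd[of _ "\<lambda>t. A * (t - t0)\<^sup>2" "\<lambda>t. A * (2 * (t - t0))"] C1_with_gradient_scale
        C1_with_gradient_normsq C1_with_gradient_subset[OF \<beta>C])
       (auto intro!: derivative_eq_intros continuous_intros)
  have pc: "continuous_on (Qbar \<Omega>) \<phi>" by (rule C1_with_gradient_imp_continuous_on[OF P])
  have "usc_on (K \<times> {0..T}) (\<lambda>q. u q + - \<phi> q)"
    by (intro usc_on_add usc_K_times[OF u] continuous_imp_usc continuous_on_minus continuous_on_subset[OF pc])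
       (auto simp: Qbar_def)
  moreover have "K \<times> {0..T} \<noteq> {}" using x0K t0 by (auto simp: T_def)
  ultimately obtain p where p: "p \<in> K \<times> {0..T}" "\<forall>q\<in>K \<times> {0..T}. u q + - \<phi> q \<le> u p + - \<phi> p"
    using usc_attains_sup[OF compact_K_times] by blast
  obtain x t where pt: "p = (x, t)" "x \<in> K" "0 \<le> t" "t \<le> T" using p(1) by auto
  have mx: "u (y, s) - \<phi> (y, s) \<le> u (x, t) - \<phi> (x, t)" if "y \<in> K" "s \<in> {0..T}" for y s
    using p(2) that pt by force
  have val: "u (x0, t0) + k * \<beta> x + A * (norm (x - x0))\<^sup>2 + A * (t - t0)\<^sup>2 \<le> u (x, t)"
    using mx[of x0 t0] x0K t0 bx0 by (simp add: \<phi>_def T_def)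
  have uC: "u (x, t) \<le> C0" using C0 pt by simp
  have nn: "A * (norm (x - x0))\<^sup>2 \<ge> 0" "A * (t - t0)\<^sup>2 \<ge> 0" "k * \<beta> x \<ge> 0" using A k \<beta>0[OF pt(2)] by auto
  have "A * (norm (x - x0))\<^sup>2 < D" "A * (t - t0)\<^sup>2 < D" using val uC nn by (simp_all add: D_def)
  then have "(norm (x - x0))\<^sup>2 < r\<^sup>2" "\<bar>t - t0\<bar>\<^sup>2 < r\<^sup>2" using D r by (simp_all add: A_def divide_simps)
  then have xr: "dist x x0 < r" and tr: "\<bar>t - t0\<bar> < r"
    using r power2_less_imp_less[of _ r] by (auto simp: dist_norm)
  have tpos: "0 < t" "t < T" using tr r by (auto simp: T_def)
  have ge: "u (x, t) \<ge> u (x0, t0)" using val nn by linarith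
  define \<Lambda> where "\<Lambda> = (B + 1) * k"
  have kA: "4 * A * R + k \<le> 2 * k" using k by simp
  have L2: "\<Lambda> \<ge> 2" using B k mult_mono[of 1 "B + 1" 2 k] by (simp add: \<Lambda>_def)
  have sa: "sub_at u \<phi> G x t (1 / \<Lambda>)"
    by (rule sub_at_local[OF u P pt(2,3), of T]) (use tpos L2 mx in auto)
  have E: "E (1 / \<Lambda>) u \<phi> G x t \<le> 0"
    using sa r1(2)[of x t] xr r ge tr K_cases[OF pt(2)] pt(3) tpos
    by (auto simp: sub_at_def min_def split: if_splits)
  have lip: "\<phi> (y, t) - \<phi> (x, t) \<le> \<Lambda> * dist y x" if y: "y \<in> K" for y
  proof -
    have "(norm (y - x0))\<^sup>2 - (norm (x - x0))\<^sup>2 = (norm (y - x0) - norm (x - x0)) * (norm (y - x0) + norm (x - x0))"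
      by (simp add: power2_eq_square algebra_simps)
    also have "\<dots> \<le> dist y x * (2 * R)"
    proof (rule mult_mono)
      show "norm (y - x0) - norm (x - x0) \<le> dist y x"
        using norm_triangle_ineq2[of "y - x0" "x - x0"] by (simp add: dist_norm)
      show "norm (y - x0) + norm (x - x0) \<le> 2 * R"
        using R(2)[OF y x0K] R(2)[OF pt(2) x0K] by (simp add: dist_norm)
    qed auto
    finally have "A * ((norm (y - x0))\<^sup>2 - (norm (x - x0))\<^sup>2) \<le> A * (dist y x * (2 * R))"
      using A by (intro mult_left_mono) auto
    also have "\<dots> \<le> k * dist y x"
      using mult_right_mono[of "2 * A * R" k "dist y x"] k A R by (simp add: algebra_simps)
    finally have a: "A * (norm (y - x0))\<^sup>2 - A * (norm (x - x0))\<^sup>2 \<le> k * dist y x" by (simp add: algebra_simps)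
    have "k * (\<beta> y - \<beta> x) \<le> k * (B * dist y x)" using \<beta>lip[OF y pt(2)] k by (intro mult_left_mono) auto
    then show ?thesis using a by (simp add: \<phi>_def \<Lambda>_def algebra_simps)
  qed
  have "norm (fst (G (x, t))) powr m \<le> D' * \<Lambda> powr \<sigma>"
  proof (rule D'(2)[rule_format], intro conjI ballI impI)
    show "\<bar>u (x, t)\<bar> \<le> C" using ge uC A unfolding C_def by linarith
    show "u (y, t) - u (x, t) \<le> 2 * C" if "y \<in> K" for y
    proof -
      have "u (y, t) \<le> C0" using C0[of "(y, t)"] that pt by simp
      then show ?thesis using ge A by (simp add: C_def)
    qed
    have "- (t - t0) \<le> 1" using tr r by linarith
    then have "(2 * A) * - (t - t0) \<le> (2 * A) * 1" using A by (intro mult_left_mono) auto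
    then have "- (A * (2 * (t - t0))) \<le> A * (2 * 1)" by (simp add: algebra_simps)
    then show "- C \<le> snd (G (x, t))" by (simp add: G_def C_def)
    show "f (x, t) \<le> C" using fb[of "(x, t)"] pt A by (simp add: C_def)
  qed (use pt L2 lip E in auto)
  moreover have "1/2 * k \<le> norm (fst (G (x, t)))"
  proof -
    have "1 \<le> norm (N x)" using barrier_norm_ge[OF b, of x] xr r by (simp add: dist_commute)
    then have "k \<le> norm (k *\<^sub>R N x)" using k mult_left_mono[of 1 "norm (N x)" k] by simp
    moreover have "norm (A *\<^sub>R (2 *\<^sub>R (x - x0))) \<le> 2 * A * R" using R(2)[OF pt(2) x0K] A by (simp add: dist_norm)
    ultimately show ?thesis
      using norm_triangle_ineq2[of "k *\<^sub>R N x" "- (A *\<^sub>R (2 *\<^sub>R (x - x0)))"] k(2) by (simp add: G_def)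
  qed
  then have "(1/2 * k) powr m \<le> norm (fst (G (x, t))) powr m"
    using k m_gt sigma_pos by (intro powr_mono2) auto
  moreover have "D' * \<Lambda> powr \<sigma> < (1/2 * k) powr m" using X0(2)[OF k(1)] by (simp add: \<Lambda>_def)
  ultimately show False by linarith
qed

end

subsection \<open>Regularity of subsolutions up to the boundary\<close>

context coercive_equation
begin

text \<open>All that is kept of the equation once time has been frozen: a purely spatial inequality
  at interior points, between the gradient of a touching function and its Lipschitz constant on the
  scale 1/\<Lambda>.\<close>

definition slope_bound :: "('a \<Rightarrow> real) \<Rightarrow> real \<Rightarrow> bool" where
  "slope_bound U D \<longleftrightarrow> (\<forall>\<phi> G x \<Lambda>. C1_with_gradient K \<phi> G \<and> x \<in> \<Omega> \<and>
     (\<forall>y\<in>K. U y - \<phi> y \<le> U x - \<phi> x) \<and> 2 \<le> \<Lambda> \<and>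
     (\<forall>y\<in>K. dist y x < 1 / \<Lambda> \<longrightarrow> \<phi> y - \<phi> x \<le> \<Lambda> * dist y x) \<longrightarrow>
     norm (G x) powr m \<le> D * \<Lambda> powr \<sigma>)"

text \<open>Regularisation in time only. It bounds the time derivative of the test functions and
  leaves the space variable, in which regularity comes from coercivity, untouched.\<close>

definition sup_conv :: "('a \<times> real \<Rightarrow> real) \<Rightarrow> real \<Rightarrow> real \<Rightarrow> real \<Rightarrow> 'a \<Rightarrow> real" where
  "sup_conv u \<eta> T t x = (SUP s\<in>{0..T}. u (x, s) - (s - t)\<^sup>2 / \<eta>)"

text \<open>The time may move as well, because the envelope of a family is nearly attained only at
  nearby points of space-time; \<open>sup_conv\<close> tolerates such shifts.\<close>

definition boundary_regular :: "('a \<times> real \<Rightarrow> real) \<Rightarrow> bool" where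
  "boundary_regular u \<longleftrightarrow> (\<forall>w\<in>frontier \<Omega>. \<forall>t\<ge>0. \<forall>\<epsilon>>0. \<exists>x\<in>\<Omega>. \<exists>s\<ge>0.
     dist x w < \<epsilon> \<and> \<bar>s - t\<bar> < \<epsilon> \<and> u (w, t) < u (x, s) + \<epsilon>)"

lemma usc_penalised:
  assumes "usc_on (K \<times> {0..T}) u"
  shows "usc_on (K \<times> {0..T}) (\<lambda>q. u q + - ((snd q - t)\<^sup>2 / \<eta>))"
  unfolding divide_inverse by (intro usc_on_add assms continuous_imp_usc continuous_intros)

lemma sup_conv_attained:
  assumes u: "usc_on (K \<times> {0..T}) u" and "0 \<le> T" "x \<in> K"
  shows "\<exists>s\<in>{0..T}. sup_conv u \<eta> T t x = u (x, s) - (s - t)\<^sup>2 / \<eta>"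
    and "s \<in> {0..T} \<Longrightarrow> u (x, s) - (s - t)\<^sup>2 / \<eta> \<le> sup_conv u \<eta> T t x"
proof -
  have "usc_on {0..T} (\<lambda>s. u (x, s) + - ((snd (x, s) - t)\<^sup>2 / \<eta>))"
    by (rule usc_on_compose[OF usc_penalised[OF u]]) (use assms in \<open>auto intro!: continuous_intros\<close>)
  then obtain s0 where s0: "s0 \<in> {0..T}" "\<And>s. s \<in> {0..T} \<Longrightarrow> u (x, s) - (s - t)\<^sup>2 / \<eta> \<le> u (x, s0) - (s0 - t)\<^sup>2 / \<eta>"
    using usc_attains_sup[of "{0..T}"] assms(2) by fastforce
  have "sup_conv u \<eta> T t x = u (x, s0) - (s0 - t)\<^sup>2 / \<eta>"
    unfolding sup_conv_def using s0 by (intro cSup_eq_maximum) auto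
  then show "\<exists>s\<in>{0..T}. sup_conv u \<eta> T t x = u (x, s) - (s - t)\<^sup>2 / \<eta>"
    "s \<in> {0..T} \<Longrightarrow> u (x, s) - (s - t)\<^sup>2 / \<eta> \<le> sup_conv u \<eta> T t x"
    using s0 by auto
qed

lemma usc_sup_conv:
  assumes u: "usc_on (K \<times> {0..T}) u" and T: "0 \<le> T"
  shows "usc_on K (sup_conv u \<eta> T t)"
proof (rule usc_onI, rule ccontr)
  fix x a assume x: "x \<in> K" and a: "sup_conv u \<eta> T t x < a"
    and "\<not> (\<exists>r>0. \<forall>y\<in>K. dist y x < r \<longrightarrow> sup_conv u \<eta> T t y < a)"
  then have "\<forall>n. \<exists>y. y \<in> K \<and> dist y x < 1 / real (Suc n) \<and> a \<le> sup_conv u \<eta> T t y"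
    by (meson not_le of_nat_0_less_iff zero_less_Suc zero_less_divide_1_iff)
  then obtain y where y: "\<And>n. y n \<in> K" "\<And>n. dist (y n) x < 1 / real (Suc n)" "\<And>n. a \<le> sup_conv u \<eta> T t (y n)"
    by metis
  then have "\<forall>n. \<exists>s\<in>{0..T}. a \<le> u (y n, s) - (s - t)\<^sup>2 / \<eta>"
    using sup_conv_attained(1)[OF u T] by metis
  then obtain s where s: "\<And>n. s n \<in> {0..T}" "\<And>n. a \<le> u (y n, s n) - (s n - t)\<^sup>2 / \<eta>" by metis
  obtain s0 \<rho> where s0: "s0 \<in> {0..T}" "strict_mono \<rho>" "(s \<circ> \<rho>) \<longlonglongrightarrow> s0"
    using compact_Icc[of 0 T] s(1) unfolding compact_def by metis
  have "(\<lambda>n. dist (y n) x) \<longlonglongrightarrow> 0"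
    by (rule Lim_null_comparison[OF _ LIMSEQ_inverse_real_of_nat])
       (use y(2) in \<open>auto intro!: always_eventually less_imp_le simp: inverse_eq_divide\<close>)
  then have "y \<longlonglongrightarrow> x" by (rule tendsto_dist_iff[THEN iffD2])
  then have "(\<lambda>n. (y (\<rho> n), s (\<rho> n))) \<longlonglongrightarrow> (x, s0)"
    using s0 by (intro tendsto_Pair) (auto simp: o_def LIMSEQ_subseq_LIMSEQ[unfolded o_def])
  moreover have "u (x, s0) + - ((snd (x, s0) - t)\<^sup>2 / \<eta>) < a"
    using sup_conv_attained(2)[OF u T x s0(1), of t \<eta>] a by simp
  ultimately have "\<forall>\<^sub>F n in sequentially. u (y (\<rho> n), s (\<rho> n)) + - ((snd (y (\<rho> n), s (\<rho> n)) - t)\<^sup>2 / \<eta>) < a"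
    by (intro usc_on_sequentially[OF usc_penalised[OF u], of "\<lambda>n. (y (\<rho> n), s (\<rho> n))" "(x, s0)"])
       (use y s x s0 in auto)
  moreover have "\<not> u (y (\<rho> n), s (\<rho> n)) + - ((snd (y (\<rho> n), s (\<rho> n)) - t)\<^sup>2 / \<eta>) < a" for n
    using s(2)[of "\<rho> n"] by simp
  ultimately show False by (simp add: eventually_sequentially) blast
qed

lemma sup_conv_near:
  fixes C \<eta> \<tau> t s :: real and u :: "'a \<times> real \<Rightarrow> real"
  assumes "0 < \<eta>" "2 * C * \<eta> < \<tau>\<^sup>2" "0 < \<tau>" "\<bar>u (x, t)\<bar> \<le> C" "\<bar>u (x, s)\<bar> \<le> C"
    and "u (x, t) \<le> u (x, s) - (s - t)\<^sup>2 / \<eta>"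
  shows "\<bar>s - t\<bar> < \<tau>"
proof -
  have "(s - t)\<^sup>2 / \<eta> \<le> 2 * C" using assms by linarith
  then have "(s - t)\<^sup>2 \<le> 2 * C * \<eta>" using assms(1) by (simp add: divide_le_eq)
  then have "\<bar>s - t\<bar>\<^sup>2 < \<tau>\<^sup>2" using assms(2) by simp
  then show ?thesis using assms(3) by (meson less_imp_le power2_less_imp_less)
qed

text \<open>A function touching the sup-convolution from above, plus the time penalty, touches
  \<open>u\<close> itself at the optimal time \<open>s\<close>. There \<bar>s - t\<bar> < \<tau>, so
  \<open>s\<close> is interior and the time derivative is at most 2\<tau>/\<eta> in modulus,
  uniformly in \<open>t\<close>.\<close>

lemma slope_bound_sup_conv:
  assumes u: "subsolution u" and C: "C > 0" "\<And>q. q \<in> K \<times> {0..T} \<Longrightarrow> \<bar>u q\<bar> \<le> C"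
    and \<eta>: "\<eta> > 0" "2 * C * \<eta> < \<tau>\<^sup>2" "0 < \<tau>"
  shows "\<exists>D>0. \<forall>t. \<tau> \<le> t \<and> t + \<tau> \<le> T \<longrightarrow> slope_bound (sup_conv u \<eta> T t) D"
proof -
  obtain fb where fb: "\<And>q. q \<in> K \<times> {0..T} \<Longrightarrow> \<bar>f q\<bar> \<le> fb"
    using continuous_bounded_on_K_times[OF f_continuous] by blast
  define C' where "C' = C + \<bar>fb\<bar> + 2 * \<tau> / \<eta>"
  have C': "C' > 0" using C \<eta> by (simp add: C'_def add_pos_pos add_pos_nonneg)
  obtain D where D: "D > 0" "\<forall>u \<phi> G x t \<Lambda>. x \<in> K \<and> 2 \<le> \<Lambda> \<and> \<bar>u (x, t)\<bar> \<le> C' \<and>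
    (\<forall>y\<in>K. u (y, t) - u (x, t) \<le> 2 * C') \<and>
    (\<forall>y\<in>K. dist y x < 1 / \<Lambda> \<longrightarrow> \<phi> (y, t) - \<phi> (x, t) \<le> \<Lambda> * dist y x) \<and>
    E (1 / \<Lambda>) u \<phi> G x t \<le> 0 \<and> - C' \<le> snd (G (x, t)) \<and> f (x, t) \<le> C' \<longrightarrow>
    norm (fst (G (x, t))) powr m \<le> D * \<Lambda> powr \<sigma>"
    using coercive_bound[OF C'] by blast
  have "norm (G x) powr m \<le> D * \<Lambda> powr \<sigma>"
    if t: "\<tau> \<le> t" "t + \<tau> \<le> T" and \<phi>: "C1_with_gradient K \<phi> G" and x: "x \<in> \<Omega>"
      and mx: "\<And>y. y \<in> K \<Longrightarrow> sup_conv u \<eta> T t y - \<phi> y \<le> sup_conv u \<eta> T t x - \<phi> x"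
      and L: "2 \<le> \<Lambda>" "\<And>y. y \<in> K \<Longrightarrow> dist y x < 1 / \<Lambda> \<Longrightarrow> \<phi> y - \<phi> x \<le> \<Lambda> * dist y x" for t \<phi> G x \<Lambda>
  proof -
    have T: "0 \<le> T" "t \<in> {0..T}" using t \<eta> by auto
    have xK: "x \<in> K" using domain_subset_K x by blast
    note us = usc_K_times[OF u, of T]
    obtain s where s: "s \<in> {0..T}" "sup_conv u \<eta> T t x = u (x, s) - (s - t)\<^sup>2 / \<eta>"
      using sup_conv_attained(1)[OF us T(1) xK] by blast
    have "u (x, t) \<le> u (x, s) - (s - t)\<^sup>2 / \<eta>"
      using sup_conv_attained(2)[OF us T(1) xK T(2), of t \<eta>] s(2) by simp
    then have st: "\<bar>s - t\<bar> < \<tau>"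
      using sup_conv_near[OF \<eta>, of u x t s] C(2) T s xK by auto
    then have s0: "0 < s" "s < T" using t by auto
    define \<psi> where "\<psi> = (\<lambda>q. \<phi> (fst q) + (snd q - t)\<^sup>2 / \<eta>)"
    define F where "F = (\<lambda>q::'a \<times> real. (G (fst q), 0) + (0::'a, 2 * (snd q - t) / \<eta>))"
    have P: "C1_with_gradient (Qbar \<Omega>) \<psi> F"
      unfolding \<psi>_def F_def Qbar_def
      by (intro C1_with_gradient_add C1_with_gradient_fst[OF \<phi>]
          C1_with_gradient_snd[of _ "\<lambda>s. (s - t)\<^sup>2 / \<eta>" "\<lambda>s. 2 * (s - t) / \<eta>"])
         (use \<eta> in \<open>auto intro!: derivative_eq_intros continuous_intros\<close>)
    have "sub_at u \<psi> F x s (1 / \<Lambda>)"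
    proof (rule sub_at_local[OF u P xK])
      fix y s' assume ys: "y \<in> K" "s' \<in> {0..T}"
      show "u (y, s') - \<psi> (y, s') \<le> u (x, s) - \<psi> (x, s)"
        using mx[OF ys(1)] sup_conv_attained(2)[OF us T(1) ys, of t \<eta>] s(2) by (simp add: \<psi>_def)
    qed (use s0 L in auto)
    then have E: "E (1 / \<Lambda>) u \<psi> F x s \<le> 0" using x s0 by (simp add: sub_at_def)
    have "norm (fst (F (x, s))) powr m \<le> D * \<Lambda> powr \<sigma>"
    proof (rule D(2)[rule_format], intro conjI ballI impI)
      have CC: "C \<le> C'" "\<bar>fb\<bar> \<le> C'" "2 * \<tau> / \<eta> \<le> C'" using C \<eta> by (auto simp: C'_def)
      show "\<bar>u (x, s)\<bar> \<le> C'" using C(2)[of "(x, s)"] xK s CC by simp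
      show "u (y, s) - u (x, s) \<le> 2 * C'" if "y \<in> K" for y
      proof -
        have "\<bar>u (y, s)\<bar> \<le> C" "\<bar>u (x, s)\<bar> \<le> C" using C(2) that xK s by auto
        then show ?thesis using CC by linarith
      qed
      have "- (2 * \<tau> / \<eta>) \<le> 2 * (s - t) / \<eta>" using st \<eta> by (simp add: divide_simps)
      then show "- C' \<le> snd (F (x, s))" using CC by (simp add: F_def)
      show "f (x, s) \<le> C'" using fb[of "(x, s)"] xK s CC by simp
    qed (use xK L E in \<open>auto simp: \<psi>_def\<close>)
    then show ?thesis by (simp add: F_def)
  qed
  then show ?thesis unfolding slope_bound_def using D(1) by (intro exI[of _ D]) blast
qed

text \<open>A cone with slope \<open>L s\<^sup>-\<^sup>\<sigma>\<^sup>/\<^sup>m\<close> and vertex \<open>y\<close>, steepened outside \<open>ball y (s/4)\<close> so that it cannot be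
  touched outside \<open>ball y (s/2)\<close>, lies above \<open>U\<close>.\<close>

lemma interior_lipschitz:
  assumes "C > 0" "D > 0"
  shows "\<exists>L>0. \<forall>U y s x. (\<forall>z\<in>K. \<bar>U z\<bar> \<le> C) \<and> usc_on K U \<and> slope_bound U D \<and>
    0 < s \<and> s \<le> 1 \<and> ball y s \<subseteq> \<Omega> \<and> x \<in> K \<and> dist x y \<le> s / 4 \<longrightarrow>
    U x - U y \<le> L * s powr (- \<sigma> / m) * dist x y"
proof -
  have m: "m > 0" using m_gt sigma_pos by simp
  obtain X0 where X0: "X0 > 0" "\<And>X. X \<ge> X0 \<Longrightarrow> D * (2 * X) powr \<sigma> < (1/2 * X) powr m"
    using powr_dominates[OF m_gt, of "1/2" 2 D] assms by auto
  define L where "L = max X0 (1000 * C + 2)"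
  have L: "L \<ge> X0" "L \<ge> 1000 * C + 2" "L > 0" using X0 by (auto simp: L_def)
  have "U x1 - U y \<le> L * s powr (- \<sigma> / m) * dist x1 y"
    if U: "\<And>z. z \<in> K \<Longrightarrow> \<bar>U z\<bar> \<le> C" "usc_on K U" "slope_bound U D"
      and s: "0 < s" "s \<le> 1" and b: "ball y s \<subseteq> \<Omega>" and x1: "x1 \<in> K" "dist x1 y \<le> s / 4" for U y s x1
  proof (rule ccontr)
    define Ls where "Ls = L * s powr (- \<sigma> / m)"
    assume "\<not> ?thesis"
    then have gt: "U x1 - U y - Ls * dist x1 y > 0" by (simp add: Ls_def)
    define \<epsilon> where "\<epsilon> = U x1 - U y - Ls * dist x1 y"
    have "y \<in> ball y s" using s by simp
    then have yK: "y \<in> K" using b domain_subset_K by blast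
    have Ls: "Ls > 0" using L s by (simp add: Ls_def)
    \<comment> \<open>Within \<rho> of \<open>y\<close> the function cannot rise by \<epsilon>. The
      maximum point thus has distance at least \<rho> from \<open>y\<close>, where the smoothed cone
      has at least half its full slope.\<close>
    obtain \<rho> where \<rho>: "\<rho> > 0" "\<And>z. z \<in> K \<Longrightarrow> dist z y < \<rho> \<Longrightarrow> U z < U y + \<epsilon>"
      using usc_onD[OF U(2) yK, of "U y + \<epsilon>"] gt by (auto simp: \<epsilon>_def)
    \<comment> \<open>From distance \<open>s / 2\<close> on, \<open>w\<close> is at least 3 s^2/16
      and \<open>M * w\<^sup>2\<close> exceeds 7 C, more than the total oscillation 2 C of
      \<open>U\<close>. The gradient of this term is still only of order C/s.\<close>
    define M where "M = 200 * C / s ^ 4"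
    have M: "M > 0" using assms s by (simp add: M_def)
    define w where "w = (\<lambda>x. max 0 ((norm (x - y))\<^sup>2 + - (s / 4)\<^sup>2))"
    define \<phi> where "\<phi> = (\<lambda>x. Ls * (sqrt ((norm (x - y))\<^sup>2 + \<rho>\<^sup>2) + - \<rho>) + M * (w x)\<^sup>2)"
    define G where "G = (\<lambda>x. Ls *\<^sub>R ((1 / sqrt ((norm (x - y))\<^sup>2 + \<rho>\<^sup>2)) *\<^sub>R (x - y) + 0)
        + M *\<^sub>R ((2 * w x) *\<^sub>R (2 *\<^sub>R (x - y) + 0)))"
    have P: "C1_with_gradient K \<phi> G"
      unfolding \<phi>_def G_def w_def
      by (intro C1_with_gradient_add C1_with_gradient_scale C1_with_gradient_sqrt \<rho>
          C1_with_gradient_pos_part_square C1_with_gradient_normsq C1_with_gradient_const)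
    have sq0: "\<rho> \<le> sqrt ((norm (x - y))\<^sup>2 + \<rho>\<^sup>2)" for x
      by (rule real_le_rsqrt) simp
    have "Ls * (sqrt ((norm (x - y))\<^sup>2 + \<rho>\<^sup>2) + - \<rho>) \<ge> 0" for x
      using sq0[of x] Ls by (intro mult_nonneg_nonneg) auto
    then have \<phi>0: "\<phi> x \<ge> M * (w x)\<^sup>2" "\<phi> x \<ge> 0" for x
      using M by (auto simp: \<phi>_def)
    have "usc_on K (\<lambda>x. U x + - \<phi> x)"
      by (intro usc_on_add U continuous_imp_usc continuous_on_minus C1_with_gradient_imp_continuous_on[OF P])
    then obtain x where x: "x \<in> K" "\<And>z. z \<in> K \<Longrightarrow> U z - \<phi> z \<le> U x - \<phi> x"
      using usc_attains_sup[OF compact_K K_nonempty] by fastforce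
    have "w x1 = 0" using x1(2) s power_mono[of "dist x1 y" "s / 4" 2] by (simp add: w_def dist_norm)
    moreover have "sqrt ((norm (x1 - y))\<^sup>2 + \<rho>\<^sup>2) \<le> norm (x1 - y) + \<rho>"
      using \<rho> by (intro sqrt_sum_squares_le_sum) auto
    ultimately have "\<phi> x1 \<le> Ls * dist x1 y" using Ls by (simp add: \<phi>_def dist_norm)
    then have val: "U x - \<phi> x \<ge> U y + \<epsilon>" using x(2)[OF x1(1)] by (simp add: \<epsilon>_def)
    then have "U x \<ge> U y + \<epsilon>" using \<phi>0(2)[of x] by linarith
    then have far: "\<rho> \<le> norm (x - y)" using \<rho>(2)[OF x(1)] by (force simp: dist_norm)
    have "\<phi> x \<le> 2 * C" using val U(1)[OF x(1)] U(1)[OF yK] gt unfolding \<epsilon>_def by linarith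
    then have Mw: "M * (w x)\<^sup>2 \<le> 2 * C" using \<phi>0(1)[of x] by linarith
    have close: "norm (x - y) < s / 2"
    proof (rule ccontr)
      assume "\<not> ?thesis"
      then have "(s / 2)\<^sup>2 \<le> (norm (x - y))\<^sup>2" using s by (intro power_mono) auto
      moreover have "(norm (x - y))\<^sup>2 + - (s / 4)\<^sup>2 \<le> w x" by (simp add: w_def)
      ultimately have "3 * s\<^sup>2 / 16 \<le> w x" by (simp add: power_divide)
      then have "(3 * s\<^sup>2 / 16)\<^sup>2 \<le> (w x)\<^sup>2" using s by (intro power_mono) auto
      then have "M * (3 * s\<^sup>2 / 16)\<^sup>2 \<le> M * (w x)\<^sup>2" using M by simp
      moreover have "M * (3 * s\<^sup>2 / 16)\<^sup>2 = 200 * 9 / 256 * C"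
        using s by (simp add: M_def power_divide power_mult_distrib flip: power_mult)
      ultimately show False using Mw assms by simp
    qed
    then have xO: "x \<in> \<Omega>" using b s by (auto simp: dist_norm norm_minus_commute subset_iff)
    \<comment> \<open>Cone and steepening each have Lipschitz constant at most \<open>L / s\<close>
      near \<open>x\<close>: the former because s^(-\<sigma>/m) is at most 1/s, the latter because
      \<open>L\<close> exceeds 1000 C. The cost \<Lambda>^\<sigma> then carries s^(-\<sigma>), the
      same power as the m-th power of the slope of the cone, so one \<open>L\<close> serves for all
      \<open>s\<close>.\<close>
    define \<Lambda> where "\<Lambda> = 2 * L / s"
    have Ls_le: "Ls \<le> L / s"
    proof -
      have "s powr (- \<sigma> / m) \<le> s powr (-1)"
        using s m_gt m by (intro powr_mono') (auto simp: divide_simps)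
      then show ?thesis using L s by (simp add: Ls_def powr_minus_divide divide_inverse)
    qed
    have "2 * 1 \<le> 2 * L / s" using L s assms by (simp add: le_divide_eq)
    then have L2: "2 \<le> \<Lambda>" by (simp add: \<Lambda>_def)
    have Ls1: "1 / \<Lambda> \<le> s"
      using L s assms by (simp add: \<Lambda>_def divide_simps)
    have lip: "\<phi> z - \<phi> x \<le> \<Lambda> * dist z x" if z: "z \<in> K" "dist z x < 1 / \<Lambda>" for z
    proof -
      have zy: "norm (z - y) \<le> 3 / 2 * s"
        using norm_triangle_ineq[of "z - x" "x - y"] z Ls1 close by (simp add: dist_norm)
      have d: "norm (z - y) - norm (x - y) \<le> dist z x"
        using norm_triangle_ineq2[of "z - y" "x - y"] by (simp add: dist_norm)
      have "sqrt ((norm (z - y))\<^sup>2 + \<rho>\<^sup>2) \<le> sqrt ((norm (x - y))\<^sup>2 + \<rho>\<^sup>2) + dist z x"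
      proof -
        have "sqrt ((norm (z - y))\<^sup>2 + \<rho>\<^sup>2) \<le> sqrt ((norm (x - y) + dist z x)\<^sup>2 + (\<rho> + 0)\<^sup>2)"
          using d \<rho> by (intro real_sqrt_le_mono add_mono power_mono) auto
        also have "\<dots> \<le> sqrt ((norm (x - y))\<^sup>2 + \<rho>\<^sup>2) + sqrt ((dist z x)\<^sup>2 + 0\<^sup>2)"
          by (rule real_sqrt_sum_squares_triangle_ineq)
        finally show ?thesis by simp
      qed
      then have "Ls * (sqrt ((norm (z - y))\<^sup>2 + \<rho>\<^sup>2) - sqrt ((norm (x - y))\<^sup>2 + \<rho>\<^sup>2)) \<le> Ls * dist z x"
        using Ls by (intro mult_left_mono) auto
      also have "\<dots> \<le> L / s * dist z x" using Ls_le by (intro mult_right_mono) auto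
      finally have 1: "Ls * (sqrt ((norm (z - y))\<^sup>2 + \<rho>\<^sup>2) - sqrt ((norm (x - y))\<^sup>2 + \<rho>\<^sup>2)) \<le> L / s * dist z x" .
      have 2: "(w z)\<^sup>2 - (w x)\<^sup>2 \<le> 5 * s ^ 3 * dist z x"
      proof (cases "w z \<le> w x")
        case True
        then have "(w z)\<^sup>2 \<le> (w x)\<^sup>2" by (intro power_mono) (auto simp: w_def)
        moreover have "0 \<le> 5 * s ^ 3 * dist z x" using s by simp
        ultimately show ?thesis by linarith
      next
        case False
        have zs: "(norm (z - y))\<^sup>2 \<le> (3 / 2 * s)\<^sup>2" "(norm (x - y))\<^sup>2 \<le> (s / 2)\<^sup>2"
          using zy close s by (auto intro!: power_mono)
        have "w z - w x \<le> (norm (z - y))\<^sup>2 - (norm (x - y))\<^sup>2"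
          using False unfolding w_def by linarith
        also have "\<dots> = (norm (z - y) - norm (x - y)) * (norm (z - y) + norm (x - y))"
          by (simp add: power2_eq_square algebra_simps)
        also have "\<dots> \<le> dist z x * (2 * s)" using d zy close by (intro mult_mono) auto
        finally have a: "w z - w x \<le> dist z x * (2 * s)" .
        have b: "w z + w x \<le> 5 / 2 * s\<^sup>2"
          using zs s by (auto simp: w_def max_def power_divide power_mult_distrib)
        have "(w z)\<^sup>2 - (w x)\<^sup>2 = (w z - w x) * (w z + w x)" by (simp add: power2_eq_square algebra_simps)
        also have "\<dots> \<le> (dist z x * (2 * s)) * (5 / 2 * s\<^sup>2)"
          using a b s by (intro mult_mono) (auto simp: w_def)
        finally show ?thesis by (simp add: power2_eq_square power3_eq_cube algebra_simps)
      qed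
      have "M * ((w z)\<^sup>2 - (w x)\<^sup>2) \<le> M * (5 * s ^ 3 * dist z x)" using 2 M by (intro mult_left_mono) auto
      also have "\<dots> = 1000 * C / s * dist z x" using s by (simp add: M_def divide_simps power3_eq_cube power4_eq_xxxx)
      also have "\<dots> \<le> L / s * dist z x" using L s by (intro mult_right_mono divide_right_mono) auto
      finally have "M * ((w z)\<^sup>2 - (w x)\<^sup>2) \<le> L / s * dist z x" .
      moreover have "\<phi> z - \<phi> x = Ls * (sqrt ((norm (z - y))\<^sup>2 + \<rho>\<^sup>2) - sqrt ((norm (x - y))\<^sup>2 + \<rho>\<^sup>2)) + M * ((w z)\<^sup>2 - (w x)\<^sup>2)"
        by (simp add: \<phi>_def algebra_simps)
      moreover have "\<Lambda> * dist z x = L / s * dist z x + L / s * dist z x" by (simp add: \<Lambda>_def)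
      ultimately show ?thesis using 1 by linarith
    qed
    have "norm (G x) powr m \<le> D * \<Lambda> powr \<sigma>"
      using U(3)[unfolded slope_bound_def, rule_format, of \<phi> G x \<Lambda>] P xO x L2 lip by blast
    moreover have "1/2 * L * s powr (- \<sigma> / m) \<le> norm (G x)"
    proof -
      define S where "S = sqrt ((norm (x - y))\<^sup>2 + \<rho>\<^sup>2)"
      have S: "S > 0" using \<rho> by (simp add: S_def add_nonneg_pos)
      have "S \<le> norm (x - y) + \<rho>" unfolding S_def using \<rho> by (intro sqrt_sum_squares_le_sum) auto
      then have "S \<le> 2 * norm (x - y)" using far by simp
      then have "Ls * S \<le> Ls * (2 * norm (x - y))" using Ls by (intro mult_left_mono) auto
      then have h: "1/2 * Ls \<le> Ls / S * norm (x - y)" using S by (simp add: field_simps)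
      have "G x = (Ls / S + M * (2 * w x) * 2) *\<^sub>R (x - y)"
        by (simp add: G_def S_def algebra_simps)
      then have "norm (G x) = (Ls / S + M * (2 * w x) * 2) * norm (x - y)"
        using Ls S M by (simp add: w_def)
      also have "\<dots> \<ge> Ls / S * norm (x - y)" using M by (intro mult_right_mono) (auto simp: w_def)
      finally have "1/2 * Ls \<le> norm (G x)" using h by linarith
      then show ?thesis by (simp add: Ls_def mult.assoc)
    qed
    then have "(1/2 * L * s powr (- \<sigma> / m)) powr m \<le> norm (G x) powr m"
      using m L by (intro powr_mono2) auto
    moreover have "(1/2 * L * s powr (- \<sigma> / m)) powr m = (1/2 * L) powr m * s powr (- \<sigma>)"
      using m L s by (subst powr_mult) (auto simp: powr_powr)
    moreover have "D * \<Lambda> powr \<sigma> = D * (2 * L) powr \<sigma> * s powr (- \<sigma>)"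
      using L s by (simp add: \<Lambda>_def powr_divide powr_minus_divide)
    moreover have "D * (2 * L) powr \<sigma> * s powr (- \<sigma>) < (1/2 * L) powr m * s powr (- \<sigma>)"
      using X0(2)[OF L(1)] s by (intro mult_strict_right_mono) auto
    ultimately show False by linarith
  qed
  then show ?thesis using L(3) by (intro exI[of _ L]) blast
qed

text \<open>Summing the interior estimate along the points \<open>x + \<lambda>\<^sup>k \<tau> e\<close> approaching the boundary.\<close>

lemma holder_transversal:
  assumes C: "C > 0" and D: "D > 0" and b: "barrier x0 \<beta> N e r l B"
  shows "\<exists>A>0. \<exists>\<tau>0>0. \<tau>0 \<le> r \<and> (\<forall>U w \<tau>. (\<forall>z\<in>K. \<bar>U z\<bar> \<le> C) \<and> usc_on K U \<and> slope_bound U D \<and>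
    (\<forall>w\<in>frontier \<Omega>. \<forall>\<epsilon>>0. \<exists>x\<in>\<Omega>. dist x w < \<epsilon> \<and> U w < U x + \<epsilon>) \<and>
    w \<in> K \<and> dist w x0 < \<tau>0 \<and> 0 < \<tau> \<and> \<tau> < \<tau>0 \<longrightarrow> U w \<le> U (w + \<tau> *\<^sub>R e) + A * \<tau> powr (1 - \<sigma> / m))"
proof -
  obtain L where L: "L > 0" and lip: "\<And>U y s x. (\<And>z. z \<in> K \<Longrightarrow> \<bar>U z\<bar> \<le> C) \<Longrightarrow> usc_on K U \<Longrightarrow> slope_bound U D \<Longrightarrow>
    0 < s \<Longrightarrow> s \<le> 1 \<Longrightarrow> ball y s \<subseteq> \<Omega> \<Longrightarrow> x \<in> K \<Longrightarrow> dist x y \<le> s / 4 \<Longrightarrow>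
    U x - U y \<le> L * s powr (- \<sigma> / m) * dist x y"
    using interior_lipschitz[OF C D] by meson
  have m: "m > 0" using m_gt sigma_pos by simp
  define \<gamma> where "\<gamma> = 1 - \<sigma> / m"
  have \<gamma>: "\<gamma> > 0" using m_gt m by (simp add: \<gamma>_def)
  have r: "r > 0" and l: "l \<ge> 1" and e: "norm e = 1"
    and cone: "\<And>x \<tau>. x \<in> K \<Longrightarrow> 0 < \<tau> \<Longrightarrow> \<tau> < r \<Longrightarrow> dist x x0 < r \<Longrightarrow> ball (x + \<tau> *\<^sub>R e) (\<tau> / (2 * l)) \<subseteq> \<Omega>"
    using b by (auto simp: barrier_def)
  define c where "c = 1 / (2 * l)"
  have c: "c > 0" "c \<le> 1 / 2" using l by (auto simp: c_def field_simps)
  \<comment> \<open>Consecutive points are then \<open>c * t / 4\<close> apart, the largest distance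
    allowed by the interior estimate on the ball of radius \<open>c * t\<close> about the farther
    point.\<close>
  define \<zeta> where "\<zeta> = 1 - c / 4"
  have \<zeta>: "0 < \<zeta>" "\<zeta> < 1" using c by (auto simp: \<zeta>_def)
  define q where "q = \<zeta> powr \<gamma>"
  have q: "0 < q" "q < 1" using \<zeta> \<gamma> powr_less_mono2[of \<gamma> \<zeta> 1] by (auto simp: q_def)
  define A1 where "A1 = L * c powr (- \<sigma> / m)"
  have A1: "A1 > 0" using L c by (simp add: A1_def)
  \<comment> \<open>Sum of a geometric series: the step at height \<open>t\<close> costs
    \<open>A1 * t powr \<gamma>\<close>, and successive costs shrink by the factor \<open>q\<close>,
    which is below 1 because \<sigma>/m < 1.\<close>
  define A where "A = A1 / (1 - q)"
  have A: "A > 0" using A1 q by (simp add: A_def)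
  define \<tau>0 where "\<tau>0 = min (r / 2) 1"
  have \<tau>0: "\<tau>0 > 0" "\<tau>0 \<le> r" "\<tau>0 \<le> 1" "\<tau>0 \<le> r / 2" using r by (auto simp: \<tau>0_def)
  have main: "U w \<le> U (w + \<tau> *\<^sub>R e) + A * \<tau> powr \<gamma>"
    if U: "\<And>z. z \<in> K \<Longrightarrow> \<bar>U z\<bar> \<le> C" "usc_on K U" "slope_bound U D"
      and reg: "\<And>w \<epsilon>. w \<in> frontier \<Omega> \<Longrightarrow> \<epsilon> > 0 \<Longrightarrow> \<exists>x\<in>\<Omega>. dist x w < \<epsilon> \<and> U w < U x + \<epsilon>"
      and w: "w \<in> K" "dist w x0 < \<tau>0" and \<tau>: "0 < \<tau>" "\<tau> < \<tau>0" for U w \<tau>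
  proof -
    have up: "x + t *\<^sub>R e \<in> \<Omega>" if "x \<in> K" "dist x x0 < r" "0 < t" "t < r" for x t
      using cone[OF that(1,3,4,2)] l that(3) by auto
    have inside: "U x \<le> U (x + \<tau> *\<^sub>R e) + A * \<tau> powr \<gamma>" if x: "x \<in> \<Omega>" "dist x x0 < r" for x
    proof -
      have xK: "x \<in> K" using x domain_subset_K by blast
      define F where "F = (\<lambda>t. U (x + t *\<^sub>R e))"
      have step: "F (\<zeta> * t) \<le> F t + A1 * t powr \<gamma>" if t: "0 < t" "t \<le> \<tau>" for t
      proof -
        have tr: "t < r" "t \<le> 1" "\<zeta> * t < r" "\<zeta> * t \<le> t" using t \<tau> \<tau>0 \<zeta> by (auto simp: mult_left_le_one_le intro: le_less_trans[of _ t])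
        have dd: "dist (x + (\<zeta> * t) *\<^sub>R e) (x + t *\<^sub>R e) = c * t / 4"
        proof -
          have "(x + (\<zeta> * t) *\<^sub>R e) - (x + t *\<^sub>R e) = (- (c * t / 4)) *\<^sub>R e" by (simp add: \<zeta>_def algebra_simps)
          then show ?thesis using e c t by (simp add: dist_norm)
        qed
        have "c * t \<le> 1" using c t tr mult_mono[of c 1 t 1] by auto
        moreover have "ball (x + t *\<^sub>R e) (c * t) \<subseteq> \<Omega>" using cone[OF xK t(1) tr(1) x(2)] by (simp add: c_def)
        moreover have "x + (\<zeta> * t) *\<^sub>R e \<in> K" using up[OF xK x(2), of "\<zeta> * t"] \<zeta> t tr domain_subset_K by auto
        ultimately have "U (x + (\<zeta> * t) *\<^sub>R e) - U (x + t *\<^sub>R e) \<le> L * (c * t) powr (- \<sigma> / m) *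
            dist (x + (\<zeta> * t) *\<^sub>R e) (x + t *\<^sub>R e)"
          by (intro lip[OF U]) (use c t in \<open>auto simp only: dd order_refl intro!: mult_pos_pos\<close>)
        then have "U (x + (\<zeta> * t) *\<^sub>R e) - U (x + t *\<^sub>R e) \<le> L * (c * t) powr (- \<sigma> / m) * (c * t / 4)"
          unfolding dd .
        also have "\<dots> = A1 * (t powr (- \<sigma> / m) * t) * (c / 4)" using c t by (simp add: A1_def powr_mult)
        also have "t powr (- \<sigma> / m) * t = t powr \<gamma>"
          using t powr_add[of t "- \<sigma> / m" 1] by (simp add: \<gamma>_def)
        also have "A1 * t powr \<gamma> * (c / 4) \<le> A1 * t powr \<gamma>" using A1 c by (intro mult_left_le) auto
        finally show ?thesis by (simp add: F_def)
      qed
      have it: "F (\<zeta> ^ k * \<tau>) \<le> F \<tau> + A1 * \<tau> powr \<gamma> * (\<Sum>j<k. q ^ j)" for k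
      proof (induction k)
        case (Suc k)
        have lk: "0 < \<zeta> ^ k * \<tau>" "\<zeta> ^ k * \<tau> \<le> \<tau>" using \<zeta> \<tau> by (auto simp: mult_left_le_one_le power_le_one)
        have "(\<zeta> ^ k * \<tau>) powr \<gamma> = q ^ k * \<tau> powr \<gamma>"
          using \<zeta> \<tau> by (simp add: powr_mult q_def powr_powr mult.commute flip: powr_realpow)
        then have "F (\<zeta> ^ Suc k * \<tau>) \<le> F (\<zeta> ^ k * \<tau>) + A1 * (q ^ k * \<tau> powr \<gamma>)"
          using step[OF lk] by (simp add: mult.assoc)
        then show ?case using Suc by (simp add: algebra_simps)
      qed simp
      have bound: "F (\<zeta> ^ k * \<tau>) \<le> F \<tau> + A * \<tau> powr \<gamma>" for k
      proof -
        have "(\<Sum>j<k. q ^ j) \<le> 1 / (1 - q)"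
          using q by (simp add: sum_gp_strict divide_right_mono)
        then have "A1 * \<tau> powr \<gamma> * (\<Sum>j<k. q ^ j) \<le> A1 * \<tau> powr \<gamma> * (1 / (1 - q))"
          using A1 by (intro mult_left_mono) auto
        then show ?thesis using it[of k] by (simp add: A_def)
      qed
      \<comment> \<open>The chain only converges to \<open>x\<close>. As \<open>x\<close> is
        interior, the remaining gap is covered by the interior estimate on a ball of fixed radius
        and vanishes in the limit.\<close>
      obtain s1 where s1: "s1 > 0" "ball x s1 \<subseteq> \<Omega>" using x open_domain open_contains_ball by blast
      define s where "s = min (s1 / 2) 1"
      have s: "0 < s" "s \<le> 1" "s \<le> s1 / 2" using s1 by (auto simp: s_def)
      have lim: "(\<lambda>k. \<zeta> ^ k * \<tau>) \<longlonglongrightarrow> 0"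
        using LIMSEQ_realpow_zero[of \<zeta>] \<zeta> by (auto intro!: tendsto_eq_intros)
      have "(\<lambda>k. F \<tau> + A * \<tau> powr \<gamma> + L * s powr (- \<sigma> / m) * (\<zeta> ^ k * \<tau>)) \<longlonglongrightarrow> F \<tau> + A * \<tau> powr \<gamma> + L * s powr (- \<sigma> / m) * 0"
        by (intro tendsto_intros lim)
      moreover have "\<forall>\<^sub>F k in sequentially. U x \<le> F \<tau> + A * \<tau> powr \<gamma> + L * s powr (- \<sigma> / m) * (\<zeta> ^ k * \<tau>)"
      proof -
        have "\<forall>\<^sub>F k in sequentially. \<zeta> ^ k * \<tau> < s / 4" using order_tendstoD(2)[OF lim, of "s / 4"] s by simp
        then show ?thesis
        proof (rule eventually_mono)
          fix k assume k: "\<zeta> ^ k * \<tau> < s / 4"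
          have pos: "\<zeta> ^ k * \<tau> > 0" using \<zeta> \<tau> by simp
          have d: "dist x (x + (\<zeta> ^ k * \<tau>) *\<^sub>R e) = \<zeta> ^ k * \<tau>" using e pos by (simp add: dist_norm)
          have "ball (x + (\<zeta> ^ k * \<tau>) *\<^sub>R e) s \<subseteq> ball x s1"
          proof
            fix z assume "z \<in> ball (x + (\<zeta> ^ k * \<tau>) *\<^sub>R e) s"
            then show "z \<in> ball x s1"
              using dist_triangle[of x z "x + (\<zeta> ^ k * \<tau>) *\<^sub>R e"] d k s by auto
          qed
          then have "U x - F (\<zeta> ^ k * \<tau>) \<le> L * s powr (- \<sigma> / m) * (\<zeta> ^ k * \<tau>)"
            using lip[OF U s(1,2), of "x + (\<zeta> ^ k * \<tau>) *\<^sub>R e" x] s1 xK d k by (simp add: F_def)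
          then show "U x \<le> F \<tau> + A * \<tau> powr \<gamma> + L * s powr (- \<sigma> / m) * (\<zeta> ^ k * \<tau>)" using bound[of k] by linarith
        qed
      qed
      ultimately have "U x \<le> F \<tau> + A * \<tau> powr \<gamma> + L * s powr (- \<sigma> / m) * 0"
        by (intro tendsto_lowerbound[OF _ _ trivial_limit_sequentially])
      then show ?thesis by (simp add: F_def)
    qed
    have wr: "dist w x0 < r / 2" "dist w x0 < r" using w \<tau>0 r by auto
    show ?thesis
    proof (cases "w \<in> \<Omega>")
      case True
      then show ?thesis using inside wr by blast
    next
      case False
      \<comment> \<open>Upper semicontinuity at \<open>w\<close> does not bound \<open>U w\<close>
        by interior values; this is what regularity at the boundary supplies. At the shifted point,
        which is interior, semicontinuity works in the right direction.\<close>
      then have wf: "w \<in> frontier \<Omega>" using K_cases w by blast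
      show ?thesis
      proof (rule field_le_epsilon)
        fix \<epsilon> :: real assume \<epsilon>: "\<epsilon> > 0"
        have "w + \<tau> *\<^sub>R e \<in> K" using up[of w \<tau>] w wr \<tau> \<tau>0 domain_subset_K by auto
        then obtain d where d: "d > 0" "\<And>z. z \<in> K \<Longrightarrow> dist z (w + \<tau> *\<^sub>R e) < d \<Longrightarrow> U z < U (w + \<tau> *\<^sub>R e) + \<epsilon> / 2"
          using usc_onD[OF U(2), of "w + \<tau> *\<^sub>R e" "U (w + \<tau> *\<^sub>R e) + \<epsilon> / 2"] \<epsilon> by auto
        define \<epsilon>' where "\<epsilon>' = Min {\<epsilon> / 2, d, r / 2}"
        have \<epsilon>': "\<epsilon>' > 0" "\<epsilon>' \<le> \<epsilon> / 2" "\<epsilon>' \<le> d" "\<epsilon>' \<le> r / 2" using \<epsilon> d r by (auto simp: \<epsilon>'_def)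
        obtain x where x: "x \<in> \<Omega>" "dist x w < \<epsilon>'" "U w < U x + \<epsilon>'" using reg[OF wf \<epsilon>'(1)] by blast
        have xr: "dist x x0 < r" using dist_triangle[of x x0 w] x \<epsilon>' wr by linarith
        have "x + \<tau> *\<^sub>R e \<in> K" using up[of x \<tau>] x xr \<tau> \<tau>0 domain_subset_K by auto
        moreover have "dist (x + \<tau> *\<^sub>R e) (w + \<tau> *\<^sub>R e) < d" using x \<epsilon>' by simp
        ultimately have "U (x + \<tau> *\<^sub>R e) < U (w + \<tau> *\<^sub>R e) + \<epsilon> / 2" using d by blast
        then show "U w \<le> U (w + \<tau> *\<^sub>R e) + A * \<tau> powr \<gamma> + \<epsilon>"
          using inside[OF x(1) xr] x(3) \<epsilon>' by linarith
      qed
    qed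
  qed
  show ?thesis
    by (rule exI[of _ A], intro conjI A, rule exI[of _ \<tau>0], intro conjI \<tau>0(1,2) allI impI, elim conjE, rule main[unfolded \<gamma>_def]) auto
qed

lemma sup_conv_boundary_regular:
  assumes reg: "boundary_regular u" and us: "usc_on (K \<times> {0..T}) u"
    and C: "\<And>q. q \<in> K \<times> {0..T} \<Longrightarrow> \<bar>u q\<bar> \<le> C"
    and \<eta>: "\<eta> > 0" "2 * C * \<eta> < \<tau>\<^sup>2" "0 < \<tau>" and t: "\<tau> \<le> t" "t + \<tau> \<le> T"
    and w: "w \<in> frontier \<Omega>" and \<epsilon>: "\<epsilon> > 0"
  shows "\<exists>x\<in>\<Omega>. dist x w < \<epsilon> \<and> sup_conv u \<eta> T t w < sup_conv u \<eta> T t x + \<epsilon>"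
proof -
  have wK: "w \<in> K" using w frontier_subset_K by blast
  have T: "0 \<le> T" "t \<in> {0..T}" "T > 0" using t \<eta> by auto
  obtain s where s: "s \<in> {0..T}" "sup_conv u \<eta> T t w = u (w, s) - (s - t)\<^sup>2 / \<eta>"
    using sup_conv_attained(1)[OF us T(1) wK] by blast
  have "u (w, t) \<le> u (w, s) - (s - t)\<^sup>2 / \<eta>"
    using sup_conv_attained(2)[OF us T(1) wK T(2), of t \<eta>] s(2) by simp
  then have st: "\<bar>s - t\<bar> < \<tau>" using sup_conv_near[OF \<eta>, of u w t s] C T s wK by auto
  then have s0: "0 < s" "s < T" using t by auto
  \<comment> \<open>Moving the optimal time by less than \<epsilon>' changes the time penalty by at
    most \<epsilon>' * 2T/\<eta>; together with the error in \<open>u\<close> the loss is at most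
    \<open>\<epsilon>' * k\<close>.\<close>
  define k where "k = 1 + 2 * T / \<eta>"
  have k: "k \<ge> 1" using T \<eta> by (simp add: k_def)
  define \<epsilon>' where "\<epsilon>' = Min {\<epsilon> / k, T - s}"
  have \<epsilon>': "\<epsilon>' > 0" "\<epsilon>' \<le> \<epsilon> / k" "\<epsilon>' \<le> T - s" using \<epsilon> k s0 by (auto simp: \<epsilon>'_def)
  have "\<epsilon> / k \<le> \<epsilon>" using k \<epsilon> by (simp add: divide_le_eq mult_le_cancel_left1)
  then have \<epsilon>'\<epsilon>: "\<epsilon>' \<le> \<epsilon>" using \<epsilon>' by simp
  obtain x s' where x: "x \<in> \<Omega>" "s' \<ge> 0" "dist x w < \<epsilon>'" "\<bar>s' - s\<bar> < \<epsilon>'" "u (w, s) < u (x, s') + \<epsilon>'"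
    using reg w s0 \<epsilon>'(1) unfolding boundary_regular_def by (meson less_imp_le)
  have s': "s' \<in> {0..T}" using x \<epsilon>' by auto
  have xK: "x \<in> K" using x domain_subset_K by blast
  have "\<bar>(s' - t)\<^sup>2 - (s - t)\<^sup>2\<bar> = \<bar>s' - s\<bar> * \<bar>(s' - t) + (s - t)\<bar>"
    by (simp add: power2_eq_square abs_mult[symmetric] algebra_simps)
  also have "\<dots> \<le> \<epsilon>' * (2 * T)" using x(4) s s' T by (intro mult_mono) auto
  finally have "(s' - t)\<^sup>2 / \<eta> - (s - t)\<^sup>2 / \<eta> \<le> \<epsilon>' * (2 * T) / \<eta>"
    using \<eta> by (simp add: diff_divide_distrib[symmetric] divide_right_mono abs_le_iff)
  moreover have "\<epsilon>' + \<epsilon>' * (2 * T) / \<eta> \<le> \<epsilon>"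
  proof -
    have "\<epsilon>' * k \<le> \<epsilon>" using \<epsilon>'(2) k by (simp add: le_divide_eq)
    then show ?thesis by (simp add: k_def algebra_simps)
  qed
  moreover have "u (x, s') - (s' - t)\<^sup>2 / \<eta> \<le> sup_conv u \<eta> T t x" by (rule sup_conv_attained(2)[OF us T(1) xK s'])
  ultimately have "sup_conv u \<eta> T t w < sup_conv u \<eta> T t x + \<epsilon>" using s(2) x(5) by linarith
  then show ?thesis using x \<epsilon>'\<epsilon> by (intro bexI[of _ x]) auto
qed

end

subsection \<open>Doubling of variables\<close>

context levy_kernels
begin

lemma diagonal_subsequence:
  fixes s t :: "nat \<Rightarrow> real"
  assumes "\<And>n. x n \<in> K" "\<And>n. y n \<in> K" "\<And>n. s n \<in> {0..T}" "\<And>n. t n \<in> {0..T}"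
    and "(\<lambda>n. dist (x n) (y n)) \<longlonglongrightarrow> 0"
  shows "\<exists>\<rho> x0 s0 t0. strict_mono \<rho> \<and> x0 \<in> K \<and> s0 \<in> {0..T} \<and> t0 \<in> {0..T} \<and>
    (\<lambda>n. x (\<rho> n)) \<longlonglongrightarrow> x0 \<and> (\<lambda>n. y (\<rho> n)) \<longlonglongrightarrow> x0 \<and> (\<lambda>n. s (\<rho> n)) \<longlonglongrightarrow> s0 \<and> (\<lambda>n. t (\<rho> n)) \<longlonglongrightarrow> t0"
proof -
  have "compact (K \<times> {0..T} \<times> {0..T})" by (intro compact_Times compact_K compact_Icc)
  moreover have "\<forall>n. (x n, s n, t n) \<in> K \<times> {0..T} \<times> {0..T}" using assms by auto
  ultimately obtain l \<rho> where l: "l \<in> K \<times> {0..T} \<times> {0..T}" "strict_mono \<rho>"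
    "((\<lambda>n. (x n, s n, t n)) \<circ> \<rho>) \<longlonglongrightarrow> l"
    unfolding compact_def by (elim allE[of _ "\<lambda>n. (x n, s n, t n)"]) blast
  obtain x0 s0 t0 where l0: "l = (x0, s0, t0)" by (cases l) auto
  have lim: "(\<lambda>n. (x (\<rho> n), s (\<rho> n), t (\<rho> n))) \<longlonglongrightarrow> (x0, s0, t0)" using l(3) l0 by (simp add: o_def)
  have x: "(\<lambda>n. x (\<rho> n)) \<longlonglongrightarrow> x0" using tendsto_fst[OF lim] by simp
  have "(\<lambda>n. dist (x (\<rho> n)) (y (\<rho> n))) \<longlonglongrightarrow> 0"
    using LIMSEQ_subseq_LIMSEQ[OF assms(5) l(2)] by (simp add: o_def)
  then have "(\<lambda>n. x (\<rho> n) - y (\<rho> n)) \<longlonglongrightarrow> 0" unfolding dist_norm by (rule tendsto_norm_zero_cancel)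
  from tendsto_diff[OF x this] have y: "(\<lambda>n. y (\<rho> n)) \<longlonglongrightarrow> x0" by simp
  show ?thesis
    using l l0 x y tendsto_fst[OF tendsto_snd[OF lim]] tendsto_snd[OF tendsto_snd[OF lim]]
    by (intro exI[of _ \<rho>] exI[of _ x0] exI[of _ s0] exI[of _ t0]) auto
qed

end

text \<open>With q = b/a the claim is q \<le> q^\<gamma>. The derivative is taken at
  \<open>a\<close>, not at the smaller point as concavity would have it, and the factor \<gamma> is
  given up in return; this way only the point \<open>a\<close>, later the maximum point, appears in
  the bound.\<close>

lemma powr_concave_diff:
  fixes a b \<gamma> :: real
  assumes "0 < a" "0 < b" "0 < \<gamma>" "\<gamma> \<le> 1" "a - b \<le> d" "0 \<le> d"
  shows "a powr \<gamma> - b powr \<gamma> \<le> a powr (\<gamma> - 1) * d"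
proof (cases "b \<le> a")
  case True
  define q where "q = b / a"
  have q: "0 < q" "q \<le> 1" using True assms by (auto simp: q_def)
  have "q \<le> q powr \<gamma>" using q assms powr_mono'[of \<gamma> 1 q] by simp
  then have "a powr \<gamma> * (1 - q powr \<gamma>) \<le> a powr \<gamma> * (1 - q)" by (intro mult_left_mono) auto
  moreover have "a powr \<gamma> * (1 - q powr \<gamma>) = a powr \<gamma> - b powr \<gamma>"
    using assms by (simp add: q_def powr_divide right_diff_distrib)
  moreover have "a powr \<gamma> * (1 - q) = a powr (\<gamma> - 1) * (a - b)"
    using assms by (simp add: q_def powr_diff field_simps)
  moreover have "a powr (\<gamma> - 1) * (a - b) \<le> a powr (\<gamma> - 1) * d" using assms by (intro mult_left_mono) auto
  ultimately show ?thesis by linarith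
next
  case False
  then have "a powr \<gamma> \<le> b powr \<gamma>" using assms by (intro powr_mono2) auto
  moreover have "0 \<le> a powr (\<gamma> - 1) * d" using assms by simp
  ultimately show ?thesis by linarith
qed

text \<open>A short step along \<open>N x\<close> raises \<beta> by nearly its length times
  \<open>norm (N x)\<close>, up to the Taylor error 1/4, and the Lipschitz constant \<open>l\<close>
  limits this rise.\<close>

lemma (in levy_kernels) barrier_norm_le:
  assumes b: "barrier x0 \<beta> N e r l B" and x: "x \<in> ball x0 r"
  shows "norm (N x) \<le> l + 1"
proof -
  have r: "r > 0" and l: "l \<ge> 1" and lip: "\<And>y. y \<in> ball x0 r \<Longrightarrow> \<bar>\<beta> x - \<beta> y\<bar> \<le> l * dist x y"
    and diff: "\<And>y. y \<in> ball x0 r \<Longrightarrow> \<bar>\<beta> y - \<beta> x - N x \<bullet> (y - x)\<bar> \<le> dist x y / 4"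
    using b x by (auto simp: barrier_def)
  have "N x \<bullet> e = 1" using b x by (simp add: barrier_def)
  then have N: "norm (N x) > 0" by auto
  obtain d where d: "d > 0" "ball x d \<subseteq> ball x0 r" using openE[OF open_ball x] by blast
  define h where "h = d / (2 * norm (N x))"
  have h: "h > 0" using d N by (simp add: h_def)
  define y where "y = x + h *\<^sub>R N x"
  have dist: "dist x y = h * norm (N x)" using h by (simp add: y_def dist_norm)
  have "dist x y < d" using d N by (simp add: dist h_def)
  then have y: "y \<in> ball x0 r" using d by auto
  have "N x \<bullet> (y - x) = h * (norm (N x))\<^sup>2" by (simp add: y_def power2_norm_eq_inner)
  then have "h * (norm (N x))\<^sup>2 \<le> l * dist x y + dist x y / 4"
    using lip[OF y] diff[OF y] by linarith
  also have "\<dots> \<le> (l + 1) * dist x y" by (simp add: algebra_simps)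
  finally have "h * (norm (N x))\<^sup>2 \<le> (l + 1) * (h * norm (N x))" by (simp only: dist)
  then show ?thesis using h N by (simp add: power2_eq_square)
qed

lemma (in coercive_equation) slope_boundD:
  assumes "slope_bound U D" "C1_with_gradient K \<phi> G" "x \<in> \<Omega>" "\<And>y. y \<in> K \<Longrightarrow> U y - \<phi> y \<le> U x - \<phi> x"
    "2 \<le> \<Lambda>" "\<And>y. y \<in> K \<Longrightarrow> dist y x < 1 / \<Lambda> \<Longrightarrow> \<phi> y - \<phi> x \<le> \<Lambda> * dist y x"
  shows "norm (G x) powr m \<le> D * \<Lambda> powr \<sigma>"
  using assms unfolding slope_bound_def by blast

text \<open>The situation that comparison has to exclude, with all constants fixed in advance.
  \<open>M\<close> is the maximal gap at a common space point and two times, attained at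
  \<open>xh\<close>. \<open>close\<close> says what a large gap near the diagonal implies: times
  away from 0, \<open>v\<close> below the datum on the boundary, nearly equal sources. \<theta>
  keeps maxima away from \<open>T\<close>, and its slope \<kappa> produces the
  contradiction.\<close>

locale doubling = coercive_equation \<Omega> \<nu> \<sigma> H f g u0 m
  for \<Omega> :: "'a::euclidean_space set" and \<nu> \<sigma> H f g u0 m +
  fixes u v :: "'a \<times> real \<Rightarrow> real" and T C \<eta> \<tau> \<kappa> M :: real and \<theta> \<theta>' :: "real \<Rightarrow> real" and xh :: 'a
  assumes sub: "subsolution u" and reg: "boundary_regular u" and super: "supersolution v"
    and u_le: "\<And>q. q \<in> closure \<Omega> \<times> {0..T} \<Longrightarrow> \<bar>u q\<bar> \<le> C" and v_le: "\<And>q. q \<in> closure \<Omega> \<times> {0..T} \<Longrightarrow> \<bar>v q\<bar> \<le> C"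
    and C: "C \<ge> 1" and eta: "\<eta> > 0" "2 * C * \<eta> < \<tau>\<^sup>2" and tau: "\<tau> > 0" and kappa: "\<kappa> > 0" and M: "M > 0"
    and theta: "\<And>s. (\<theta> has_real_derivative \<theta>' s) (at s)" "continuous_on UNIV \<theta>'"
      "\<And>s. s \<ge> 0 \<Longrightarrow> \<theta> s \<ge> 0" "\<And>s. s \<ge> 0 \<Longrightarrow> \<theta>' s \<ge> \<kappa>"
      "\<And>s. s \<in> {0..T} \<Longrightarrow> \<theta> s \<le> 2 * C \<Longrightarrow> s + \<tau> < T"
    and close: "\<And>x y s t. x \<in> closure \<Omega> \<Longrightarrow> y \<in> closure \<Omega> \<Longrightarrow> s \<in> {0..T} \<Longrightarrow> t \<in> {0..T} \<Longrightarrow> dist x y \<le> \<tau> \<Longrightarrow>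
      \<bar>s - t\<bar> \<le> \<tau> \<Longrightarrow> M / 2 \<le> u (x, s) - v (y, t) \<Longrightarrow>
      2 * \<tau> \<le> t \<and> (y \<in> frontier \<Omega> \<longrightarrow> v (y, t) < g (y, t)) \<and> \<bar>f (x, s) - f (y, t)\<bar> \<le> \<kappa> / 4"
    and xh: "xh \<in> closure \<Omega>" and M_attained: "\<exists>s\<in>{0..T}. \<exists>t\<in>{0..T}. u (xh, s) - v (xh, t) - (s - t)\<^sup>2 / \<eta> - \<theta> t = M"
    and M_max: "\<And>x s t. x \<in> closure \<Omega> \<Longrightarrow> s \<in> {0..T} \<Longrightarrow> t \<in> {0..T} \<Longrightarrow> u (x, s) - v (x, t) - (s - t)\<^sup>2 / \<eta> - \<theta> t \<le> M"
begin

lemma usc_u: "usc_on (K \<times> {0..T}) u"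
  by (rule usc_K_times[OF sub])

lemma usc_v: "usc_on (K \<times> {0..T}) (\<lambda>q. - v q)"
  by (rule equation.usc_K_times[OF dual supersolution_dual[OF super]])

lemma T_pos: "T > 0"
proof -
  obtain s t where st: "s \<in> {0..T}" "t \<in> {0..T}" "u (xh, s) - v (xh, t) - (s - t)\<^sup>2 / \<eta> - \<theta> t = M"
    using M_attained by blast
  have "0 \<le> (s - t)\<^sup>2 / \<eta>" using eta by simp
  moreover have "\<bar>u (xh, s)\<bar> \<le> C" "\<bar>v (xh, t)\<bar> \<le> C" using u_le v_le st xh by auto
  ultimately have "\<theta> t \<le> 2 * C" using st(3) M by linarith
  then show ?thesis using theta(5)[OF st(2)] st tau by auto
qed

lemma continuous_theta: "continuous_on A \<theta>"
  using theta(1) by (meson DERIV_continuous_on has_field_derivative_at_within)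

lemma limit_values:
  fixes x y :: "nat \<Rightarrow> 'a" and s t :: "nat \<Rightarrow> real"
  assumes "\<And>n. x n \<in> K" "\<And>n. y n \<in> K" "\<And>n. s n \<in> {0..T}" "\<And>n. t n \<in> {0..T}"
    and "x \<longlonglongrightarrow> x0" "y \<longlonglongrightarrow> x0" "s \<longlonglongrightarrow> s0" "t \<longlonglongrightarrow> t0" "x0 \<in> K" "s0 \<in> {0..T}" "t0 \<in> {0..T}" "e > 0"
  shows "\<forall>\<^sub>F n in sequentially. u (x n, s n) - v (y n, t n) < u (x0, s0) - v (x0, t0) + e"
proof -
  have "\<forall>\<^sub>F n in sequentially. u (x n, s n) < u (x0, s0) + e / 2"
    using assms by (intro usc_on_sequentially[OF usc_u, of "\<lambda>n. (x n, s n)" "(x0, s0)"] tendsto_Pair) auto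
  moreover have "\<forall>\<^sub>F n in sequentially. - v (y n, t n) < - v (x0, t0) + e / 2"
    using assms by (intro usc_on_sequentially[OF usc_v, of "\<lambda>n. (y n, t n)" "(x0, t0)"] tendsto_Pair) auto
  ultimately show ?thesis by eventually_elim linarith
qed

text \<open>By compactness almost maximal configurations with \<open>x\<close> close to
  \<open>y\<close> converge to a diagonal one. There the gap is at most \<open>M\<close>, so nothing
  is left for the square \<open>(norm (y - xh))\<^sup>2\<close>.\<close>

lemma localise:
  assumes "r0 > 0"
  shows "\<exists>\<epsilon>>0. \<forall>x\<in>K. \<forall>y\<in>K. \<forall>s\<in>{0..T}. \<forall>t\<in>{0..T}. dist x y \<le> \<epsilon> \<and>
    M - \<epsilon> \<le> u (x, s) - v (y, t) - (s - t)\<^sup>2 / \<eta> - \<theta> t - (norm (y - xh))\<^sup>2 \<longrightarrow> dist y xh < r0"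
proof (rule ccontr)
  assume "\<not> ?thesis"
  then have "\<forall>n. \<exists>x y s t. x \<in> K \<and> y \<in> K \<and> s \<in> {0..T} \<and> t \<in> {0..T} \<and> dist x y \<le> inverse (real (Suc n)) \<and>
    M - inverse (real (Suc n)) \<le> u (x, s) - v (y, t) - (s - t)\<^sup>2 / \<eta> - \<theta> t - (norm (y - xh))\<^sup>2 \<and> r0 \<le> dist y xh"
    by (meson inverse_positive_iff_positive not_le of_nat_0_less_iff zero_less_Suc)
  then obtain x y s t where a: "\<And>n. x n \<in> K" "\<And>n. y n \<in> K" "\<And>n. s n \<in> {0..T}" "\<And>n. t n \<in> {0..T}"
    "\<And>n. dist (x n) (y n) \<le> inverse (real (Suc n))"
    "\<And>n. M - inverse (real (Suc n)) \<le> u (x n, s n) - v (y n, t n) - (s n - t n)\<^sup>2 / \<eta> - \<theta> (t n) - (norm (y n - xh))\<^sup>2"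
    "\<And>n. r0 \<le> dist (y n) xh" by metis
  have dl: "(\<lambda>n. dist (x n) (y n)) \<longlonglongrightarrow> 0"
    by (rule Lim_null_comparison[OF _ LIMSEQ_inverse_real_of_nat]) (use a(5) in auto)
  obtain \<rho> x0 s0 t0 where l: "strict_mono \<rho>" "x0 \<in> K" "s0 \<in> {0..T}" "t0 \<in> {0..T}"
    "(\<lambda>n. x (\<rho> n)) \<longlonglongrightarrow> x0" "(\<lambda>n. y (\<rho> n)) \<longlonglongrightarrow> x0" "(\<lambda>n. s (\<rho> n)) \<longlonglongrightarrow> s0" "(\<lambda>n. t (\<rho> n)) \<longlonglongrightarrow> t0"
    using diagonal_subsequence[of x y s T t] a(1-4) dl by blast
  have inv: "(\<lambda>n. inverse (real (Suc (\<rho> n)))) \<longlonglongrightarrow> 0"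
    using LIMSEQ_subseq_LIMSEQ[OF LIMSEQ_inverse_real_of_nat l(1)] by (simp add: o_def)
  have "(\<lambda>n. dist (y (\<rho> n)) xh) \<longlonglongrightarrow> dist x0 xh" by (intro tendsto_intros l)
  then have far: "r0 \<le> dist x0 xh" by (rule tendsto_lowerbound) (use a(7) in auto)
  define W where "W = (\<lambda>n. M - inverse (real (Suc (\<rho> n))) + (s (\<rho> n) - t (\<rho> n))\<^sup>2 / \<eta> + \<theta> (t (\<rho> n)) + (norm (y (\<rho> n) - xh))\<^sup>2)"
  have "(\<lambda>n. \<theta> (t (\<rho> n))) \<longlonglongrightarrow> \<theta> t0"
    by (rule continuous_on_tendsto_compose[OF continuous_theta[of UNIV] l(8)]) auto
  then have W: "W \<longlonglongrightarrow> M - 0 + (s0 - t0)\<^sup>2 / \<eta> + \<theta> t0 + (norm (x0 - xh))\<^sup>2"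
    unfolding W_def using eta by (intro tendsto_intros inv l) auto
  have "M + (s0 - t0)\<^sup>2 / \<eta> + \<theta> t0 + (norm (x0 - xh))\<^sup>2 \<le> u (x0, s0) - v (x0, t0) + e" if e: "e > 0" for e
  proof -
    have "\<forall>\<^sub>F n in sequentially. W n \<le> u (x0, s0) - v (x0, t0) + e"
      using limit_values[of "\<lambda>n. x (\<rho> n)" "\<lambda>n. y (\<rho> n)" "\<lambda>n. s (\<rho> n)" "\<lambda>n. t (\<rho> n)", OF a(1) a(2) a(3) a(4) l(5-8) l(2-4) e]
    proof (rule eventually_mono)
      fix n assume "u (x (\<rho> n), s (\<rho> n)) - v (y (\<rho> n), t (\<rho> n)) < u (x0, s0) - v (x0, t0) + e"
      then show "W n \<le> u (x0, s0) - v (x0, t0) + e" using a(6)[of "\<rho> n"] unfolding W_def by linarith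
    qed
    then show ?thesis using tendsto_upperbound[OF W] by simp
  qed
  then have "M + (s0 - t0)\<^sup>2 / \<eta> + \<theta> t0 + (norm (x0 - xh))\<^sup>2 \<le> u (x0, s0) - v (x0, t0)" by (rule field_le_epsilon)
  then have "(norm (x0 - xh))\<^sup>2 \<le> 0" using M_max[OF l(2-4)] by linarith
  then show False using far assms by (simp add: dist_norm)
qed

text \<open>The penalty grows linearly, with slope \<open>L\<close> that stays fixed as \<rho> tends
  to 0. The shift \<rho>\<xi> places its vertex inside the domain when \<open>xh\<close> is a
  boundary point, \<open>b\<close> is a small corrector that repels \<open>x\<close> from the
  boundary, and the last square singles out \<open>xh\<close>.\<close>

definition Psi where
  "Psi L \<rho> \<xi> b x s y t = u (x, s) - v (y, t) - L * sqrt ((norm (x - (y + \<rho> *\<^sub>R \<xi>)))\<^sup>2 + \<rho>\<^sup>2) + b x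
     - (s - t)\<^sup>2 / \<eta> - \<theta> t - (norm (y - xh))\<^sup>2"

definition maximal where
  "maximal L \<rho> \<xi> b x s y t \<longleftrightarrow> x \<in> K \<and> y \<in> K \<and> s \<in> {0..T} \<and> t \<in> {0..T} \<and>
     (\<forall>x'\<in>K. \<forall>y'\<in>K. \<forall>s'\<in>{0..T}. \<forall>t'\<in>{0..T}. Psi L \<rho> \<xi> b x' s' y' t' \<le> Psi L \<rho> \<xi> b x s y t)"

lemma maximal_exists:
  assumes "continuous_on K b"
  shows "\<exists>x s y t. maximal L \<rho> \<xi> b x s y t"
proof -
  define P where "P = (K \<times> {0..T}) \<times> (K \<times> {0..T})"
  have cP: "compact P" unfolding P_def by (intro compact_Times compact_K_times)
  have neP: "P \<noteq> {}" using K_nonempty T_pos by (auto simp: P_def)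
  define F where "F = (\<lambda>p. u (fst p) + (- v (snd p) + (- L * sqrt ((norm (fst (fst p) - (fst (snd p) + \<rho> *\<^sub>R \<xi>)))\<^sup>2 + \<rho>\<^sup>2) + b (fst (fst p))
     - (snd (fst p) - snd (snd p))\<^sup>2 / \<eta> - \<theta> (snd (snd p)) - (norm (fst (snd p) - xh))\<^sup>2)))"
  have "usc_on P (\<lambda>p. u (fst p) + (- v (snd p) + (- L * sqrt ((norm (fst (fst p) - (fst (snd p) + \<rho> *\<^sub>R \<xi>)))\<^sup>2 + \<rho>\<^sup>2) + b (fst (fst p))
     - (snd (fst p) - snd (snd p))\<^sup>2 / \<eta> - \<theta> (snd (snd p)) - (norm (fst (snd p) - xh))\<^sup>2)))"
  proof (intro usc_on_add)
    show "usc_on P (\<lambda>p. u (fst p))"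
      by (rule usc_on_compose[OF usc_u]) (auto simp: P_def intro!: continuous_intros)
    show "usc_on P (\<lambda>p. - v (snd p))"
      by (rule usc_on_compose[OF usc_v, of P snd]) (auto simp: P_def intro!: continuous_intros)
    show "usc_on P (\<lambda>p. - L * sqrt ((norm (fst (fst p) - (fst (snd p) + \<rho> *\<^sub>R \<xi>)))\<^sup>2 + \<rho>\<^sup>2) + b (fst (fst p))
     - (snd (fst p) - snd (snd p))\<^sup>2 / \<eta> - \<theta> (snd (snd p)) - (norm (fst (snd p) - xh))\<^sup>2)"
      using eta by (intro continuous_imp_usc continuous_intros continuous_on_compose2[OF assms]
          continuous_on_compose2[OF continuous_theta[of UNIV]]) (auto simp: P_def)
  qed
  from usc_attains_sup[OF cP neP this] obtain p where p: "p \<in> P" and F: "\<forall>q\<in>P. F q \<le> F p"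
    unfolding F_def by blast
  have "Psi L \<rho> \<xi> b (fst (fst q)) (snd (fst q)) (fst (snd q)) (snd (snd q)) = F q" for q
    unfolding Psi_def F_def prod.collapse by linarith
  with F have mx: "\<And>q. q \<in> P \<Longrightarrow>
     Psi L \<rho> \<xi> b (fst (fst q)) (snd (fst q)) (fst (snd q)) (snd (snd q)) \<le> Psi L \<rho> \<xi> b (fst (fst p)) (snd (fst p)) (fst (snd p)) (snd (snd p))"
    by simp
  have "Psi L \<rho> \<xi> b x' s' y' t' \<le> Psi L \<rho> \<xi> b (fst (fst p)) (snd (fst p)) (fst (snd p)) (snd (snd p))"
    if "x' \<in> K" "y' \<in> K" "s' \<in> {0..T}" "t' \<in> {0..T}" for x' s' y' t'
    using mx[of "((x', s'), (y', t'))"] that by (simp add: P_def)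
  then show ?thesis using p unfolding maximal_def P_def
    by (intro exI[of _ "fst (fst p)"] exI[of _ "snd (fst p)"] exI[of _ "fst (snd p)"] exI[of _ "snd (snd p)"]) auto
qed

text \<open>Comparison with \<open>xh\<close> in both space variables. Missing the vertex there
  costs only \<open>L * \<rho> * (norm \<xi> + 1)\<close>, which vanishes with \<rho>, so the
  competitor need not be shifted.\<close>

lemma maximal_lower_bound:
  assumes "maximal L \<rho> \<xi> b x s y t" "L \<ge> 0" "\<rho> > 0" "b xh \<ge> 0" "b x \<le> k"
  shows "M - L * (\<rho> * (norm \<xi> + 1)) + L * norm (x - (y + \<rho> *\<^sub>R \<xi>))
    \<le> u (x, s) - v (y, t) + k - (s - t)\<^sup>2 / \<eta> - \<theta> t - (norm (y - xh))\<^sup>2"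
proof -
  obtain s1 t1 where 1: "s1 \<in> {0..T}" "t1 \<in> {0..T}" "u (xh, s1) - v (xh, t1) - (s1 - t1)\<^sup>2 / \<eta> - \<theta> t1 = M"
    using M_attained by blast
  have "Psi L \<rho> \<xi> b xh s1 xh t1 \<le> Psi L \<rho> \<xi> b x s y t" using assms(1) 1 xh by (simp add: maximal_def)
  moreover have "sqrt ((norm (xh - (xh + \<rho> *\<^sub>R \<xi>)))\<^sup>2 + \<rho>\<^sup>2) \<le> norm (xh - (xh + \<rho> *\<^sub>R \<xi>)) + \<rho>"
    using assms(3) by (intro sqrt_sum_squares_le_sum) auto
  then have "L * sqrt ((norm (xh - (xh + \<rho> *\<^sub>R \<xi>)))\<^sup>2 + \<rho>\<^sup>2) \<le> L * (\<rho> * (norm \<xi> + 1))"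
    using assms by (intro mult_left_mono) (auto simp: algebra_simps)
  moreover have "L * norm (x - (y + \<rho> *\<^sub>R \<xi>)) \<le> L * sqrt ((norm (x - (y + \<rho> *\<^sub>R \<xi>)))\<^sup>2 + \<rho>\<^sup>2)"
    using assms(2) by (intro mult_left_mono real_le_rsqrt) auto
  moreover have "(norm (xh - xh))\<^sup>2 = 0" by simp
  ultimately show ?thesis using 1(3) assms(4,5) unfolding Psi_def by linarith
qed

text \<open>The conditions on \<rho> and \<open>b\<close> make all errors of order 1/L. The gap is
  bounded by 2C, hence \<open>L * norm (x - y)\<close> is at most a constant \<open>k\<close>
  independent of \<open>L\<close>, and a large \<open>L\<close> brings the maximum into the range of
  \<open>localise\<close> and \<open>close\<close>.\<close>

lemma maximal_position:
  assumes "r0 > 0"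
  shows "\<exists>L0\<ge>1. \<forall>L\<ge>L0. \<forall>\<rho> b x s y t. 0 < \<rho> \<and> \<rho> \<le> 1 / L\<^sup>2 \<and> (\<forall>x\<in>K. b x \<le> 1 / L) \<and> b xh \<ge> 0 \<and>
    maximal L \<rho> \<xi> b x s y t \<longrightarrow>
    dist x y \<le> r0 \<and> dist y xh < r0 \<and> \<bar>s - t\<bar> < \<tau> \<and> 2 * \<tau> \<le> t \<and> t + \<tau> < T \<and>
    (y \<in> frontier \<Omega> \<longrightarrow> v (y, t) < g (y, t)) \<and> \<bar>f (x, s) - f (y, t)\<bar> \<le> \<kappa> / 4"
proof -
  obtain \<epsilon> where \<epsilon>: "\<epsilon> > 0" and loc: "\<And>x y s t. x \<in> K \<Longrightarrow> y \<in> K \<Longrightarrow> s \<in> {0..T} \<Longrightarrow> t \<in> {0..T} \<Longrightarrow> dist x y \<le> \<epsilon> \<Longrightarrow>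
    M - \<epsilon> \<le> u (x, s) - v (y, t) - (s - t)\<^sup>2 / \<eta> - \<theta> t - (norm (y - xh))\<^sup>2 \<Longrightarrow> dist y xh < r0"
    using localise[OF assms] by blast
  define k where "k = 2 * C + 2 * norm \<xi> + 2"
  define e where "e = Min {\<epsilon>, M / 2, r0, \<tau>}"
  have e: "e > 0" "e \<le> \<epsilon>" "e \<le> M / 2" "e \<le> r0" "e \<le> \<tau>" using \<epsilon> M assms tau by (auto simp: e_def)
  define L0 where "L0 = max 1 (k / e)"
  have "dist x y \<le> r0 \<and> dist y xh < r0 \<and> \<bar>s - t\<bar> < \<tau> \<and> 2 * \<tau> \<le> t \<and> t + \<tau> < T \<and>
    (y \<in> frontier \<Omega> \<longrightarrow> v (y, t) < g (y, t)) \<and> \<bar>f (x, s) - f (y, t)\<bar> \<le> \<kappa> / 4"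
    if L: "L \<ge> L0" and \<rho>: "0 < \<rho>" "\<rho> \<le> 1 / L\<^sup>2" and b: "\<And>x. x \<in> K \<Longrightarrow> b x \<le> 1 / L" "b xh \<ge> 0"
      and mx: "maximal L \<rho> \<xi> b x s y t" for L \<rho> b x s y t
  proof -
    have L1: "L \<ge> 1" and "L \<ge> k / e" using L by (auto simp: L0_def)
    then have kL: "k / L \<le> e" using e by (simp add: divide_le_eq mult.commute)
    have D: "x \<in> K" "y \<in> K" "s \<in> {0..T}" "t \<in> {0..T}" using mx by (auto simp: maximal_def)
    have "L * \<rho> \<le> L * (1 / L\<^sup>2)" using \<rho> L1 by (intro mult_left_mono) auto
    then have Lr: "L * \<rho> \<le> 1 / L" using L1 by (simp add: power2_eq_square)
    have Lrx: "L * \<rho> * norm \<xi> \<le> 1 / L * norm \<xi>" using Lr by (intro mult_right_mono) auto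
    have "norm (x - y) \<le> norm (x - (y + \<rho> *\<^sub>R \<xi>)) + \<rho> * norm \<xi>"
      using norm_triangle_ineq[of "x - (y + \<rho> *\<^sub>R \<xi>)" "\<rho> *\<^sub>R \<xi>"] \<rho> by (simp add: algebra_simps)
    then have "L * norm (x - y) \<le> L * (norm (x - (y + \<rho> *\<^sub>R \<xi>)) + \<rho> * norm \<xi>)" using L1 by (intro mult_left_mono) auto
    then have a: "L * norm (x - y) \<le> L * norm (x - (y + \<rho> *\<^sub>R \<xi>)) + 1 / L * norm \<xi>"
      using Lrx by (simp add: algebra_simps)
    have low: "M - L * (\<rho> * (norm \<xi> + 1)) + L * norm (x - (y + \<rho> *\<^sub>R \<xi>))
        \<le> u (x, s) - v (y, t) + 1 / L - (s - t)\<^sup>2 / \<eta> - \<theta> t - (norm (y - xh))\<^sup>2"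
      by (rule maximal_lower_bound[OF mx]) (use L1 \<rho> b D in auto)
    define q where "q = 1 / L * (2 * norm \<xi> + 2)"
    have "L * (\<rho> * (norm \<xi> + 1)) = L * \<rho> * norm \<xi> + L * \<rho>" by (simp add: algebra_simps)
    moreover have "q = 2 * (1 / L * norm \<xi>) + 2 * (1 / L)" by (simp add: q_def algebra_simps)
    ultimately have low2: "M - q + L * norm (x - y) \<le> u (x, s) - v (y, t) - (s - t)\<^sup>2 / \<eta> - \<theta> t - (norm (y - xh))\<^sup>2"
      using low a Lrx Lr by linarith
    have "q \<le> k / L" using L1 C by (simp add: q_def k_def divide_right_mono)
    then have h: "q \<le> e" using kL by linarith
    have uv: "\<bar>u (x, s)\<bar> \<le> C" "\<bar>v (y, t)\<bar> \<le> C" using u_le v_le D by auto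
    have nn: "0 \<le> (s - t)\<^sup>2 / \<eta>" "0 \<le> \<theta> t" "0 \<le> (norm (y - xh))\<^sup>2" "0 \<le> L * norm (x - y)"
      using eta theta(3)[of t] D L1 by auto
    have "q \<le> 1 * (2 * norm \<xi> + 2)" unfolding q_def using L1 by (intro mult_right_mono) auto
    moreover have "u (x, s) \<le> C" "- v (y, t) \<le> C" using uv by linarith+
    moreover have "L * norm (x - y) \<le> u (x, s) - v (y, t) + q" using low2 nn M by linarith
    ultimately have "L * norm (x - y) \<le> k" unfolding k_def by argo
    then have "norm (x - y) \<le> k / L" using L1 by (simp add: le_divide_eq mult.commute)
    then have dxy: "dist x y \<le> e" using kL by (simp add: dist_norm)
    have "u (x, t) - (t - t)\<^sup>2 / \<eta> \<le> u (x, s) - (s - t)\<^sup>2 / \<eta>"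
    proof -
      have "Psi L \<rho> \<xi> b x t y t \<le> Psi L \<rho> \<xi> b x s y t" using mx D by (simp add: maximal_def)
      then show ?thesis by (simp add: Psi_def)
    qed
    then have st: "\<bar>s - t\<bar> < \<tau>"
      by (intro sup_conv_near[OF eta tau, of u x t s]) (use u_le D in auto)
    have "M / 2 \<le> u (x, s) - v (y, t)" using low2 h e nn by linarith
    then have c: "2 * \<tau> \<le> t \<and> (y \<in> frontier \<Omega> \<longrightarrow> v (y, t) < g (y, t)) \<and> \<bar>f (x, s) - f (y, t)\<bar> \<le> \<kappa> / 4"
      using close[OF D] dxy e st by auto
    have "\<theta> t \<le> 2 * C" using low2 h e nn uv M by linarith
    then have "t + \<tau> < T" using theta(5) D by blast
    moreover have "dist y xh < r0" by (rule loc[OF D]) (use dxy e low2 h nn in auto)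
    ultimately show ?thesis using dxy e st c by auto
  qed
  note main = this
  have L01: "L0 \<ge> 1" by (simp add: L0_def)
  show ?thesis
  proof (rule exI[of _ L0], rule conjI[OF L01], intro allI impI, elim conjE)
    fix L \<rho> b x s y t
    assume "L \<ge> L0" "0 < \<rho>" "\<rho> \<le> 1 / L\<^sup>2" "\<forall>x\<in>K. b x \<le> 1 / L" "b xh \<ge> 0" "maximal L \<rho> \<xi> b x s y t"
    then show "dist x y \<le> r0 \<and> dist y xh < r0 \<and> \<bar>s - t\<bar> < \<tau> \<and> 2 * \<tau> \<le> t \<and> t + \<tau> < T \<and>
      (y \<in> frontier \<Omega> \<longrightarrow> v (y, t) < g (y, t)) \<and> \<bar>f (x, s) - f (y, t)\<bar> \<le> \<kappa> / 4"
      by (intro main) auto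
  qed
qed

text \<open>With \<open>y\<close> and \<open>t\<close> frozen, maximising over the time of
  \<open>u\<close> turns it into its sup-convolution. This makes \<open>slope_bound\<close>
  applicable at \<open>x\<close>.\<close>

lemma maximal_sup_conv:
  assumes mx: "maximal L \<rho> \<xi> b x s y t" and z: "z \<in> K"
  shows "sup_conv u \<eta> T t z - (L * sqrt ((norm (z - (y + \<rho> *\<^sub>R \<xi>)))\<^sup>2 + \<rho>\<^sup>2) - b z)
    \<le> sup_conv u \<eta> T t x - (L * sqrt ((norm (x - (y + \<rho> *\<^sub>R \<xi>)))\<^sup>2 + \<rho>\<^sup>2) - b x)"
proof -
  have T: "0 \<le> T" using T_pos by simp
  have D: "x \<in> K" "y \<in> K" "s \<in> {0..T}" "t \<in> {0..T}" using mx by (auto simp: maximal_def)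
  obtain s' where s': "s' \<in> {0..T}" "sup_conv u \<eta> T t z = u (z, s') - (s' - t)\<^sup>2 / \<eta>"
    using sup_conv_attained(1)[OF usc_u T z] by blast
  have "Psi L \<rho> \<xi> b z s' y t \<le> Psi L \<rho> \<xi> b x s y t" using mx z s' by (simp add: maximal_def)
  moreover have "u (x, s) - (s - t)\<^sup>2 / \<eta> \<le> sup_conv u \<eta> T t x" by (rule sup_conv_attained(2)[OF usc_u T D(1,3)])
  ultimately show ?thesis using s'(2) by (simp add: Psi_def)
qed

lemma slope_bound_exists: "\<exists>D>0. \<forall>t. \<tau> \<le> t \<and> t + \<tau> \<le> T \<longrightarrow> slope_bound (sup_conv u \<eta> T t) D"
  by (rule slope_bound_sup_conv[OF sub]) (use C u_le eta tau in auto)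

text \<open>What the final limit requires of a maximum point, common to the interior and the
  boundary case: \<open>x\<close> inside the domain, both equations usable, and a corrector that is
  small together with its gradient at \<open>x\<close>. \<open>L\<close> and \<xi> do not depend on
  \<epsilon>.\<close>

definition doubled where
  "doubled L \<xi> \<epsilon> \<rho> b Nb x s y t \<longleftrightarrow> 0 < \<rho> \<and> \<rho> < \<epsilon> \<and> maximal L \<rho> \<xi> b x s y t \<and> x \<in> \<Omega> \<and>
     norm (x - (y + \<rho> *\<^sub>R \<xi>)) < \<rho> \<and> C1_with_gradient K b Nb \<and> (\<forall>z\<in>K. \<bar>b z\<bar> \<le> \<epsilon>) \<and> b xh \<ge> 0 \<and>
     norm (Nb x) \<le> \<epsilon> \<and> (\<forall>z\<in>K. b x - b z \<le> dist z x) \<and>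
     0 < s \<and> s < T \<and> 0 < t \<and> t < T \<and> (y \<in> frontier \<Omega> \<longrightarrow> v (y, t) < g (y, t)) \<and> \<bar>f (x, s) - f (y, t)\<bar> \<le> \<kappa> / 4"

lemma penalty_gradient:
  assumes "C1_with_gradient K b Nb" "\<rho> > 0"
  shows "C1_with_gradient K (\<lambda>z. L * sqrt ((norm (z - a))\<^sup>2 + \<rho>\<^sup>2) - b z)
    (\<lambda>z. L *\<^sub>R ((1 / sqrt ((norm (z - a))\<^sup>2 + \<rho>\<^sup>2)) *\<^sub>R (z - a)) - Nb z)"
  by (intro C1_with_gradient_diff C1_with_gradient_scale C1_with_gradient_sqrt assms)

lemma penalty_lipschitz:
  assumes "L \<ge> 0"
  shows "L * sqrt ((norm (z - a))\<^sup>2 + \<rho>\<^sup>2) - L * sqrt ((norm (x - a))\<^sup>2 + \<rho>\<^sup>2) \<le> L * dist z x"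
proof -
  have "(norm (z - a))\<^sup>2 \<le> (norm (x - a) + dist z x)\<^sup>2"
    using norm_triangle_ineq2[of "z - a" "x - a"] by (intro power_mono) (auto simp: dist_norm)
  then have "sqrt ((norm (z - a))\<^sup>2 + \<rho>\<^sup>2) \<le> sqrt ((norm (x - a) + dist z x)\<^sup>2 + (\<rho> + 0)\<^sup>2)" by simp
  also have "\<dots> \<le> sqrt ((norm (x - a))\<^sup>2 + \<rho>\<^sup>2) + sqrt ((dist z x)\<^sup>2 + 0\<^sup>2)"
    by (rule real_sqrt_sum_squares_triangle_ineq)
  finally have "sqrt ((norm (z - a))\<^sup>2 + \<rho>\<^sup>2) \<le> sqrt ((norm (x - a))\<^sup>2 + \<rho>\<^sup>2) + dist z x" by simp
  from mult_left_mono[OF this assms] show ?thesis by (simp add: algebra_simps)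
qed

text \<open>Beyond distance \<rho> from the vertex, smoothing costs at most a factor 2 in the
  slope.\<close>

lemma penalty_slope:
  assumes "\<rho> > 0" "\<rho> \<le> norm (x - a)" "L \<ge> 0"
  shows "L / 2 \<le> norm (L *\<^sub>R ((1 / sqrt ((norm (x - a))\<^sup>2 + \<rho>\<^sup>2)) *\<^sub>R (x - a)))"
proof -
  define S where "S = sqrt ((norm (x - a))\<^sup>2 + \<rho>\<^sup>2)"
  have S: "S > 0" using assms by (simp add: S_def add_nonneg_pos)
  have "S \<le> norm (x - a) + \<rho>" unfolding S_def using assms by (intro sqrt_sum_squares_le_sum) auto
  then have "S \<le> 2 * norm (x - a)" using assms by simp
  then have "L * S \<le> L * (2 * norm (x - a))" using assms by (intro mult_left_mono) auto
  then have "L / 2 \<le> L / S * norm (x - a)" using S by (simp add: field_simps)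
  then show ?thesis using S assms by (simp add: S_def)
qed

text \<open>Neither shift nor corrector is needed. If \<open>x\<close> were at distance at least
  \<rho> from \<open>y\<close>, the penalty would touch the sup-convolution with slope at least
  \<open>L / 2\<close> and Lipschitz constant \<open>L\<close>, which coercivity forbids for large
  \<open>L\<close>. The threshold comes from the slope bound and the localisation and is independent
  of \<epsilon>.\<close>

lemma doubled_interior:
  assumes "xh \<in> \<Omega>"
  shows "\<exists>L\<ge>0. \<exists>\<xi>. \<forall>\<epsilon>>0. \<exists>\<rho> b Nb x s y t. doubled L \<xi> \<epsilon> \<rho> b Nb x s y t"
proof -
  obtain r where r: "r > 0" "ball xh r \<subseteq> \<Omega>" using assms open_domain open_contains_ball by blast
  obtain L0 where L0: "L0 \<ge> 1" and pos: "\<And>L \<rho> b x s y t. L \<ge> L0 \<Longrightarrow> 0 < \<rho> \<Longrightarrow> \<rho> \<le> 1 / L\<^sup>2 \<Longrightarrow> (\<And>x. x \<in> K \<Longrightarrow> b x \<le> 1 / L) \<Longrightarrow> b xh \<ge> 0 \<Longrightarrow>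
    maximal L \<rho> (0::'a) b x s y t \<Longrightarrow>
    dist x y \<le> r / 2 \<and> dist y xh < r / 2 \<and> \<bar>s - t\<bar> < \<tau> \<and> 2 * \<tau> \<le> t \<and> t + \<tau> < T \<and>
    (y \<in> frontier \<Omega> \<longrightarrow> v (y, t) < g (y, t)) \<and> \<bar>f (x, s) - f (y, t)\<bar> \<le> \<kappa> / 4"
    using maximal_position[of "r / 2" 0] r by (metis half_gt_zero)
  obtain D where D: "D > 0" "\<And>t. \<tau> \<le> t \<Longrightarrow> t + \<tau> \<le> T \<Longrightarrow> slope_bound (sup_conv u \<eta> T t) D"
    using slope_bound_exists by blast
  obtain X0 where X0: "X0 > 0" "\<And>X. X \<ge> X0 \<Longrightarrow> D * (1 * X) powr \<sigma> < (1/2 * X) powr m"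
    using powr_dominates[OF m_gt, of "1/2" 1 D] D by auto
  define L where "L = max L0 (max X0 2)"
  have L: "L \<ge> L0" "L \<ge> X0" "L \<ge> 2" by (auto simp: L_def)
  have "\<exists>\<rho> b Nb x s y t. doubled L 0 \<epsilon> \<rho> b Nb x s y t" if \<epsilon>: "\<epsilon> > 0" for \<epsilon>
  proof -
    define \<rho> where "\<rho> = min (1 / L\<^sup>2) (\<epsilon> / 2)"
    have \<rho>: "\<rho> > 0" "\<rho> \<le> 1 / L\<^sup>2" "\<rho> < \<epsilon>" using L \<epsilon> by (auto simp: \<rho>_def min_less_iff_disj)
    define b where "b = (\<lambda>x::'a. 0::real)"
    have bC: "C1_with_gradient K b (\<lambda>_. 0)" unfolding b_def by (rule C1_with_gradient_const)
    obtain x s y t where mx: "maximal L \<rho> 0 b x s y t"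
      using maximal_exists[of b L \<rho> 0] by (auto simp: b_def)
    have D': "x \<in> K" "y \<in> K" "s \<in> {0..T}" "t \<in> {0..T}" using mx by (auto simp: maximal_def)
    have p: "dist x y \<le> r / 2 \<and> dist y xh < r / 2 \<and> \<bar>s - t\<bar> < \<tau> \<and> 2 * \<tau> \<le> t \<and> t + \<tau> < T \<and>
      (y \<in> frontier \<Omega> \<longrightarrow> v (y, t) < g (y, t)) \<and> \<bar>f (x, s) - f (y, t)\<bar> \<le> \<kappa> / 4"
      by (rule pos[OF L(1) \<rho>(1,2) _ _ mx]) (use L in \<open>auto simp: b_def\<close>)
    have "dist x xh < r" using dist_triangle[of x xh y] p by linarith
    then have xO: "x \<in> \<Omega>" using r by (auto simp: dist_commute subset_iff)
    have near: "norm (x - (y + \<rho> *\<^sub>R 0)) < \<rho>"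
    proof (rule ccontr)
      assume "\<not> ?thesis"
      then have far: "\<rho> \<le> norm (x - (y + \<rho> *\<^sub>R 0))" by simp
      define G where "G = (\<lambda>z. L *\<^sub>R ((1 / sqrt ((norm (z - (y + \<rho> *\<^sub>R 0)))\<^sup>2 + \<rho>\<^sup>2)) *\<^sub>R (z - (y + \<rho> *\<^sub>R 0))) - 0)"
      have sb: "slope_bound (sup_conv u \<eta> T t) D" using D(2)[of t] p tau by simp
      have "norm (G x) powr m \<le> D * L powr \<sigma>"
      proof (rule slope_boundD[OF sb, where G = G])
        show "C1_with_gradient K (\<lambda>z. L * sqrt ((norm (z - (y + \<rho> *\<^sub>R 0)))\<^sup>2 + \<rho>\<^sup>2) - b z) G"
          unfolding G_def by (rule penalty_gradient[OF bC \<rho>(1)])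
        show "sup_conv u \<eta> T t z - (L * sqrt ((norm (z - (y + \<rho> *\<^sub>R 0)))\<^sup>2 + \<rho>\<^sup>2) - b z)
          \<le> sup_conv u \<eta> T t x - (L * sqrt ((norm (x - (y + \<rho> *\<^sub>R 0)))\<^sup>2 + \<rho>\<^sup>2) - b x)" if "z \<in> K" for z
          by (rule maximal_sup_conv[OF mx that])
        show "(L * sqrt ((norm (z - (y + \<rho> *\<^sub>R 0)))\<^sup>2 + \<rho>\<^sup>2) - b z) - (L * sqrt ((norm (x - (y + \<rho> *\<^sub>R 0)))\<^sup>2 + \<rho>\<^sup>2) - b x)
          \<le> L * dist z x" for z
          using penalty_lipschitz[of L z "y + \<rho> *\<^sub>R 0" \<rho> x] L by (simp add: b_def)
      qed (use xO L in auto)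
      moreover have "1/2 * L \<le> norm (G x)" using penalty_slope[OF \<rho>(1) far, of L] L by (simp add: G_def)
      then have "(1/2 * L) powr m \<le> norm (G x) powr m" using L m_gt sigma_pos by (intro powr_mono2) auto
      ultimately show False using X0(2)[OF L(2)] by simp
    qed
    have "doubled L 0 \<epsilon> \<rho> b (\<lambda>_. 0) x s y t"
      unfolding doubled_def using \<rho> mx xO near bC \<epsilon> p tau by (auto simp: b_def)
    then show ?thesis by blast
  qed
  then show ?thesis using L by (intro exI[of _ L]) auto
qed

end

section \<open>Maximum points near the boundary\<close>

context doubling
begin

lemma sup_conv_bounded:
  assumes "z \<in> K" "t \<in> {0..T}"
  shows "\<bar>sup_conv u \<eta> T t z\<bar> \<le> C"
proof -
  have T: "0 \<le> T" using T_pos by simp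
  obtain s where s: "s \<in> {0..T}" "sup_conv u \<eta> T t z = u (z, s) - (s - t)\<^sup>2 / \<eta>"
    using sup_conv_attained(1)[OF usc_u T assms(1)] by blast
  have "u (z, t) - (t - t)\<^sup>2 / \<eta> \<le> sup_conv u \<eta> T t z"
    by (rule sup_conv_attained(2)[OF usc_u T assms])
  moreover have "0 \<le> (s - t)\<^sup>2 / \<eta>" using eta by simp
  moreover have "\<bar>u (z, t)\<bar> \<le> C" "\<bar>u (z, s)\<bar> \<le> C" using u_le assms s by auto
  ultimately show ?thesis using s(2) by (auto simp: abs_le_iff)
qed

text \<open>The term \<open>\<rho>\<^sup>2 (\<beta> + \<iota>)\<^sup>\<gamma>'\<close> beats the modulus of \<open>U\<close> transversally to the boundary and so keeps \<open>x\<close>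
  inside \<open>\<Omega>\<close>. Close to the boundary its gradient is large, but it forms an obtuse angle with that of the penalty
  because of the shift \<open>\<rho> \<xi>\<close>, so that coercivity applies.\<close>

lemma doubled_boundary:
  assumes xhf: "xh \<in> frontier \<Omega>"
  shows "\<exists>L\<ge>0. \<exists>\<xi>. \<forall>\<epsilon>>0. \<exists>\<rho> b Nb x s y t. doubled L \<xi> \<epsilon> \<rho> b Nb x s y t"
proof -
  have m: "m > 0" using m_gt sigma_pos by simp
  obtain \<beta> N e r l B where bar: "barrier xh \<beta> N e r l B" using barrier_exists[OF xhf] by blast
  then have r: "r > 0" and l: "l \<ge> 1" and B: "B \<ge> 1" and e: "norm e = 1" and \<beta>C: "C1_with_gradient UNIV \<beta> N"
    and \<beta>\<Omega>: "\<And>x. x \<in> ball xh r \<Longrightarrow> x \<in> \<Omega> \<longleftrightarrow> \<beta> x > 0" and \<beta>0: "\<And>x. x \<in> K \<Longrightarrow> \<beta> x \<ge> 0"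
    and shift: "\<And>x \<tau>. x \<in> ball xh r \<Longrightarrow> x + \<tau> *\<^sub>R e \<in> ball xh r \<Longrightarrow> \<beta> (x + \<tau> *\<^sub>R e) = \<beta> x + \<tau>"
    and lip: "\<And>x y. x \<in> ball xh r \<Longrightarrow> y \<in> ball xh r \<Longrightarrow> \<bar>\<beta> x - \<beta> y\<bar> \<le> l * dist x y"
    and diff: "\<And>x y. x \<in> ball xh r \<Longrightarrow> y \<in> ball xh r \<Longrightarrow> \<bar>\<beta> y - \<beta> x - N x \<bullet> (y - x)\<bar> \<le> dist x y / 4"
    and Ne: "\<And>x. x \<in> ball xh r \<Longrightarrow> N x \<bullet> e = 1"
    and cone: "\<And>x \<tau>. x \<in> K \<Longrightarrow> 0 < \<tau> \<Longrightarrow> \<tau> < r \<Longrightarrow> dist x xh < r \<Longrightarrow> ball (x + \<tau> *\<^sub>R e) (\<tau> / (2 * l)) \<subseteq> \<Omega>"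
    and \<beta>lip: "\<And>x y. x \<in> K \<Longrightarrow> y \<in> K \<Longrightarrow> \<beta> x - \<beta> y \<le> B * dist x y"
    by (auto simp: barrier_def)
  have bxh: "\<beta> xh = 0" using \<beta>\<Omega>[of xh] \<beta>0[OF xh] r frontier_not_domain[OF xhf] by simp
  obtain D where D: "D > 0" "\<And>t. \<tau> \<le> t \<Longrightarrow> t + \<tau> \<le> T \<Longrightarrow> slope_bound (sup_conv u \<eta> T t) D"
    using slope_bound_exists by blast
  define \<gamma> where "\<gamma> = 1 - \<sigma> / m"
  have \<gamma>: "0 < \<gamma>" "\<gamma> < 1" using m_gt m sigma_pos by (auto simp: \<gamma>_def)
  \<comment> \<open>Any exponent below the transversal Hoelder exponent \<gamma> would do: at small
    heights the gain \<rho>^2 t^\<gamma>' then outweighs the loss A t^\<gamma>, however small \<rho>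
    is.\<close>
  define \<gamma>' where "\<gamma>' = \<gamma> / 2"
  have \<gamma>': "0 < \<gamma>'" "\<gamma>' < 1" "2 * \<gamma>' = \<gamma>" using \<gamma> by (auto simp: \<gamma>'_def)
  have C0: "C > 0" using C by simp
  obtain A \<tau>0 where A: "A > 0" and \<tau>0: "\<tau>0 > 0" "\<tau>0 \<le> r" and hold0: "\<forall>U w \<tau>. (\<forall>z\<in>K. \<bar>U z\<bar> \<le> C) \<and> usc_on K U \<and> slope_bound U D \<and>
    (\<forall>w\<in>frontier \<Omega>. \<forall>\<epsilon>>0. \<exists>x\<in>\<Omega>. dist x w < \<epsilon> \<and> U w < U x + \<epsilon>) \<and>
    w \<in> K \<and> dist w xh < \<tau>0 \<and> 0 < \<tau> \<and> \<tau> < \<tau>0 \<longrightarrow> U w \<le> U (w + \<tau> *\<^sub>R e) + A * \<tau> powr (1 - \<sigma> / m)"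
    using holder_transversal[OF C0 D(1) bar] by blast
  have hold: "U w \<le> U (w + \<tau> *\<^sub>R e) + A * \<tau> powr \<gamma>"
    if "\<And>z. z \<in> K \<Longrightarrow> \<bar>U z\<bar> \<le> C" "usc_on K U" "slope_bound U D"
      "\<And>w \<epsilon>. w \<in> frontier \<Omega> \<Longrightarrow> \<epsilon> > 0 \<Longrightarrow> \<exists>x\<in>\<Omega>. dist x w < \<epsilon> \<and> U w < U x + \<epsilon>"
      "w \<in> K" "dist w xh < \<tau>0" "0 < \<tau>" "\<tau> < \<tau>0" for U w \<tau>
    unfolding \<gamma>_def by (rule hold0[rule_format], intro conjI ballI allI impI) (use that in auto)
  define r0 where "r0 = \<tau>0 / 4"
  have r0: "r0 > 0" "4 * r0 = \<tau>0" "4 * r0 \<le> r" using \<tau>0 by (auto simp: r0_def)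
  \<comment> \<open>The vertex is raised by \<rho>(1 + l). As \<beta> has Lipschitz constant
    \<open>l\<close> near \<open>xh\<close>, the whole ball of radius \<rho> about the vertex then
    has height at least \<rho>.\<close>
  define \<xi> where "\<xi> = (1 + l) *\<^sub>R e"
  obtain L0 where L0: "L0 \<ge> 1" and pos: "\<And>L \<rho> b x s y t. L \<ge> L0 \<Longrightarrow> 0 < \<rho> \<Longrightarrow> \<rho> \<le> 1 / L\<^sup>2 \<Longrightarrow> (\<And>x. x \<in> K \<Longrightarrow> b x \<le> 1 / L) \<Longrightarrow> b xh \<ge> 0 \<Longrightarrow>
    maximal L \<rho> \<xi> b x s y t \<Longrightarrow>
    dist x y \<le> r0 \<and> dist y xh < r0 \<and> \<bar>s - t\<bar> < \<tau> \<and> 2 * \<tau> \<le> t \<and> t + \<tau> < T \<and>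
    (y \<in> frontier \<Omega> \<longrightarrow> v (y, t) < g (y, t)) \<and> \<bar>f (x, s) - f (y, t)\<bar> \<le> \<kappa> / 4"
    using maximal_position[OF r0(1), of \<xi>] by metis
  define k where "k = 1 + B / \<gamma>'"
  have k: "k > 0" "k \<ge> 1" "B / \<gamma>' \<le> k" using B \<gamma>' by (auto simp: k_def add_pos_pos)
  obtain X0 where X0: "X0 > 0" "\<And>X. X \<ge> X0 \<Longrightarrow> D * (k * X) powr \<sigma> < (1/8 * X) powr m"
    using powr_dominates[OF m_gt, of "1/8" k D] D k by auto
  define L where "L = Max {L0, X0, 2, 4 * (l + 1)}"
  have L: "L \<ge> L0" "L \<ge> X0" "L \<ge> 2" "L \<ge> 4 * (l + 1)" by (auto simp: L_def)
  obtain R where R: "R > 0" "\<And>x y. x \<in> K \<Longrightarrow> y \<in> K \<Longrightarrow> dist x y \<le> R" using K_bounded by blast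
  define Q where "Q = B * R + 2"
  have Q: "Q \<ge> 2" using B R by (simp add: Q_def)
  have "\<exists>\<rho> b Nb x s y t. doubled L \<xi> \<epsilon> \<rho> b Nb x s y t" if \<epsilon>: "\<epsilon> > 0" for \<epsilon>
  proof -
    \<comment> \<open>The entries serve in turn: \<open>maximal_position\<close>; \<rho> <
      \<epsilon> and the gradient of the corrector; the vertex inside the chart; the slope of the
      corrector below 1; the corrector below 1/L; the corrector below \<epsilon>.\<close>
    define \<rho> where "\<rho> = Min {1 / L\<^sup>2, \<epsilon> / (l + 2), r / (4 * (1 + l)), 1 / B, 1 / (L * Q), \<epsilon> / Q}"
    have "\<rho> > 0" using L \<epsilon> l r B Q by (simp add: \<rho>_def)
    moreover have "\<rho> \<le> 1 / L\<^sup>2" "\<rho> \<le> \<epsilon> / (l + 2)" "\<rho> \<le> r / (4 * (1 + l))" "\<rho> \<le> 1 / B" "\<rho> \<le> 1 / (L * Q)" "\<rho> \<le> \<epsilon> / Q"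
      by (auto simp: \<rho>_def)
    ultimately have \<rho>: "\<rho> > 0" "\<rho> \<le> 1 / L\<^sup>2" "\<rho> * (l + 2) \<le> \<epsilon>" "\<rho> * (1 + l) \<le> r / 4" "\<rho> * B \<le> 1" "\<rho> * Q \<le> 1 / L" "\<rho> * Q \<le> \<epsilon>"
      using L l B Q by (auto simp: field_simps)
    have "\<rho> * 1 \<le> \<rho> * B" using \<rho> B by (intro mult_left_mono) auto
    then have \<rho>1: "\<rho> \<le> 1" using \<rho>(5) by linarith
    have "\<rho> * 1 < \<rho> * (l + 2)" using \<rho> l by (intro mult_strict_left_mono) auto
    then have \<rho>\<epsilon>: "\<rho> < \<epsilon>" using \<rho>(3) by linarith
    have \<rho>sq: "\<rho>\<^sup>2 \<le> \<rho>" using \<rho> \<rho>1 by (simp add: power2_eq_square mult_left_le)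
    define q where "q = \<rho>\<^sup>2 / 4 / (A + L)"
    have q: "q > 0" using \<rho> A L by (simp add: q_def)
    \<comment> \<open>The height at which a competitor is compared with a boundary point. With w1 =
      \<tau>1^\<gamma>' both \<tau>1^\<gamma> and \<tau>1 are at most w1^2, and w1 \<le> q, so the
      Hoelder loss and the penalty together lose at most \<rho>^2 w1/4.\<close>
    define \<tau>1 where "\<tau>1 = Min {q powr (1 / \<gamma>'), r0, 1}"
    have \<tau>1: "\<tau>1 > 0" "\<tau>1 \<le> q powr (1 / \<gamma>')" "\<tau>1 \<le> r0" "\<tau>1 \<le> 1" using q r0 by (auto simp: \<tau>1_def)
    define w1 where "w1 = \<tau>1 powr \<gamma>'"
    have w1: "w1 > 0" using \<tau>1 by (simp add: w1_def)
    have "w1 \<le> (q powr (1 / \<gamma>')) powr \<gamma>'" unfolding w1_def using \<tau>1 \<gamma>' by (intro powr_mono2) auto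
    also have "\<dots> = q" using q \<gamma>' by (simp add: powr_powr)
    finally have w1q: "w1 \<le> q" .
    have pg: "\<tau>1 powr \<gamma> = w1 * w1" using \<tau>1 \<gamma>'(3) powr_add[of \<tau>1 \<gamma>' \<gamma>'] by (simp add: w1_def)
    have "\<tau>1 powr 1 \<le> \<tau>1 powr \<gamma>" using \<tau>1 \<gamma> by (intro powr_mono') auto
    then have pt: "\<tau>1 \<le> w1 * w1" using \<tau>1 pg by simp
    have "A * \<tau>1 powr \<gamma> + L * \<tau>1 \<le> A * (w1 * w1) + L * (w1 * w1)"
      using pt pg L A by (intro add_mono mult_left_mono) auto
    also have "\<dots> = (A + L) * w1 * w1" by (simp add: algebra_simps)
    also have "\<dots> \<le> (A + L) * q * w1" using w1q w1 A L by (intro mult_right_mono mult_left_mono) auto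
    also have "(A + L) * q = \<rho>\<^sup>2 / 4"
    proof -
      have "A + L \<noteq> 0" using A L by simp
      then show ?thesis unfolding q_def by (metis nonzero_mult_div_cancel_left times_divide_eq_right)
    qed
    finally have loss: "A * \<tau>1 powr \<gamma> + L * \<tau>1 \<le> \<rho>\<^sup>2 / 4 * w1" .
    \<comment> \<open>\<iota> keeps the corrector differentiable up to the boundary. Its size makes
      the value there a quarter of \<rho>^2 w1, so moving up to height \<tau>1 gains at least 3/4 of
      \<rho>^2 w1, against a loss of at most 1/4.\<close>
    define \<iota> where "\<iota> = \<tau>1 * (1/4) powr (1 / \<gamma>')"
    have \<iota>p: "\<iota> powr \<gamma>' = w1 / 4" using \<tau>1 \<gamma>' by (simp add: \<iota>_def w1_def powr_mult powr_powr)
    have "(1/4) powr (1 / \<gamma>') \<le> (1::real)" using \<gamma>' by (intro powr_le1) auto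
    then have \<iota>: "\<iota> > 0" "\<iota> \<le> 1" using \<tau>1 mult_mono[of \<tau>1 1 "(1/4) powr (1 / \<gamma>')" 1] by (auto simp: \<iota>_def)
    define b where "b = (\<lambda>z. \<rho>\<^sup>2 * (\<beta> z + \<iota>) powr \<gamma>')"
    define Nb where "Nb = (\<lambda>z. \<rho>\<^sup>2 *\<^sub>R ((\<gamma>' * (\<beta> z + \<iota>) powr (\<gamma>' - 1)) *\<^sub>R (N z + 0)))"
    have bpos: "\<beta> z + \<iota> > 0" if "z \<in> K" for z using \<beta>0[OF that] \<iota> by simp
    have bC: "C1_with_gradient K b Nb"
      unfolding b_def Nb_def
    proof (intro C1_with_gradient_scale C1_with_gradient_compose[where h = "\<lambda>t. t powr \<gamma>'" and h' = "\<lambda>t. \<gamma>' * t powr (\<gamma>' - 1)"]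
        C1_with_gradient_add C1_with_gradient_const C1_with_gradient_subset[OF \<beta>C] subset_UNIV)
      show "((\<lambda>t. t powr \<gamma>') has_real_derivative \<gamma>' * (\<beta> z + \<iota>) powr (\<gamma>' - 1)) (at (\<beta> z + \<iota>))" if "z \<in> K" for z
        by (rule has_real_derivative_powr[OF bpos[OF that]])
      have "continuous_on K \<beta>" using C1_with_gradient_imp_continuous_on[OF \<beta>C] continuous_on_subset by blast
      then show "continuous_on K (\<lambda>z. \<gamma>' * (\<beta> z + \<iota>) powr (\<gamma>' - 1))"
        using bpos by (intro continuous_intros) (auto simp: less_le)
    qed
    have b_le: "b z \<le> \<rho> * Q" "0 \<le> b z" if z: "z \<in> K" for z
    proof -
      have "B * dist z xh \<le> B * R" using R(2)[OF z xh] B by (intro mult_left_mono) auto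
      then have "\<beta> z + \<iota> \<le> B * R + 1" using \<beta>lip[OF z xh] bxh \<iota> by linarith
      then have "(\<beta> z + \<iota>) powr \<gamma>' \<le> (B * R + 1) powr \<gamma>'" using bpos[OF z] \<gamma>' by (intro powr_mono2) auto
      also have "\<dots> \<le> (B * R + 1) powr 1" using B R \<gamma>' by (intro powr_mono) auto
      also have "\<dots> \<le> Q" using B R by (simp add: Q_def)
      finally have "b z \<le> \<rho>\<^sup>2 * Q" unfolding b_def by (intro mult_left_mono) auto
      also have "\<dots> \<le> \<rho> * Q" using \<rho>sq Q by (intro mult_right_mono) auto
      finally show "b z \<le> \<rho> * Q" "0 \<le> b z" by (auto simp: b_def)
    qed
    obtain x s y t where mx: "maximal L \<rho> \<xi> b x s y t"
      using maximal_exists[OF C1_with_gradient_imp_continuous_on[OF bC]] by blast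
    have D': "x \<in> K" "y \<in> K" "s \<in> {0..T}" "t \<in> {0..T}" using mx by (auto simp: maximal_def)
    have "dist x y \<le> r0 \<and> dist y xh < r0 \<and> \<bar>s - t\<bar> < \<tau> \<and> 2 * \<tau> \<le> t \<and> t + \<tau> < T \<and>
      (y \<in> frontier \<Omega> \<longrightarrow> v (y, t) < g (y, t)) \<and> \<bar>f (x, s) - f (y, t)\<bar> \<le> \<kappa> / 4"
      by (rule pos[OF L(1) \<rho>(1,2) _ _ mx]) (use b_le xh \<rho> in \<open>auto intro: order_trans\<close>)
    then have p: "dist x y \<le> r0" "dist y xh < r0" "\<bar>s - t\<bar> < \<tau>" "2 * \<tau> \<le> t" "t + \<tau> < T"
      "y \<in> frontier \<Omega> \<longrightarrow> v (y, t) < g (y, t)" "\<bar>f (x, s) - f (y, t)\<bar> \<le> \<kappa> / 4" by auto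
    have dx: "dist x xh < 2 * r0" using dist_triangle[of x xh y] p by linarith
    have ball: "x \<in> ball xh r" "y \<in> ball xh r" using dx p r0 by (auto simp: dist_commute)
    define U where "U = sup_conv u \<eta> T t"
    have sb: "slope_bound U D" unfolding U_def using D(2)[of t] p tau by simp
    define a where "a = y + \<rho> *\<^sub>R \<xi>"
    have x\<Omega>: "x \<in> \<Omega>"
    proof (rule ccontr)
      assume nx: "x \<notin> \<Omega>"
      then have bx: "\<beta> x = 0" using \<beta>\<Omega>[OF ball(1)] \<beta>0[OF D'(1)] by simp
      define z where "z = x + \<tau>1 *\<^sub>R e"
      have dz: "dist z x = \<tau>1" using e \<tau>1 by (simp add: z_def dist_norm)
      have "z \<in> ball z (\<tau>1 / (2 * l))" using \<tau>1 l by simp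
      moreover have "ball z (\<tau>1 / (2 * l)) \<subseteq> \<Omega>"
        unfolding z_def by (rule cone[OF D'(1)]) (use \<tau>1 r0 dx in auto)
      ultimately have zK: "z \<in> K" using domain_subset_K by blast
      have "dist z xh < r" using dist_triangle[of z xh x] dz dx \<tau>1 r0 by linarith
      then have "\<beta> z = \<tau>1" using shift[OF ball(1), of \<tau>1] bx by (simp add: z_def dist_commute)
      then have "w1 \<le> (\<beta> z + \<iota>) powr \<gamma>'" unfolding w1_def using \<tau>1 \<iota> \<gamma>' by (intro powr_mono2) auto
      then have bz: "\<rho>\<^sup>2 * w1 \<le> b z" unfolding b_def by (intro mult_left_mono) auto
      have bx': "b x = \<rho>\<^sup>2 * w1 / 4" by (simp add: b_def bx \<iota>p)
      have "U x \<le> U (x + \<tau>1 *\<^sub>R e) + A * \<tau>1 powr \<gamma>"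
      proof (rule hold[OF _ _ sb])
        show "\<bar>U z\<bar> \<le> C" if "z \<in> K" for z unfolding U_def by (rule sup_conv_bounded[OF that D'(4)])
        show "usc_on K U" unfolding U_def using usc_sup_conv[OF usc_u] T_pos by simp
        show "\<exists>x\<in>\<Omega>. dist x w < \<epsilon> \<and> U w < U x + \<epsilon>" if "w \<in> frontier \<Omega>" "\<epsilon> > 0" for w \<epsilon>
          unfolding U_def by (rule sup_conv_boundary_regular[OF reg usc_u _ eta tau _ _ that]) (use u_le p tau in auto)
      qed (use D' dx \<tau>1 r0 in auto)
      moreover have "U z - (L * sqrt ((norm (z - a))\<^sup>2 + \<rho>\<^sup>2) - b z) \<le> U x - (L * sqrt ((norm (x - a))\<^sup>2 + \<rho>\<^sup>2) - b x)"
        unfolding U_def a_def by (rule maximal_sup_conv[OF mx zK])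
      moreover have "L * sqrt ((norm (z - a))\<^sup>2 + \<rho>\<^sup>2) - L * sqrt ((norm (x - a))\<^sup>2 + \<rho>\<^sup>2) \<le> L * dist z x"
        by (rule penalty_lipschitz) (use L in simp)
      ultimately have "b z - b x \<le> A * \<tau>1 powr \<gamma> + L * \<tau>1" unfolding dz z_def[symmetric] by linarith
      moreover have "0 < \<rho>\<^sup>2 * w1" using \<rho> w1 by simp
      ultimately show False using loss bz bx' by linarith
    qed
    define \<mu> where "\<mu> = \<rho>\<^sup>2 * (\<gamma>' * (\<beta> x + \<iota>) powr (\<gamma>' - 1))"
    have \<mu>: "\<mu> > 0" using \<rho> \<gamma>' bpos[OF D'(1)] by (simp add: \<mu>_def)
    have Nbx: "Nb x = \<mu> *\<^sub>R N x" by (simp add: Nb_def \<mu>_def)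
    have N1: "1 \<le> norm (N x)" by (rule barrier_norm_ge[OF bar ball(1)])
    have Nl: "norm (N x) \<le> l + 1" by (rule barrier_norm_le[OF bar ball(1)])
    have blip: "b x - b z \<le> \<mu> * (B / \<gamma>') * dist z x" if z: "z \<in> K" for z
    proof -
      have "(\<beta> x + \<iota>) powr \<gamma>' - (\<beta> z + \<iota>) powr \<gamma>' \<le> (\<beta> x + \<iota>) powr (\<gamma>' - 1) * (B * dist x z)"
        by (rule powr_concave_diff) (use bpos[OF z] bpos[OF D'(1)] \<gamma>' \<beta>lip[OF D'(1) z] B in auto)
      then have "\<rho>\<^sup>2 * ((\<beta> x + \<iota>) powr \<gamma>' - (\<beta> z + \<iota>) powr \<gamma>') \<le> \<rho>\<^sup>2 * ((\<beta> x + \<iota>) powr (\<gamma>' - 1) * (B * dist x z))"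
        by (intro mult_left_mono) auto
      then show ?thesis using \<gamma>' by (simp add: b_def \<mu>_def dist_commute algebra_simps)
    qed
    have near: "norm (x - a) < \<rho>"
    proof (rule ccontr)
      assume "\<not> ?thesis"
      then have far: "\<rho> \<le> norm (x - a)" by simp
      define P where "P = L *\<^sub>R ((1 / sqrt ((norm (x - a))\<^sup>2 + \<rho>\<^sup>2)) *\<^sub>R (x - a))"
      have P: "L / 2 \<le> norm P" unfolding P_def using penalty_slope[OF \<rho>(1) far, of L] L by simp
      have "norm (P - \<mu> *\<^sub>R N x) powr m \<le> D * (L + \<mu> * (B / \<gamma>')) powr \<sigma>"
      proof -
        have "norm (L *\<^sub>R ((1 / sqrt ((norm (x - a))\<^sup>2 + \<rho>\<^sup>2)) *\<^sub>R (x - a)) - Nb x) powr m \<le> D * (L + \<mu> * (B / \<gamma>')) powr \<sigma>"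
        proof (rule slope_boundD[OF sb, where G = "\<lambda>x. L *\<^sub>R ((1 / sqrt ((norm (x - a))\<^sup>2 + \<rho>\<^sup>2)) *\<^sub>R (x - a)) - Nb x"])
          show "C1_with_gradient K (\<lambda>z. L * sqrt ((norm (z - a))\<^sup>2 + \<rho>\<^sup>2) - b z)
              (\<lambda>x. L *\<^sub>R ((1 / sqrt ((norm (x - a))\<^sup>2 + \<rho>\<^sup>2)) *\<^sub>R (x - a)) - Nb x)"
            by (rule penalty_gradient[OF bC \<rho>(1)])
          show "U z - (L * sqrt ((norm (z - a))\<^sup>2 + \<rho>\<^sup>2) - b z) \<le> U x - (L * sqrt ((norm (x - a))\<^sup>2 + \<rho>\<^sup>2) - b x)" if "z \<in> K" for z
            unfolding U_def a_def by (rule maximal_sup_conv[OF mx that])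
          have "0 \<le> \<mu> * (B / \<gamma>')" using \<mu> B \<gamma>' by simp
          then show "2 \<le> L + \<mu> * (B / \<gamma>')" using L by linarith
          show "(L * sqrt ((norm (z - a))\<^sup>2 + \<rho>\<^sup>2) - b z) - (L * sqrt ((norm (x - a))\<^sup>2 + \<rho>\<^sup>2) - b x)
            \<le> (L + \<mu> * (B / \<gamma>')) * dist z x" if "z \<in> K" for z
            using penalty_lipschitz[of L z a \<rho> x] blip[OF that] L by (simp add: algebra_simps)
        qed (rule x\<Omega>)
        then show ?thesis by (simp add: P_def Nbx)
      qed
      \<comment> \<open>The gradients of penalty and corrector must not cancel. Either the corrector
        has at most half the norm of \<open>P\<close>, or \<mu> > 1, which forces \<open>x\<close>
        to within height \<rho>^2 of the boundary; the vertex then lies above \<open>x\<close>, and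
        \<open>P\<close> and \<open>N x\<close> are at worst slightly acute.\<close>
      moreover have "1/8 * (L + \<mu>) \<le> norm (P - \<mu> *\<^sub>R N x)"
      proof (cases "\<mu> * norm (N x) \<le> norm P / 2")
        case True
        have "norm P - \<mu> * norm (N x) \<le> norm (P - \<mu> *\<^sub>R N x)" using norm_triangle_ineq2[of P "\<mu> *\<^sub>R N x"] \<mu> by simp
        moreover have "\<mu> \<le> \<mu> * norm (N x)" using \<mu> N1 by simp
        moreover have "norm P \<le> L"
        proof -
          have "norm (x - a) \<le> sqrt ((norm (x - a))\<^sup>2 + \<rho>\<^sup>2)" by (rule real_le_rsqrt) simp
          moreover have "0 < sqrt ((norm (x - a))\<^sup>2 + \<rho>\<^sup>2)" using \<rho> by (simp add: add_nonneg_pos)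
          ultimately have "norm (x - a) / sqrt ((norm (x - a))\<^sup>2 + \<rho>\<^sup>2) \<le> 1" by simp
          then show ?thesis using L mult_left_mono[of "norm (x - a) / sqrt ((norm (x - a))\<^sup>2 + \<rho>\<^sup>2)" 1 L] by (simp add: P_def)
        qed
        ultimately show ?thesis using True P \<mu> by argo
      next
        case False
        then have "L / 4 < \<mu> * norm (N x)" using P by linarith
        also have "\<dots> \<le> \<mu> * (l + 1)" using \<mu> Nl by (intro mult_left_mono) auto
        finally have "L < \<mu> * (4 * (l + 1))" by (simp add: algebra_simps)
        also have "\<dots> \<le> \<mu> * L" using L \<mu> by (intro mult_left_mono) auto
        finally have "1 < \<mu>" using L by simp
        define Z where "Z = \<beta> x + \<iota>"
        have Z: "Z > 0" using bpos[OF D'(1)] by (simp add: Z_def)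
        have "1 < \<rho>\<^sup>2 * (\<gamma>' * Z powr (\<gamma>' - 1))" using \<open>1 < \<mu>\<close> by (simp add: \<mu>_def Z_def)
        also have "\<dots> \<le> \<rho>\<^sup>2 * (1 * Z powr (\<gamma>' - 1))" using \<gamma>' by (intro mult_left_mono mult_right_mono) auto
        also have "\<dots> = \<rho>\<^sup>2 / Z powr (1 - \<gamma>')" using Z by (simp add: powr_diff divide_simps flip: powr_add)
        finally have Zp: "Z powr (1 - \<gamma>') < \<rho>\<^sup>2" using Z by (simp add: less_divide_eq)
        have Z1: "Z < 1"
        proof (rule ccontr)
          assume "\<not> Z < 1"
          then have "1 \<le> Z powr (1 - \<gamma>')" using \<gamma>' by (intro ge_one_powr_ge_zero) auto
          then show False using Zp \<rho>sq \<rho>1 by linarith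
        qed
        have "Z powr 1 \<le> Z powr (1 - \<gamma>')" using Z Z1 \<gamma>' by (intro powr_mono') auto
        then have bx: "\<beta> x \<le> \<rho>\<^sup>2" using Zp Z \<iota> by (simp add: Z_def)
        define S where "S = sqrt ((norm (x - a))\<^sup>2 + \<rho>\<^sup>2)"
        have S: "S > 0" using \<rho> by (simp add: S_def add_nonneg_pos)
        \<comment> \<open>The height of \<open>x\<close> is at most \<rho>^2 and that of
          \<open>y\<close> is nonnegative. The shift subtracts \<rho>(1 + l) from the normal
          component of \<open>x - a\<close>; of this a quarter is lost to the Taylor error and at
          most \<rho> to the height of \<open>x\<close>. As 1 + l is at least 2, only a quarter of
          \<open>norm (x - a)\<close> remains.\<close>
        have "N x \<bullet> (x - y) \<le> \<beta> x - \<beta> y + dist x y / 4"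
        proof -
          have "N x \<bullet> (y - x) = - (N x \<bullet> (x - y))" by (simp add: inner_diff_right)
          then show ?thesis using diff[OF ball] by linarith
        qed
        moreover have "dist x y \<le> norm (x - a) + \<rho> * (1 + l)"
          using norm_triangle_ineq[of "x - a" "\<rho> *\<^sub>R \<xi>"] \<rho> e l by (simp add: a_def \<xi>_def dist_norm)
        moreover have "N x \<bullet> (x - a) = N x \<bullet> (x - y) - \<rho> * (1 + l)"
          using Ne[OF ball(1)] by (simp add: a_def \<xi>_def inner_diff_right inner_add_right)
        moreover have "\<rho> * 2 \<le> \<rho> * (1 + l)" using \<rho> l by (intro mult_left_mono) auto
        ultimately have NP: "N x \<bullet> (x - a) \<le> norm (x - a) / 4"
          using bx \<beta>0[OF D'(2)] \<rho>sq \<rho>(1) by argo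
        have "N x \<bullet> P = L / S * (N x \<bullet> (x - a))" by (simp add: P_def S_def)
        also have "\<dots> \<le> L / S * (norm (x - a) / 4)" using NP S L by (intro mult_left_mono) auto
        also have "\<dots> = norm P / 4" using S L by (simp add: P_def S_def)
        finally have NP2: "N x \<bullet> P \<le> norm P / 4" .
        have "(norm (P - \<mu> *\<^sub>R N x))\<^sup>2 = (norm P)\<^sup>2 + \<mu>\<^sup>2 * (norm (N x))\<^sup>2 - 2 * \<mu> * (N x \<bullet> P)"
          by (simp add: power2_norm_eq_inner inner_diff_left inner_diff_right inner_commute power2_eq_square[of \<mu>] algebra_simps)
        moreover have "\<mu>\<^sup>2 * 1 \<le> \<mu>\<^sup>2 * (norm (N x))\<^sup>2" using N1 by (intro mult_left_mono) auto
        moreover have "2 * \<mu> * (N x \<bullet> P) \<le> 2 * \<mu> * (norm P / 4)" using NP2 \<mu> by (intro mult_left_mono) auto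
        ultimately have "(norm P)\<^sup>2 + \<mu>\<^sup>2 - \<mu> * norm P / 2 \<le> (norm (P - \<mu> *\<^sub>R N x))\<^sup>2" by simp
        moreover have "((norm P + \<mu>) / 2)\<^sup>2 \<le> (norm P)\<^sup>2 + \<mu>\<^sup>2 - \<mu> * norm P / 2"
        proof -
          have "(norm P)\<^sup>2 + \<mu>\<^sup>2 - \<mu> * norm P / 2 - ((norm P + \<mu>) / 2)\<^sup>2 = 1/2 * (norm P - \<mu>)\<^sup>2 + 1/4 * (norm P)\<^sup>2 + 1/4 * \<mu>\<^sup>2"
            by (simp add: power2_eq_square field_simps)
          then show ?thesis by (smt (verit) mult_nonneg_nonneg zero_le_power2 zero_le_divide_1_iff zero_le_numeral)
        qed
        ultimately have "((norm P + \<mu>) / 2)\<^sup>2 \<le> (norm (P - \<mu> *\<^sub>R N x))\<^sup>2" by linarith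
        then have "(norm P + \<mu>) / 2 \<le> norm (P - \<mu> *\<^sub>R N x)" by (rule power2_le_imp_le) simp
        then show ?thesis using P \<mu> L by argo
      qed
      then have "(1/8 * (L + \<mu>)) powr m \<le> norm (P - \<mu> *\<^sub>R N x) powr m" using m L \<mu> by (intro powr_mono2) auto
      moreover have "D * (L + \<mu> * (B / \<gamma>')) powr \<sigma> \<le> D * (k * (L + \<mu>)) powr \<sigma>"
      proof (intro mult_left_mono powr_mono2)
        have "\<mu> * (B / \<gamma>') \<le> \<mu> * k" by (rule mult_left_mono[OF k(3)]) (use \<mu> in simp)
        moreover have "1 * L \<le> k * L" by (rule mult_right_mono[OF k(2)]) (use L in simp)
        ultimately show "L + \<mu> * (B / \<gamma>') \<le> k * (L + \<mu>)" by (simp add: algebra_simps)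
        show "0 \<le> L + \<mu> * (B / \<gamma>')" using L \<mu> B \<gamma>' by simp
      qed (use D sigma_pos in auto)
      moreover have "D * (k * (L + \<mu>)) powr \<sigma> < (1/8 * (L + \<mu>)) powr m" by (rule X0(2)) (use L \<mu> in simp)
      ultimately show False by linarith
    qed
    \<comment> \<open>Now that \<open>x\<close> is within \<rho> of the vertex, its height is at
      least \<rho>. The slope of the corrector, possibly large near the boundary, is there of order
      \<rho>^(1+\<gamma>') and disappears in the limit.\<close>
    have "\<mu> \<le> \<rho> * (\<rho> powr \<gamma>' * \<gamma>')" "\<rho> powr \<gamma>' \<le> 1"
    proof -
      have "y + (\<rho> * (1 + l)) *\<^sub>R e \<in> ball xh r"
      proof -
        have "dist (y + (\<rho> * (1 + l)) *\<^sub>R e) xh \<le> dist (y + (\<rho> * (1 + l)) *\<^sub>R e) y + dist y xh" by (rule dist_triangle)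
        then show ?thesis using p(2) r0 \<rho> e l r by (simp add: dist_norm norm_minus_commute)
      qed
      then have aa: "a \<in> ball xh r" "\<beta> a = \<beta> y + \<rho> * (1 + l)"
        using shift[OF ball(2), of "\<rho> * (1 + l)"] by (simp_all add: a_def \<xi>_def)
      have "l * dist x a \<le> l * \<rho>" using near l by (intro mult_left_mono) (auto simp: dist_norm)
      then have "\<bar>\<beta> x - \<beta> a\<bar> \<le> l * \<rho>" using lip[OF ball(1) aa(1)] by linarith
      then have "\<rho> \<le> \<beta> x + \<iota>" using aa(2) \<beta>0[OF D'(2)] \<iota> by (simp add: algebra_simps)
      then have "(\<beta> x + \<iota>) powr (\<gamma>' - 1) \<le> \<rho> powr (\<gamma>' - 1)" using \<rho> \<gamma>' by (intro powr_mono2') auto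
      then have "\<mu> \<le> \<rho>\<^sup>2 * (\<gamma>' * \<rho> powr (\<gamma>' - 1))" unfolding \<mu>_def using \<gamma>' by (intro mult_left_mono) auto
      also have "\<dots> = \<rho> * (\<rho> powr \<gamma>' * \<gamma>')" using \<rho> by (simp add: powr_diff power2_eq_square)
      finally show "\<mu> \<le> \<rho> * (\<rho> powr \<gamma>' * \<gamma>')" .
      show "\<rho> powr \<gamma>' \<le> 1" using \<rho> \<rho>1 \<gamma>' by (intro powr_le1) auto
    qed
    moreover from this have "\<rho> * (\<rho> powr \<gamma>' * \<gamma>') \<le> \<rho> * (1 * \<gamma>')" using \<rho> \<gamma>' by (intro mult_left_mono mult_right_mono) auto
    ultimately have \<mu>\<rho>: "\<mu> \<le> \<rho> * \<gamma>'" by simp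
    have bl1: "b x - b z \<le> dist z x" if z: "z \<in> K" for z
    proof -
      have "\<mu> * (B / \<gamma>') \<le> \<rho> * \<gamma>' * (B / \<gamma>')" using \<mu>\<rho> B \<gamma>' by (intro mult_right_mono) auto
      also have "\<dots> \<le> 1" using \<gamma>' \<rho> by simp
      finally have "\<mu> * (B / \<gamma>') * dist z x \<le> 1 * dist z x" by (intro mult_right_mono) auto
      then show ?thesis using blip[OF z] by simp
    qed
    have "\<rho> * \<gamma>' \<le> \<rho> * 1" using \<rho> \<gamma>' by (intro mult_left_mono) auto
    then have "\<mu> \<le> \<rho>" using \<mu>\<rho> by simp
    then have "\<mu> * norm (N x) \<le> \<rho> * (l + 1)" using Nl \<mu> \<rho> by (intro mult_mono) auto
    also have "\<dots> \<le> \<epsilon>" using \<rho> by (simp add: algebra_simps)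
    finally have Nb\<epsilon>: "norm (Nb x) \<le> \<epsilon>" using \<mu> by (simp add: Nbx)
    have st: "0 < s" "s < T" "0 < t" "t < T" using p tau by auto
    have "doubled L \<xi> \<epsilon> \<rho> b Nb x s y t"
      unfolding doubled_def
      using \<rho>(1) \<rho>\<epsilon> mx x\<Omega> near bC Nb\<epsilon> bl1 st p(6,7) b_le \<rho>(7) xh
      by (auto simp: a_def intro: order_trans)
    then show ?thesis by blast
  qed
  then show ?thesis using L by (intro exI[of _ L] conjI exI[of _ \<xi>]) auto
qed

end

section \<open>The doubled equations in the limit\<close>

context doubling
begin

text \<open>Sum of the two viscosity inequalities. The time derivatives of the penalty cancel and
  leave the slope \<kappa> of \<theta>. The near terms are controlled by the Lipschitz constants
  \<open>L + 1\<close> (penalty and corrector) and \<open>L + 2 * R\<close> (penalty and the square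
  about \<open>xh\<close>). If \<open>y\<close> is a boundary point, \<open>v\<close> lies below the
  datum, so its equation holds there as well.\<close>

lemma doubled_inequality:
  assumes d: "doubled L \<xi> \<epsilon> \<rho> b Nb x s y t" and L: "L \<ge> 0" and \<epsilon>: "\<epsilon> \<le> 1" and \<delta>: "0 < \<delta>" "\<delta> < 1"
    and R: "\<And>x y. x \<in> K \<Longrightarrow> y \<in> K \<Longrightarrow> dist x y \<le> R" "R > 0"
    and p: "p = L *\<^sub>R ((1 / sqrt ((norm (x - (y + \<rho> *\<^sub>R \<xi>)))\<^sup>2 + \<rho>\<^sup>2)) *\<^sub>R (x - (y + \<rho> *\<^sub>R \<xi>)))"
  shows "\<kappa> \<le> (2 * L + 1 + 2 * R) * (C\<nu> * \<delta> powr (1 - \<sigma>)) + \<kappa> / 4 +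
     nonlocal \<Omega> \<nu> (- ball 0 \<delta>) (\<lambda>z. u (z, s)) x + nonlocal \<Omega> \<nu> (- ball 0 \<delta>) (\<lambda>z. - v (z, t)) y
     - H x (u (x, s)) (p - Nb x) + H y (v (y, t)) (p - 2 *\<^sub>R (y - xh))"
proof -
  have dd: "\<rho> > 0" "\<rho> < \<epsilon>" "maximal L \<rho> \<xi> b x s y t" "x \<in> \<Omega>" "C1_with_gradient K b Nb" "0 < s" "s < T" "0 < t" "t < T"
      "y \<in> frontier \<Omega> \<Longrightarrow> v (y, t) < g (y, t)" "\<bar>f (x, s) - f (y, t)\<bar> \<le> \<kappa> / 4" and bl: "\<And>z. z \<in> K \<Longrightarrow> b x - b z \<le> dist z x"
    using d by (auto simp: doubled_def)
  have D: "x \<in> K" "y \<in> K" "s \<in> {0..T}" "t \<in> {0..T}" using dd(3) by (auto simp: maximal_def)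
  have max: "Psi L \<rho> \<xi> b x' s' y' t' \<le> Psi L \<rho> \<xi> b x s y t" if "x' \<in> K" "y' \<in> K" "s' \<in> {0..T}" "t' \<in> {0..T}" for x' s' y' t'
    using dd(3) that by (simp add: maximal_def)
  define a where "a = y + \<rho> *\<^sub>R \<xi>"
  define \<phi> where "\<phi> = (\<lambda>q. (L * sqrt ((norm (fst q - a))\<^sup>2 + \<rho>\<^sup>2) - b (fst q)) + (snd q - t)\<^sup>2 / \<eta>)"
  define G where "G = (\<lambda>q::'a \<times> real. (L *\<^sub>R ((1 / sqrt ((norm (fst q - a))\<^sup>2 + \<rho>\<^sup>2)) *\<^sub>R (fst q - a)) - Nb (fst q), 0) + (0::'a, 2 * (snd q - t) / \<eta>))"
  have P: "C1_with_gradient (Qbar \<Omega>) \<phi> G"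
    unfolding \<phi>_def G_def Qbar_def
    by (intro C1_with_gradient_add C1_with_gradient_fst[OF penalty_gradient[OF dd(5,1)]]
          C1_with_gradient_snd[of _ "\<lambda>s. (s - t)\<^sup>2 / \<eta>" "\<lambda>s. 2 * (s - t) / \<eta>"])
       (use eta in \<open>auto intro!: derivative_eq_intros continuous_intros\<close>)
  have "sub_at u \<phi> G x s \<delta>"
  proof (rule sub_at_local[OF sub P D(1)])
    fix x' s' assume "x' \<in> K" "s' \<in> {0..T}"
    from max[OF this(1) D(2) this(2) D(4)] show "u (x', s') - \<phi> (x', s') \<le> u (x, s) - \<phi> (x, s)"
      by (simp add: Psi_def \<phi>_def a_def)
  qed (use dd \<delta> in auto)
  then have Eu: "E \<delta> u \<phi> G x s \<le> 0" using dd by (simp add: sub_at_def)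
  have fG: "fst (G (x, s)) = p - Nb x" "snd (G (x, s)) = 2 * (s - t) / \<eta>" by (simp_all add: G_def p a_def)
  have near_u: "nonlocal \<Omega> \<nu> (ball 0 \<delta>) (\<lambda>z. \<phi> (z, s)) x \<le> (L + 1) * (C\<nu> * \<delta> powr (1 - \<sigma>))"
  proof (rule nonlocal_near_le[OF \<delta> D(1)])
    fix z assume "z \<in> K"
    then show "\<phi> (z, s) - \<phi> (x, s) \<le> (L + 1) * dist z x"
      using penalty_lipschitz[OF L, of z a \<rho> x] bl[of z] by (simp add: \<phi>_def algebra_simps)
  qed (use L in simp)
  \<comment> \<open>Seen as a function of the second variable, the same penalty has its vertex at
    \<open>x - \<rho> *\<^sub>R \<xi>\<close>.\<close>
  define c where "c = x - \<rho> *\<^sub>R \<xi>"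
  have nc: "norm (x - (z + \<rho> *\<^sub>R \<xi>)) = norm (z - c)" for z
    by (subst norm_minus_commute) (simp add: c_def algebra_simps)
  define \<psi> where "\<psi> = (\<lambda>q. (L * sqrt ((norm (fst q - c))\<^sup>2 + \<rho>\<^sup>2) + (norm (fst q - xh))\<^sup>2) + ((snd q - s)\<^sup>2 / \<eta> + \<theta> (snd q)))"
  define F where "F = (\<lambda>q::'a \<times> real. (L *\<^sub>R ((1 / sqrt ((norm (fst q - c))\<^sup>2 + \<rho>\<^sup>2)) *\<^sub>R (fst q - c)) + 2 *\<^sub>R (fst q - xh), 0)
      + (0::'a, 2 * (snd q - s) / \<eta> + \<theta>' (snd q)))"
  have Pv: "C1_with_gradient (Qbar \<Omega>) \<psi> F"
    unfolding \<psi>_def F_def Qbar_def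
  proof (intro C1_with_gradient_add C1_with_gradient_fst[of _ "\<lambda>z. L * sqrt ((norm (z - c))\<^sup>2 + \<rho>\<^sup>2) + (norm (z - xh))\<^sup>2"]
      C1_with_gradient_scale C1_with_gradient_sqrt dd(1) C1_with_gradient_normsq
      C1_with_gradient_snd[of _ "\<lambda>q. (q - s)\<^sup>2 / \<eta> + \<theta> q" "\<lambda>q. 2 * (q - s) / \<eta> + \<theta>' q"])
    show "continuous_on {0..} (\<lambda>q. 2 * (q - s) / \<eta> + \<theta>' q)"
      using eta by (intro continuous_intros continuous_on_subset[OF theta(2)]) auto
    show "((\<lambda>q. (q - s)\<^sup>2 / \<eta> + \<theta> q) has_real_derivative 2 * (q - s) / \<eta> + \<theta>' q) (at q within {0..})" for q
      using eta by (intro DERIV_add has_field_derivative_at_within[OF theta(1)]) (auto intro!: derivative_eq_intros)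
  qed
  interpret dl: equation \<Omega> \<nu> \<sigma> "\<lambda>x r p. - H x (- r) (- p)" "\<lambda>q. - f q" "\<lambda>q. - g q" "\<lambda>x. - u0 x" by (rule dual)
  have sa: "dl.sub_at (\<lambda>q. - v q) \<psi> F y t \<delta>"
  proof (rule dl.sub_at_local[OF supersolution_dual[OF super] Pv D(2)])
    fix y' t' assume "y' \<in> K" "t' \<in> {0..T}"
    from max[OF D(1) this(1) D(3) this(2)] show "- v (y', t') - \<psi> (y', t') \<le> - v (y, t) - \<psi> (y, t)"
      unfolding Psi_def nc \<psi>_def by (simp add: power2_commute)
  qed (use dd \<delta> in auto)
  then have Ev: "visc_E \<Omega> \<nu> (\<lambda>x r p. - H x (- r) (- p)) (\<lambda>q. - f q) \<delta> (\<lambda>q. - v q) \<psi> F y t \<le> 0"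
    using dd K_cases[OF D(2)] by (auto simp: dl.sub_at_def min_def split: if_splits)
  have sgn: "(y - c) = - (x - (y + \<rho> *\<^sub>R \<xi>))" by (simp add: c_def algebra_simps)
  have "L *\<^sub>R ((1 / sqrt ((norm (y - c))\<^sup>2 + \<rho>\<^sup>2)) *\<^sub>R (y - c)) = - p"
    unfolding p sgn norm_minus_cancel scaleR_minus_right by (rule refl)
  then have fF: "- fst (F (y, t)) = p - 2 *\<^sub>R (y - xh)" "snd (F (y, t)) = 2 * (t - s) / \<eta> + \<theta>' t"
    by (simp_all add: F_def)
  have near_v: "nonlocal \<Omega> \<nu> (ball 0 \<delta>) (\<lambda>z. \<psi> (z, t)) y \<le> (L + 2 * R) * (C\<nu> * \<delta> powr (1 - \<sigma>))"
  proof (rule nonlocal_near_le[OF \<delta> D(2)])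
    fix z assume z: "z \<in> K"
    have "(norm (z - xh))\<^sup>2 - (norm (y - xh))\<^sup>2 = (norm (z - xh) - norm (y - xh)) * (norm (z - xh) + norm (y - xh))"
      by (simp add: power2_eq_square algebra_simps)
    also have "\<dots> \<le> dist z y * (2 * R)"
    proof (rule mult_mono)
      show "norm (z - xh) - norm (y - xh) \<le> dist z y"
        using norm_triangle_ineq2[of "z - xh" "y - xh"] by (simp add: dist_norm)
      show "norm (z - xh) + norm (y - xh) \<le> 2 * R"
        using R(1)[OF z xh] R(1)[OF D(2) xh] by (simp add: dist_norm)
    qed auto
    finally show "\<psi> (z, t) - \<psi> (y, t) \<le> (L + 2 * R) * dist z y"
      using penalty_lipschitz[OF L, of z c \<rho> y] by (simp add: \<psi>_def algebra_simps)
  qed (use L R in simp)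
  have "\<theta>' t \<ge> \<kappa>" using theta(4) dd by simp
  moreover have "2 * (s - t) / \<eta> + 2 * (t - s) / \<eta> = 0" by (simp add: diff_divide_distrib)
  moreover have "f (x, s) - f (y, t) \<le> \<kappa> / 4" using dd(11) by linarith
  moreover have "(2 * L + 1 + 2 * R) * (C\<nu> * \<delta> powr (1 - \<sigma>)) = (L + 1) * (C\<nu> * \<delta> powr (1 - \<sigma>)) + (L + 2 * R) * (C\<nu> * \<delta> powr (1 - \<sigma>))"
    by (simp add: algebra_simps)
  ultimately show ?thesis
    using Eu Ev near_u near_v unfolding visc_E_def fG fF minus_minus by linarith
qed

text \<open>With \<open>L\<close> fixed the gradients \<open>p\<close> stay in a ball, so along a
  subsequence both Hamiltonians receive the same limit gradient and monotonicity in \<open>r\<close>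
  compares them. The far terms compare because the limit gap is maximal over \<open>K\<close>. Only
  \<kappa> is left over.\<close>

lemma no_doubling:
  assumes L: "L \<ge> 0" and all: "\<And>\<epsilon>. \<epsilon> > 0 \<Longrightarrow> \<exists>\<rho> b Nb x s y t. doubled L \<xi> \<epsilon> \<rho> b Nb x s y t"
  shows False
proof -
  obtain R where R: "R > 0" "\<And>x y. x \<in> K \<Longrightarrow> y \<in> K \<Longrightarrow> dist x y \<le> R" using K_bounded by blast
  have "\<forall>n. \<exists>\<rho> b Nb x s y t. doubled L \<xi> (inverse (real (Suc n))) \<rho> b Nb x s y t"
    using all by simp
  then obtain \<rho> b Nb x s y t where dn: "\<And>n. doubled L \<xi> (inverse (real (Suc n))) (\<rho> n) (b n) (Nb n) (x n) (s n) (y n) (t n)"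
    by metis
  have D: "\<And>n. x n \<in> K" "\<And>n. y n \<in> K" "\<And>n. s n \<in> {0..T}" "\<And>n. t n \<in> {0..T}"
    and \<rho>: "\<And>n. 0 < \<rho> n" "\<And>n. \<rho> n \<le> inverse (real (Suc n))"
    and mx: "\<And>n. maximal L (\<rho> n) \<xi> (b n) (x n) (s n) (y n) (t n)"
    and Nb: "\<And>n. norm (Nb n (x n)) \<le> inverse (real (Suc n))"
    and bb: "\<And>n z. z \<in> K \<Longrightarrow> \<bar>b n z\<bar> \<le> inverse (real (Suc n))" "\<And>n. b n xh \<ge> 0"
    and near: "\<And>n. norm (x n - (y n + \<rho> n *\<^sub>R \<xi>)) \<le> \<rho> n"
    using dn unfolding doubled_def maximal_def by (auto intro: less_imp_le)
  define p where "p = (\<lambda>n. L *\<^sub>R ((1 / sqrt ((norm (x n - (y n + \<rho> n *\<^sub>R \<xi>)))\<^sup>2 + (\<rho> n)\<^sup>2)) *\<^sub>R (x n - (y n + \<rho> n *\<^sub>R \<xi>))))"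
  have pL: "p n \<in> cball 0 L" for n
  proof -
    define q where "q = x n - (y n + \<rho> n *\<^sub>R \<xi>)"
    have "norm q \<le> sqrt ((norm q)\<^sup>2 + (\<rho> n)\<^sup>2)" by (rule real_le_rsqrt) simp
    moreover have "0 < sqrt ((norm q)\<^sup>2 + (\<rho> n)\<^sup>2)" using \<rho>(1)[of n] by (simp add: add_nonneg_pos)
    ultimately have "norm q / sqrt ((norm q)\<^sup>2 + (\<rho> n)\<^sup>2) \<le> 1" by simp
    then have "L * (norm q / sqrt ((norm q)\<^sup>2 + (\<rho> n)\<^sup>2)) \<le> L * 1" using L by (intro mult_left_mono) auto
    then show ?thesis using L by (simp add: p_def q_def)
  qed
  have uC: "u (x n, s n) \<in> {-C..C}" "v (y n, t n) \<in> {-C..C}" for n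
    using u_le[of "(x n, s n)"] v_le[of "(y n, t n)"] D by (auto simp: abs_le_iff)
  \<comment> \<open>The values of \<open>u\<close> and \<open>v\<close> are included in the
    sequence: semicontinuity does not make them converge to the values at the limit point, and
    \<open>ub\<close> and \<open>vb\<close> take the place of those values below.\<close>
  define Z where "Z = (\<lambda>n. (x n, y n, s n, t n, p n, u (x n, s n), v (y n, t n)))"
  have cZ: "compact (K \<times> K \<times> {0..T} \<times> {0..T} \<times> cball (0::'a) L \<times> {-C..C} \<times> {-C..C})"
    by (intro compact_Times compact_K compact_Icc compact_cball)
  have Zin: "Z n \<in> K \<times> K \<times> {0..T} \<times> {0..T} \<times> cball 0 L \<times> {-C..C} \<times> {-C..C}" for n
    using D pL uC unfolding Z_def by blast
  obtain l where l: "l \<in> K \<times> K \<times> {0..T} \<times> {0..T} \<times> cball 0 L \<times> {-C..C} \<times> {-C..C}"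
    and "\<exists>r. strict_mono r \<and> (Z \<circ> r) \<longlonglongrightarrow> l"
    using cZ[unfolded compact_def, rule_format, OF Zin] by (rule bexE)
  then obtain r :: "nat \<Rightarrow> nat" where r: "strict_mono r" "(Z \<circ> r) \<longlonglongrightarrow> l" by blast
  obtain x0 y0 s0 t0 p0 ub vb where l0: "l = (x0, y0, s0, t0, p0, ub, vb)" by (cases l) auto
  have L0: "x0 \<in> K" "s0 \<in> {0..T}" "t0 \<in> {0..T}" using l by (auto simp: l0)
  note Zl = r(2)[unfolded l0 Z_def o_def]
  note Z1 = tendsto_snd[OF Zl, simplified]
  note Z2 = tendsto_snd[OF Z1, simplified]
  note Z3 = tendsto_snd[OF Z2, simplified]
  note Z4 = tendsto_snd[OF Z3, simplified]
  note Z5 = tendsto_snd[OF Z4, simplified]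
  have lim: "(\<lambda>n. x (r n)) \<longlonglongrightarrow> x0" "(\<lambda>n. y (r n)) \<longlonglongrightarrow> y0" "(\<lambda>n. s (r n)) \<longlonglongrightarrow> s0" "(\<lambda>n. t (r n)) \<longlonglongrightarrow> t0"
    "(\<lambda>n. p (r n)) \<longlonglongrightarrow> p0" "(\<lambda>n. u (x (r n), s (r n))) \<longlonglongrightarrow> ub" "(\<lambda>n. v (y (r n), t (r n))) \<longlonglongrightarrow> vb"
    using tendsto_fst[OF Zl] tendsto_fst[OF Z1] tendsto_fst[OF Z2] tendsto_fst[OF Z3] tendsto_fst[OF Z4]
      tendsto_fst[OF Z5] tendsto_snd[OF Z5] by simp_all
  have inv: "(\<lambda>n. inverse (real (Suc (r n)))) \<longlonglongrightarrow> 0"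
    using LIMSEQ_subseq_LIMSEQ[OF LIMSEQ_inverse_real_of_nat r(1)] by (simp add: o_def)
  have rho0: "(\<lambda>n. \<rho> (r n)) \<longlonglongrightarrow> 0"
    by (rule Lim_null_comparison[OF _ inv]) (use \<rho> in \<open>auto simp: abs_of_pos\<close>)
  have Nb0: "(\<lambda>n. Nb (r n) (x (r n))) \<longlonglongrightarrow> 0"
    by (rule Lim_null_comparison[OF _ inv]) (use Nb in auto)
  have q0: "(\<lambda>n. x (r n) - (y (r n) + \<rho> (r n) *\<^sub>R \<xi>)) \<longlonglongrightarrow> 0"
    by (rule Lim_null_comparison[OF _ rho0]) (use near in auto)
  have "(\<lambda>n. x (r n) - (y (r n) + \<rho> (r n) *\<^sub>R \<xi>)) \<longlonglongrightarrow> x0 - (y0 + 0 *\<^sub>R \<xi>)"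
    by (intro tendsto_intros lim rho0)
  then have "x0 - (y0 + 0 *\<^sub>R \<xi>) = 0" using q0 LIMSEQ_unique by blast
  then have y0: "y0 = x0" by simp
  have "\<forall>n. M - L * (\<rho> (r n) * (norm \<xi> + 1)) + L * norm (x (r n) - (y (r n) + \<rho> (r n) *\<^sub>R \<xi>))
    \<le> u (x (r n), s (r n)) - v (y (r n), t (r n)) + inverse (real (Suc (r n))) - (s (r n) - t (r n))\<^sup>2 / \<eta> - \<theta> (t (r n)) - (norm (y (r n) - xh))\<^sup>2"
    by (intro allI maximal_lower_bound[OF mx L \<rho>(1) bb(2)] order_trans[OF abs_ge_self bb(1)] D)
  moreover have "(\<lambda>n. M - L * (\<rho> (r n) * (norm \<xi> + 1)) + L * norm (x (r n) - (y (r n) + \<rho> (r n) *\<^sub>R \<xi>)))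
      \<longlonglongrightarrow> M - L * (0 * (norm \<xi> + 1)) + L * norm (0::'a)"
    by (intro tendsto_intros rho0 q0)
  moreover have "(\<lambda>n. u (x (r n), s (r n)) - v (y (r n), t (r n)) + inverse (real (Suc (r n))) - (s (r n) - t (r n))\<^sup>2 / \<eta> - \<theta> (t (r n)) - (norm (y (r n) - xh))\<^sup>2)
      \<longlonglongrightarrow> ub - vb + 0 - (s0 - t0)\<^sup>2 / \<eta> - \<theta> t0 - (norm (x0 - xh))\<^sup>2"
  proof -
    have "(\<lambda>n. \<theta> (t (r n))) \<longlonglongrightarrow> \<theta> t0"
      by (rule continuous_on_tendsto_compose[OF continuous_theta[of UNIV] lim(4)]) auto
    then show ?thesis using eta lim(2)[unfolded y0] by (intro tendsto_intros lim inv) auto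
  qed
  ultimately have low: "M \<le> ub - vb - (s0 - t0)\<^sup>2 / \<eta> - \<theta> t0 - (norm (x0 - xh))\<^sup>2"
    using LIMSEQ_le[where X = "\<lambda>n. M - L * (\<rho> (r n) * (norm \<xi> + 1)) + L * norm (x (r n) - (y (r n) + \<rho> (r n) *\<^sub>R \<xi>))"] by fastforce
  have "ub \<le> u (x0, s0)"
    by (rule usc_on_limit_le[OF usc_u, of "\<lambda>n. (x (r n), s (r n))"]) (use D lim L0 in \<open>auto intro!: tendsto_Pair\<close>)
  moreover have "- vb \<le> - v (x0, t0)"
    by (rule usc_on_limit_le[OF usc_v, of "\<lambda>n. (y (r n), t (r n))"]) (use D lim L0 y0 in \<open>auto intro!: tendsto_Pair tendsto_minus\<close>)
  ultimately have "(norm (x0 - xh))\<^sup>2 \<le> 0" using low M_max[OF L0] by linarith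
  then have x0: "x0 = xh" by simp
  have low': "M \<le> ub - vb - (s0 - t0)\<^sup>2 / \<eta> - \<theta> t0" using low x0 by simp
  \<comment> \<open>The limit gap inherits maximality from \<open>M\<close>: at no common point do
    \<open>u (z, s0)\<close> and \<open>v (z, t0)\<close> differ by more. Integrated, this bounds
    the two averages by \<open>(ub - vb) * mass \<delta> x0\<close>.\<close>
  have gap: "u (z, s0) - v (z, t0) \<le> ub - vb" if "z \<in> K" for z using M_max[OF that L0(2,3)] low' by linarith
  have "0 \<le> (s0 - t0)\<^sup>2 / \<eta>" "0 \<le> \<theta> t0" using eta theta(3) L0 by auto
  then have uv: "vb \<le> ub" using low' M by linarith
  define c1 where "c1 = (2 * L + 1 + 2 * R) * C\<nu>"
  have c1: "c1 > 0" using L R C\<nu>_pos by (simp add: c1_def add_nonneg_pos add_pos_pos)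
  \<comment> \<open>The budget against \<kappa>: \<kappa>/8 for the near terms by this choice,
    \<kappa>/4 for the sources, \<kappa>/16 for each far limit, and \<kappa>/8 for the
    Hamiltonians.\<close>
  define \<delta> where "\<delta> = min (1/2) ((\<kappa> / (8 * c1)) powr (1 / (1 - \<sigma>)))"
  have \<delta>: "0 < \<delta>" "\<delta> < 1" using kappa c1 by (auto simp: \<delta>_def)
  have "\<delta> powr (1 - \<sigma>) \<le> ((\<kappa> / (8 * c1)) powr (1 / (1 - \<sigma>))) powr (1 - \<sigma>)"
    using \<delta> sigma_less by (intro powr_mono2) (auto simp: \<delta>_def)
  also have "\<dots> = \<kappa> / (8 * c1)" using kappa c1 sigma_less by (simp add: powr_powr)
  finally have "c1 * \<delta> powr (1 - \<sigma>) \<le> c1 * (\<kappa> / (8 * c1))" using c1 by (intro mult_left_mono) auto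
  also have "c1 * (\<kappa> / (8 * c1)) = \<kappa> / 8" using c1 by simp
  finally have small: "(2 * L + 1 + 2 * R) * (C\<nu> * \<delta> powr (1 - \<sigma>)) \<le> \<kappa> / 8" unfolding c1_def by (simp only: mult.assoc)
  have slice: "borel_K (\<lambda>z. u (z, t))" "borel_K (\<lambda>z. - v (z, t))" if "t \<in> {0..T}" for t
    using that u_le v_le
    by (auto intro!: borel_K_usc[of _ C] usc_on_compose[OF usc_u, of K "\<lambda>z. (z, t)"] usc_on_compose[OF usc_v, of K "\<lambda>z. (z, t)"] continuous_intros)
  have far_u: "\<forall>\<^sub>F n in sequentially. nonlocal \<Omega> \<nu> (- ball 0 \<delta>) (\<lambda>z. u (z, s (r n))) (x (r n))
      \<le> average \<delta> (\<lambda>z. u (z, s0)) x0 - ub * mass \<delta> x0 + \<kappa> / 16"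
    by (rule nonlocal_far_limit_le[OF usc_u u_le \<delta>(1)]) (use D lim L0 u_le kappa slice in auto)
  have far_v: "\<forall>\<^sub>F n in sequentially. nonlocal \<Omega> \<nu> (- ball 0 \<delta>) (\<lambda>z. - v (z, t (r n))) (y (r n))
      \<le> average \<delta> (\<lambda>z. - v (z, t0)) x0 - (- vb) * mass \<delta> x0 + \<kappa> / 16"
    by (rule nonlocal_far_limit_le[OF usc_v _ \<delta>(1), of C]) (use D lim L0 y0 v_le kappa slice in \<open>auto intro!: tendsto_minus\<close>)
  have av: "average \<delta> (\<lambda>z. u (z, s0)) x0 + average \<delta> (\<lambda>z. - v (z, t0)) x0 \<le> (ub - vb) * mass \<delta> x0"
  proof -
    have iu: "set_integrable (\<nu> x0) (far \<delta> x0) (\<lambda>z. u (x0 + z, s0))"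
      by (rule far_integrable[OF slice(1)[OF L0(2)] _ \<delta>(1) L0(1), of C]) (use u_le L0 in auto)
    have iv: "set_integrable (\<nu> x0) (far \<delta> x0) (\<lambda>z. - v (x0 + z, t0))"
      by (rule far_integrable[OF slice(2)[OF L0(3)] _ \<delta>(1) L0(1), of C]) (use v_le L0 in auto)
    have "average \<delta> (\<lambda>z. u (z, s0)) x0 + average \<delta> (\<lambda>z. - v (z, t0)) x0 = (LINT z:far \<delta> x0|\<nu> x0. u (x0 + z, s0) + - v (x0 + z, t0))"
      unfolding average_def by (rule set_integral_add(2)[OF iu iv, symmetric])
    also have "\<dots> \<le> (LINT z:far \<delta> x0|\<nu> x0. ub - vb)"
      by (rule set_integral_mono[OF set_integral_add(1)[OF iu iv] far_integrable_const[OF \<delta>(1) L0(1)]])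
         (use gap in \<open>auto simp: far_def\<close>)
    finally show ?thesis by (simp add: set_integral_far_const[OF \<delta>(1) L0(1)])
  qed
  have Hlim: "(\<lambda>n. H (a n) (w n) (P n)) \<longlonglongrightarrow> H x0 wb p0"
    if "a \<longlonglongrightarrow> x0" "w \<longlonglongrightarrow> wb" "P \<longlonglongrightarrow> p0" "\<And>n. a n \<in> K" for a w P wb
  proof -
    have "(\<lambda>n. (\<lambda>(x, r, p). H x r p) (a n, w n, P n)) \<longlonglongrightarrow> (\<lambda>(x, r, p). H x r p) (x0, wb, p0)"
      by (rule continuous_on_tendsto_compose[OF H_continuous]) (use that L0 in \<open>auto intro!: tendsto_Pair\<close>)
    then show ?thesis by simp
  qed
  have P1: "(\<lambda>n. p (r n) - Nb (r n) (x (r n))) \<longlonglongrightarrow> p0" using tendsto_diff[OF lim(5) Nb0] by simp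
  have "(\<lambda>n. p (r n) - 2 *\<^sub>R (y (r n) - xh)) \<longlonglongrightarrow> p0 - 2 *\<^sub>R (x0 - xh)"
    using lim(2) y0 by (intro tendsto_intros lim) auto
  then have P2: "(\<lambda>n. p (r n) - 2 *\<^sub>R (y (r n) - xh)) \<longlonglongrightarrow> p0" using x0 by simp
  have "(\<lambda>n. H (y (r n)) (v (y (r n), t (r n))) (p (r n) - 2 *\<^sub>R (y (r n) - xh)) - H (x (r n)) (u (x (r n), s (r n))) (p (r n) - Nb (r n) (x (r n))))
     \<longlonglongrightarrow> H x0 vb p0 - H x0 ub p0"
    using lim(2) y0 by (intro tendsto_diff Hlim lim P1 P2 D) auto
  moreover have "H x0 vb p0 - H x0 ub p0 < \<kappa> / 8" using H_mono[OF L0(1) uv, of p0] kappa by linarith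
  ultimately have H8: "\<forall>\<^sub>F n in sequentially. H (y (r n)) (v (y (r n), t (r n))) (p (r n) - 2 *\<^sub>R (y (r n) - xh)) - H (x (r n)) (u (x (r n), s (r n))) (p (r n) - Nb (r n) (x (r n))) < \<kappa> / 8"
    by (rule order_tendstoD(2))
  have "\<forall>\<^sub>F n in sequentially. False"
    using far_u far_v H8
  proof eventually_elim
    case (elim n)
    have "inverse (real (Suc (r n))) \<le> 1" by (simp add: inverse_le_1_iff)
    note doubled_inequality[OF dn[of "r n"] L this \<delta> R(2) R(1), of "p (r n)"]
    then have "\<kappa> \<le> (2 * L + 1 + 2 * R) * (C\<nu> * \<delta> powr (1 - \<sigma>)) + \<kappa> / 4 +
     nonlocal \<Omega> \<nu> (- ball 0 \<delta>) (\<lambda>z. u (z, s (r n))) (x (r n)) + nonlocal \<Omega> \<nu> (- ball 0 \<delta>) (\<lambda>z. - v (z, t (r n))) (y (r n))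
     - H (x (r n)) (u (x (r n), s (r n))) (p (r n) - Nb (r n) (x (r n))) + H (y (r n)) (v (y (r n), t (r n))) (p (r n) - 2 *\<^sub>R (y (r n) - xh))"
      by (simp add: p_def)
    moreover have "(ub - vb) * mass \<delta> x0 = ub * mass \<delta> x0 - vb * mass \<delta> x0" "(- vb) * mass \<delta> x0 = - (vb * mass \<delta> x0)"
      by (simp_all add: algebra_simps)
    ultimately show ?case using elim small av kappa by argo
  qed
  then show False by simp
qed

lemma contradiction: False
proof (cases "xh \<in> \<Omega>")
  case True
  then show ?thesis using doubled_interior no_doubling by metis
next
  case False
  then have "xh \<in> frontier \<Omega>" using K_cases[OF xh] by blast
  then show ?thesis using doubled_boundary no_doubling by metis
qed

end

subsection \<open>Comparison\<close>

context coercive_equation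
begin

text \<open>By compactness a violation would leave a gap of at least \<open>m0\<close> at a single
  limit point. At time 0 this contradicts u \<le> u0 \<le> v. At a lateral point u \<le> g, so the
  gap pushes nearby values of \<open>v\<close> strictly below the datum, although \<open>v\<close>
  itself need not attain it.\<close>

lemma near_diagonal:
  assumes sub: "subsolution u" and super: "supersolution v" and m0: "m0 > 0" and k: "k > 0"
  shows "\<exists>\<tau>>0. \<tau> < 1 \<and> (\<forall>x\<in>K. \<forall>y\<in>K. \<forall>s\<in>{0..T}. \<forall>t\<in>{0..T}. dist x y \<le> \<tau> \<and> \<bar>s - t\<bar> \<le> \<tau> \<and> m0 \<le> u (x, s) - v (y, t) \<longrightarrow>
    2 * \<tau> \<le> t \<and> (y \<in> frontier \<Omega> \<longrightarrow> v (y, t) < g (y, t)) \<and> \<bar>f (x, s) - f (y, t)\<bar> \<le> k)"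
proof (rule ccontr)
  assume neg: "\<not> ?thesis"
  have "\<forall>n. \<exists>x y s t. x \<in> K \<and> y \<in> K \<and> s \<in> {0..T} \<and> t \<in> {0..T} \<and> dist x y \<le> inverse (real (Suc (Suc n))) \<and>
    \<bar>s - t\<bar> \<le> inverse (real (Suc (Suc n))) \<and> m0 \<le> u (x, s) - v (y, t) \<and>
    \<not> (2 * inverse (real (Suc (Suc n))) \<le> t \<and> (y \<in> frontier \<Omega> \<longrightarrow> v (y, t) < g (y, t)) \<and> \<bar>f (x, s) - f (y, t)\<bar> \<le> k)"
  proof
    fix n
    have "inverse (real (Suc (Suc n))) > 0 \<and> inverse (real (Suc (Suc n))) < 1" by (simp add: inverse_less_1_iff)
    then show "\<exists>x y s t. x \<in> K \<and> y \<in> K \<and> s \<in> {0..T} \<and> t \<in> {0..T} \<and> dist x y \<le> inverse (real (Suc (Suc n))) \<and>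
    \<bar>s - t\<bar> \<le> inverse (real (Suc (Suc n))) \<and> m0 \<le> u (x, s) - v (y, t) \<and>
    \<not> (2 * inverse (real (Suc (Suc n))) \<le> t \<and> (y \<in> frontier \<Omega> \<longrightarrow> v (y, t) < g (y, t)) \<and> \<bar>f (x, s) - f (y, t)\<bar> \<le> k)"
      using neg by blast
  qed
  then obtain x y s t where a: "\<And>n. x n \<in> K" "\<And>n. y n \<in> K" "\<And>n. s n \<in> {0..T}" "\<And>n. t n \<in> {0..T}"
    "\<And>n. dist (x n) (y n) \<le> inverse (real (Suc (Suc n)))" "\<And>n. \<bar>s n - t n\<bar> \<le> inverse (real (Suc (Suc n)))"
    "\<And>n. m0 \<le> u (x n, s n) - v (y n, t n)"
    "\<And>n. \<not> (2 * inverse (real (Suc (Suc n))) \<le> t n \<and> (y n \<in> frontier \<Omega> \<longrightarrow> v (y n, t n) < g (y n, t n)) \<and> \<bar>f (x n, s n) - f (y n, t n)\<bar> \<le> k)"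
    by metis
  have inv0: "(\<lambda>n. inverse (real (Suc (Suc n)))) \<longlonglongrightarrow> 0"
    using LIMSEQ_Suc[OF LIMSEQ_inverse_real_of_nat] by simp
  have dl: "(\<lambda>n. dist (x n) (y n)) \<longlonglongrightarrow> 0"
    by (rule Lim_null_comparison[OF _ inv0]) (use a(5) in auto)
  obtain r x0 s0 t0 where l: "strict_mono r" "x0 \<in> K" "s0 \<in> {0..T}" "t0 \<in> {0..T}"
    "(\<lambda>n. x (r n)) \<longlonglongrightarrow> x0" "(\<lambda>n. y (r n)) \<longlonglongrightarrow> x0" "(\<lambda>n. s (r n)) \<longlonglongrightarrow> s0" "(\<lambda>n. t (r n)) \<longlonglongrightarrow> t0"
    using diagonal_subsequence[of x y s T t] a(1-4) dl by blast
  have inv: "(\<lambda>n. inverse (real (Suc (Suc (r n))))) \<longlonglongrightarrow> 0"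
    using LIMSEQ_subseq_LIMSEQ[OF inv0 l(1)] by (simp add: o_def)
  have "(\<lambda>n. s (r n) - t (r n)) \<longlonglongrightarrow> 0" by (rule Lim_null_comparison[OF _ inv]) (use a(6) in auto)
  then have st: "t0 = s0" using tendsto_diff[OF l(7,8)] LIMSEQ_unique by fastforce
  have usc_u: "usc_on (K \<times> {0..T}) u" by (rule usc_K_times[OF sub])
  have usc_v: "usc_on (K \<times> {0..T}) (\<lambda>q. - v q)" by (rule equation.usc_K_times[OF dual supersolution_dual[OF super]])
  have eu: "\<forall>\<^sub>F n in sequentially. u (x (r n), s (r n)) < u (x0, s0) + e" if "e > 0" for e
    by (rule usc_on_sequentially[OF usc_u, of "\<lambda>n. (x (r n), s (r n))"]) (use a l that in \<open>auto intro!: tendsto_Pair\<close>)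
  have ev: "\<forall>\<^sub>F n in sequentially. - v (y (r n), t (r n)) < - v (x0, t0) + e" if "e > 0" for e
    by (rule usc_on_sequentially[OF usc_v, of "\<lambda>n. (y (r n), t (r n))"]) (use a l that in \<open>auto intro!: tendsto_Pair\<close>)
  have gap: "m0 \<le> u (x0, s0) - v (x0, s0)"
  proof (rule field_le_epsilon)
    fix e :: real assume e: "e > 0"
    have e2: "e / 2 > 0" using e by simp
    have "\<forall>\<^sub>F n in sequentially. m0 \<le> u (x0, s0) - v (x0, s0) + e"
      using eu[OF e2] ev[OF e2]
    proof eventually_elim
      case (elim n)
      then show ?case using a(7)[of "r n"] e st by simp
    qed
    then show "m0 \<le> u (x0, s0) - v (x0, s0) + e" by simp
  qed
  have "s0 \<noteq> 0" using gap m0 subsolution_initial[OF sub l(2)] supersolution_initial[OF super l(2)] by auto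
  then have t0: "t0 > 0" using l(3) st by auto
  have A: "\<forall>\<^sub>F n in sequentially. 2 * inverse (real (Suc (Suc (r n)))) \<le> t (r n)"
  proof -
    have "(\<lambda>n. t (r n) - 2 * inverse (real (Suc (Suc (r n))))) \<longlonglongrightarrow> t0 - 2 * 0" by (intro tendsto_intros l inv)
    then have "\<forall>\<^sub>F n in sequentially. 0 < t (r n) - 2 * inverse (real (Suc (Suc (r n))))"
      using t0 by (intro order_tendstoD(1)) auto
    then show ?thesis by (rule eventually_mono) simp
  qed
  have fc: "continuous_on (K \<times> {0..T}) f" by (rule continuous_on_subset[OF f_continuous]) (auto simp: Qbar_def)
  have B: "\<forall>\<^sub>F n in sequentially. \<bar>f (x (r n), s (r n)) - f (y (r n), t (r n))\<bar> \<le> k"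
  proof -
    have 1: "(\<lambda>n. f (x (r n), s (r n))) \<longlonglongrightarrow> f (x0, s0)" "(\<lambda>n. f (y (r n), t (r n))) \<longlonglongrightarrow> f (x0, t0)"
      by (rule continuous_on_tendsto_compose[OF fc]; use a l in \<open>auto intro!: tendsto_Pair\<close>)+
    have "(\<lambda>n. \<bar>f (x (r n), s (r n)) - f (y (r n), t (r n))\<bar>) \<longlonglongrightarrow> \<bar>f (x0, s0) - f (x0, t0)\<bar>"
      by (intro tendsto_intros 1)
    then have "\<forall>\<^sub>F n in sequentially. \<bar>f (x (r n), s (r n)) - f (y (r n), t (r n))\<bar> < k"
      using st k by (intro order_tendstoD(2)) auto
    then show ?thesis by (rule eventually_mono) simp
  qed
  have Cc: "\<forall>\<^sub>F n in sequentially. y (r n) \<in> frontier \<Omega> \<longrightarrow> v (y (r n), t (r n)) < g (y (r n), t (r n))"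
  proof (cases "x0 \<in> frontier \<Omega>")
    case False
    have "\<forall>\<^sub>F n in sequentially. y (r n) \<in> - frontier \<Omega>"
      by (rule topological_tendstoD[OF l(6)]) (use False in auto)
    then show ?thesis by (rule eventually_mono) auto
  next
    case True
    have "u (x0, s0) \<le> g (x0, s0)" using subsolution_lateral[OF sub True] t0 st by simp
    then have lt: "u (x0, s0) - m0 / 2 < g (x0, t0)" using m0 st by simp
    have "usc_on (frontier \<Omega> \<times> {0..}) (\<lambda>q. - g q)" by (intro continuous_imp_usc continuous_on_minus g_continuous)
    then obtain d where d: "d > 0" "\<forall>q\<in>frontier \<Omega> \<times> {0..}. dist q (x0, t0) < d \<longrightarrow> - g q < - (u (x0, s0) - m0 / 2)"
      using usc_onD[of "frontier \<Omega> \<times> {0..}" "\<lambda>q. - g q" "(x0, t0)" "- (u (x0, s0) - m0 / 2)"] True t0 lt by auto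
    have "(\<lambda>n. (y (r n), t (r n))) \<longlonglongrightarrow> (x0, t0)" by (intro tendsto_Pair l)
    then have "\<forall>\<^sub>F n in sequentially. dist (y (r n), t (r n)) (x0, t0) < d" using d(1) by (rule tendstoD)
    moreover have "\<forall>\<^sub>F n in sequentially. u (x (r n), s (r n)) < u (x0, s0) + m0 / 2" by (rule eu) (use m0 in simp)
    ultimately show ?thesis
    proof eventually_elim
      case (elim n)
      show ?case
      proof
        assume "y (r n) \<in> frontier \<Omega>"
        then have "(y (r n), t (r n)) \<in> frontier \<Omega> \<times> {0..}" using a(4)[of "r n"] by auto
        then have "u (x0, s0) - m0 / 2 < g (y (r n), t (r n))" using d(2) elim(1) by fastforce
        then show "v (y (r n), t (r n)) < g (y (r n), t (r n))" using a(7)[of "r n"] elim(2) by linarith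
      qed
    qed
  qed
  have "\<forall>\<^sub>F n in sequentially. False"
    using A B Cc by eventually_elim (use a(8) in blast)
  then show False by simp
qed

text \<open>The work is in \<open>doubling\<close>; the point here is the order of the constants.
  \<kappa> comes from the gap, \<tau> from \<open>near_diagonal\<close> for that \<kappa>, then
  \<eta> from \<tau>. Half of the gap \<open>2 * m0\<close> pays for \<theta> at \<open>t1\<close>,
  and at least \<open>m0\<close> remains for the maximum.\<close>

theorem comparison:
  assumes sub: "subsolution u" and reg: "boundary_regular u" and super: "supersolution v"
    and bnd: "\<And>T. \<exists>C. \<forall>q\<in>K \<times> {0..T}. \<bar>u q\<bar> \<le> C" "\<And>T. \<exists>C. \<forall>q\<in>K \<times> {0..T}. \<bar>v q\<bar> \<le> C"
    and x1: "x1 \<in> K" and t1: "t1 \<ge> 0"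
  shows "u (x1, t1) \<le> v (x1, t1)"
proof (rule ccontr)
  assume neg: "\<not> ?thesis"
  define m0 where "m0 = (u (x1, t1) - v (x1, t1)) / 2"
  have m0: "m0 > 0" using neg by (simp add: m0_def)
  define T where "T = t1 + 2"
  obtain C1 C2 where C12: "\<And>q. q \<in> K \<times> {0..T} \<Longrightarrow> \<bar>u q\<bar> \<le> C1" "\<And>q. q \<in> K \<times> {0..T} \<Longrightarrow> \<bar>v q\<bar> \<le> C2"
    using bnd[of T] by blast
  define C where "C = max 1 (max C1 C2)"
  have C: "C \<ge> 1" "\<And>q. q \<in> K \<times> {0..T} \<Longrightarrow> \<bar>u q\<bar> \<le> C" "\<And>q. q \<in> K \<times> {0..T} \<Longrightarrow> \<bar>v q\<bar> \<le> C"
    using C12 by (auto simp: C_def le_max_iff_disj)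
  define \<kappa> where "\<kappa> = m0 / (t1 + 1)"
  have \<kappa>: "\<kappa> > 0" "\<kappa> * t1 \<le> m0" using m0 t1 by (auto simp: \<kappa>_def field_simps)
  obtain \<tau> where \<tau>: "\<tau> > 0" "\<tau> < 1" and close: "\<forall>x\<in>K. \<forall>y\<in>K. \<forall>s\<in>{0..T}. \<forall>t\<in>{0..T}. dist x y \<le> \<tau> \<and> \<bar>s - t\<bar> \<le> \<tau> \<and> m0 / 2 \<le> u (x, s) - v (y, t) \<longrightarrow>
    2 * \<tau> \<le> t \<and> (y \<in> frontier \<Omega> \<longrightarrow> v (y, t) < g (y, t)) \<and> \<bar>f (x, s) - f (y, t)\<bar> \<le> \<kappa> / 4"
    using near_diagonal[OF sub super, of "m0 / 2" "\<kappa> / 4" T] m0 \<kappa> by auto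
  define \<eta> where "\<eta> = \<tau>\<^sup>2 / (4 * C)"
  have \<eta>: "\<eta> > 0" "2 * C * \<eta> < \<tau>\<^sup>2" using \<tau> C(1) by (auto simp: \<eta>_def)
  \<comment> \<open>From one unit of time after \<open>t1\<close> on, \<theta> exceeds 2C, more than
    any gap. As \<open>T\<close> is two units after \<open>t1\<close> and \<tau> < 1, maximum points
    stay more than \<tau> before \<open>T\<close>.\<close>
  define N where "N = 2 * C + 1"
  define \<theta> where "\<theta> = (\<lambda>t. \<kappa> * t + N * (max 0 (t - t1))\<^sup>2)"
  define \<theta>' where "\<theta>' = (\<lambda>t. \<kappa> + N * (2 * max 0 (t - t1)))"
  have sq: "((\<lambda>s. (max 0 (s - t1))\<^sup>2) has_real_derivative 2 * max 0 (s - t1)) (at s)" for s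
  proof -
    have "((\<lambda>s. (max 0 (s - t1))\<^sup>2) has_real_derivative (2 * max 0 (s - t1)) * 1) (at s)"
      by (rule DERIV_chain2[where f = "\<lambda>t. (max 0 t)\<^sup>2", OF has_real_derivative_pos_part_square])
         (auto intro!: derivative_eq_intros)
    then show ?thesis by simp
  qed
  have th1: "(\<theta> has_real_derivative \<theta>' s) (at s)" for s
    unfolding \<theta>_def \<theta>'_def by (intro DERIV_add DERIV_cmult_Id DERIV_cmult sq)
  have thc: "continuous_on UNIV \<theta>'" unfolding \<theta>'_def by (intro continuous_intros)
  have th0: "\<theta> s \<ge> 0" "\<theta>' s \<ge> \<kappa>" if "s \<ge> 0" for s using \<kappa> C(1) that by (auto simp: \<theta>_def \<theta>'_def N_def)
  have thT: "s + \<tau> < T" if "s \<in> {0..T}" "\<theta> s \<le> 2 * C" for s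
  proof (rule ccontr)
    assume "\<not> s + \<tau> < T"
    then have "1 \<le> max 0 (s - t1)" using \<tau> by (simp add: T_def)
    then have "1 \<le> (max 0 (s - t1))\<^sup>2" by (rule one_le_power)
    then have "N * 1 \<le> N * (max 0 (s - t1))\<^sup>2" using C(1) by (intro mult_left_mono) (auto simp: N_def)
    moreover have "0 \<le> \<kappa> * s" using \<kappa> that by simp
    ultimately show False using that(2) by (simp add: \<theta>_def N_def)
  qed
  have us: "usc_on (K \<times> {0..T}) u" by (rule usc_K_times[OF sub])
  have vs: "usc_on (K \<times> {0..T}) (\<lambda>q. - v q)" by (rule equation.usc_K_times[OF dual supersolution_dual[OF super]])
  define P where "P = K \<times> {0..T} \<times> {0..T}"
  have cP: "compact P" unfolding P_def by (intro compact_Times compact_K compact_Icc)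
  have neP: "P \<noteq> {}" using K_nonempty t1 by (auto simp: P_def T_def)
  define W where "W = (\<lambda>p. u (fst p, fst (snd p)) + (- v (fst p, snd (snd p)) + (- ((fst (snd p) - snd (snd p))\<^sup>2 * inverse \<eta>) - \<theta> (snd (snd p)))))"
  have "usc_on P W"
    unfolding W_def
  proof (intro usc_on_add)
    show "usc_on P (\<lambda>p. u (fst p, fst (snd p)))"
      by (rule usc_on_compose[OF us]) (auto simp: P_def intro!: continuous_intros)
    show "usc_on P (\<lambda>p. - v (fst p, snd (snd p)))"
      by (rule usc_on_compose[OF vs, of P "\<lambda>p. (fst p, snd (snd p))"]) (auto simp: P_def intro!: continuous_intros)
    show "usc_on P (\<lambda>p. - ((fst (snd p) - snd (snd p))\<^sup>2 * inverse \<eta>) - \<theta> (snd (snd p)))"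
      unfolding \<theta>_def by (intro continuous_imp_usc continuous_intros)
  qed
  from usc_attains_sup[OF cP neP this] obtain z where z: "z \<in> P" "\<And>p. p \<in> P \<Longrightarrow> W p \<le> W z" by blast
  obtain xh sh th where zz: "z = (xh, sh, th)" by (cases z) auto
  have zP: "xh \<in> K" "sh \<in> {0..T}" "th \<in> {0..T}" using z(1) by (auto simp: zz P_def)
  define M where "M = W z"
  have mx: "u (x, s) - v (x, t) - (s - t)\<^sup>2 / \<eta> - \<theta> t \<le> M" if "x \<in> K" "s \<in> {0..T}" "t \<in> {0..T}" for x s t
    using z(2)[of "(x, s, t)"] that by (simp add: P_def M_def W_def divide_inverse)
  have att: "u (xh, sh) - v (xh, th) - (sh - th)\<^sup>2 / \<eta> - \<theta> th = M" by (simp add: M_def zz W_def divide_inverse)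
  have "u (x1, t1) - v (x1, t1) - (t1 - t1)\<^sup>2 / \<eta> - \<theta> t1 \<le> M" by (rule mx[OF x1]) (use t1 in \<open>auto simp: T_def\<close>)
  moreover have "\<theta> t1 \<le> m0" using \<kappa> by (simp add: \<theta>_def)
  moreover have "u (x1, t1) - v (x1, t1) = 2 * m0" by (simp add: m0_def)
  ultimately have Mm: "m0 \<le> M" by simp
  have "doubling \<Omega> \<nu> \<sigma> H f g u0 m u v T C \<eta> \<tau> \<kappa> M \<theta> \<theta>' xh"
  proof (unfold_locales)
    show "2 * \<tau> \<le> t \<and> (y \<in> frontier \<Omega> \<longrightarrow> v (y, t) < g (y, t)) \<and> \<bar>f (x, s) - f (y, t)\<bar> \<le> \<kappa> / 4"
      if "x \<in> K" "y \<in> K" "s \<in> {0..T}" "t \<in> {0..T}" "dist x y \<le> \<tau>" "\<bar>s - t\<bar> \<le> \<tau>" "M / 2 \<le> u (x, s) - v (y, t)" for x y s t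
      using close that Mm by fastforce
    show "\<exists>s\<in>{0..T}. \<exists>t\<in>{0..T}. u (xh, s) - v (xh, t) - (s - t)\<^sup>2 / \<eta> - \<theta> t = M" using att zP by blast
  qed (use sub reg super C \<eta> \<tau> \<kappa> Mm m0 th1 thc th0 thT zP mx in auto)
  then show False by (rule doubling.contradiction)
qed

end

subsection \<open>Bounds for subsolutions\<close>

context equation
begin

lemma subsolution_le_linear:
  assumes u: "subsolution u"
    and h: "\<And>x. x \<in> K \<Longrightarrow> \<bar>H x 0 0\<bar> \<le> h" and F: "\<And>x t. x \<in> K \<Longrightarrow> 0 \<le> t \<Longrightarrow> t \<le> T \<Longrightarrow> \<bar>f (x, t)\<bar> \<le> F"
    and g: "\<And>x t. x \<in> frontier \<Omega> \<Longrightarrow> 0 < t \<Longrightarrow> t \<le> T \<Longrightarrow> \<bar>g (x, t)\<bar> \<le> Gb"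
    and u0: "\<And>x. x \<in> K \<Longrightarrow> \<bar>u0 x\<bar> \<le> Ub" and nn: "0 \<le> h" "0 \<le> F" "0 \<le> Gb" "0 \<le> Ub"
    and x: "x \<in> K" "0 \<le> t" "t < T"
  shows "u (x, t) \<le> (h + F) * t + Gb + Ub"
proof -
  define a where "a = (\<lambda>t. (h + F) * t + (Gb + Ub))"
  have der: "(a has_real_derivative (h + F)) (at s)" for s
    unfolding a_def by (auto intro!: derivative_eq_intros)
  have "u (x, t) \<le> a t"
  proof (rule maximum_principle[OF u der])
    fix y s r assume y: "y \<in> K" "0 \<le> s" "s \<le> T" "a s \<le> r"
    have "0 \<le> a s" using nn y by (simp add: a_def)
    then have "H y 0 0 \<le> H y r 0" using y by (intro H_mono) auto
    then show "0 \<le> h + F + H y r 0 - f (y, s)" using h[OF y(1)] F[OF y(1-3)] by linarith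
  next
    fix y s assume "y \<in> frontier \<Omega>" "0 < s" "s \<le> T"
    then have "g (y, s) \<le> Gb" "0 \<le> (h + F) * s" using g[of y s] nn by auto
    then show "g (y, s) \<le> a s" using nn by (simp add: a_def)
  next
    fix y assume "y \<in> K"
    then show "u0 y \<le> a 0" using u0[of y] nn by (simp add: a_def)
  qed (use x in auto)
  then show ?thesis by (simp add: a_def)
qed

lemma subsolution_le_const:
  assumes u: "subsolution u" and l0: "l0 > 0" "\<And>x r. x \<in> K \<Longrightarrow> 0 \<le> r \<Longrightarrow> H x 0 0 + l0 * r \<le> H x r 0"
    and h: "\<And>x. x \<in> K \<Longrightarrow> \<bar>H x 0 0\<bar> \<le> h" and F: "\<And>x t. x \<in> K \<Longrightarrow> 0 \<le> t \<Longrightarrow> \<bar>f (x, t)\<bar> \<le> F"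
    and g: "\<And>x t. x \<in> frontier \<Omega> \<Longrightarrow> 0 < t \<Longrightarrow> \<bar>g (x, t)\<bar> \<le> Gb"
    and u0: "\<And>x. x \<in> K \<Longrightarrow> \<bar>u0 x\<bar> \<le> Ub" and nn: "0 \<le> h" "0 \<le> F" "0 \<le> Gb" "0 \<le> Ub"
    and x: "x \<in> K" "0 \<le> t"
  shows "u (x, t) \<le> inverse l0 * (h + F) + Gb + Ub"
proof -
  define c where "c = inverse l0 * (h + F) + Gb + Ub"
  have c0: "0 \<le> inverse l0 * (h + F)" using l0 nn by simp
  have "u (x, t) \<le> (\<lambda>_. c) t"
  proof (rule maximum_principle[OF u, where a' = "\<lambda>_. 0" and T = "t + 1"])
    fix y s r assume y: "y \<in> K" "0 \<le> s" "s \<le> t + 1" "c \<le> r"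
    have "0 \<le> r" using y c0 nn by (simp add: c_def)
    then have "H y 0 0 + l0 * r \<le> H y r 0" using l0(2) y by blast
    moreover have "h + F \<le> l0 * r"
    proof -
      have "l0 * (inverse l0 * (h + F)) \<le> l0 * r" using y nn l0(1) by (intro mult_left_mono) (auto simp: c_def)
      moreover have "l0 * (inverse l0 * (h + F)) = h + F" using l0(1) by simp
      ultimately show ?thesis by linarith
    qed
    ultimately show "0 \<le> 0 + H y r 0 - f (y, s)" using h[OF y(1)] F[OF y(1,2)] by linarith
  next
    fix y s assume "y \<in> frontier \<Omega>" "0 < s" "s \<le> t + 1"
    then show "g (y, s) \<le> c" using g[of y s] nn c0 by (simp add: c_def)
  next
    fix y assume "y \<in> K"
    then show "u0 y \<le> c" using u0[of y] nn c0 by (simp add: c_def)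
  qed (use x in auto)
  then show ?thesis by (simp add: c_def)
qed

lemma data_bounded:
  "\<exists>b\<ge>0. (\<forall>x\<in>K. \<bar>H x 0 0\<bar> \<le> b) \<and> (\<forall>x\<in>K. \<forall>t\<in>{0..T}. \<bar>f (x, t)\<bar> \<le> b) \<and>
     (\<forall>x\<in>frontier \<Omega>. \<forall>t\<in>{0..T}. \<bar>g (x, t)\<bar> \<le> b) \<and> (\<forall>x\<in>K. \<bar>u0 x\<bar> \<le> b)"
proof -
  obtain h where h: "\<forall>x\<in>K. \<bar>H x 0 0\<bar> \<le> h" using H_bounded[of 0 0 0] by auto
  obtain F where F: "\<forall>q\<in>K \<times> {0..T}. \<bar>f q\<bar> \<le> F" using continuous_bounded_on_K_times[OF f_continuous] by blast
  have "compact (frontier \<Omega> \<times> {0..T})"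
    using bounded_domain by (intro compact_Times compact_Icc compact_frontier_bounded)
  moreover have "continuous_on (frontier \<Omega> \<times> {0..T}) g" by (rule continuous_on_subset[OF g_continuous]) auto
  ultimately have "bounded (g ` (frontier \<Omega> \<times> {0..T}))" using compact_continuous_image compact_imp_bounded by blast
  then obtain Gb where g: "\<forall>q\<in>frontier \<Omega> \<times> {0..T}. \<bar>g q\<bar> \<le> Gb" unfolding bounded_iff by auto
  have "bounded (u0 ` K)" using u0_continuous compact_K compact_continuous_image compact_imp_bounded by blast
  then obtain Ub where u: "\<forall>x\<in>K. \<bar>u0 x\<bar> \<le> Ub" unfolding bounded_iff by auto
  define b where "b = \<bar>h\<bar> + \<bar>F\<bar> + \<bar>Gb\<bar> + \<bar>Ub\<bar>"
  have "h \<le> b" "F \<le> b" "Gb \<le> b" "Ub \<le> b" "0 \<le> b" by (auto simp: b_def)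
  moreover have "\<forall>x\<in>K. \<bar>H x 0 0\<bar> \<le> b" using h order_trans[OF _ \<open>h \<le> b\<close>] by blast
  moreover have "\<bar>f (x, t)\<bar> \<le> b" if "x \<in> K" "t \<in> {0..T}" for x t
    using F[rule_format, of "(x, t)"] that order_trans[OF _ \<open>F \<le> b\<close>] by blast
  moreover have "\<bar>g (x, t)\<bar> \<le> b" if "x \<in> frontier \<Omega>" "t \<in> {0..T}" for x t
    using g[rule_format, of "(x, t)"] that order_trans[OF _ \<open>Gb \<le> b\<close>] by blast
  moreover have "\<forall>x\<in>K. \<bar>u0 x\<bar> \<le> b" using u order_trans[OF _ \<open>Ub \<le> b\<close>] by blast
  ultimately show ?thesis by (intro exI[of _ b]) blast
qed

lemma subsolutions_bounded_above: "\<exists>C. \<forall>w. subsolution w \<longrightarrow> (\<forall>q\<in>K \<times> {0..T}. w q \<le> C)"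
proof -
  obtain b where b: "b \<ge> 0" "\<forall>x\<in>K. \<bar>H x 0 0\<bar> \<le> b" "\<forall>x\<in>K. \<forall>t\<in>{0..T+1}. \<bar>f (x, t)\<bar> \<le> b"
     "\<forall>x\<in>frontier \<Omega>. \<forall>t\<in>{0..T+1}. \<bar>g (x, t)\<bar> \<le> b" "\<forall>x\<in>K. \<bar>u0 x\<bar> \<le> b" using data_bounded by blast
  have "w (x, t) \<le> (b + b) * T + b + b" if w: "subsolution w" and x: "x \<in> K" "t \<in> {0..T}" for w x t
  proof -
    have "w (x, t) \<le> (b + b) * t + b + b"
      by (rule subsolution_le_linear[OF w, where T = "T + 1"]) (use b x in auto)
    also have "(b + b) * t \<le> (b + b) * T" using b x by (intro mult_left_mono) auto
    finally show ?thesis by simp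
  qed
  then show ?thesis by (intro exI[of _ "(b + b) * T + b + b"]) auto
qed

text \<open>At an interior maximum of the difference its gradient vanishes. At a lateral point or at
  time 0 only directions into the set count and the gradients may differ.\<close>

lemma interior_gradient_unique:
  assumes "C1_with_gradient (Qbar \<Omega>) \<phi> G" "C1_with_gradient (Qbar \<Omega>) \<psi> F" "x \<in> \<Omega>" "0 < t" "t < T"
    and mx: "\<And>y s. y \<in> K \<Longrightarrow> s \<in> {0..T} \<Longrightarrow> \<psi> (y, s) - \<phi> (y, s) \<le> \<psi> (x, t) - \<phi> (x, t)"
  shows "F (x, t) = G (x, t)"
proof -
  define A where "A = \<Omega> \<times> {0<..<T}"
  have A: "open A" "(x, t) \<in> A" "A \<subseteq> Qbar \<Omega>"
    using open_domain assms domain_subset_K by (auto simp: A_def Qbar_def intro!: open_Times)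
  have "C1_with_gradient (Qbar \<Omega>) (\<lambda>q. \<psi> q - \<phi> q) (\<lambda>q. F q - G q)"
    by (rule C1_with_gradient_diff[OF assms(2,1)])
  then have "((\<lambda>q. \<psi> q - \<phi> q) has_derivative (\<lambda>h. (F (x, t) - G (x, t)) \<bullet> h)) (at (x, t) within Qbar \<Omega>)"
    using C1_with_gradientD(2) A by blast
  then have "((\<lambda>q. \<psi> q - \<phi> q) has_derivative (\<lambda>h. (F (x, t) - G (x, t)) \<bullet> h)) (at (x, t) within A)"
    using A(3) has_derivative_subset by blast
  then have "((\<lambda>q. \<psi> q - \<phi> q) has_derivative (\<lambda>h. (F (x, t) - G (x, t)) \<bullet> h)) (at (x, t))"
    unfolding at_within_open[OF A(2,1)] .
  moreover have "\<forall>q\<in>A. \<psi> q - \<phi> q \<le> \<psi> (x, t) - \<phi> (x, t)"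
    using mx domain_subset_K by (auto simp: A_def)
  ultimately have eq: "(\<lambda>h. (F (x, t) - G (x, t)) \<bullet> h) = (\<lambda>v. 0)"
    using differential_zero_maxmin[OF A(2,1)] by blast
  show ?thesis using fun_cong[OF eq, of "F (x, t) - G (x, t)"] by (simp only: inner_eq_zero_iff right_minus_eq)
qed

lemma nonlocal_nonneg:
  assumes "\<And>y. y \<in> K \<Longrightarrow> u x \<le> u y"
  shows "0 \<le> nonlocal \<Omega> \<nu> D u x"
  using nonlocal_nonpos[of "\<lambda>y. - u y" x D] assms by (simp add: nonlocal_minus)

lemma nonlocal_cong:
  assumes "\<And>y. y \<in> K \<Longrightarrow> u y = v y" "x \<in> K"
  shows "nonlocal \<Omega> \<nu> D u x = nonlocal \<Omega> \<nu> D v x"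
proof -
  have "indicator {z \<in> D. x + z \<in> K} z *\<^sub>R (u (x + z) - u x) = indicator {z \<in> D. x + z \<in> K} z *\<^sub>R (v (x + z) - v x)" for z
    using assms by (auto simp: indicator_def)
  then show ?thesis by (simp only: nonlocal_def set_lebesgue_integral_def)
qed

lemma subsolution_cong:
  assumes u: "subsolution u" and eq: "\<And>q. q \<in> Qbar \<Omega> \<Longrightarrow> u q = v q"
  shows "subsolution v"
  unfolding subsolution_iff
proof (intro conjI allI impI)
  show "usc_on (Qbar \<Omega>) v"
  proof (rule usc_onI)
    fix q a assume q: "q \<in> Qbar \<Omega>" "v q < a"
    then obtain r where "r > 0" "\<forall>y\<in>Qbar \<Omega>. dist y q < r \<longrightarrow> u y < a"
      using u eq usc_onD[of "Qbar \<Omega>" u q a] by (auto simp: subsolution_iff)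
    then show "\<exists>r>0. \<forall>y\<in>Qbar \<Omega>. dist y q < r \<longrightarrow> v y < a" using eq by (metis)
  qed
  fix \<phi> G x t and \<delta> :: real
  assume a: "C1_with_gradient (Qbar \<Omega>) \<phi> G \<and> (x, t) \<in> Qbar \<Omega> \<and> (\<forall>q\<in>Qbar \<Omega>. v q - \<phi> q \<le> v (x, t) - \<phi> (x, t))" and d: "\<delta> > 0"
  then have xt: "x \<in> K" "t \<ge> 0" by (auto simp: Qbar_def)
  have s: "sub_at u \<phi> G x t \<delta>" using u a d eq unfolding subsolution_iff by auto
  have "nonlocal \<Omega> \<nu> (- ball 0 \<delta>) (\<lambda>y. u (y, t)) x = nonlocal \<Omega> \<nu> (- ball 0 \<delta>) (\<lambda>y. v (y, t)) x"
    by (rule nonlocal_cong[OF _ xt(1)]) (use eq xt in \<open>auto simp: Qbar_def\<close>)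
  moreover have e: "u (x, t) = v (x, t)" using eq a by blast
  ultimately have "E \<delta> u \<phi> G x t = E \<delta> v \<phi> G x t" by (simp only: visc_E_def)
  then show "sub_at v \<phi> G x t \<delta>" using s unfolding sub_at_def by (simp only: e)
qed

text \<open>Raising a function away from the test point increases only its nonlocal term, which
  enters the subsolution inequality with a minus sign.\<close>

lemma sub_at_mono:
  assumes s: "sub_at w \<phi> G x t \<delta>" and x: "x \<in> K" "t \<ge> 0" "\<delta> > 0"
    and c: "continuous_on (Qbar \<Omega>) w" "continuous_on (Qbar \<Omega>) w'"
    and le: "\<And>y. y \<in> K \<Longrightarrow> w (y, t) \<le> w' (y, t)" and eq: "w (x, t) = w' (x, t)"
  shows "sub_at w' \<phi> G x t \<delta>"
proof -
  have xt: "t \<in> {0..t}" using x by simp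
  obtain C1 where C1: "\<forall>q\<in>K \<times> {0..t}. \<bar>w q\<bar> \<le> C1" using continuous_bounded_on_K_times[OF c(1)] by blast
  obtain C2 where C2: "\<forall>q\<in>K \<times> {0..t}. \<bar>w' q\<bar> \<le> C2" using continuous_bounded_on_K_times[OF c(2)] by blast
  have b1: "\<bar>w (y, t)\<bar> \<le> max C1 C2" "\<bar>w' (y, t)\<bar> \<le> max C1 C2" if "y \<in> K" for y
    using C1 C2 that xt by (auto simp: le_max_iff_disj)
  have bk: "borel_K (\<lambda>y. w (y, t))" "borel_K (\<lambda>y. w' (y, t))"
    using continuous_slice[OF c(1) x(2)] continuous_slice[OF c(2) x(2)] by (auto intro: continuous_imp_borel_K)
  have "nonlocal \<Omega> \<nu> (- ball 0 \<delta>) (\<lambda>y. w (y, t)) x \<le> nonlocal \<Omega> \<nu> (- ball 0 \<delta>) (\<lambda>y. w' (y, t)) x"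
    using nonlocal_far[OF bk(1) b1(1) x(3,1)] nonlocal_far[OF bk(2) b1(2) x(3,1)]
      average_mono[OF bk b1 x(3,1) le] eq by simp
  then have "E \<delta> w' \<phi> G x t \<le> E \<delta> w \<phi> G x t" by (simp add: visc_E_def eq)
  then show ?thesis using s eq unfolding sub_at_def min_le_iff_disj by (elim conjE, intro conjI impI) auto
qed

subsection \<open>Perron's method\<close>

definition perron_class :: "('a \<times> real \<Rightarrow> real) set" where
  "perron_class = {w. continuous_on (Qbar \<Omega>) w \<and> subsolution w}"

lemma perron_class_max:
  assumes "w1 \<in> perron_class" "w2 \<in> perron_class"
  shows "(\<lambda>q. max (w1 q) (w2 q)) \<in> perron_class"
proof -
  have c: "continuous_on (Qbar \<Omega>) w1" "continuous_on (Qbar \<Omega>) w2" and s: "subsolution w1" "subsolution w2"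
    using assms by (auto simp: perron_class_def)
  have cm: "continuous_on (Qbar \<Omega>) (\<lambda>q. max (w1 q) (w2 q))" by (intro continuous_intros c)
  have "subsolution (\<lambda>q. max (w1 q) (w2 q))"
    unfolding subsolution_iff
  proof (intro conjI allI impI continuous_imp_usc cm)
    fix \<phi> G x t and \<delta> :: real
    assume a: "C1_with_gradient (Qbar \<Omega>) \<phi> G \<and> (x, t) \<in> Qbar \<Omega> \<and>
      (\<forall>q\<in>Qbar \<Omega>. max (w1 q) (w2 q) - \<phi> q \<le> max (w1 (x, t)) (w2 (x, t)) - \<phi> (x, t))" and d: "\<delta> > 0"
    then have xt: "x \<in> K" "t \<ge> 0" by (auto simp: Qbar_def)
    have *: "sub_at (\<lambda>q. max (w1 q) (w2 q)) \<phi> G x t \<delta>"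
      if w: "subsolution w" "continuous_on (Qbar \<Omega>) w" "\<And>q. w q \<le> max (w1 q) (w2 q)" "w (x, t) = max (w1 (x, t)) (w2 (x, t))" for w
    proof (rule sub_at_mono[OF _ xt d w(2) cm w(3,4)])
      have "w q - \<phi> q \<le> w (x, t) - \<phi> (x, t)" if "q \<in> Qbar \<Omega>" for q
      proof -
        have "max (w1 q) (w2 q) - \<phi> q \<le> w (x, t) - \<phi> (x, t)" using a that w(4) by simp
        then show ?thesis using w(3)[of q] by linarith
      qed
      then show "sub_at w \<phi> G x t \<delta>" using w(1) a d unfolding subsolution_iff by blast
    qed
    show "sub_at (\<lambda>q. max (w1 q) (w2 q)) \<phi> G x t \<delta>"
      using *[OF s(1) c(1)] *[OF s(2) c(2)] by (cases "w1 (x, t) \<le> w2 (x, t)") (auto simp: max_def)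
  qed
  then show ?thesis using cm by (simp add: perron_class_def)
qed

text \<open>The negative of a smooth function of time that majorises the data, and whose derivative
  majorises \<bar>H x 0 0\<bar> + \<bar>f (x, s)\<bar>. The data may grow with time without
  restriction, hence the locally finite construction of \<theta>.\<close>

lemma perron_class_nonempty: "perron_class \<noteq> {}"
proof -
  have "\<forall>n::nat. \<exists>b. b \<ge> 0 \<and> (\<forall>x\<in>K. \<bar>H x 0 0\<bar> \<le> b) \<and> (\<forall>x\<in>K. \<forall>t\<in>{0..real n + 1}. \<bar>f (x, t)\<bar> \<le> b) \<and>
     (\<forall>x\<in>frontier \<Omega>. \<forall>t\<in>{0..real n + 1}. \<bar>g (x, t)\<bar> \<le> b) \<and> (\<forall>x\<in>K. \<bar>u0 x\<bar> \<le> b)"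
    using data_bounded[of "real _ + 1"] by blast
  from choice[OF this] obtain b :: "nat \<Rightarrow> real" where b: "\<And>n. b n \<ge> 0 \<and> (\<forall>x\<in>K. \<bar>H x 0 0\<bar> \<le> b n) \<and> (\<forall>x\<in>K. \<forall>t\<in>{0..real n + 1}. \<bar>f (x, t)\<bar> \<le> b n) \<and>
     (\<forall>x\<in>frontier \<Omega>. \<forall>t\<in>{0..real n + 1}. \<bar>g (x, t)\<bar> \<le> b n) \<and> (\<forall>x\<in>K. \<bar>u0 x\<bar> \<le> b n)"
    by blast
  \<comment> \<open>\<open>b n\<close> bounds the data up to time n + 1, hence at all times with
    integer part \<open>n\<close>. The factor 2 accounts for the sum of the Hamiltonian and the
    source.\<close>
  define M where "M = (\<lambda>s::real. 2 * b (nat \<lfloor>s\<rfloor>))"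
  have Mb: "\<exists>C. \<forall>s\<in>{0..T}. M s \<le> C" for T
  proof -
    have "M s \<le> Max ((\<lambda>n. 2 * b n) ` {..nat \<lfloor>T\<rfloor>})" if "s \<in> {0..T}" for s
      unfolding M_def using that by (intro Max_ge) (auto intro!: imageI nat_mono floor_mono)
    then show ?thesis by blast
  qed
  from smooth_majorant[of M] Mb obtain \<theta> \<theta>' where th: "\<And>s. (\<theta> has_real_derivative \<theta>' s) (at s)" "continuous_on UNIV \<theta>'"
    "\<And>s. s \<ge> 0 \<Longrightarrow> M s \<le> \<theta> s \<and> M s \<le> \<theta>' s \<and> 0 \<le> \<theta> s \<and> 0 \<le> \<theta>' s"
    by blast
  have bd: "\<bar>H x 0 0\<bar> + \<bar>f (x, s)\<bar> \<le> \<theta>' s" "\<bar>u0 x\<bar> \<le> \<theta> s" "x \<in> frontier \<Omega> \<Longrightarrow> \<bar>g (x, s)\<bar> \<le> \<theta> s" if "x \<in> K" "s \<ge> 0" for x s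
  proof -
    define n where "n = nat \<lfloor>s\<rfloor>"
    have "s \<in> {0..real n + 1}" using that by (auto simp: n_def)
    then have "\<bar>f (x, s)\<bar> \<le> b n" "\<bar>H x 0 0\<bar> \<le> b n" "\<bar>u0 x\<bar> \<le> b n" "b n \<ge> 0" "x \<in> frontier \<Omega> \<Longrightarrow> \<bar>g (x, s)\<bar> \<le> b n"
      using b[of n] that by auto
    moreover have "2 * b n \<le> \<theta> s" "2 * b n \<le> \<theta>' s" using th(3)[OF that(2)] by (auto simp: M_def n_def)
    ultimately show "\<bar>H x 0 0\<bar> + \<bar>f (x, s)\<bar> \<le> \<theta>' s" "\<bar>u0 x\<bar> \<le> \<theta> s" "x \<in> frontier \<Omega> \<Longrightarrow> \<bar>g (x, s)\<bar> \<le> \<theta> s" by auto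
  qed
  define l where "l = (\<lambda>q::'a \<times> real. - \<theta> (snd q))"
  define F where "F = (\<lambda>q::'a \<times> real. - (0::'a, \<theta>' (snd q)))"
  have C: "C1_with_gradient (Qbar \<Omega>) l F"
    unfolding l_def F_def Qbar_def
    by (intro C1_with_gradient_minus C1_with_gradient_snd has_field_derivative_at_within[OF th(1)] continuous_on_subset[OF th(2)]) auto
  have cl: "continuous_on (Qbar \<Omega>) l" by (rule C1_with_gradient_imp_continuous_on[OF C])
  have "subsolution l"
    unfolding subsolution_iff
  proof (intro conjI allI impI continuous_imp_usc cl)
    fix \<phi> G x t and \<delta> :: real
    assume a: "C1_with_gradient (Qbar \<Omega>) \<phi> G \<and> (x, t) \<in> Qbar \<Omega> \<and> (\<forall>q\<in>Qbar \<Omega>. l q - \<phi> q \<le> l (x, t) - \<phi> (x, t))" and d: "\<delta> > 0"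
    then have xt: "x \<in> K" "t \<ge> 0" by (auto simp: Qbar_def)
    have "E \<delta> l \<phi> G x t \<le> 0" if xO: "x \<in> \<Omega>" "t > 0"
    proof -
      have "F (x, t) = G (x, t)"
        by (rule interior_gradient_unique[OF _ C xO, of _ _ "t + 1"]) (use a in \<open>auto simp: Qbar_def\<close>)
      then have G: "G (x, t) = (0, - \<theta>' t)" by (simp add: F_def)
      have "0 \<le> nonlocal \<Omega> \<nu> (ball 0 \<delta>) (\<lambda>y. \<phi> (y, t)) x"
        by (rule nonlocal_nonneg) (use a xt in \<open>force simp: Qbar_def l_def\<close>)
      moreover have "H x (- \<theta> t) 0 \<le> H x 0 0" using th(3)[OF xt(2)] xt by (intro H_mono) auto
      ultimately show ?thesis using bd(1)[OF xt] by (simp add: visc_E_def G l_def nonlocal_const)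
    qed
    moreover have "l (x, t) \<le> g (x, t)" if "x \<in> frontier \<Omega>" using bd(3)[OF xt that] by (simp add: l_def)
    moreover have "l (x, t) \<le> u0 x" using bd(2)[OF xt] by (simp add: l_def)
    ultimately show "sub_at l \<phi> G x t \<delta>" by (auto simp: sub_at_def min_def)
  qed
  then show ?thesis using cl by (auto simp: perron_class_def)
qed

definition perron :: "'a \<times> real \<Rightarrow> real" where
  "perron q = (SUP w\<in>perron_class. w q)"

text \<open>The upper semicontinuous envelope of the supremum, written in terms of the members
  themselves: its value is approached by continuous members at nearby points.\<close>

definition perron_usc :: "'a \<times> real \<Rightarrow> real" where
  "perron_usc q = Inf {c. \<exists>r>0. \<forall>w\<in>perron_class. \<forall>q'\<in>Qbar \<Omega>. dist q' q < r \<longrightarrow> w q' \<le> c}"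

lemma perron_class_bdd: "\<exists>C. \<forall>w\<in>perron_class. \<forall>q\<in>K \<times> {0..T}. w q \<le> C"
  using subsolutions_bounded_above[of T] by (auto simp: perron_class_def)

lemma perron_upper: "w \<in> perron_class \<Longrightarrow> q \<in> Qbar \<Omega> \<Longrightarrow> w q \<le> perron q"
proof -
  assume w: "w \<in> perron_class" and q: "q \<in> Qbar \<Omega>"
  obtain C where "\<forall>w\<in>perron_class. \<forall>q\<in>K \<times> {0..snd q}. w q \<le> C" using perron_class_bdd by blast
  then have "bdd_above ((\<lambda>w. w q) ` perron_class)"
    using q by (intro bdd_aboveI2[of _ _ C]) (auto simp: Qbar_def)
  then show "w q \<le> perron q" unfolding perron_def by (rule cSUP_upper[OF w])
qed

lemma perron_approx: "q \<in> Qbar \<Omega> \<Longrightarrow> c < perron q \<Longrightarrow> \<exists>w\<in>perron_class. c < w q"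
  unfolding perron_def using perron_class_nonempty less_cSUP_iff[of perron_class "\<lambda>w. w q" c]
  by (metis (no_types, lifting) cSUP_least linorder_not_less order_less_imp_le)

lemma perron_le: "(\<And>w. w \<in> perron_class \<Longrightarrow> w q \<le> c) \<Longrightarrow> perron q \<le> c"
  unfolding perron_def by (rule cSUP_least[OF perron_class_nonempty])

lemma perron_usc_facts:
  assumes q: "q \<in> Qbar \<Omega>"
  shows "w \<in> perron_class \<Longrightarrow> w q \<le> perron_usc q"
    and "perron_usc q < c \<Longrightarrow> \<exists>r>0. \<forall>w\<in>perron_class. \<forall>q'\<in>Qbar \<Omega>. dist q' q < r \<longrightarrow> w q' \<le> c"
    and "r > 0 \<Longrightarrow> c < perron_usc q \<Longrightarrow> \<exists>w\<in>perron_class. \<exists>q'\<in>Qbar \<Omega>. dist q' q < r \<and> c < w q'"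
    and "r > 0 \<Longrightarrow> (\<And>w q'. w \<in> perron_class \<Longrightarrow> q' \<in> Qbar \<Omega> \<Longrightarrow> dist q' q < r \<Longrightarrow> w q' \<le> c) \<Longrightarrow> perron_usc q \<le> c"
proof -
  define A where "A = {c. \<exists>r>0. \<forall>w\<in>perron_class. \<forall>q'\<in>Qbar \<Omega>. dist q' q < r \<longrightarrow> w q' \<le> c}"
  have pu: "perron_usc q = Inf A" by (simp add: perron_usc_def A_def)
  obtain x t where xt: "q = (x, t)" "x \<in> K" "t \<ge> 0" using q by (auto simp: Qbar_def)
  obtain C where C: "\<forall>w\<in>perron_class. \<forall>q\<in>K \<times> {0..t + 1}. w q \<le> C" using perron_class_bdd by blast
  have "C \<in> A" unfolding A_def
  proof (rule CollectI, intro exI[of _ 1] conjI ballI impI)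
    fix w q' assume w: "w \<in> perron_class" "q' \<in> Qbar \<Omega>" "dist q' q < 1"
    have "\<bar>snd q' - t\<bar> \<le> dist q' q" using dist_snd_le[of q' q] xt by (simp add: dist_real_def)
    then have "q' \<in> K \<times> {0..t + 1}" using w by (auto simp: Qbar_def)
    then show "w q' \<le> C" using C w by blast
  qed simp
  then have ne: "A \<noteq> {}" by blast
  have low: "w q \<le> c" if "w \<in> perron_class" "c \<in> A" for w c
    using that q unfolding A_def by force
  obtain w0 where w0: "w0 \<in> perron_class" using perron_class_nonempty by blast
  have bdd: "bdd_below A" by (rule bdd_belowI[of _ "w0 q"]) (use low w0 in blast)
  show "w \<in> perron_class \<Longrightarrow> w q \<le> perron_usc q" unfolding pu by (rule cInf_greatest[OF ne]) (rule low)
  show "\<exists>r>0. \<forall>w\<in>perron_class. \<forall>q'\<in>Qbar \<Omega>. dist q' q < r \<longrightarrow> w q' \<le> c" if "perron_usc q < c"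
  proof -
    have "Inf A < c" using that by (simp only: pu)
    then have "\<exists>c'\<in>A. c' < c" using cInf_less_iff[OF ne bdd] by blast
    then obtain c' where c': "c' \<in> A" "c' < c" by blast
    then obtain r where "r > 0" "\<forall>w\<in>perron_class. \<forall>q'\<in>Qbar \<Omega>. dist q' q < r \<longrightarrow> w q' \<le> c'" unfolding A_def by blast
    then show ?thesis using c'(2) by (intro exI[of _ r]) force
  qed
  show "\<exists>w\<in>perron_class. \<exists>q'\<in>Qbar \<Omega>. dist q' q < r \<and> c < w q'" if "r > 0" "c < perron_usc q"
  proof (rule ccontr)
    assume neg: "\<not> ?thesis"
    have "\<forall>w\<in>perron_class. \<forall>q'\<in>Qbar \<Omega>. dist q' q < r \<longrightarrow> w q' \<le> c" using neg by (meson not_less)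
    then have "c \<in> A" unfolding A_def using that(1) by blast
    from cInf_lower[OF this bdd] show False using that(2) pu by linarith
  qed
  show "r > 0 \<Longrightarrow> (\<And>w q'. w \<in> perron_class \<Longrightarrow> q' \<in> Qbar \<Omega> \<Longrightarrow> dist q' q < r \<Longrightarrow> w q' \<le> c) \<Longrightarrow> perron_usc q \<le> c"
    unfolding pu by (rule cInf_lower[OF _ bdd]) (auto simp: A_def)
qed

lemma usc_perron_usc: "usc_on (Qbar \<Omega>) perron_usc"
proof (rule usc_onI)
  fix q a assume q: "q \<in> Qbar \<Omega>" "perron_usc q < a"
  obtain c where c: "perron_usc q < c" "c < a" using dense[OF q(2)] by blast
  obtain r where r: "r > 0" "\<forall>w\<in>perron_class. \<forall>q'\<in>Qbar \<Omega>. dist q' q < r \<longrightarrow> w q' \<le> c"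
    using perron_usc_facts(2)[OF q(1) c(1)] by blast
  have "perron_usc y < a" if y: "y \<in> Qbar \<Omega>" "dist y q < r / 2" for y
  proof -
    have "perron_usc y \<le> c"
    proof (rule perron_usc_facts(4)[OF y(1)])
      show "r / 2 > 0" using r by simp
      fix w q' assume "w \<in> perron_class" "q' \<in> Qbar \<Omega>" "dist q' y < r / 2"
      then show "w q' \<le> c" using r(2) y dist_triangle[of q' q y] by (smt (verit) field_sum_of_halves)
    qed
    then show ?thesis using c by simp
  qed
  then show "\<exists>r>0. \<forall>y\<in>Qbar \<Omega>. dist y q < r \<longrightarrow> perron_usc y < a" using r(1) by (intro exI[of _ "r / 2"]) auto
qed

lemma perron_le_usc: "q \<in> Qbar \<Omega> \<Longrightarrow> perron q \<le> perron_usc q"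
  using perron_le perron_usc_facts(1) by blast

lemma perron_bounded: "\<exists>C. \<forall>q\<in>K \<times> {0..T}. \<bar>perron q\<bar> \<le> C \<and> \<bar>perron_usc q\<bar> \<le> C"
proof -
  obtain C1 where C1: "\<forall>w\<in>perron_class. \<forall>q\<in>K \<times> {0..T + 1}. w q \<le> C1" using perron_class_bdd by blast
  obtain w0 where w0: "w0 \<in> perron_class" using perron_class_nonempty by blast
  obtain C2 where C2: "\<forall>q\<in>K \<times> {0..T}. \<bar>w0 q\<bar> \<le> C2"
    using continuous_bounded_on_K_times w0 unfolding perron_class_def by blast
  have "\<bar>perron q\<bar> \<le> max C1 C2 \<and> \<bar>perron_usc q\<bar> \<le> max C1 C2" if q: "q \<in> K \<times> {0..T}" for q
  proof -
    have qQ: "q \<in> Qbar \<Omega>" using q by (auto simp: Qbar_def)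
    have "perron_usc q \<le> C1"
    proof (rule perron_usc_facts(4)[OF qQ zero_less_one])
      fix w q' assume w: "w \<in> perron_class" "q' \<in> Qbar \<Omega>" "dist q' q < 1"
      have "\<bar>snd q' - snd q\<bar> \<le> dist q' q" using dist_snd_le[of q' q] by (simp add: dist_real_def)
      then have "q' \<in> K \<times> {0..T + 1}" using w q by (auto simp: Qbar_def)
      then show "w q' \<le> C1" using C1 w by blast
    qed
    moreover have "\<bar>w0 q\<bar> \<le> C2" using C2 q by blast
    then have "- C2 \<le> w0 q" by linarith
    moreover have "w0 q \<le> perron q" "perron q \<le> perron_usc q" using perron_upper[OF w0 qQ] perron_le_usc[OF qQ] .
    ultimately show ?thesis by (auto simp: abs_le_iff)
  qed
  then show ?thesis by blast
qed

text \<open>For test functions the integral over \<open>near \<delta> x\<close> converges for every \<open>\<delta>\<close>, although only small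
  neighbourhoods of \<open>x\<close> are controlled by the Lipschitz estimate.\<close>

lemma test_function_near_integrable:
  assumes \<phi>: "C1_with_gradient (Qbar \<Omega>) \<phi> G" and x: "x \<in> K" "0 \<le> t" and d: "\<delta> > 0"
  shows "set_integrable (\<nu> x) (near \<delta> x) (\<lambda>z. \<phi> (x + z, t) - \<phi> (x, t))"
proof -
  obtain r B where r: "r > 0" and B: "B \<ge> 0" and lip: "\<And>x' y t'. x'\<in>K \<inter> ball x r \<Longrightarrow> y\<in>K \<inter> ball x r \<Longrightarrow> t'\<in>{0..t} \<Longrightarrow>
    \<bar>\<phi> (x', t') - \<phi> (y, t')\<bar> \<le> B * dist x' y"
    using test_function_locally_lipschitz[OF \<phi> x(1), of t] by blast
  have cont: "continuous_on (Qbar \<Omega>) \<phi>" by (rule C1_with_gradient_imp_continuous_on[OF \<phi>])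
  obtain C where C: "\<And>q. q \<in> K \<times> {0..t} \<Longrightarrow> \<bar>\<phi> q\<bar> \<le> C" using continuous_bounded_on_K_times[OF cont] by blast
  have bor: "borel_K (\<lambda>y. \<phi> (y, t))" using continuous_slice[OF cont x(2)] by (rule continuous_imp_borel_K)
  define d' where "d' = Min {1/2, \<delta>, r}"
  have d': "0 < d'" "d' < 1" "d' \<le> \<delta>" "d' \<le> r" using d r by (auto simp: d'_def)
  have 1: "set_integrable (\<nu> x) (near d' x) (\<lambda>z. \<phi> (x + z, t) - \<phi> (x, t))"
    by (rule near_integrable[OF d'(1,2) x(1) bor, of B]) (use lip x r d' in \<open>auto simp: dist_commute\<close>)
  have 2: "set_integrable (\<nu> x) (far d' x) (\<lambda>z. \<phi> (x + z, t) - \<phi> (x, t))"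
    using C x d' by (intro set_integral_diff far_integrable[OF bor, of C] far_integrable_const) auto
  have sets: "near d' x \<in> sets (\<nu> x)" "near \<delta> x \<in> sets (\<nu> x)" "far d' x \<in> sets (\<nu> x)"
    using sets_kernel[OF x(1)] by auto
  have "set_integrable (\<nu> x) (near d' x \<union> far d' x) (\<lambda>z. \<phi> (x + z, t) - \<phi> (x, t))"
    by (rule set_integrable_Un[OF 1 2 sets(1,3)])
  then show ?thesis by (rule set_integrable_subset[OF _ sets(2)]) (auto simp: near_def far_def)
qed

lemma penalised_test_function:
  assumes \<phi>: "C1_with_gradient (Qbar \<Omega>) \<phi> G"
  shows "C1_with_gradient (Qbar \<Omega>) (\<lambda>q. \<phi> q + \<alpha> * (norm (q - q0))\<^sup>2) (\<lambda>q. G q + \<alpha> *\<^sub>R (2 *\<^sub>R (q - q0)))"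
  by (intro C1_with_gradient_add \<phi> C1_with_gradient_scale C1_with_gradient_normsq)

text \<open>The quadratic term is itself a C^1 test function, so its integral converges for every
  \<delta>. Making the contact strict thus costs \<alpha> times a fixed number.\<close>

lemma nonlocal_penalised:
  assumes \<phi>: "C1_with_gradient (Qbar \<Omega>) \<phi> G" and x: "x \<in> K" "0 \<le> t" and d: "\<delta> > 0"
  shows "nonlocal \<Omega> \<nu> (ball 0 \<delta>) (\<lambda>y. \<phi> (y, t) + \<alpha> * (norm ((y, t) - (x, t)))\<^sup>2) x
    = nonlocal \<Omega> \<nu> (ball 0 \<delta>) (\<lambda>y. \<phi> (y, t)) x + \<alpha> * nonlocal \<Omega> \<nu> (ball 0 \<delta>) (\<lambda>y. (norm (y - x))\<^sup>2) x"
proof -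
  have 1: "set_integrable (\<nu> x) (near \<delta> x) (\<lambda>z. \<phi> (x + z, t) - \<phi> (x, t))"
    by (rule test_function_near_integrable[OF \<phi> x d])
  have "C1_with_gradient (Qbar \<Omega>) (\<lambda>q. (norm (fst q - x))\<^sup>2) (\<lambda>q. (2 *\<^sub>R (fst q - x), 0))"
    unfolding Qbar_def by (intro C1_with_gradient_fst C1_with_gradient_normsq)
  from test_function_near_integrable[OF this x d]
  have 2: "set_integrable (\<nu> x) (near \<delta> x) (\<lambda>z. (norm (x + z - x))\<^sup>2 - (norm (x - x))\<^sup>2)" by simp
  have "nonlocal \<Omega> \<nu> (ball 0 \<delta>) (\<lambda>y. \<phi> (y, t) + \<alpha> * (norm ((y, t) - (x, t)))\<^sup>2) x
      = (LINT z:near \<delta> x|\<nu> x. (\<phi> (x + z, t) - \<phi> (x, t)) + \<alpha> * ((norm (x + z - x))\<^sup>2 - (norm (x - x))\<^sup>2))"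
    unfolding nonlocal_def near_def by (simp add: algebra_simps)
  also have "\<dots> = (LINT z:near \<delta> x|\<nu> x. \<phi> (x + z, t) - \<phi> (x, t)) + (LINT z:near \<delta> x|\<nu> x. \<alpha> * ((norm (x + z - x))\<^sup>2 - (norm (x - x))\<^sup>2))"
    by (rule set_integral_add(2)[OF 1]) (use 2 in \<open>auto intro!: set_integrable_mult_right\<close>)
  finally show ?thesis by (simp add: nonlocal_def near_def)
qed

end

section \<open>The envelope is a subsolution\<close>

context equation
begin

lemma H_tendsto:
  assumes "X \<longlonglongrightarrow> x" "r \<longlonglongrightarrow> r0" "p \<longlonglongrightarrow> p0" "\<And>n. X n \<in> K" "x \<in> K"
  shows "(\<lambda>n. H (X n) (r n) (p n)) \<longlonglongrightarrow> H x r0 p0"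
proof -
  have "(\<lambda>n. (\<lambda>(x, r, p). H x r p) (X n, r n, p n)) \<longlonglongrightarrow> (\<lambda>(x, r, p). H x r p) (x, r0, p0)"
    by (rule continuous_on_tendsto_compose[OF H_continuous]) (use assms in \<open>auto intro!: tendsto_Pair\<close>)
  then show ?thesis by simp
qed

text \<open>A strict inequality against the datum at the limit point persists near by and rules out
  the data alternative there. The limit value \<open>c\<close> is arbitrary, so the dual equation
  can use the lemma with reversed signs.\<close>

lemma lateral_eventually:
  assumes X: "\<And>n. X n \<in> K" "X \<longlonglongrightarrow> x" "x \<in> K" and s: "\<And>n. s n \<ge> 0" "s \<longlonglongrightarrow> t" "t \<ge> 0"
    and r: "r \<longlonglongrightarrow> c" and less: "x \<in> frontier \<Omega> \<Longrightarrow> g (x, t) < c"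
  shows "\<forall>\<^sub>F n in sequentially. X n \<in> frontier \<Omega> \<longrightarrow> g (X n, s n) < r n"
proof (cases "x \<in> \<Omega>")
  case True
  have "\<forall>\<^sub>F n in sequentially. X n \<in> \<Omega>" by (rule topological_tendstoD[OF X(2) open_domain True])
  then show ?thesis by (rule eventually_mono) (use frontier_not_domain in blast)
next
  case False
  then have x: "x \<in> frontier \<Omega>" using K_cases X(3) by blast
  obtain b where b: "g (x, t) < b" "b < c" using dense[OF less[OF x]] by blast
  obtain d where d: "d > 0" "\<forall>y\<in>frontier \<Omega>. \<forall>s\<ge>0. dist y x < d \<longrightarrow> \<bar>s - t\<bar> < d \<longrightarrow> g (y, s) < b"
    using g_near[OF x s(3) b(1)] by blast
  have "\<forall>\<^sub>F n in sequentially. dist (X n) x < d" "\<forall>\<^sub>F n in sequentially. dist (s n) t < d" "\<forall>\<^sub>F n in sequentially. b < r n"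
    using tendstoD[OF X(2) d(1)] tendstoD[OF s(2) d(1)] order_tendstoD(1)[OF r b(2)] .
  then show ?thesis
  proof eventually_elim
    case (elim n)
    show ?case
    proof
      assume "X n \<in> frontier \<Omega>"
      then have "g (X n, s n) < b" using d(2) elim s(1) by (simp add: dist_real_def)
      then show "g (X n, s n) < r n" using elim by simp
    qed
  qed
qed

lemma initial_eventually:
  assumes X: "\<And>n. X n \<in> K" "X \<longlonglongrightarrow> x" "x \<in> K" and s: "\<And>n. s n \<ge> (0::real)" "s \<longlonglongrightarrow> t" "t \<ge> 0"
    and r: "r \<longlonglongrightarrow> c" and less: "t = 0 \<Longrightarrow> u0 x < c"
  shows "\<forall>\<^sub>F n in sequentially. s n = 0 \<longrightarrow> u0 (X n) < r n"
proof (cases "t = 0")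
  case True
  have "(\<lambda>n. u0 (X n)) \<longlonglongrightarrow> u0 x" by (rule continuous_on_tendsto_compose[OF u0_continuous X(2,3)]) (use X in auto)
  then have "(\<lambda>n. r n - u0 (X n)) \<longlonglongrightarrow> c - u0 x" using r by (intro tendsto_diff)
  then have "\<forall>\<^sub>F n in sequentially. 0 < r n - u0 (X n)" using less[OF True] by (intro order_tendstoD(1)) auto
  then show ?thesis by (rule eventually_mono) simp
next
  case False
  then have "\<forall>\<^sub>F n in sequentially. 0 < s n" using s by (intro order_tendstoD(1)) auto
  then show ?thesis by (rule eventually_mono) simp
qed

text \<open>Taking the maximum with one fixed member \<open>w0\<close> keeps the whole sequence
  bounded below on bounded time intervals, as the limit of the far integrals requires.\<close>

lemma perron_usc_sequence:
  assumes q0: "q0 \<in> Qbar \<Omega>" and w0: "w0 \<in> perron_class"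
  shows "\<exists>w p. \<forall>n::nat. w n \<in> perron_class \<and> (\<forall>q. w0 q \<le> w n q) \<and> p n \<in> Qbar \<Omega> \<and>
    dist (p n) q0 < 1 / real (Suc n) \<and> perron_usc q0 - 1 / real (Suc n) < w n (p n)"
proof -
  have "\<exists>w p. w \<in> perron_class \<and> (\<forall>q. w0 q \<le> w q) \<and> p \<in> Qbar \<Omega> \<and>
    dist p q0 < 1 / real (Suc n) \<and> perron_usc q0 - 1 / real (Suc n) < w p" for n
  proof -
    obtain w p where w: "w \<in> perron_class" "p \<in> Qbar \<Omega>" "dist p q0 < 1 / real (Suc n)" "perron_usc q0 - 1 / real (Suc n) < w p"
      using perron_usc_facts(3)[OF q0, of "1 / real (Suc n)" "perron_usc q0 - 1 / real (Suc n)"] by auto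
    have "(\<lambda>q. max (w0 q) (w q)) \<in> perron_class" by (rule perron_class_max[OF w0 w(1)])
    then show ?thesis using w by (intro exI[of _ "\<lambda>q. max (w0 q) (w q)"] exI[of _ p]) auto
  qed
  then show ?thesis by metis
qed

lemma nonlocal_far_perron_usc:
  assumes "x \<in> K" "t \<ge> 0" "\<delta> > 0"
  shows "nonlocal \<Omega> \<nu> (- ball 0 \<delta>) (\<lambda>y. perron_usc (y, t)) x
    = average \<delta> (\<lambda>y. perron_usc (y, t)) x - perron_usc (x, t) * mass \<delta> x"
proof -
  obtain C where C: "\<And>q. q \<in> K \<times> {0..t} \<Longrightarrow> \<bar>perron_usc q\<bar> \<le> C" using perron_bounded[of t] by blast
  have b: "\<bar>perron_usc (y, t)\<bar> \<le> C" if "y \<in> K" for y using C that assms by auto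
  have "usc_on K (\<lambda>y. perron_usc (y, t))"
    by (rule usc_on_compose[OF usc_perron_usc]) (use assms in \<open>auto simp: Qbar_def intro!: continuous_intros\<close>)
  then show ?thesis by (intro nonlocal_far[where C = C] borel_K_usc[where C = C]) (use b assms in auto)
qed

text \<open>Maximising \<open>w\<^sub>n - \<phi> - \<alpha> |q - q\<^sub>0|\<^sup>2\<close> for members \<open>w\<^sub>n\<close> of the class that almost attain
  the value of the envelope near \<open>q\<^sub>0\<close> gives maximum points that converge to \<open>q\<^sub>0\<close>.\<close>

lemma envelope_maximum_points:
  assumes \<phi>: "C1_with_gradient (Qbar \<Omega>) \<phi> G" and q0: "q0 \<in> K \<times> {0..T - 1}" and al: "\<alpha> > 0"
    and max: "\<And>q. q \<in> Qbar \<Omega> \<Longrightarrow> perron_usc q - \<phi> q \<le> perron_usc q0 - \<phi> q0" and w0: "w0 \<in> perron_class"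
  shows "\<exists>w p. (\<forall>n::nat. w n \<in> perron_class \<and> (\<forall>q. w0 q \<le> w n q) \<and> p n \<in> K \<times> {0..T} \<and>
      (\<forall>q\<in>K \<times> {0..T}. w n q - (\<phi> q + \<alpha> * (norm (q - q0))\<^sup>2) \<le> w n (p n) - (\<phi> (p n) + \<alpha> * (norm (p n - q0))\<^sup>2))) \<and>
    p \<longlonglongrightarrow> q0 \<and> (\<lambda>n. w n (p n)) \<longlonglongrightarrow> perron_usc q0"
proof -
  have q0Q: "q0 \<in> Qbar \<Omega>" using q0 by (auto simp: Qbar_def)
  define \<phi>' where "\<phi>' = (\<lambda>q. \<phi> q + \<alpha> * (norm (q - q0))\<^sup>2)"
  obtain w q where w: "\<And>n. w n \<in> perron_class" "\<And>n r. w0 r \<le> w n r" "\<And>n. q n \<in> Qbar \<Omega>"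
    "\<And>n. dist (q n) q0 < 1 / real (Suc n)" "\<And>n. perron_usc q0 - 1 / real (Suc n) < w n (q n)"
    using perron_usc_sequence[OF q0Q w0] by blast
  have c\<phi>: "continuous_on (Qbar \<Omega>) \<phi>" by (rule C1_with_gradient_imp_continuous_on[OF \<phi>])
  then have c: "continuous_on (Qbar \<Omega>) \<phi>'" unfolding \<phi>'_def by (intro continuous_intros)
  have sub: "K \<times> {0..T} \<subseteq> Qbar \<Omega>" by (auto simp: Qbar_def)
  have ne: "K \<times> {0..T} \<noteq> {}" using q0 by auto
  have "\<exists>p\<in>K \<times> {0..T}. \<forall>r\<in>K \<times> {0..T}. w n r - \<phi>' r \<le> w n p - \<phi>' p" for n
    using w(1)[of n] by (intro continuous_attains_sup compact_K_times ne continuous_on_diff continuous_on_subset[OF c sub])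
       (auto simp: perron_class_def intro: continuous_on_subset[OF _ sub])
  then obtain p where p: "\<And>n. p n \<in> K \<times> {0..T}" "\<And>n r. r \<in> K \<times> {0..T} \<Longrightarrow> w n r - \<phi>' r \<le> w n (p n) - \<phi>' (p n)"
    by metis
  have pQ: "p n \<in> Qbar \<Omega>" for n using p(1) sub by blast
  have qK: "q n \<in> K \<times> {0..T}" for n
  proof -
    have "\<bar>snd (q n) - snd q0\<bar> \<le> dist (q n) q0" using dist_snd_le[of "q n" q0] by (simp add: dist_real_def)
    moreover have "1 / real (Suc n) \<le> 1" by simp
    ultimately have "snd (q n) \<le> snd q0 + 1" using w(4)[of n] by linarith
    then show ?thesis using w(3)[of n] q0 by (auto simp: Qbar_def)
  qed
  have inv: "(\<lambda>n. 1 / real (Suc n)) \<longlonglongrightarrow> 0" using LIMSEQ_inverse_real_of_nat by (simp add: inverse_eq_divide)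
  have q: "q \<longlonglongrightarrow> q0"
    by (rule tendsto_dist_iff[THEN iffD2], rule tendsto_sandwich[OF _ _ tendsto_const inv])
       (use w(4) in \<open>auto intro!: always_eventually less_imp_le\<close>)
  have lower: "perron_usc q0 - 1 / real (Suc n) - \<phi>' (q n) \<le> w n (p n) - \<phi>' (p n)" for n
    using w(5)[of n] p(2)[OF qK, of n n] by linarith
  have upper: "w n (p n) \<le> perron_usc q0 - \<phi> q0 + \<phi> (p n)" for n
    using perron_usc_facts(1)[OF pQ w(1), of n n] max[OF pQ, of n] by linarith
  define \<epsilon> where "\<epsilon> = (\<lambda>n. \<phi>' (q n) - \<phi> q0 + 1 / real (Suc n))"
  have "(\<lambda>n. \<phi>' (q n)) \<longlonglongrightarrow> \<phi>' q0"
    by (rule continuous_on_tendsto_compose[OF c q q0Q]) (use w(3) in auto)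
  then have eps: "\<epsilon> \<longlonglongrightarrow> \<phi>' q0 - \<phi> q0 + 0" unfolding \<epsilon>_def by (intro tendsto_intros inv)
  then have eps0: "\<epsilon> \<longlonglongrightarrow> 0" by (simp add: \<phi>'_def)
  have pen: "\<alpha> * (norm (p n - q0))\<^sup>2 \<le> \<epsilon> n" for n
    using lower[of n] upper[of n] by (simp add: \<epsilon>_def \<phi>'_def)
  have "(\<lambda>n. \<alpha> * (norm (p n - q0))\<^sup>2) \<longlonglongrightarrow> 0"
    by (rule tendsto_sandwich[OF _ _ tendsto_const eps0]) (use pen al in \<open>auto intro!: always_eventually\<close>)
  then have "(\<lambda>n. \<alpha> * (norm (p n - q0))\<^sup>2 / \<alpha>) \<longlonglongrightarrow> 0 / \<alpha>" using al by (intro tendsto_divide tendsto_const) auto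
  then have "(\<lambda>n. sqrt ((norm (p n - q0))\<^sup>2)) \<longlonglongrightarrow> sqrt 0" using al by (intro tendsto_real_sqrt) simp
  then have "(\<lambda>n. dist (p n) q0) \<longlonglongrightarrow> 0" by (simp add: dist_norm)
  then have plim: "p \<longlonglongrightarrow> q0" by (rule tendsto_dist_iff[THEN iffD2])
  have \<phi>p: "(\<lambda>n. \<phi> (p n)) \<longlonglongrightarrow> \<phi> q0"
    by (rule continuous_on_tendsto_compose[OF c\<phi> plim q0Q]) (use pQ in auto)
  have wlim: "(\<lambda>n. w n (p n)) \<longlonglongrightarrow> perron_usc q0"
  proof (rule tendsto_sandwich)
    show "\<forall>\<^sub>F n in sequentially. perron_usc q0 - \<phi> q0 + \<phi> (p n) - \<epsilon> n \<le> w n (p n)"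
    proof (intro always_eventually allI)
      fix n
      have "0 \<le> \<alpha> * (norm (p n - q0))\<^sup>2" using al by simp
      then show "perron_usc q0 - \<phi> q0 + \<phi> (p n) - \<epsilon> n \<le> w n (p n)" using lower[of n] by (simp add: \<epsilon>_def \<phi>'_def)
    qed
    show "\<forall>\<^sub>F n in sequentially. w n (p n) \<le> perron_usc q0 - \<phi> q0 + \<phi> (p n)" using upper by (intro always_eventually allI)
    have "(\<lambda>n. perron_usc q0 - \<phi> q0 + \<phi> (p n) - \<epsilon> n) \<longlonglongrightarrow> perron_usc q0 - \<phi> q0 + \<phi> q0 - 0" by (intro tendsto_intros \<phi>p eps0)
    then show "(\<lambda>n. perron_usc q0 - \<phi> q0 + \<phi> (p n) - \<epsilon> n) \<longlonglongrightarrow> perron_usc q0" by simp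
    have "(\<lambda>n. perron_usc q0 - \<phi> q0 + \<phi> (p n)) \<longlonglongrightarrow> perron_usc q0 - \<phi> q0 + \<phi> q0" by (intro tendsto_intros \<phi>p)
    then show "(\<lambda>n. perron_usc q0 - \<phi> q0 + \<phi> (p n)) \<longlonglongrightarrow> perron_usc q0" by simp
  qed
  show ?thesis
    by (intro exI[of _ w] exI[of _ p] conjI allI plim wlim w(1,2) p(1) ballI p(2)[unfolded \<phi>'_def])
qed

text \<open>If the conclusion failed with defect \<open>e\<close>, the equations of the
  approximating members would be violated in the limit: \<alpha> is so small that the quadratic term
  costs at most e/4, and the far term and the remaining terms may each be off by e/4. The data
  inequalities are strict and exclude the alternatives along the sequence.\<close>

theorem perron_usc_subsolution: "subsolution perron_usc"
  unfolding subsolution_iff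
proof (intro conjI allI impI usc_perron_usc)
  fix \<phi> G x t and \<delta> :: real
  assume a: "C1_with_gradient (Qbar \<Omega>) \<phi> G \<and> (x, t) \<in> Qbar \<Omega> \<and>
    (\<forall>q\<in>Qbar \<Omega>. perron_usc q - \<phi> q \<le> perron_usc (x, t) - \<phi> (x, t))" and d: "\<delta> > 0"
  then have \<phi>: "C1_with_gradient (Qbar \<Omega>) \<phi> G" and xt: "x \<in> K" "t \<ge> 0" by (auto simp: Qbar_def)
  show "sub_at perron_usc \<phi> G x t \<delta>"
  proof (rule ccontr)
    assume neg: "\<not> sub_at perron_usc \<phi> G x t \<delta>"
    define e where "e = E \<delta> perron_usc \<phi> G x t"
    have e: "e > 0" using neg unfolding sub_at_def e_def min_le_iff_disj by auto
    have ini: "t = 0 \<Longrightarrow> u0 x < perron_usc (x, t)" using neg frontier_not_domain unfolding sub_at_def min_le_iff_disj by auto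
    have "t > 0 \<Longrightarrow> x \<in> frontier \<Omega> \<Longrightarrow> g (x, t) < perron_usc (x, t)"
      using neg frontier_not_domain unfolding sub_at_def min_le_iff_disj by auto
    then have lat: "x \<in> frontier \<Omega> \<Longrightarrow> g (x, t) < perron_usc (x, t)" using ini compatible[of x] xt(2) by (cases "t = 0") auto
    define N where "N = nonlocal \<Omega> \<nu> (ball 0 \<delta>) (\<lambda>y. (norm (y - x))\<^sup>2) x"
    define \<alpha> where "\<alpha> = e / (4 * (\<bar>N\<bar> + 1))"
    have al: "\<alpha> > 0" using e by (simp add: \<alpha>_def)
    have "\<alpha> * N \<le> \<alpha> * (\<bar>N\<bar> + 1)" using al by (intro mult_left_mono) auto
    also have "\<alpha> * (\<bar>N\<bar> + 1) = e / 4"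
    proof -
      have "\<bar>N\<bar> + 1 \<noteq> 0" by linarith
      then show ?thesis unfolding \<alpha>_def by (simp only: times_divide_eq_left nonzero_mult_divide_mult_cancel_right not_False_eq_True)
    qed
    finally have aN: "\<alpha> * N \<le> e / 4" .
    define T where "T = t + 1"
    define \<phi>' where "\<phi>' = (\<lambda>q. \<phi> q + \<alpha> * (norm (q - (x, t)))\<^sup>2)"
    define G' where "G' = (\<lambda>q. G q + \<alpha> *\<^sub>R (2 *\<^sub>R (q - (x, t))))"
    have \<phi>': "C1_with_gradient (Qbar \<Omega>) \<phi>' G'" unfolding \<phi>'_def G'_def by (rule penalised_test_function[OF \<phi>])
    obtain w0 where w0: "w0 \<in> perron_class" using perron_class_nonempty by blast
    have q0: "(x, t) \<in> K \<times> {0..T - 1}" using xt by (simp add: T_def)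
    have mx: "perron_usc q - \<phi> q \<le> perron_usc (x, t) - \<phi> (x, t)" if "q \<in> Qbar \<Omega>" for q using a that by blast
    obtain w p where w: "\<And>n::nat. w n \<in> perron_class" "\<And>n q. w0 q \<le> w n q" and p: "\<And>n. p n \<in> K \<times> {0..T}"
      "\<And>n q. q \<in> K \<times> {0..T} \<Longrightarrow> w n q - \<phi>' q \<le> w n (p n) - \<phi>' (p n)" "p \<longlonglongrightarrow> (x, t)"
      and wlim: "(\<lambda>n. w n (p n)) \<longlonglongrightarrow> perron_usc (x, t)"
      using envelope_maximum_points[OF \<phi> q0 al mx w0] unfolding \<phi>'_def by blast
    define X where "X = (\<lambda>n. fst (p n))"
    define s where "s = (\<lambda>n. snd (p n))"
    have pe: "p n = (X n, s n)" for n by (simp add: X_def s_def)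
    have X: "X n \<in> K" and s: "s n \<in> {0..T}" for n using p(1)[of n] by (auto simp: pe)
    have Xl: "X \<longlonglongrightarrow> x" using tendsto_fst[OF p(3)] by (simp add: X_def)
    have sl: "s \<longlonglongrightarrow> t" using tendsto_snd[OF p(3)] by (simp add: s_def)
    have tT: "t \<in> {0..T}" "t < T" using xt by (auto simp: T_def)
    have s0: "s n \<ge> 0" for n using s[of n] by simp
    have xQ: "(x, t) \<in> Qbar \<Omega>" using a by blast
    have pQ: "p n \<in> Qbar \<Omega>" for n using p(1)[of n] by (auto simp: Qbar_def)
    have cG: "continuous_on (Qbar \<Omega>) G'" by (rule C1_with_gradientD(1)[OF \<phi>'])
    have Gl: "(\<lambda>n. G' (p n)) \<longlonglongrightarrow> G (x, t)"
      using continuous_on_tendsto_compose[OF cG p(3) xQ] pQ by (simp add: G'_def)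
    have fl: "(\<lambda>n. f (p n)) \<longlonglongrightarrow> f (x, t)"
      by (rule continuous_on_tendsto_compose[OF f_continuous p(3) xQ]) (use pQ in auto)
    have Hl: "(\<lambda>n. H (X n) (w n (p n)) (fst (G' (p n)))) \<longlonglongrightarrow> H x (perron_usc (x, t)) (fst (G (x, t)))"
      by (rule H_tendsto[OF Xl wlim tendsto_fst[OF Gl] X xt(1)])
    have "(\<lambda>n. nonlocal \<Omega> \<nu> (ball 0 \<delta>) (\<lambda>y. \<phi>' (y, s n)) (X n)) \<longlonglongrightarrow> nonlocal \<Omega> \<nu> (ball 0 \<delta>) (\<lambda>y. \<phi>' (y, t)) x"
      by (rule nonlocal_near_tendsto[OF \<phi>' d X Xl xt(1) s sl tT(1)])
    then have Nl: "(\<lambda>n. nonlocal \<Omega> \<nu> (ball 0 \<delta>) (\<lambda>y. \<phi>' (y, s n)) (X n))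
        \<longlonglongrightarrow> nonlocal \<Omega> \<nu> (ball 0 \<delta>) (\<lambda>y. \<phi> (y, t)) x + \<alpha> * N"
      unfolding \<phi>'_def nonlocal_penalised[OF \<phi> xt d] N_def .
    obtain C0 where C0: "\<And>q. q \<in> K \<times> {0..T} \<Longrightarrow> \<bar>w0 q\<bar> \<le> C0"
      using continuous_bounded_on_K_times w0 unfolding perron_class_def by blast
    obtain C1 where C1: "\<And>q. q \<in> K \<times> {0..T} \<Longrightarrow> \<bar>perron_usc q\<bar> \<le> C1" using perron_bounded[of T] by blast
    define C where "C = max C0 C1"
    have wU: "w n q \<le> perron_usc q" if "q \<in> K \<times> {0..T}" for n q
      using perron_usc_facts(1)[OF _ w(1), of q n] that by (auto simp: Qbar_def)
    have C: "\<bar>w n q\<bar> \<le> C" "\<bar>perron_usc q\<bar> \<le> C" if "q \<in> K \<times> {0..T}" for n q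
      using C0[OF that] C1[OF that] w(2)[of q n] wU[OF that, of n] by (auto simp: C_def abs_le_iff)
    have "\<forall>\<^sub>F n in sequentially. nonlocal \<Omega> \<nu> (- ball 0 \<delta>) (\<lambda>y. w n (y, s n)) (X n)
        \<le> average \<delta> (\<lambda>y. perron_usc (y, t)) x - perron_usc (x, t) * mass \<delta> x + e / 4"
    proof (rule nonlocal_far_limit_le[where U = perron_usc and T = T and C = C, OF _ C(2) d X Xl xt(1) s sl tT(1)])
      show "usc_on (K \<times> {0..T}) perron_usc" by (rule usc_on_subset[OF usc_perron_usc]) (auto simp: Qbar_def)
      show "borel_K (\<lambda>y. w n (y, s n))" for n
        using w(1)[of n] continuous_slice[OF _ s0] by (auto simp: perron_class_def intro: continuous_imp_borel_K)
      show "\<bar>w n (y, s n)\<bar> \<le> C" "w n (y, s n) \<le> perron_usc (y, s n)" if "y \<in> K" for n y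
        using C(1)[of "(y, s n)" n] wU[of "(y, s n)" n] that s[of n] by auto
      show "(\<lambda>n. w n (X n, s n)) \<longlonglongrightarrow> perron_usc (x, t)" using wlim by (simp add: pe)
    qed (use e in auto)
    then have far: "\<forall>\<^sub>F n in sequentially. nonlocal \<Omega> \<nu> (- ball 0 \<delta>) (\<lambda>y. w n (y, s n)) (X n)
        \<le> nonlocal \<Omega> \<nu> (- ball 0 \<delta>) (\<lambda>y. perron_usc (y, t)) x + e / 4"
      unfolding nonlocal_far_perron_usc[OF xt d] .
    define Z where "Z = (\<lambda>n. snd (G' (p n)) - nonlocal \<Omega> \<nu> (ball 0 \<delta>) (\<lambda>y. \<phi>' (y, s n)) (X n)
      + H (X n) (w n (p n)) (fst (G' (p n))) - f (p n))"
    have "Z \<longlonglongrightarrow> snd (G (x, t)) - (nonlocal \<Omega> \<nu> (ball 0 \<delta>) (\<lambda>y. \<phi> (y, t)) x + \<alpha> * N)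
        + H x (perron_usc (x, t)) (fst (G (x, t))) - f (x, t)"
      unfolding Z_def by (intro tendsto_intros tendsto_snd[OF Gl] Nl Hl fl)
    then have "\<forall>\<^sub>F n in sequentially. snd (G (x, t)) - (nonlocal \<Omega> \<nu> (ball 0 \<delta>) (\<lambda>y. \<phi> (y, t)) x + \<alpha> * N)
        + H x (perron_usc (x, t)) (fst (G (x, t))) - f (x, t) - e / 4 < Z n"
      by (rule order_tendstoD(1)) (use e in simp)
    moreover have "\<forall>\<^sub>F n in sequentially. X n \<in> frontier \<Omega> \<longrightarrow> g (X n, s n) < w n (p n)"
      by (rule lateral_eventually[OF X Xl xt(1) s0 sl xt(2) wlim lat])
    moreover have "\<forall>\<^sub>F n in sequentially. s n = 0 \<longrightarrow> u0 (X n) < w n (p n)"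
      by (rule initial_eventually[OF X Xl xt(1) s0 sl xt(2) wlim ini])
    moreover have "\<forall>\<^sub>F n in sequentially. s n < T" by (rule order_tendstoD(2)[OF sl tT(2)])
    ultimately have "\<forall>\<^sub>F n in sequentially. False" using far
    proof eventually_elim
      case (elim n)
      have wn: "subsolution (w n)" using w(1)[of n] by (simp add: perron_class_def)
      have "sub_at (w n) \<phi>' G' (X n) (s n) \<delta>"
        by (rule sub_at_local[OF wn \<phi>' X s0 elim(4) d]) (use p(2)[of _ n] in \<open>simp add: pe\<close>)
      then have "E \<delta> (w n) \<phi>' G' (X n) (s n) \<le> 0"
        using elim(2,3) s0[of n] K_cases[OF X, of n] unfolding sub_at_def min_le_iff_disj pe
        by (cases "s n = 0") auto
      then have "Z n - nonlocal \<Omega> \<nu> (- ball 0 \<delta>) (\<lambda>y. w n (y, s n)) (X n) \<le> 0"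
        by (simp add: visc_E_def Z_def pe)
      moreover have "e = snd (G (x, t)) - nonlocal \<Omega> \<nu> (ball 0 \<delta>) (\<lambda>y. \<phi> (y, t)) x
          - nonlocal \<Omega> \<nu> (- ball 0 \<delta>) (\<lambda>y. perron_usc (y, t)) x + H x (perron_usc (x, t)) (fst (G (x, t))) - f (x, t)"
        by (simp add: e_def visc_E_def)
      ultimately show False using elim(1,5) aN e by linarith
    qed
    then show False by simp
  qed
qed

lemma continuous_boundary_approx:
  assumes w: "continuous_on (Qbar \<Omega>) w" and q: "q \<in> Qbar \<Omega>" and e: "e > 0"
  shows "\<exists>x\<in>\<Omega>. dist x (fst q) < e \<and> w q < w (x, snd q) + e"
proof -
  obtain d where d: "d > 0" "\<And>p. p \<in> Qbar \<Omega> \<Longrightarrow> dist p q < d \<Longrightarrow> dist (w p) (w q) < e"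
    using w q e unfolding continuous_on_iff by blast
  have q': "fst q \<in> K" "snd q \<ge> 0" using q by (auto simp: Qbar_def)
  have "min d e > 0" using d(1) e by simp
  then obtain x where x: "x \<in> \<Omega>" "dist x (fst q) < min d e" using q'(1) closure_approachable[of "fst q" \<Omega>] by blast
  have "dist (x, snd q) q = dist x (fst q)" by (cases q) (simp add: dist_Pair_Pair)
  moreover have "(x, snd q) \<in> Qbar \<Omega>" using x(1) domain_subset_K q'(2) by (auto simp: Qbar_def)
  ultimately have "dist (w (x, snd q)) (w q) < e" using d(2) x(2) by simp
  then have "w q < w (x, snd q) + e" by (simp add: dist_real_def abs_less_iff)
  then show ?thesis using x by auto
qed

end

context coercive_equation
begin

lemma boundary_regular_continuous:
  assumes "continuous_on (Qbar \<Omega>) w" shows "boundary_regular w"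
  unfolding boundary_regular_def
proof (intro ballI allI impI)
  fix y and t e :: real assume y: "y \<in> frontier \<Omega>" "0 \<le> t" "e > 0"
  then have "(y, t) \<in> Qbar \<Omega>" using frontier_subset_K by (auto simp: Qbar_def)
  from continuous_boundary_approx[OF assms this y(3)] obtain x where "x \<in> \<Omega>" "dist x y < e" "w (y, t) < w (x, t) + e" by auto
  then show "\<exists>x\<in>\<Omega>. \<exists>s\<ge>0. dist x y < e \<and> \<bar>s - t\<bar> < e \<and> w (y, t) < w (x, s) + e"
    using y by (intro bexI[of _ x] exI[of _ t]) auto
qed

text \<open>A member that nearly attains the envelope does so at a nearby point of space-time; by
  continuity it keeps that value, up to a small error, at an interior point at the same time, and
  the envelope lies above it there.\<close>

lemma boundary_regular_perron_usc: "boundary_regular perron_usc"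
  unfolding boundary_regular_def
proof (intro ballI allI impI)
  fix y and t e :: real assume y: "y \<in> frontier \<Omega>" "0 \<le> t" "e > 0"
  then have yQ: "(y, t) \<in> Qbar \<Omega>" using frontier_subset_K by (auto simp: Qbar_def)
  obtain w q where w: "w \<in> perron_class" "q \<in> Qbar \<Omega>" "dist q (y, t) < e / 2" "perron_usc (y, t) - e / 2 < w q"
    using perron_usc_facts(3)[OF yQ, of "e / 2" "perron_usc (y, t) - e / 2"] y(3) by auto
  obtain x where x: "x \<in> \<Omega>" "dist x (fst q) < e / 2" "w q < w (x, snd q) + e / 2"
    using continuous_boundary_approx[of w q "e / 2"] w y(3) unfolding perron_class_def by auto
  have s: "snd q \<ge> 0" using w(2) by (auto simp: Qbar_def)
  then have "(x, snd q) \<in> Qbar \<Omega>" using x(1) domain_subset_K by (auto simp: Qbar_def)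
  then have "w (x, snd q) \<le> perron_usc (x, snd q)" by (rule perron_usc_facts(1)[OF _ w(1)])
  moreover have "dist (fst q) y \<le> dist q (y, t)" using dist_fst_le[of q "(y, t)"] by simp
  then have "dist x y < e" using dist_triangle[of x y "fst q"] x(2) w(3) by linarith
  moreover have "\<bar>snd q - t\<bar> \<le> dist q (y, t)" using dist_snd_le[of q "(y, t)"] by (simp add: dist_real_def)
  then have "\<bar>snd q - t\<bar> < e" using w(3) y(3) by linarith
  ultimately show "\<exists>x\<in>\<Omega>. \<exists>s\<ge>0. dist x y < e \<and> \<bar>s - t\<bar> < e \<and> perron_usc (y, t) < perron_usc (x, s) + e"
    using w(4) x s by (intro bexI[of _ x] exI[of _ "snd q"]) auto
qed

end

section \<open>The supremum is a supersolution\<close>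

context equation
begin

lemma lsc_perron: "lsc_on (Qbar \<Omega>) perron"
  unfolding lsc_on_def
proof (intro ballI allI impI)
  fix q a assume q: "q \<in> Qbar \<Omega>" "a < perron q"
  then obtain w where w: "w \<in> perron_class" "a < w q" using perron_approx by blast
  then have "(w \<longlongrightarrow> w q) (at q within Qbar \<Omega>)" using q(1) by (auto simp: perron_class_def continuous_on_def)
  then have "\<forall>\<^sub>F y in at q within Qbar \<Omega>. a < w y" by (rule order_tendstoD(1)[OF _ w(2)])
  moreover have "\<forall>\<^sub>F y in at q within Qbar \<Omega>. y \<in> Qbar \<Omega>" by (simp add: eventually_at_filter)
  ultimately show "\<forall>\<^sub>F y in at q within Qbar \<Omega>. a < perron y"
    by eventually_elim (use perron_upper[OF w(1)] in \<open>auto intro: less_le_trans\<close>)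
qed

lemma perron_class_finite_max:
  assumes "finite F" "F \<subseteq> perron_class"
  shows "\<exists>w\<in>perron_class. \<forall>v\<in>F. \<forall>q. v q \<le> w q"
  using assms
proof (induction F)
  case empty
  then show ?case using perron_class_nonempty by blast
next
  case (insert v F)
  then obtain w where w: "w \<in> perron_class" "\<forall>v\<in>F. \<forall>q. v q \<le> w q" by blast
  have "(\<lambda>q. max (v q) (w q)) \<in> perron_class" by (rule perron_class_max) (use insert.prems w in auto)
  moreover have "\<forall>v'\<in>insert v F. \<forall>q. v' q \<le> max (v q) (w q)" using w(2) by (auto simp: le_max_iff_disj)
  ultimately show ?case by (intro bexI[of _ "\<lambda>q. max (v q) (w q)"])
qed

text \<open>A Dini argument: each point has a member above \<open>c\<close> on a neighbourhood,
  finitely many neighbourhoods cover \<open>P\<close>, and the class is closed under finite maxima.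
  The result is one continuous member where the supremum alone would be only lower
  semicontinuous.\<close>

lemma perron_above_continuous:
  assumes P: "compact P" "P \<subseteq> Qbar \<Omega>" and c: "continuous_on P c" "\<And>q. q \<in> P \<Longrightarrow> c q < perron q"
  shows "\<exists>w\<in>perron_class. \<forall>q\<in>P. c q < w q"
proof -
  have "\<forall>q\<in>P. \<exists>z. fst z \<in> perron_class \<and> open (snd z) \<and> q \<in> snd z \<and> (\<forall>p\<in>snd z \<inter> P. c p < fst z p)"
  proof
    fix q assume q: "q \<in> P"
    obtain w where w: "w \<in> perron_class" "c q < w q" using perron_approx c(2)[OF q] P(2) q by blast
    have "continuous_on P (\<lambda>p. w p - c p)"
      using w(1) by (intro continuous_on_diff c(1)) (auto simp: perron_class_def intro: continuous_on_subset[OF _ P(2)])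
    then have "\<exists>A. open A \<and> A \<inter> P = (\<lambda>p. w p - c p) -` {0<..} \<inter> P"
      unfolding continuous_on_open_invariant by (rule allE[of _ "{0<..}"]) auto
    then obtain A where A: "open A" "A \<inter> P = (\<lambda>p. w p - c p) -` {0<..} \<inter> P" by blast
    have "q \<in> (\<lambda>p. w p - c p) -` {0<..} \<inter> P" using q w(2) by simp
    then have "q \<in> A" using A(2) by blast
    moreover have "c p < w p" if "p \<in> A \<inter> P" for p using that unfolding A(2) by simp
    ultimately show "\<exists>z. fst z \<in> perron_class \<and> open (snd z) \<and> q \<in> snd z \<and> (\<forall>p\<in>snd z \<inter> P. c p < fst z p)"
      using w(1) A(1) by (intro exI[of _ "(w, A)"]) simp
  qed
  from bchoice[OF this] obtain z where z: "\<forall>q\<in>P. fst (z q) \<in> perron_class \<and> open (snd (z q)) \<and> q \<in> snd (z q) \<and>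
    (\<forall>p\<in>snd (z q) \<inter> P. c p < fst (z q) p)" by blast
  define w where "w = (\<lambda>q. fst (z q))"
  define A where "A = (\<lambda>q. snd (z q))"
  have w: "\<And>q. q \<in> P \<Longrightarrow> w q \<in> perron_class" and A: "\<And>q. q \<in> P \<Longrightarrow> open (A q)"
    "\<And>q. q \<in> P \<Longrightarrow> q \<in> A q" "\<And>q p. q \<in> P \<Longrightarrow> p \<in> A q \<Longrightarrow> p \<in> P \<Longrightarrow> c p < w q p"
    using z unfolding w_def A_def by blast+
  have "P \<subseteq> (\<Union>q\<in>P. A q)" using A(2) by blast
  from compactE_image[OF P(1) A(1) this] obtain D where D: "D \<subseteq> P" "finite D" "P \<subseteq> (\<Union>q\<in>D. A q)" .
  obtain v where v: "v \<in> perron_class" "\<forall>u\<in>w ` D. \<forall>q. u q \<le> v q"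
    using perron_class_finite_max[of "w ` D"] D w by blast
  have "c p < v p" if p: "p \<in> P" for p
  proof -
    obtain q where q: "q \<in> D" "p \<in> A q" using D(3) p by blast
    then have "c p < w q p" using A(3) D(1) p by blast
    also have "w q p \<le> v p" using v(2) q(1) by blast
    finally show ?thesis .
  qed
  then show ?thesis using v(1) by blast
qed

text \<open>Approximation of the lower semicontinuous supremum from below, lowered further by a
  small constant to make the inequality strict. The far integral at the given point suffers by less
  than \<open>e\<close>.\<close>

lemma perron_minorant:
  assumes x: "x \<in> K" "t \<in> {0..T}" and d: "\<delta> > 0" and e: "e > 0"
  shows "\<exists>c. continuous_on (K \<times> {0..T}) c \<and> (\<forall>q\<in>K \<times> {0..T}. c q < perron q) \<and>
    nonlocal \<Omega> \<nu> (- ball 0 \<delta>) (\<lambda>y. perron (y, t)) x < average \<delta> (\<lambda>y. c (y, t)) x - perron (x, t) * mass \<delta> x + e"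
proof -
  obtain C where C: "\<And>q. q \<in> K \<times> {0..T} \<Longrightarrow> \<bar>perron q\<bar> \<le> C" using perron_bounded[of T] by blast
  have "usc_on (K \<times> {0..T}) (\<lambda>q. - perron q)"
    by (rule usc_on_subset[OF lsc_perron[unfolded lsc_on_iff_usc_on_minus]]) (auto simp: Qbar_def)
  moreover have "\<bar>- perron q\<bar> \<le> C" if "q \<in> K \<times> {0..T}" for q using C[OF that] by simp
  ultimately obtain b :: "nat \<Rightarrow> 'a \<times> real \<Rightarrow> real" where b: "\<And>n. continuous_on (K \<times> {0..T}) (b n)"
    "\<And>n q. q \<in> K \<times> {0..T} \<Longrightarrow> - perron q \<le> b n q" "\<And>n q. q \<in> K \<times> {0..T} \<Longrightarrow> b n q \<le> C"
    "\<And>q. q \<in> K \<times> {0..T} \<Longrightarrow> (\<lambda>n. b n q) \<longlonglongrightarrow> - perron q"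
    using usc_approximation_from_above[of "K \<times> {0..T}" "\<lambda>q. - perron q" C] by blast
  have bC: "\<bar>b n (y, t)\<bar> \<le> C" if "y \<in> K" for n y
    using b(2,3)[of "(y, t)" n] C[of "(y, t)"] that x(2) by auto
  have bb: "borel_K (\<lambda>y. b n (y, t))" for n
    by (rule continuous_imp_borel_K, rule continuous_on_compose2[OF b(1)[of n]])
       (use x(2) in \<open>auto intro!: continuous_intros\<close>)
  have lim: "(\<lambda>n. b n (y, t)) \<longlonglongrightarrow> - perron (y, t)" if "y \<in> K" for y using b(4) that x(2) by auto
  have "borel_K (\<lambda>y. - perron (y, t))" by (rule borel_K_limit[OF bb lim])
  from borel_K_minus[OF this] have pb: "borel_K (\<lambda>y. perron (y, t))" by simp
  have "(\<lambda>n. average \<delta> (\<lambda>y. b n (y, t)) x) \<longlonglongrightarrow> average \<delta> (\<lambda>y. - perron (y, t)) x"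
    by (rule average_dominated_convergence[OF bb bC lim d x(1)])
  then have "\<forall>\<^sub>F n in sequentially. average \<delta> (\<lambda>y. b n (y, t)) x < average \<delta> (\<lambda>y. - perron (y, t)) x + e / 2"
    by (rule order_tendstoD(2)) (use e in simp)
  then obtain n where n: "average \<delta> (\<lambda>y. b n (y, t)) x < average \<delta> (\<lambda>y. - perron (y, t)) x + e / 2"
    by (auto simp: eventually_sequentially)
  define \<eta> where "\<eta> = e / (2 * (mass \<delta> x + 1))"
  have m1: "mass \<delta> x + 1 > 0" using mass_nonneg[of \<delta> x] by simp
  then have eta: "\<eta> > 0" using e by (simp add: \<eta>_def)
  have eta2: "\<eta> * (mass \<delta> x + 1) = e / 2"
    unfolding \<eta>_def using m1 by (simp only: times_divide_eq_left nonzero_mult_divide_mult_cancel_right less_imp_neq[symmetric] not_False_eq_True)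
  have etam: "\<eta> * mass \<delta> x \<le> e / 2" using eta eta2 by (simp add: algebra_simps)
  define c where "c = (\<lambda>q. - b n q - \<eta>)"
  have cc: "continuous_on (K \<times> {0..T}) c" unfolding c_def by (intro continuous_intros b(1))
  have clt: "c q < perron q" if "q \<in> K \<times> {0..T}" for q using b(2)[OF that, of n] eta by (simp add: c_def)
  have cb: "borel_K (\<lambda>y. c (y, t))"
    by (rule continuous_imp_borel_K, rule continuous_on_compose2[OF cc]) (use x(2) in \<open>auto intro!: continuous_intros\<close>)
  have "\<bar>average \<delta> (\<lambda>y. c (y, t)) x - average \<delta> (\<lambda>y. - b n (y, t)) x\<bar> \<le> \<eta> * mass \<delta> x"
  proof (rule average_diff_le[OF cb borel_K_minus[OF bb] _ _ d x(1)])
    fix y assume "y \<in> K"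
    from bC[OF this, of n] show "\<bar>c (y, t)\<bar> \<le> C + \<eta>" "\<bar>- b n (y, t)\<bar> \<le> C + \<eta>" "\<bar>c (y, t) - - b n (y, t)\<bar> \<le> \<eta>"
      using eta by (auto simp: c_def abs_le_iff)
  qed
  moreover have "nonlocal \<Omega> \<nu> (- ball 0 \<delta>) (\<lambda>y. perron (y, t)) x = average \<delta> (\<lambda>y. perron (y, t)) x - perron (x, t) * mass \<delta> x"
    by (rule nonlocal_far[where C = C]) (use pb C x d in auto)
  ultimately have "nonlocal \<Omega> \<nu> (- ball 0 \<delta>) (\<lambda>y. perron (y, t)) x < average \<delta> (\<lambda>y. c (y, t)) x - perron (x, t) * mass \<delta> x + e"
    using n etam unfolding average_minus by linarith
  then show ?thesis using cc clt by blast
qed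

text \<open>Enlarging the region in which the test function is used only weakens the subsolution
  inequality, because the two integrands are ordered.\<close>

lemma nonlocal_compare:
  assumes \<phi>: "C1_with_gradient (Qbar \<Omega>) \<phi> F" and \<psi>: "C1_with_gradient (Qbar \<Omega>) \<psi> G" and W: "continuous_on (Qbar \<Omega>) W"
    and c: "continuous_on K c" and x: "x \<in> K" "0 \<le> t" and d: "\<delta> > 0" "\<delta>' > 0"
    and le: "\<And>y. y \<in> K \<Longrightarrow> \<phi> (y, t) - \<phi> (x, t) \<le> W (y, t) - W (x, t)" "\<And>y. y \<in> K \<Longrightarrow> c y \<le> W (y, t)"
      "\<And>y. y \<in> K \<Longrightarrow> W (y, t) - W (x, t) \<le> \<psi> (y, t) - \<psi> (x, t)"
  shows "nonlocal \<Omega> \<nu> (ball 0 \<delta>) (\<lambda>y. \<phi> (y, t)) x + average \<delta> c x - W (x, t) * mass \<delta> x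
    \<le> nonlocal \<Omega> \<nu> (ball 0 \<delta>') (\<lambda>y. \<psi> (y, t)) x + nonlocal \<Omega> \<nu> (- ball 0 \<delta>') (\<lambda>y. W (y, t)) x"
proof -
  have split: "set_integrable (\<nu> x) {z. x + z \<in> K} (\<lambda>z. if z \<in> near \<delta> x then a z else b z) \<and>
     (LINT z:{z. x + z \<in> K}|\<nu> x. (if z \<in> near \<delta> x then a z else b z)) = (LINT z:near \<delta> x|\<nu> x. a z) + (LINT z:far \<delta> x|\<nu> x. b z)"
    if "set_integrable (\<nu> x) (near \<delta> x) a" "set_integrable (\<nu> x) (far \<delta> x) b" for \<delta> and a b :: "'a \<Rightarrow> real"
  proof -
    let ?h = "\<lambda>z. if z \<in> near \<delta> x then a z else b z"
    have dj: "near \<delta> x \<inter> far \<delta> x = {}" by (auto simp: near_def far_def)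
    have un: "{z. x + z \<in> K} = near \<delta> x \<union> far \<delta> x" by (auto simp: near_def far_def)
    have e: "indicator (near \<delta> x) z *\<^sub>R ?h z = indicator (near \<delta> x) z *\<^sub>R a z"
      "indicator (far \<delta> x) z *\<^sub>R ?h z = indicator (far \<delta> x) z *\<^sub>R b z" for z
      using dj by (auto simp: indicator_def)
    have i: "set_integrable (\<nu> x) (near \<delta> x) ?h" "set_integrable (\<nu> x) (far \<delta> x) ?h"
      using that unfolding set_integrable_def e .
    have "set_integrable (\<nu> x) {z. x + z \<in> K} ?h"
      unfolding un by (rule set_integrable_Un[OF i]) (use sets_kernel[OF x(1)] in auto)
    moreover have "(LINT z:{z. x + z \<in> K}|\<nu> x. ?h z) = (LINT z:near \<delta> x|\<nu> x. ?h z) + (LINT z:far \<delta> x|\<nu> x. ?h z)"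
      unfolding un by (rule set_integral_Un[OF dj i])
    ultimately show ?thesis unfolding set_lebesgue_integral_def e by blast
  qed
  have sl: "continuous_on K (\<lambda>y. W (y, t))" by (rule continuous_slice[OF W x(2)])
  obtain C1 where C1: "\<And>y. y \<in> K \<Longrightarrow> \<bar>W (y, t)\<bar> \<le> C1"
    using continuous_bounded_on_K_times[OF W, of t] x(2) by fastforce
  have "bounded (c ` K)" using c compact_K compact_continuous_image compact_imp_bounded by blast
  then obtain C2 where C2: "\<And>y. y \<in> K \<Longrightarrow> \<bar>c y\<bar> \<le> C2" unfolding bounded_iff by auto
  have ic: "set_integrable (\<nu> x) (far \<delta> x) (\<lambda>z. c (x + z))"
    by (rule far_integrable[OF continuous_imp_borel_K[OF c] C2 d(1) x(1)])
  have if1: "set_integrable (\<nu> x) (far \<delta> x) (\<lambda>z. c (x + z) - W (x, t))"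
    by (intro set_integral_diff ic far_integrable_const d x)
  have iW: "set_integrable (\<nu> x) (far \<delta>' x) (\<lambda>z. W (x + z, t) - W (x, t))"
    by (intro set_integral_diff far_integrable_const far_integrable[OF continuous_imp_borel_K[OF sl] C1] d x)
  note A = split[OF test_function_near_integrable[OF \<phi> x d(1)] if1]
  note B = split[OF test_function_near_integrable[OF \<psi> x d(2)] iW]
  have "(LINT z:{z. x + z \<in> K}|\<nu> x. (if z \<in> near \<delta> x then \<phi> (x + z, t) - \<phi> (x, t) else c (x + z) - W (x, t)))
    \<le> (LINT z:{z. x + z \<in> K}|\<nu> x. (if z \<in> near \<delta>' x then \<psi> (x + z, t) - \<psi> (x, t) else W (x + z, t) - W (x, t)))"
  proof (rule set_integral_mono[OF A[THEN conjunct1] B[THEN conjunct1]])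
    fix z assume "z \<in> {z. x + z \<in> K}"
    then have z: "x + z \<in> K" by simp
    have "(if z \<in> near \<delta> x then \<phi> (x + z, t) - \<phi> (x, t) else c (x + z) - W (x, t)) \<le> W (x + z, t) - W (x, t)"
      using le(1,2)[OF z] by simp
    also have "\<dots> \<le> (if z \<in> near \<delta>' x then \<psi> (x + z, t) - \<psi> (x, t) else W (x + z, t) - W (x, t))"
      using le(3)[OF z] by simp
    finally show "(if z \<in> near \<delta> x then \<phi> (x + z, t) - \<phi> (x, t) else c (x + z) - W (x, t))
      \<le> (if z \<in> near \<delta>' x then \<psi> (x + z, t) - \<psi> (x, t) else W (x + z, t) - W (x, t))" .
  qed
  moreover have "(LINT z:far \<delta> x|\<nu> x. c (x + z) - W (x, t)) = average \<delta> c x - W (x, t) * mass \<delta> x"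
    using set_integral_diff(2)[OF ic far_integrable_const[OF d(1) x(1)]]
    by (simp add: average_def set_integral_far_const[OF d(1) x(1)])
  moreover have "nonlocal \<Omega> \<nu> (ball 0 \<delta>) (\<lambda>y. \<phi> (y, t)) x = (LINT z:near \<delta> x|\<nu> x. \<phi> (x + z, t) - \<phi> (x, t))"
    "nonlocal \<Omega> \<nu> (ball 0 \<delta>') (\<lambda>y. \<psi> (y, t)) x = (LINT z:near \<delta>' x|\<nu> x. \<psi> (x + z, t) - \<psi> (x, t))"
    "nonlocal \<Omega> \<nu> (- ball 0 \<delta>') (\<lambda>y. W (y, t)) x = (LINT z:far \<delta>' x|\<nu> x. W (x + z, t) - W (x, t))"
    by (simp_all add: nonlocal_def near_def far_def)
  ultimately show ?thesis unfolding A[THEN conjunct2] B[THEN conjunct2] by linarith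
qed

text \<open>The operator at the raised test function \<open>\<phi> + \<kappa>\<close>, but with the
  continuous minorant \<open>c\<close> in the far integral. This makes the residual continuous in
  point and height, and it bounds the operator of every function that lies above
  \<open>c\<close>.\<close>

definition bump_residual where
  "bump_residual \<phi> G c \<delta> \<kappa> x t = snd (G (x, t)) - nonlocal \<Omega> \<nu> (ball 0 \<delta>) (\<lambda>y. \<phi> (y, t)) x
     - (average \<delta> (\<lambda>y. c (y, t)) x - (\<phi> (x, t) + \<kappa>) * mass \<delta> x)
     + H x (\<phi> (x, t) + \<kappa>) (fst (G (x, t))) - f (x, t)"

definition bump_admissible where
  "bump_admissible \<phi> G c \<delta> \<kappa> x t \<longleftrightarrow> bump_residual \<phi> G c \<delta> \<kappa> x t < 0 \<and>
     (x \<in> frontier \<Omega> \<longrightarrow> \<phi> (x, t) + \<kappa> < g (x, t)) \<and> (t = 0 \<longrightarrow> \<phi> (x, t) + \<kappa> < u0 x)"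

lemma bump_admissible_near:
  assumes \<phi>: "C1_with_gradient (Qbar \<Omega>) \<phi> G" and c: "continuous_on (K \<times> {0..T}) c" and d: "\<delta> > 0"
    and x: "x \<in> K" "t \<in> {0..T}" and adm: "bump_admissible \<phi> G c \<delta> 0 x t"
  shows "\<exists>r>0. \<forall>y\<in>K. \<forall>s\<in>{0..T}. \<forall>\<kappa>\<in>{0..r}. dist (y, s) (x, t) \<le> r \<longrightarrow> bump_admissible \<phi> G c \<delta> \<kappa> y s"
proof (rule ccontr)
  assume neg: "\<not> ?thesis"
  have "\<exists>y s \<kappa>. y \<in> K \<and> s \<in> {0..T} \<and> \<kappa> \<in> {0..1 / real (Suc n)} \<and> dist (y, s) (x, t) \<le> 1 / real (Suc n) \<and>
    \<not> bump_admissible \<phi> G c \<delta> \<kappa> y s" for n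
  proof -
    have "1 / real (Suc n) > 0" by simp
    then show ?thesis using neg by meson
  qed
  then obtain X s \<kappa> where X: "\<And>n. X n \<in> K" and s: "\<And>n. s n \<in> {0..T}" and k: "\<And>n. \<kappa> n \<in> {0..1 / real (Suc n)}"
    and q: "\<And>n. dist (X n, s n) (x, t) \<le> 1 / real (Suc n)" and bad: "\<And>n. \<not> bump_admissible \<phi> G c \<delta> (\<kappa> n) (X n) (s n)"
    by metis
  have inv: "(\<lambda>n. 1 / real (Suc n)) \<longlonglongrightarrow> 0" using LIMSEQ_inverse_real_of_nat by (simp add: inverse_eq_divide)
  have "(\<lambda>n. dist (X n, s n) (x, t)) \<longlonglongrightarrow> 0"
    by (rule tendsto_sandwich[OF _ _ tendsto_const inv]) (use q in \<open>auto intro!: always_eventually\<close>)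
  then have ql: "(\<lambda>n. (X n, s n)) \<longlonglongrightarrow> (x, t)" by (rule tendsto_dist_iff[THEN iffD2])
  have Xl: "X \<longlonglongrightarrow> x" using tendsto_fst[OF ql] by simp
  have sl: "s \<longlonglongrightarrow> t" using tendsto_snd[OF ql] by simp
  have kl: "\<kappa> \<longlonglongrightarrow> 0"
    by (rule tendsto_sandwich[OF _ _ tendsto_const inv]) (use k in \<open>auto intro!: always_eventually\<close>)
  have t0: "t \<ge> 0" and s0: "\<And>n. s n \<ge> 0" using x(2) s by auto
  have xQ: "(x, t) \<in> Qbar \<Omega>" and qQ: "\<And>n. (X n, s n) \<in> Qbar \<Omega>" using x X s0 t0 by (auto simp: Qbar_def)
  have cont: "((\<lambda>n. h (X n, s n)) \<longlonglongrightarrow> h (x, t))" if "continuous_on (Qbar \<Omega>) h" for h :: "'a \<times> real \<Rightarrow> 'b::topological_space"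
    by (rule continuous_on_tendsto_compose[OF that ql xQ]) (use qQ in auto)
  have Gl: "(\<lambda>n. G (X n, s n)) \<longlonglongrightarrow> G (x, t)" by (rule cont[OF C1_with_gradientD(1)[OF \<phi>]])
  have "(\<lambda>n. \<phi> (X n, s n)) \<longlonglongrightarrow> \<phi> (x, t)" by (rule cont[OF C1_with_gradient_imp_continuous_on[OF \<phi>]])
  then have pl: "(\<lambda>n. \<phi> (X n, s n) + \<kappa> n) \<longlonglongrightarrow> \<phi> (x, t) + 0" by (intro tendsto_intros kl)
  have "(\<lambda>n. bump_residual \<phi> G c \<delta> (\<kappa> n) (X n) (s n)) \<longlonglongrightarrow> bump_residual \<phi> G c \<delta> 0 x t"
    unfolding bump_residual_def
    by (intro tendsto_intros tendsto_fst[OF Gl] tendsto_snd[OF Gl] pl cont[OF f_continuous] nonlocal_near_tendsto[OF \<phi> d X Xl x(1) s sl x(2)]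
        average_tendsto[OF c d X Xl x(1) s sl x(2)] mass_tendsto[OF d X Xl x(1)] H_tendsto[OF Xl pl tendsto_fst[OF Gl] X x(1)])
  then have "\<forall>\<^sub>F n in sequentially. bump_residual \<phi> G c \<delta> (\<kappa> n) (X n) (s n) < 0"
    by (rule order_tendstoD(2)) (use adm in \<open>simp add: bump_admissible_def\<close>)
  moreover have "\<forall>\<^sub>F n in sequentially. X n \<in> frontier \<Omega> \<longrightarrow> - g (X n, s n) < - (\<phi> (X n, s n) + \<kappa> n)"
    by (rule equation.lateral_eventually[OF dual X Xl x(1) s0 sl t0 tendsto_minus[OF pl]])
       (use adm in \<open>simp add: bump_admissible_def\<close>)
  moreover have "\<forall>\<^sub>F n in sequentially. s n = 0 \<longrightarrow> - u0 (X n) < - (\<phi> (X n, s n) + \<kappa> n)"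
    by (rule equation.initial_eventually[OF dual X Xl x(1) s0 sl t0 tendsto_minus[OF pl]])
       (use adm in \<open>simp add: bump_admissible_def\<close>)
  ultimately have "\<forall>\<^sub>F n in sequentially. False"
  proof eventually_elim
    case (elim n)
    then show ?case using bad[of n] unfolding bump_admissible_def by auto
  qed
  then show False by simp
qed

text \<open>The condition \<open>out\<close> makes the two branches agree on the sphere of radius
  \<rho>, so the glued function is continuous. Where it equals \<open>w\<close>, raising
  \<open>w\<close> elsewhere preserves the inequality; elsewhere it equals
  \<open>\<phi> + \<kappa>\<close>, and admissibility applies.\<close>

lemma bump_subsolution:
  assumes w: "w \<in> perron_class" and \<phi>: "C1_with_gradient (Qbar \<Omega>) \<phi> G" and T: "t + 1 \<le> T" "t \<ge> 0"
    and c: "continuous_on (K \<times> {0..T}) c" "\<And>q. q \<in> K \<times> {0..T} \<Longrightarrow> c q < w q" and d: "\<delta> > 0"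
    and \<rho>: "0 < \<rho>" "\<rho> < 1"
    and out: "\<And>q. q \<in> K \<times> {0..T} \<Longrightarrow> \<rho> \<le> dist q (x, t) \<Longrightarrow> \<phi> q + \<kappa> < w q"
    and adm: "\<And>y s. y \<in> K \<Longrightarrow> s \<in> {0..T} \<Longrightarrow> dist (y, s) (x, t) \<le> \<rho> \<Longrightarrow> bump_admissible \<phi> G c \<delta> \<kappa> y s"
  shows "(\<lambda>q. if dist q (x, t) \<le> \<rho> then max (w q) (\<phi> q + \<kappa>) else w q) \<in> perron_class"
proof -
  define W where "W = (\<lambda>q. if dist q (x, t) \<le> \<rho> then max (w q) (\<phi> q + \<kappa>) else w q)"
  have ball: "q \<in> K \<times> {0..<T}" if "q \<in> Qbar \<Omega>" "dist q (x, t) \<le> \<rho>" for q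
  proof -
    have "\<bar>snd q - t\<bar> \<le> dist q (x, t)" using dist_snd_le[of q "(x, t)"] by (simp add: dist_real_def)
    then have "snd q < T" using that(2) \<rho> T by linarith
    then show ?thesis using that(1) by (auto simp: Qbar_def)
  qed
  have wc: "continuous_on (Qbar \<Omega>) w" and ws: "subsolution w" using w by (auto simp: perron_class_def)
  have \<phi>c: "continuous_on (Qbar \<Omega>) \<phi>" by (rule C1_with_gradient_imp_continuous_on[OF \<phi>])
  have cQ: "closed (Qbar \<Omega>)" unfolding Qbar_def by (intro closed_Times closed_closure closed_atLeast)
  have Qu: "Qbar \<Omega> = Qbar \<Omega> \<inter> {q. dist q (x, t) \<le> \<rho>} \<union> Qbar \<Omega> \<inter> {q. \<rho> \<le> dist q (x, t)}" by auto
  have "continuous_on (Qbar \<Omega> \<inter> {q. dist q (x, t) \<le> \<rho>} \<union> Qbar \<Omega> \<inter> {q. \<rho> \<le> dist q (x, t)}) W"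
    unfolding W_def
  proof (rule continuous_on_cases)
    show "closed (Qbar \<Omega> \<inter> {q. dist q (x, t) \<le> \<rho>})" "closed (Qbar \<Omega> \<inter> {q. \<rho> \<le> dist q (x, t)})"
      by (intro closed_Int cQ closed_Collect_le continuous_intros)+
    show "continuous_on (Qbar \<Omega> \<inter> {q. dist q (x, t) \<le> \<rho>}) (\<lambda>q. max (w q) (\<phi> q + \<kappa>))"
      by (rule continuous_on_subset[of "Qbar \<Omega>"]) (auto intro!: continuous_intros wc \<phi>c)
    show "continuous_on (Qbar \<Omega> \<inter> {q. \<rho> \<le> dist q (x, t)}) w" by (rule continuous_on_subset[OF wc]) auto
    have "max (w q) (\<phi> q + \<kappa>) = w q" if "q \<in> Qbar \<Omega>" "dist q (x, t) \<le> \<rho>" "\<rho> \<le> dist q (x, t)" for q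
    proof -
      have "q \<in> K \<times> {0..T}" using ball[OF that(1,2)] by auto
      then show ?thesis using out that(3) by fastforce
    qed
    then show "\<forall>q. q \<in> Qbar \<Omega> \<inter> {q. dist q (x, t) \<le> \<rho>} \<and> \<not> dist q (x, t) \<le> \<rho> \<or>
      q \<in> Qbar \<Omega> \<inter> {q. \<rho> \<le> dist q (x, t)} \<and> dist q (x, t) \<le> \<rho> \<longrightarrow> max (w q) (\<phi> q + \<kappa>) = w q"
      by auto
  qed
  then have Wc: "continuous_on (Qbar \<Omega>) W" using Qu by simp
  have wW: "w q \<le> W q" for q by (simp add: W_def)
  have \<phi>W: "\<phi> q + \<kappa> \<le> W q" if "q \<in> K \<times> {0..T}" for q
    using out[OF that] by (auto simp: W_def)
  have "subsolution W"
    unfolding subsolution_iff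
  proof (intro conjI allI impI continuous_imp_usc Wc)
    fix \<psi> F y s and \<delta>' :: real
    assume a: "C1_with_gradient (Qbar \<Omega>) \<psi> F \<and> (y, s) \<in> Qbar \<Omega> \<and> (\<forall>q\<in>Qbar \<Omega>. W q - \<psi> q \<le> W (y, s) - \<psi> (y, s))" and d': "\<delta>' > 0"
    then have ys: "y \<in> K" "s \<ge> 0" and \<psi>: "C1_with_gradient (Qbar \<Omega>) \<psi> F" and yQ: "(y, s) \<in> Qbar \<Omega>" by (auto simp: Qbar_def)
    have mx: "W (z, s') - \<psi> (z, s') \<le> W (y, s) - \<psi> (y, s)" if "z \<in> K" "s' \<ge> 0" for z s'
      using a that by (auto simp: Qbar_def)
    show "sub_at W \<psi> F y s \<delta>'"
    proof (cases "W (y, s) = w (y, s)")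
      case True
      have "\<forall>q\<in>Qbar \<Omega>. w q - \<psi> q \<le> w (y, s) - \<psi> (y, s)"
      proof
        fix q assume "q \<in> Qbar \<Omega>"
        then have "W q - \<psi> q \<le> W (y, s) - \<psi> (y, s)" using a by blast
        then show "w q - \<psi> q \<le> w (y, s) - \<psi> (y, s)" using wW[of q] True by linarith
      qed
      then have "sub_at w \<psi> F y s \<delta>'" using ws \<psi> yQ d' unfolding subsolution_iff by blast
      then show ?thesis by (rule sub_at_mono[OF _ ys d' wc Wc wW True[symmetric]])
    next
      case False
      then have near: "dist (y, s) (x, t) \<le> \<rho>" by (auto simp: W_def split: if_splits)
      have W: "W (y, s) = \<phi> (y, s) + \<kappa>" using False by (auto simp: W_def max_def split: if_splits)
      have sT: "s \<in> {0..T}" "s < T" using ball[OF yQ near] by auto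
      have ad: "bump_admissible \<phi> G c \<delta> \<kappa> y s" by (rule adm[OF ys(1) sT(1) near])
      \<comment> \<open>Only interior points need the equation, and there the gradients of \<phi>
        and \<psi> coincide. At lateral points and at time 0 admissibility places
        \<open>\<phi> + \<kappa>\<close> below the datum.\<close>
      have "E \<delta>' W \<psi> F y s \<le> 0" if yO: "y \<in> \<Omega>" "s > 0"
      proof -
        have "G (y, s) = F (y, s)"
        proof (rule interior_gradient_unique[OF \<psi> \<phi> yO sT(2)])
          fix z s' assume z: "z \<in> K" "s' \<in> {0..T}"
          then show "\<phi> (z, s') - \<psi> (z, s') \<le> \<phi> (y, s) - \<psi> (y, s)"
            using \<phi>W[of "(z, s')"] mx[of z s'] W by auto
        qed
        moreover have "nonlocal \<Omega> \<nu> (ball 0 \<delta>) (\<lambda>y. \<phi> (y, s)) y + average \<delta> (\<lambda>y. c (y, s)) y - W (y, s) * mass \<delta> y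
            \<le> nonlocal \<Omega> \<nu> (ball 0 \<delta>') (\<lambda>y. \<psi> (y, s)) y + nonlocal \<Omega> \<nu> (- ball 0 \<delta>') (\<lambda>y. W (y, s)) y"
        proof (rule nonlocal_compare[OF \<phi> \<psi> Wc _ ys d d'])
          show "continuous_on K (\<lambda>y. c (y, s))"
            by (rule continuous_on_compose2[OF c(1)]) (use sT in \<open>auto intro!: continuous_intros\<close>)
          fix z assume z: "z \<in> K"
          show "\<phi> (z, s) - \<phi> (y, s) \<le> W (z, s) - W (y, s)" using \<phi>W[of "(z, s)"] z sT W by auto
          show "c (z, s) \<le> W (z, s)" using c(2)[of "(z, s)"] wW[of "(z, s)"] z sT by auto
          show "W (z, s) - W (y, s) \<le> \<psi> (z, s) - \<psi> (y, s)" using mx[OF z ys(2)] by linarith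
        qed
        ultimately show ?thesis using ad unfolding bump_admissible_def bump_residual_def visc_E_def W by simp
      qed
      then show ?thesis using ad W unfolding bump_admissible_def sub_at_def min_le_iff_disj by auto
    qed
  qed
  then show ?thesis using Wc by (simp add: perron_class_def W_def)
qed

end

context equation
begin

text \<open>A failure at (x, t) is strict, hence survives lowering the test function by a quadratic,
  replacing the supremum by a continuous minorant in the far integral, and moving to nearby points
  and slightly larger heights. The resulting bump belongs to the class and exceeds the supremum at
  (x, t).\<close>

theorem perron_supersolution: "supersolution perron"
  unfolding viscosity_supersolution_def
proof (rule conjI[OF lsc_perron], intro allI impI)
  fix \<phi> G x t and \<delta> :: real
  assume a: "C1_with_gradient (Qbar \<Omega>) \<phi> G \<and> (x, t) \<in> Qbar \<Omega> \<and>
    (\<forall>q\<in>Qbar \<Omega>. perron q - \<phi> q \<ge> perron (x, t) - \<phi> (x, t))" and d: "\<delta> > 0"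
  then have \<phi>: "C1_with_gradient (Qbar \<Omega>) \<phi> G" and xt: "x \<in> K" "t \<ge> 0" and xQ: "(x, t) \<in> Qbar \<Omega>" by (auto simp: Qbar_def)
  show "(x \<in> \<Omega> \<and> t > 0 \<longrightarrow> E \<delta> perron \<phi> G x t \<ge> 0) \<and>
    (x \<in> frontier \<Omega> \<and> t > 0 \<longrightarrow> max (E \<delta> perron \<phi> G x t) (perron (x, t) - g (x, t)) \<ge> 0) \<and>
    (t = 0 \<longrightarrow> max (E \<delta> perron \<phi> G x t) (perron (x, t) - u0 x) \<ge> 0)"
  proof (rule ccontr)
    assume neg: "\<not> ?thesis"
    define e where "e = - E \<delta> perron \<phi> G x t"
    have e: "e > 0" using neg unfolding e_def le_max_iff_disj by auto
    have ini: "t = 0 \<Longrightarrow> perron (x, t) < u0 x" using neg frontier_not_domain unfolding le_max_iff_disj by auto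
    have "t > 0 \<Longrightarrow> x \<in> frontier \<Omega> \<Longrightarrow> perron (x, t) < g (x, t)"
      using neg frontier_not_domain unfolding le_max_iff_disj by auto
    then have lat: "x \<in> frontier \<Omega> \<Longrightarrow> perron (x, t) < g (x, t)" using ini compatible[of x] xt(2) by (cases "t = 0") auto
    define N where "N = nonlocal \<Omega> \<nu> (ball 0 \<delta>) (\<lambda>y. (norm (y - x))\<^sup>2) x"
    define \<alpha> where "\<alpha> = e / (4 * (\<bar>N\<bar> + 1))"
    have al: "\<alpha> > 0" using e by (simp add: \<alpha>_def)
    have "\<alpha> * N \<le> \<alpha> * (\<bar>N\<bar> + 1)" using al by (intro mult_left_mono) auto
    also have "\<alpha> * (\<bar>N\<bar> + 1) = e / 4"
    proof -
      have "\<bar>N\<bar> + 1 \<noteq> 0" by linarith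
      then show ?thesis unfolding \<alpha>_def by (simp only: times_divide_eq_left nonzero_mult_divide_mult_cancel_right not_False_eq_True)
    qed
    finally have aN: "\<alpha> * N \<le> e / 4" .
    define T where "T = t + 1"
    have tT: "t \<in> {0..T}" using xt by (simp add: T_def)
    define V where "V = perron (x, t) - \<phi> (x, t)"
    \<comment> \<open>Normalised to touch the supremum from below at (x, t), strictly so because of
      the quadratic; at distance \<rho> there is room of \<alpha>\<rho>^2.\<close>
    define \<phi>' where "\<phi>' = (\<lambda>q. (\<phi> q + V) + (- \<alpha>) * (norm (q - (x, t)))\<^sup>2)"
    define G' where "G' = (\<lambda>q. (G q + 0) + (- \<alpha>) *\<^sub>R (2 *\<^sub>R (q - (x, t))))"
    have \<phi>V: "C1_with_gradient (Qbar \<Omega>) (\<lambda>q. \<phi> q + V) (\<lambda>q. G q + 0)"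
      by (intro C1_with_gradient_add \<phi> C1_with_gradient_const)
    have \<phi>': "C1_with_gradient (Qbar \<Omega>) \<phi>' G'" unfolding \<phi>'_def G'_def by (rule penalised_test_function[OF \<phi>V])
    have \<phi>'0: "\<phi>' (x, t) = perron (x, t)" "G' (x, t) = G (x, t)" by (simp_all add: \<phi>'_def V_def G'_def)
    have "nonlocal \<Omega> \<nu> (ball 0 \<delta>) (\<lambda>y. \<phi>' (y, t)) x = nonlocal \<Omega> \<nu> (ball 0 \<delta>) (\<lambda>y. \<phi> (y, t) + V) x + (- \<alpha>) * N"
      unfolding \<phi>'_def N_def by (rule nonlocal_penalised[OF \<phi>V xt d])
    then have near: "nonlocal \<Omega> \<nu> (ball 0 \<delta>) (\<lambda>y. \<phi>' (y, t)) x = nonlocal \<Omega> \<nu> (ball 0 \<delta>) (\<lambda>y. \<phi> (y, t)) x - \<alpha> * N"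
      by (simp add: nonlocal_def)
    obtain c where c: "continuous_on (K \<times> {0..T}) c" "\<And>q. q \<in> K \<times> {0..T} \<Longrightarrow> c q < perron q"
      "nonlocal \<Omega> \<nu> (- ball 0 \<delta>) (\<lambda>y. perron (y, t)) x < average \<delta> (\<lambda>y. c (y, t)) x - perron (x, t) * mass \<delta> x + e / 4"
      using perron_minorant[OF xt(1) tT d, of "e / 4"] e by auto
    have "bump_residual \<phi>' G' c \<delta> 0 x t < 0"
    proof -
      have "bump_residual \<phi>' G' c \<delta> 0 x t = snd (G (x, t)) - (nonlocal \<Omega> \<nu> (ball 0 \<delta>) (\<lambda>y. \<phi> (y, t)) x - \<alpha> * N)
          - (average \<delta> (\<lambda>y. c (y, t)) x - perron (x, t) * mass \<delta> x) + H x (perron (x, t)) (fst (G (x, t))) - f (x, t)"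
        by (simp only: bump_residual_def \<phi>'0 near add_0_right)
      moreover have "e = - (snd (G (x, t)) - nonlocal \<Omega> \<nu> (ball 0 \<delta>) (\<lambda>y. \<phi> (y, t)) x
          - nonlocal \<Omega> \<nu> (- ball 0 \<delta>) (\<lambda>y. perron (y, t)) x + H x (perron (x, t)) (fst (G (x, t))) - f (x, t))"
        by (simp only: e_def visc_E_def)
      ultimately show ?thesis using c(3) aN e by linarith
    qed
    then have adm: "bump_admissible \<phi>' G' c \<delta> 0 x t"
      unfolding bump_admissible_def \<phi>'0 using lat ini by simp
    obtain r where r: "r > 0" "\<And>y s \<kappa>. y \<in> K \<Longrightarrow> s \<in> {0..T} \<Longrightarrow> \<kappa> \<in> {0..r} \<Longrightarrow> dist (y, s) (x, t) \<le> r \<Longrightarrow>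
      bump_admissible \<phi>' G' c \<delta> \<kappa> y s"
      using bump_admissible_near[OF \<phi>' c(1) d xt(1) tT adm] by blast
    define \<rho> where "\<rho> = min r (1/2)"
    \<comment> \<open>At most half the room at distance \<rho>: from there on
      \<open>\<phi>' + \<kappa>\<close> stays strictly below the supremum, so a single member lies
      above it on the compact set \<open>P\<close>.\<close>
    define \<kappa> where "\<kappa> = min r (\<alpha> * \<rho>\<^sup>2 / 2)"
    have \<rho>: "0 < \<rho>" "\<rho> < 1" "\<rho> \<le> r" using r(1) by (auto simp: \<rho>_def)
    have ar: "0 < \<alpha> * \<rho>\<^sup>2" using al \<rho>(1) by simp
    then have \<kappa>: "0 < \<kappa>" "\<kappa> \<le> r" "\<kappa> < \<alpha> * \<rho>\<^sup>2" using r(1) by (auto simp: \<kappa>_def min_def)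
    define P where "P = K \<times> {0..T} \<inter> {q. \<rho> \<le> dist q (x, t)}"
    have KQ: "K \<times> {0..T} \<subseteq> Qbar \<Omega>" by (auto simp: Qbar_def)
    have P: "compact P" "P \<subseteq> Qbar \<Omega>"
      unfolding P_def using KQ by (auto intro!: compact_Int_closed compact_K_times closed_Collect_le continuous_intros)
    have above: "\<phi>' q + \<kappa> < perron q" if q: "q \<in> P" for q
    proof -
      have "\<rho> \<le> norm (q - (x, t))" using q by (simp add: P_def dist_norm)
      then have "\<alpha> * \<rho>\<^sup>2 \<le> \<alpha> * (norm (q - (x, t)))\<^sup>2" using al \<rho>(1) by (intro mult_left_mono power_mono) auto
      moreover have "perron (x, t) - \<phi> (x, t) \<le> perron q - \<phi> q" using a q P(2) by blast
      then have "\<phi> q + V \<le> perron q" unfolding V_def by linarith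
      ultimately show ?thesis using \<kappa>(3) by (simp add: \<phi>'_def)
    qed
    have "continuous_on P (\<lambda>q. \<phi>' q + \<kappa>)"
      by (intro continuous_intros continuous_on_subset[OF C1_with_gradient_imp_continuous_on[OF \<phi>'] P(2)])
    from perron_above_continuous[OF P this above] obtain w2 where w2: "w2 \<in> perron_class" "\<And>q. q \<in> P \<Longrightarrow> \<phi>' q + \<kappa> < w2 q" by blast
    obtain w1 where w1: "w1 \<in> perron_class" "\<And>q. q \<in> K \<times> {0..T} \<Longrightarrow> c q < w1 q"
      using perron_above_continuous[OF compact_K_times KQ c(1,2)] by blast
    have "(\<lambda>q. if dist q (x, t) \<le> \<rho> then max (max (w1 q) (w2 q)) (\<phi>' q + \<kappa>) else max (w1 q) (w2 q)) \<in> perron_class"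
    proof (rule bump_subsolution[OF perron_class_max[OF w1(1) w2(1)] \<phi>' _ xt(2) c(1) _ d \<rho>(1,2)])
      show "t + 1 \<le> T" by (simp add: T_def)
      show "c q < max (w1 q) (w2 q)" if "q \<in> K \<times> {0..T}" for q using w1(2)[OF that] by simp
      show "\<phi>' q + \<kappa> < max (w1 q) (w2 q)" if "q \<in> K \<times> {0..T}" "\<rho> \<le> dist q (x, t)" for q
        using w2(2)[of q] that by (simp add: P_def less_max_iff_disj)
      show "bump_admissible \<phi>' G' c \<delta> \<kappa> y s" if "y \<in> K" "s \<in> {0..T}" "dist (y, s) (x, t) \<le> \<rho>" for y s
        by (rule r(2)) (use that \<kappa> \<rho> in auto)
    qed
    from perron_upper[OF this xQ] have "\<phi>' (x, t) + \<kappa> \<le> perron (x, t)" using \<rho>(1) by simp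
    then show False using \<kappa>(1) \<phi>'0(1) by simp
  qed
qed

section \<open>A priori bounds for solutions\<close>

lemma solution_bound_linear:
  assumes u: "subsolution u" "supersolution u"
    and b: "\<And>x. x \<in> K \<Longrightarrow> \<bar>H x 0 0\<bar> \<le> h" "\<And>x t. x \<in> K \<Longrightarrow> 0 \<le> t \<Longrightarrow> t \<le> T \<Longrightarrow> \<bar>f (x, t)\<bar> \<le> F"
      "\<And>x t. x \<in> frontier \<Omega> \<Longrightarrow> 0 < t \<Longrightarrow> t \<le> T \<Longrightarrow> \<bar>g (x, t)\<bar> \<le> Gb"
      "\<And>x. x \<in> K \<Longrightarrow> \<bar>u0 x\<bar> \<le> Ub" and nn: "0 \<le> h" "0 \<le> F" "0 \<le> Gb" "0 \<le> Ub"
    and x: "x \<in> K" "0 \<le> t" "t < T"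
  shows "\<bar>u (x, t)\<bar> \<le> (h + F) * t + Gb + Ub"
proof -
  have "u (x, t) \<le> (h + F) * t + Gb + Ub"
    by (rule subsolution_le_linear[OF u(1) b nn x])
  moreover have "- u (x, t) \<le> (h + F) * t + Gb + Ub"
    by (rule equation.subsolution_le_linear[OF dual supersolution_dual[OF u(2)] _ _ _ _ nn x]) (use b in auto)
  ultimately show ?thesis by linarith
qed

text \<open>The maximum principle reaches only times below \<open>T\<close>, since its penalty needs
  room before the end of the interval, and the data are bounded only up to \<open>T\<close>. The
  final time follows by continuity of \<open>u\<close>.\<close>

lemma solution_bound_linear_closed:
  assumes c: "continuous_on (Qbar \<Omega>) u" and u: "subsolution u" "supersolution u"
    and b: "\<And>x. x \<in> K \<Longrightarrow> \<bar>H x 0 0\<bar> \<le> h" "\<And>x t. x \<in> K \<Longrightarrow> 0 \<le> t \<Longrightarrow> t \<le> T \<Longrightarrow> \<bar>f (x, t)\<bar> \<le> F"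
      "\<And>x t. x \<in> frontier \<Omega> \<Longrightarrow> 0 < t \<Longrightarrow> t \<le> T \<Longrightarrow> \<bar>g (x, t)\<bar> \<le> Gb"
      "\<And>x. x \<in> K \<Longrightarrow> \<bar>u0 x\<bar> \<le> Ub" and nn: "0 \<le> h" "0 \<le> F" "0 \<le> Gb" "0 \<le> Ub"
    and x: "x \<in> K" "0 \<le> t" "t \<le> T" "0 < T"
  shows "\<bar>u (x, t)\<bar> \<le> (h + F) * t + Gb + Ub"
proof (cases "t < T")
  case True
  show ?thesis by (rule solution_bound_linear[OF u b nn x(1,2) True])
next
  case False
  then have t: "t = T" using x by simp
  define s where "s = (\<lambda>n. T - T / real (Suc n))"
  have "(\<lambda>n. T - T * (1 / real (Suc n))) \<longlonglongrightarrow> T - T * 0"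
    using LIMSEQ_inverse_real_of_nat by (intro tendsto_intros) (simp add: inverse_eq_divide)
  then have s: "s \<longlonglongrightarrow> T" by (simp add: s_def)
  have "T / real (Suc n) \<le> T / 1" for n using x(4) by (intro divide_left_mono) auto
  then have s0: "0 \<le> s n" "s n < T" for n using x(4) by (auto simp: s_def)
  have "(\<lambda>n. u (x, s n)) \<longlonglongrightarrow> u (x, T)"
    by (rule continuous_on_tendsto_compose[OF c tendsto_Pair[OF tendsto_const s]]) (use x s0 in \<open>auto simp: Qbar_def\<close>)
  then have "(\<lambda>n. \<bar>u (x, s n)\<bar>) \<longlonglongrightarrow> \<bar>u (x, T)\<bar>" by (rule tendsto_rabs)
  moreover have "(\<lambda>n. (h + F) * s n + Gb + Ub) \<longlonglongrightarrow> (h + F) * T + Gb + Ub" by (intro tendsto_intros s)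
  moreover have "\<bar>u (x, s n)\<bar> \<le> (h + F) * s n + Gb + Ub" for n
    by (rule solution_bound_linear[OF u b nn x(1) s0])
  ultimately show ?thesis unfolding t by (intro LIMSEQ_le) auto
qed

lemma solution_bound_const:
  assumes u: "subsolution u" "supersolution u"
    and l0: "l0 > 0" "\<And>x r s. x \<in> K \<Longrightarrow> r \<le> s \<Longrightarrow> H x r 0 + l0 * (s - r) \<le> H x s 0"
    and b: "\<And>x. x \<in> K \<Longrightarrow> \<bar>H x 0 0\<bar> \<le> h" "\<And>x t. x \<in> K \<Longrightarrow> 0 \<le> t \<Longrightarrow> \<bar>f (x, t)\<bar> \<le> F"
      "\<And>x t. x \<in> frontier \<Omega> \<Longrightarrow> 0 < t \<Longrightarrow> \<bar>g (x, t)\<bar> \<le> Gb"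
      "\<And>x. x \<in> K \<Longrightarrow> \<bar>u0 x\<bar> \<le> Ub" and nn: "0 \<le> h" "0 \<le> F" "0 \<le> Gb" "0 \<le> Ub"
    and x: "x \<in> K" "0 \<le> t"
  shows "\<bar>u (x, t)\<bar> \<le> inverse l0 * (h + F) + Gb + Ub"
proof -
  have "H x 0 0 + l0 * r \<le> H x r 0" if "x \<in> K" "0 \<le> r" for x r using l0(2)[OF that] by simp
  then have "u (x, t) \<le> inverse l0 * (h + F) + Gb + Ub"
    by (rule subsolution_le_const[OF u(1) l0(1) _ b nn x])
  moreover have "- u (x, t) \<le> inverse l0 * (h + F) + Gb + Ub"
  proof (rule equation.subsolution_le_const[OF dual supersolution_dual[OF u(2)] l0(1) _ _ _ _ _ nn x])
    show "- H y (- 0) (- 0) + l0 * r \<le> - H y (- r) (- 0)" if "y \<in> K" "0 \<le> r" for y r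
      using l0(2)[OF that(1), of "- r" 0] that(2) by simp
  qed (use b in auto)
  ultimately show ?thesis by linarith
qed

end

section \<open>Well-posedness and the final estimates\<close>

lemma continuous_on_usc_lsc:
  fixes u :: "'b::metric_space \<Rightarrow> real"
  assumes "usc_on S u" "lsc_on S u" shows "continuous_on S u"
  unfolding continuous_on_def
  by (intro ballI order_tendstoI) (use assms in \<open>auto simp: usc_on_def lsc_on_def\<close>)

text \<open>Two uses of comparison: the envelope against the supremum yields continuity, and
  \<open>perron\<close> against another solution yields one half of uniqueness. The other half is
  immediate, since a continuous solution is a member of the class.\<close>

theorem (in coercive_equation) well_posed:
  "\<exists>u. continuous_on (Qbar \<Omega>) u \<and> subsolution u \<and> supersolution u \<and>
    (\<forall>v. continuous_on (Qbar \<Omega>) v \<and> subsolution v \<and> supersolution v \<longrightarrow> (\<forall>q\<in>Qbar \<Omega>. v q = u q))"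
proof (intro exI[of _ perron] conjI perron_supersolution allI impI ballI)
  have "perron_usc q = perron q" if "q \<in> Qbar \<Omega>" for q
  proof -
    obtain x t where q: "q = (x, t)" "x \<in> K" "t \<ge> 0" using \<open>q \<in> Qbar \<Omega>\<close> by (auto simp: Qbar_def)
    have "perron_usc (x, t) \<le> perron (x, t)"
      by (rule comparison[OF perron_usc_subsolution boundary_regular_perron_usc perron_supersolution _ _ q(2,3)])
         (use perron_bounded in blast)+
    then show ?thesis using perron_le_usc[OF that] q(1) by simp
  qed
  then show sub: "subsolution perron" by (rule subsolution_cong[OF perron_usc_subsolution])
  show cont: "continuous_on (Qbar \<Omega>) perron"
    by (rule continuous_on_usc_lsc[OF _ lsc_perron]) (use sub in \<open>simp add: subsolution_iff\<close>)
  fix v q assume v: "continuous_on (Qbar \<Omega>) v \<and> subsolution v \<and> supersolution v" and q: "q \<in> Qbar \<Omega>"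
  have "v q \<le> perron q" by (rule perron_upper[OF _ q]) (use v in \<open>simp add: perron_class_def\<close>)
  moreover have "perron q \<le> v q"
  proof -
    obtain x t where xt: "q = (x, t)" "x \<in> K" "t \<ge> 0" using q by (auto simp: Qbar_def)
    have "perron (x, t) \<le> v (x, t)"
      by (rule comparison[OF sub boundary_regular_continuous[OF cont] conjunct2[OF conjunct2[OF v]] _ _ xt(2,3)])
         (use continuous_bounded_on_K_times[OF cont] continuous_bounded_on_K_times[OF conjunct1[OF v]] in blast)+
    then show ?thesis using xt(1) by simp
  qed
  ultimately show "v q = perron q" by simp
qed

lemma le_sup_norm:
  assumes "bounded (w ` S)" "q \<in> S" shows "\<bar>w q\<bar> \<le> sup_norm S w"
proof -
  obtain b where "\<forall>q\<in>S. \<bar>w q\<bar> \<le> b" using assms(1) unfolding bounded_iff by auto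
  then show ?thesis unfolding sup_norm_def by (intro cSUP_upper[OF assms(2)] bdd_aboveI2) auto
qed

lemma sup_norm_nonneg: "bounded (w ` S) \<Longrightarrow> S \<noteq> {} \<Longrightarrow> 0 \<le> sup_norm S w"
  using le_sup_norm abs_ge_zero order_trans by (metis all_not_in_conv)

theorem proposition4p7:
  fixes \<Omega> :: "'a::euclidean_space set"
    and \<nu> :: "'a \<Rightarrow> 'a measure"
    and \<sigma> m :: real
    and H :: "'a \<Rightarrow> real \<Rightarrow> 'a \<Rightarrow> real"
    and lam :: "real \<Rightarrow> real"
    and f g :: "'a \<times> real \<Rightarrow> real"
    and u0 :: "'a \<Rightarrow> real"
  assumes "bounded \<Omega>" and "C1_domain \<Omega>"
    and "0 < \<sigma>" and "\<sigma> < 1"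
    and "\<forall>x\<in>closure \<Omega>. regular_measure (\<nu> x)"
    and "M0 \<Omega> \<nu>" and "M1 \<Omega> \<nu> \<sigma>" and "M2 \<Omega> \<nu> \<sigma>" and "M3 \<Omega> \<nu> \<sigma>"
    and "continuous_on (closure \<Omega> \<times> UNIV \<times> UNIV) (\<lambda>(x, r, p). H x r p)"
    and "H1 \<Omega> H lam"
    and "m > \<sigma>" and "H2 \<Omega> H m"
    and "continuous_on (Qbar \<Omega>) f"
    and "continuous_on (frontier \<Omega> \<times> {0..}) g"
    and "continuous_on (closure \<Omega>) u0"
    and "\<forall>x\<in>frontier \<Omega>. u0 x = g (x, 0)"
  shows "\<exists>u :: 'a \<times> real \<Rightarrow> real.
      continuous_on (Qbar \<Omega>) u \<and> viscosity_solution \<Omega> \<nu> H f g u0 u \<and>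
      (\<forall>v. continuous_on (Qbar \<Omega>) v \<and> viscosity_solution \<Omega> \<nu> H f g u0 v \<longrightarrow>
         (\<forall>q\<in>Qbar \<Omega>. v q = u q)) \<and>
      (\<forall>T>0. \<forall>x\<in>closure \<Omega>. \<forall>t\<in>{0..T}.
         \<bar>u (x, t)\<bar> \<le>
           (sup_norm (closure \<Omega>) (\<lambda>x. H x 0 0) + sup_norm (closure \<Omega> \<times> {0..T}) f) * t
           + sup_norm (frontier \<Omega> \<times> {0<..T}) g + sup_norm (closure \<Omega>) u0) \<and>
      (\<forall>l0>0. (\<forall>R>0. lam R \<ge> l0) \<and>
         bounded (f ` Qbar \<Omega>) \<and> bounded (g ` (frontier \<Omega> \<times> {0<..})) \<longrightarrow>
           bounded (u ` Qbar \<Omega>) \<and>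
           (\<forall>x\<in>closure \<Omega>. \<forall>t\<ge>0.
              \<bar>u (x, t)\<bar> \<le>
                inverse l0 * (sup_norm (closure \<Omega>) (\<lambda>x. H x 0 0) + sup_norm (Qbar \<Omega>) f)
                + sup_norm (frontier \<Omega> \<times> {0<..}) g + sup_norm (closure \<Omega>) u0))"
proof -
  have open_\<Omega>: "open \<Omega>" "\<Omega> \<noteq> {}" "C1_boundary \<Omega>" using assms(2) by (auto simp: C1_domain_def)
  have mono: "H x r p \<le> H x s p" if "x \<in> closure \<Omega>" "r \<le> s" for x r s p
  proof -
    define R where "R = \<bar>r\<bar> + \<bar>s\<bar> + 1"
    have "R > 0" "\<bar>r\<bar> \<le> R" "\<bar>s\<bar> \<le> R" by (auto simp: R_def)
    then have "lam R \<ge> 0" "H x s p - H x r p \<ge> lam R * (s - r)" using assms(11) that unfolding H1_def by auto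
    then show ?thesis using mult_nonneg_nonneg[of "lam R" "s - r"] that(2) by linarith
  qed
  have sets: "sets (\<nu> x) = sets borel" if "x \<in> closure \<Omega>" for x
    using assms(5) that by (simp add: regular_measure_def)
  have compat: "u0 x = g (x, 0)" if "x \<in> frontier \<Omega>" for x using assms(17) that by blast
  interpret coercive_equation \<Omega> \<nu> \<sigma> H f g u0 m
  proof unfold_locales
    show "bounded \<Omega>" "0 < \<sigma>" "\<sigma> < 1" "M0 \<Omega> \<nu>" "M1 \<Omega> \<nu> \<sigma>" "M2 \<Omega> \<nu> \<sigma>" by (fact assms)+
    show "open \<Omega>" "\<Omega> \<noteq> {}" "C1_boundary \<Omega>" by (fact open_\<Omega>)+
    show "continuous_on (closure \<Omega> \<times> UNIV \<times> UNIV) (\<lambda>(x, r, p). H x r p)" "continuous_on (Qbar \<Omega>) f"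
      "continuous_on (frontier \<Omega> \<times> {0..}) g" "continuous_on (closure \<Omega>) u0" "\<sigma> < m" "H2 \<Omega> H m" by (fact assms)+
    show "sets (\<nu> x) = sets borel" if "x \<in> closure \<Omega>" for x by (rule sets[OF that])
    show "H x r p \<le> H x s p" if "x \<in> closure \<Omega>" "r \<le> s" for x r s p by (rule mono[OF that])
    show "u0 x = g (x, 0)" if "x \<in> frontier \<Omega>" for x by (rule compat[OF that])
  qed
  obtain u where c: "continuous_on (Qbar \<Omega>) u" and u: "subsolution u" "supersolution u"
    and uniq: "\<And>v q. continuous_on (Qbar \<Omega>) v \<Longrightarrow> subsolution v \<Longrightarrow> supersolution v \<Longrightarrow> q \<in> Qbar \<Omega> \<Longrightarrow> v q = u q"
    using well_posed by blast
  \<comment> \<open>A supremum over an empty set would be meaningless, so nonnegativity of the norm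
    of the lateral datum needs boundary points; a bounded nonempty open set has them.\<close>
  have front: "frontier \<Omega> \<noteq> {}"
    using open_\<Omega> assms(1) not_bounded_UNIV by (auto simp: frontier_eq_empty)
  obtain hb where "\<forall>x\<in>closure \<Omega>. \<forall>s\<in>{0..0}. \<forall>p\<in>cball 0 0. \<bar>H x s p\<bar> \<le> hb" using H_bounded[where a = 0 and b = 0 and R = 0] by blast
  then have hbd: "bounded ((\<lambda>x. H x 0 0) ` closure \<Omega>)" unfolding bounded_iff by auto
  have ubd: "bounded (u0 ` closure \<Omega>)"
    using u0_continuous compact_K compact_continuous_image compact_imp_bounded by blast
  note hle = le_sup_norm[OF hbd] and ule = le_sup_norm[OF ubd]
    and hnn = sup_norm_nonneg[OF hbd K_nonempty] and unn = sup_norm_nonneg[OF ubd K_nonempty]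
  have linear: "\<bar>u (x, t)\<bar> \<le> (sup_norm (closure \<Omega>) (\<lambda>x. H x 0 0) + sup_norm (closure \<Omega> \<times> {0..T}) f) * t
           + sup_norm (frontier \<Omega> \<times> {0<..T}) g + sup_norm (closure \<Omega>) u0" if T: "T > 0" "x \<in> closure \<Omega>" "t \<in> {0..T}" for T x t
  proof -
    obtain b where b: "\<forall>x\<in>closure \<Omega>. \<forall>t\<in>{0..T}. \<bar>f (x, t)\<bar> \<le> b" "\<forall>x\<in>frontier \<Omega>. \<forall>t\<in>{0..T}. \<bar>g (x, t)\<bar> \<le> b"
      using data_bounded[of T] by blast
    have fb: "bounded (f ` (closure \<Omega> \<times> {0..T}))" unfolding bounded_iff using b(1) by auto
    have gb: "bounded (g ` (frontier \<Omega> \<times> {0<..T}))" unfolding bounded_iff using b(2) by (intro exI[of _ b]) auto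
    have ne: "closure \<Omega> \<times> {0..T} \<noteq> {}" "frontier \<Omega> \<times> {0<..T} \<noteq> {}" using front T(1) K_nonempty by auto
    show ?thesis
      by (rule solution_bound_linear_closed[OF c u hle le_sup_norm[OF fb] le_sup_norm[OF gb] ule hnn
            sup_norm_nonneg[OF fb ne(1)] sup_norm_nonneg[OF gb ne(2)] unn]) (use T in auto)
  qed
  have const: "\<bar>u (x, t)\<bar> \<le> inverse l0 * (sup_norm (closure \<Omega>) (\<lambda>x. H x 0 0) + sup_norm (Qbar \<Omega>) f)
                + sup_norm (frontier \<Omega> \<times> {0<..}) g + sup_norm (closure \<Omega>) u0"
    if l0: "l0 > 0" "\<forall>R>0. lam R \<ge> l0" and fb: "bounded (f ` Qbar \<Omega>)" and gb: "bounded (g ` (frontier \<Omega> \<times> {0<..}))"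
      and x: "x \<in> closure \<Omega>" "t \<ge> 0" for l0 x t
  proof -
    have ne: "Qbar \<Omega> \<noteq> {}" "frontier \<Omega> \<times> {0::real<..} \<noteq> {}" using front K_nonempty by (auto simp: Qbar_def intro: gt_ex)
    have "H x r 0 + l0 * (s - r) \<le> H x s 0" if "x \<in> closure \<Omega>" "r \<le> s" for x r s
    proof -
      define R where "R = \<bar>r\<bar> + \<bar>s\<bar> + 1"
      have R: "R > 0" "\<bar>r\<bar> \<le> R" "\<bar>s\<bar> \<le> R" by (auto simp: R_def)
      then have "H x s 0 - H x r 0 \<ge> lam R * (s - r)" using assms(11) that unfolding H1_def by auto
      moreover have "l0 * (s - r) \<le> lam R * (s - r)" using l0(2) R(1) that(2) by (intro mult_right_mono) auto
      ultimately show ?thesis by linarith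
    qed
    then show ?thesis
      by (rule solution_bound_const[OF u l0(1) _ hle le_sup_norm[OF fb] le_sup_norm[OF gb] ule hnn
            sup_norm_nonneg[OF fb ne(1)] sup_norm_nonneg[OF gb ne(2)] unn x]) (auto simp: Qbar_def)
  qed
  show ?thesis
  proof (intro exI[of _ u] conjI c allI impI ballI)
    show "viscosity_solution \<Omega> \<nu> H f g u0 u" using u by (simp add: viscosity_solution_def)
    show "v q = u q" if "continuous_on (Qbar \<Omega>) v \<and> viscosity_solution \<Omega> \<nu> H f g u0 v" "q \<in> Qbar \<Omega>" for v q
      using that uniq by (simp add: viscosity_solution_def)
    fix l0 :: real assume l0: "l0 > 0"
      "(\<forall>R>0. lam R \<ge> l0) \<and> bounded (f ` Qbar \<Omega>) \<and> bounded (g ` (frontier \<Omega> \<times> {0<..}))"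
    show "bounded (u ` Qbar \<Omega>)"
    proof (rule boundedI)
      fix z assume "z \<in> u ` Qbar \<Omega>"
      then obtain x t where "z = u (x, t)" "x \<in> closure \<Omega>" "t \<ge> 0" by (auto simp: Qbar_def)
      then show "norm z \<le> inverse l0 * (sup_norm (closure \<Omega>) (\<lambda>x. H x 0 0) + sup_norm (Qbar \<Omega>) f)
          + sup_norm (frontier \<Omega> \<times> {0<..}) g + sup_norm (closure \<Omega>) u0"
        using const[OF l0(1)] l0(2) by simp
    qed
  qed (use linear const in auto)
qed

end
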